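(* Let $w=w_{11}$ be the Atkin-Lehner involution of $X_0(44)$ attached to $11$. There exist $x,y,t\in\mathbb{Q}(X_0(44))$ such that $\mathbb{Q}(X_0(44))=\mathbb{Q}(x,y,t)$, the subfield of functions invariant under $w^*$ is $\mathbb{Q}(x,y)$, $w^*(t)=-t$, and $$y^2=x^3+x^2+3x-1,\qquad t^2=(2+x)^2(7+3x+5x^2+x^3).$$ In particular these two equations are equations for $X_0(44)$ over $\mathbb{Q}$ (up to birational equivalence over $\mathbb{Q}$).
   Context: $X_0(N)$ denotes the smooth projective curve over $\mathbb{Q}$ attached to $\Gamma_0(N)$, where $\mathbb{Q}(X_0(N))$ is the subfield of $\mathbb{C}(X_0(N))$ of functions with rational $q$-expansion at the cusp $\infty$, $q=e^{2\pi i z}$. For a positive divisor $d$ of $N$ coprime to $N/d$, the Atkin-Lehner involution $w_d$ of $X_0(N)$ is induced by any matrix $\frac{1}{\sqrt d}\begin{pmatrix} A d & B\\ N C & D d\end{pmatrix}$ of determinant $1$ with $A,B,C,D\in\mathbb{Z}$; it is defined over $\mathbb{Q}$. *)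

theory Defs
  imports "HOL-Complex_Analysis.Complex_Analysis" "HOL-Computational_Algebra.Polynomial"
begin

section \<open>Meromorphic functions on the upper half plane\<close>

abbreviation upper_half_plane :: "complex set" where
  "upper_half_plane \<equiv> {z. Im z > 0}"

lemma open_upper_half_plane: "open upper_half_plane"
  by (simp add: open_halfspace_Im_gt)

lemma connected_upper_half_plane: "connected upper_half_plane"
  by (intro convex_connected convex_halfspace_Im_gt)

text \<open>
  A meromorphic function is a class of HOL functions that agree outside a subset of the upper
  half plane without limit points there; this disposes of the arbitrary values that HOL functions
  take at poles and removable singularities, and outside the upper half plane.
\<close>

definition mero_eq :: "(complex \<Rightarrow> complex) \<Rightarrow> (complex \<Rightarrow> complex) \<Rightarrow> bool" where
  "mero_eq f g \<longleftrightarrow> f meromorphic_on upper_half_plane \<and> g meromorphic_on upper_half_plane \<and>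
     (\<forall>\<^sub>\<approx>z\<in>upper_half_plane. f z = g z)"

lemma part_equivp_mero_eq: "part_equivp mero_eq"
proof (rule part_equivpI)
  show "\<exists>f. mero_eq f f"
    by (rule exI[of _ "\<lambda>_. 0"]) (auto simp: mero_eq_def)
  show "symp mero_eq"
    by (auto intro!: sympI simp: mero_eq_def eq_commute)
  show "transp mero_eq"
  proof (rule transpI)
    fix f g h assume "mero_eq f g" "mero_eq g h"
    then show "mero_eq f h"
      unfolding mero_eq_def by (auto elim: eventually_elim2)
  qed
qed

quotient_type mero_uhp = "complex \<Rightarrow> complex" / partial: mero_eq
  by (rule part_equivp_mero_eq)

instantiation mero_uhp :: field
begin

lift_definition zero_mero_uhp :: mero_uhp is "\<lambda>_. 0"
  by (auto simp: mero_eq_def)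

lift_definition one_mero_uhp :: mero_uhp is "\<lambda>_. 1"
  by (auto simp: mero_eq_def)

lift_definition plus_mero_uhp :: "mero_uhp \<Rightarrow> mero_uhp \<Rightarrow> mero_uhp" is "\<lambda>f g z. f z + g z"
  by (auto simp: mero_eq_def intro!: meromorphic_intros elim: eventually_elim2)

lift_definition minus_mero_uhp :: "mero_uhp \<Rightarrow> mero_uhp \<Rightarrow> mero_uhp" is "\<lambda>f g z. f z - g z"
  by (auto simp: mero_eq_def intro!: meromorphic_intros elim: eventually_elim2)

lift_definition uminus_mero_uhp :: "mero_uhp \<Rightarrow> mero_uhp" is "\<lambda>f z. - f z"
  by (auto simp: mero_eq_def intro!: meromorphic_intros elim: eventually_mono)

lift_definition times_mero_uhp :: "mero_uhp \<Rightarrow> mero_uhp \<Rightarrow> mero_uhp" is "\<lambda>f g z. f z * g z"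
  by (auto simp: mero_eq_def intro!: meromorphic_intros elim: eventually_elim2)

lift_definition inverse_mero_uhp :: "mero_uhp \<Rightarrow> mero_uhp" is "\<lambda>f z. inverse (f z)"
  by (auto simp: mero_eq_def intro!: meromorphic_intros elim: eventually_mono)

definition divide_mero_uhp :: "mero_uhp \<Rightarrow> mero_uhp \<Rightarrow> mero_uhp" where
  "divide_mero_uhp f g = f * inverse g"

instance
proof
  fix f g h :: mero_uhp
  show "f * g * h = f * (g * h)"
    by transfer (auto simp: mero_eq_def algebra_simps intro!: meromorphic_intros)
  show "f * g = g * f"
    by transfer (auto simp: mero_eq_def algebra_simps intro!: meromorphic_intros)
  show "1 * f = f"
    by transfer (auto simp: mero_eq_def)
  show "f + g + h = f + (g + h)"
    by transfer (auto simp: mero_eq_def algebra_simps intro!: meromorphic_intros)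
  show "f + g = g + f"
    by transfer (auto simp: mero_eq_def algebra_simps intro!: meromorphic_intros)
  show "0 + f = f"
    by transfer (auto simp: mero_eq_def)
  show "- f + f = 0"
    by transfer (auto simp: mero_eq_def intro!: meromorphic_intros)
  show "f - g = f + - g"
    by transfer (auto simp: mero_eq_def intro!: meromorphic_intros)
  show "(f + g) * h = f * h + g * h"
    by transfer (auto simp: mero_eq_def algebra_simps intro!: meromorphic_intros)
  show "(0 :: mero_uhp) \<noteq> 1"
  proof transfer
    have "\<i> \<in> upper_half_plane" by simp
    then have "upper_half_plane \<noteq> {}" by blast
    then show "\<not> mero_eq (\<lambda>_. 0) (\<lambda>_. 1)"
      by (auto simp: mero_eq_def)
  qed
  show "inverse f * f = 1" if "f \<noteq> 0"
    using that
  proof transfer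
    fix f assume f: "mero_eq f f" "\<not> mero_eq f (\<lambda>_. 0)"
    then have "\<not> (\<forall>\<^sub>\<approx>z\<in>upper_half_plane. f z = 0)"
      by (auto simp: mero_eq_def)
    then have "\<forall>\<^sub>\<approx>z\<in>upper_half_plane. f z \<noteq> 0"
      using meromorphic_imp_constant_or_avoid[of f upper_half_plane 0] f(1)
        open_upper_half_plane connected_upper_half_plane by (auto simp: mero_eq_def)
    then have "\<forall>\<^sub>\<approx>z\<in>upper_half_plane. inverse (f z) * f z = 1"
      by (rule eventually_mono) simp
    then show "mero_eq (\<lambda>z. inverse (f z) * f z) (\<lambda>_. 1)"
      using f(1) by (auto simp: mero_eq_def intro!: meromorphic_intros)
  qed
  show "f div g = f * inverse g"
    by (rule divide_mero_uhp_def)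
  show "inverse (0 :: mero_uhp) = 0"
    by transfer (auto simp: mero_eq_def)
qed

end

instance mero_uhp :: field_char_0
proof
  have mero_const: "mero_eq (\<lambda>_. k) (\<lambda>_. k)" for k
    by (auto simp: mero_eq_def)
  have of_nat: "of_nat n = abs_mero_uhp (\<lambda>_. of_nat n)" for n
  proof (induction n)
    case 0
    show ?case by (simp add: zero_mero_uhp_def)
  next
    case (Suc n)
    show ?case
      using plus_mero_uhp.abs_eq[OF mero_const mero_const, of 1 "of_nat n"]
      by (simp add: Suc one_mero_uhp_def)
  qed
  have "\<i> \<in> upper_half_plane" by simp
  then have ne: "upper_half_plane \<noteq> {}" by blast
  show "inj (of_nat :: nat \<Rightarrow> mero_uhp)"
  proof (rule injI)
    fix m n :: nat assume "(of_nat m :: mero_uhp) = of_nat n"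
    then have "mero_eq (\<lambda>_. of_nat m) (\<lambda>_. of_nat n)"
      using Quotient3_rel[OF Quotient3_mero_uhp, of "\<lambda>_. of_nat m" "\<lambda>_. of_nat n"]
      by (auto simp: of_nat mero_eq_def)
    then show "m = n"
      using ne by (auto simp: mero_eq_def)
  qed
qed


section \<open>Pullback along Moebius transformations\<close>

definition moebius :: "real \<Rightarrow> real \<Rightarrow> real \<Rightarrow> real \<Rightarrow> complex \<Rightarrow> complex" where
  "moebius a b c d z = (of_real a * z + of_real b) / (of_real c * z + of_real d)"

lemma moebius_denom_nz:
  assumes "a * d - b * c > 0" "Im z > 0"
  shows "complex_of_real c * z + of_real d \<noteq> 0"
proof
  assume *: "complex_of_real c * z + of_real d = 0"
  then have "Im (complex_of_real c * z + of_real d) = 0" by simp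
  then have "c = 0" using assms(2) by simp
  then show False using * assms(1) by simp
qed

lemma Im_moebius_pos:
  assumes "a * d - b * c > 0" "Im z > 0"
  shows "Im (moebius a b c d z) > 0"
proof -
  define w where "w = complex_of_real c * z + of_real d"
  have w: "w \<noteq> 0" using moebius_denom_nz[OF assms] by (simp add: w_def)
  have "moebius a b c d z = (of_real a * z + of_real b) * cnj w / of_real ((cmod w)\<^sup>2)"
    using w unfolding moebius_def w_def[symmetric]
    by (simp add: complex_div_cnj[of _ w])
  then have "Im (moebius a b c d z) = Im ((of_real a * z + of_real b) * cnj w) / (cmod w)\<^sup>2"
    by (simp only: Im_divide_of_real)
  also have "Im ((of_real a * z + of_real b) * cnj w) = (a * d - b * c) * Im z"
    by (simp add: w_def algebra_simps)
  finally show ?thesis using w assms by simp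
qed

lemma moebius_inj:
  assumes "a * d - b * c > 0" "Im z > 0" "Im z' > 0" "moebius a b c d z = moebius a b c d z'"
  shows "z = z'"
proof -
  have "(of_real a * z + of_real b) * (of_real c * z' + of_real d) =
        (of_real a * z' + of_real b) * (complex_of_real c * z + of_real d)"
    using assms(4) moebius_denom_nz[OF assms(1,2)] moebius_denom_nz[OF assms(1,3)]
    by (simp add: moebius_def field_simps)
  then have "complex_of_real (a * d - b * c) * (z - z') = 0"
    by (simp add: algebra_simps)
  then show ?thesis using assms(1) by (simp del: of_real_diff of_real_mult)
qed

lemma moebius_analytic:
  assumes "a * d - b * c > 0"
  shows "moebius a b c d analytic_on upper_half_plane"
  unfolding moebius_def using moebius_denom_nz[OF assms]
  by (auto intro!: analytic_intros)

lemma filterlim_moebius_at: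
  assumes "a * d - b * c > 0" "Im z > 0"
  shows "filterlim (moebius a b c d) (at (moebius a b c d z)) (at z)"
proof (rule filterlim_atI)
  have "isCont (moebius a b c d) z"
    using moebius_analytic[OF assms(1)] assms(2)
    by (intro analytic_at_imp_isCont) (auto intro: analytic_on_subset)
  then show "(moebius a b c d \<longlongrightarrow> moebius a b c d z) (at z)"
    by (simp add: isCont_def)
  have "\<forall>\<^sub>F w in at z. w \<in> upper_half_plane - {z}"
    using open_upper_half_plane assms(2) by (intro eventually_at_in_open) auto
  then show "\<forall>\<^sub>F w in at z. moebius a b c d w \<noteq> moebius a b c d z"
    by eventually_elim (use moebius_inj[OF assms(1)] assms(2) in auto)
qed

lemma meromorphic_on_moebius:
  assumes "a * d - b * c > 0" "f meromorphic_on upper_half_plane"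
  shows "(\<lambda>z. f (moebius a b c d z)) meromorphic_on upper_half_plane"
  by (rule meromorphic_on_compose[OF assms(2) moebius_analytic[OF assms(1)]])
     (use Im_moebius_pos[OF assms(1)] in auto)

lemma mero_eq_moebius:
  assumes "a * d - b * c > 0" "mero_eq f g"
  shows "mero_eq (\<lambda>z. f (moebius a b c d z)) (\<lambda>z. g (moebius a b c d z))"
proof -
  have "\<forall>\<^sub>F w in at z. f (moebius a b c d w) = g (moebius a b c d w)" if "Im z > 0" for z
  proof -
    have "\<forall>\<^sub>F w in at (moebius a b c d z). f w = g w"
      using assms(2) Im_moebius_pos[OF assms(1) that]
      by (auto simp: mero_eq_def eventually_cosparse_open_eq[OF open_upper_half_plane])
    then show ?thesis
      using filterlim_moebius_at[OF assms(1) that] by (rule eventually_compose_filterlim)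
  qed
  then show ?thesis
    using assms meromorphic_on_moebius[OF assms(1)]
    by (auto simp: mero_eq_def eventually_cosparse_open_eq[OF open_upper_half_plane])
qed

text \<open>
  The determinant guard only makes the operation total: all matrices below have positive
  determinant.
\<close>

lift_definition pullback :: "real \<Rightarrow> real \<Rightarrow> real \<Rightarrow> real \<Rightarrow> mero_uhp \<Rightarrow> mero_uhp" is
  "\<lambda>a b c d f. if a * d - b * c > 0 then (\<lambda>z. f (moebius a b c d z)) else f"
  by (auto intro: mero_eq_moebius)


section \<open>Function fields of modular curves\<close>

lemma mero_eq_high_half_plane_cong:
  assumes "mero_eq f g" "c \<ge> 0"
  shows "(\<forall>\<^sub>\<approx>z\<in>{z. Im z > c}. f z = h z) \<longleftrightarrow> (\<forall>\<^sub>\<approx>z\<in>{z. Im z > c}. g z = h z)"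
proof -
  have "\<forall>\<^sub>\<approx>z\<in>{z. Im z > c}. f z = g z"
    using assms by (auto simp: mero_eq_def eventually_cosparse_open_eq open_halfspace_Im_gt)
  then show ?thesis
    by (auto elim: eventually_elim2)
qed

text \<open>
  \<open>has_q_expansion h f F\<close>: for large imaginary part of \<open>z\<close>, \<open>f\<close> is the value at
  \<open>q\<^sub>h = exp (2 \<pi> i z / h)\<close> of the convergent Laurent series \<open>F\<close>. Formal Laurent
  series have finite principal part, so this includes meromorphy at the cusp.
\<close>

lift_definition has_q_expansion :: "nat \<Rightarrow> mero_uhp \<Rightarrow> complex fls \<Rightarrow> bool" is
  "\<lambda>h f F. fls_conv_radius F > 0 \<and>
     (\<exists>c\<ge>0. \<forall>\<^sub>\<approx>z\<in>{z. Im z > c}. f z = eval_fls F (exp (2 * of_real pi * \<i> * z / of_nat h)))"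
  by (simp add: fun_eq_iff mero_eq_high_half_plane_cong cong: conj_cong)

text \<open>
  The function field of \<open>X\<^sub>0(N)\<close> over the complex numbers. As every cusp is the image of
  \<open>\<infinity>\<close> under \<open>SL\<^sub>2(\<int>)\<close>, the second condition is meromorphy at all cusps.
\<close>

definition X0_field :: "nat \<Rightarrow> mero_uhp set" where
  "X0_field N = {f.
     (\<forall>(a :: int) (b :: int) (c :: int) (d :: int).
        a * d - b * c = 1 \<and> int N dvd c \<longrightarrow> pullback a b c d f = f) \<and>
     (\<forall>(a :: int) (b :: int) (c :: int) (d :: int). a * d - b * c = 1 \<longrightarrow>
        (\<exists>h>0. \<exists>F. has_q_expansion h (pullback a b c d f) F))}"

definition X0_field_rat :: "nat \<Rightarrow> mero_uhp set" where
  "X0_field_rat N = {f \<in> X0_field N.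
     \<exists>F. has_q_expansion 1 f F \<and> (\<forall>n. fls_nth F n \<in> \<rat>)}"


section \<open>Atkin-Lehner involutions\<close>

lemma pullback_pullback:
  assumes "a * d - b * c > 0" "a' * d' - b' * c' > 0"
  shows "pullback a b c d (pullback a' b' c' d' f) =
           pullback (a' * a + b' * c) (a' * b + b' * d) (c' * a + d' * c) (c' * b + d' * d) f"
  using assms
proof transfer
  fix a b c d a' b' c' d' :: real and f
  assume pos: "a * d - b * c > 0" "a' * d' - b' * c' > 0" and f: "mero_eq f f"
  let ?p = "a' * a + b' * c" and ?q = "a' * b + b' * d"
  let ?r = "c' * a + d' * c" and ?s = "c' * b + d' * d"
  have det: "?p * ?s - ?q * ?r = (a * d - b * c) * (a' * d' - b' * c')"
    by (simp add: algebra_simps)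
  then have pos': "?p * ?s - ?q * ?r > 0"
    using pos by simp
  have comp: "moebius a' b' c' d' (moebius a b c d z) = moebius ?p ?q ?r ?s z" if "Im z > 0" for z
  proof -
    define w where "w = complex_of_real c * z + of_real d"
    define u where "u = complex_of_real a * z + of_real b"
    have w: "w \<noteq> 0" using moebius_denom_nz[OF pos(1) that] by (simp add: w_def)
    have "moebius a' b' c' d' (u / w) = (of_real a' * u + of_real b' * w) / (of_real c' * u + of_real d' * w)"
    proof -
      have "of_real a' * (u / w) + of_real b' = (of_real a' * u + of_real b' * w) / w"
        "of_real c' * (u / w) + of_real d' = (of_real c' * u + of_real d' * w) / w"
        using w by (simp_all add: field_simps)
      then show ?thesis using w by (simp add: moebius_def)
    qed
    then show ?thesis by (simp add: moebius_def u_def w_def algebra_simps)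
  qed
  have "f (moebius a' b' c' d' (moebius a b c d z)) = f (moebius ?p ?q ?r ?s z)"
    if "Im z > 0" for z using comp[OF that] by simp
  then have "\<forall>\<^sub>\<approx>z\<in>upper_half_plane.
      f (moebius a' b' c' d' (moebius a b c d z)) = f (moebius ?p ?q ?r ?s z)"
    using open_upper_half_plane
    by (intro eventually_mono[OF eventually_in_cosparse[of upper_half_plane upper_half_plane]]) auto
  moreover have "(\<lambda>z. f (moebius ?p ?q ?r ?s z)) meromorphic_on upper_half_plane"
    using meromorphic_on_moebius[OF pos'] f by (simp add: mero_eq_def)
  moreover have "(\<lambda>z. f (moebius a' b' c' d' (moebius a b c d z))) meromorphic_on upper_half_plane"
    using meromorphic_on_moebius[OF pos(1) meromorphic_on_moebius[OF pos(2)]] f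
    by (simp add: mero_eq_def)
  ultimately show "mero_eq
     (if a * d - b * c > 0
      then (\<lambda>z. (if a' * d' - b' * c' > 0 then (\<lambda>z. f (moebius a' b' c' d' z)) else f) (moebius a b c d z))
      else (if a' * d' - b' * c' > 0 then (\<lambda>z. f (moebius a' b' c' d' z)) else f))
     (if ?p * ?s - ?q * ?r > 0 then (\<lambda>z. f (moebius ?p ?q ?r ?s z)) else f)"
    using pos pos' by (simp add: mero_eq_def)
qed

text \<open>
  Integers \<open>A, B, C, D\<close> such that \<open>(A d, B; N C, D d) / \<surd>d\<close> has determinant 1.
\<close>

definition atkin_lehner_entries :: "nat \<Rightarrow> nat \<Rightarrow> int \<times> int \<times> int \<times> int \<Rightarrow> bool" where
  "atkin_lehner_entries N d = (\<lambda>(A, B, C, D).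
     (A * int d) * (D * int d) - B * (int N * C) = int d)"

definition atkin_lehner_pullback ::
    "nat \<Rightarrow> nat \<Rightarrow> int \<times> int \<times> int \<times> int \<Rightarrow> mero_uhp \<Rightarrow> mero_uhp" where
  "atkin_lehner_pullback N d = (\<lambda>(A, B, C, D).
     pullback (of_int A * of_nat d / sqrt d) (of_int B / sqrt d)
              (of_nat N * of_int C / sqrt d) (of_int D * of_nat d / sqrt d))"

text \<open>
  The pullback \<open>w\<^sub>d\<^sup>*\<close>. On the function field, all admissible matrices give the same
  result, see \<open>atkin_lehner_eq\<close> below.
\<close>

definition atkin_lehner :: "nat \<Rightarrow> nat \<Rightarrow> mero_uhp \<Rightarrow> mero_uhp" where
  "atkin_lehner N d = atkin_lehner_pullback N d (SOME E. atkin_lehner_entries N d E)"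

lemma atkin_lehner_entries_exist:
  assumes "d > 0" "d dvd N" "coprime d (N div d)"
  shows "\<exists>E. atkin_lehner_entries N d E"
proof -
  obtain e where N: "N = d * e" using assms(2) by blast
  then have "coprime (int d) (int e)" using assms by simp
  then obtain u v where uv: "u * int d + v * int e = 1"
    by (metis bezout_int coprime_iff_gcd_eq_1)
  have "(u * int d) * (1 * int d) - (- v) * (int N * 1) = int d * (u * int d + v * int e)"
    by (simp add: N algebra_simps)
  then have "atkin_lehner_entries N d (u, - v, 1, 1)"
    using uv by (simp add: atkin_lehner_entries_def)
  then show ?thesis by blast
qed

lemma atkin_lehner_eq:
  assumes "d > 0" "d dvd N" "f \<in> X0_field N" "atkin_lehner_entries N d E"
  shows "atkin_lehner N d f = atkin_lehner_pullback N d E f"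
proof -
  obtain e where N: "N = d * e" using assms(2) by blast
  have indep: "atkin_lehner_pullback N d (A, B, C, D) f = atkin_lehner_pullback N d (A', B', C', D') f"
    if E: "atkin_lehner_entries N d (A, B, C, D)" and E': "atkin_lehner_entries N d (A', B', C', D')"
    for A B C D A' B' C' D'
  proof -
    have eq: "A * D * int d - B * int e * C = 1" if "atkin_lehner_entries N d (A, B, C, D)" for A B C D
    proof -
      have "int d * (A * D * int d - B * int e * C) = int d * 1"
        using that by (simp add: atkin_lehner_entries_def N algebra_simps)
      then show ?thesis using assms(1) by simp
    qed
    note e1 = eq[OF E] and e2 = eq[OF E']
    define p q r s where "p = A' * D * int d - B' * int e * C" and "q = A * B' - A' * B"
      and "r = int N * (C' * D - D' * C)" and "s = D' * A * int d - int e * C' * B"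
    have "p * s - q * r = (A * D * int d - B * int e * C) * (A' * D' * int d - B' * int e * C')"
      by (simp add: p_def q_def r_def s_def N algebra_simps)
    then have det: "p * s - q * r = 1" using e1 e2 by simp
    have inv: "pullback p q r s f = f"
    proof -
      have "int N dvd r" by (simp add: r_def)
      then show ?thesis using assms(3) det unfolding X0_field_def by blast
    qed
    define k where "k = sqrt (real d)"
    have k: "k > 0" "k * k = real d" using assms(1) by (simp_all add: k_def)
    have det_real: "real_of_int p * real_of_int s - real_of_int q * real_of_int r > 0"
      using det by (metis of_int_1 of_int_diff of_int_mult zero_less_one)
    have "(real_of_int A * real d / k) * (real_of_int D * real d / k) -
          (real_of_int B / k) * (real N * real_of_int C / k) =
          real_of_int ((A * int d) * (D * int d) - B * (int N * C)) / (k * k)"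
      by (simp add: diff_divide_distrib)
    also have "\<dots> = 1"
      using E assms(1) k by (simp add: atkin_lehner_entries_def)
    finally have det_AL: "(real_of_int A * real d / k) * (real_of_int D * real d / k) -
          (real_of_int B / k) * (real N * real_of_int C / k) > 0" by simp
    have m1: "p * (A * int d) + q * (int N * C) = A' * int d * (A * D * int d - B * int e * C)"
      "p * B + q * (D * int d) = B' * (A * D * int d - B * int e * C)"
      "r * (A * int d) + s * (int N * C) = int N * C' * (A * D * int d - B * int e * C)"
      "r * B + s * (D * int d) = D' * int d * (A * D * int d - B * int e * C)"
      by (simp_all add: p_def q_def r_def s_def N algebra_simps)
    have m2: "real_of_int p * (real_of_int A * real d) + real_of_int q * (real N * real_of_int C) = real_of_int A' * real d"
      "real_of_int p * real_of_int B + real_of_int q * (real_of_int D * real d) = real_of_int B'"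
      "real_of_int r * (real_of_int A * real d) + real_of_int s * (real N * real_of_int C) = real N * real_of_int C'"
      "real_of_int r * real_of_int B + real_of_int s * (real_of_int D * real d) = real_of_int D' * real d"
      using m1[THEN arg_cong[of _ _ real_of_int]] unfolding e1 by simp_all
    have m3: "real_of_int p * (real_of_int A * real d / k) + real_of_int q * (real N * real_of_int C / k) = real_of_int A' * real d / k"
      "real_of_int p * (real_of_int B / k) + real_of_int q * (real_of_int D * real d / k) = real_of_int B' / k"
      "real_of_int r * (real_of_int A * real d / k) + real_of_int s * (real N * real_of_int C / k) = real N * real_of_int C' / k"
      "real_of_int r * (real_of_int B / k) + real_of_int s * (real_of_int D * real d / k) = real_of_int D' * real d / k"
      unfolding m2[symmetric] by (simp_all add: add_divide_distrib)
    have "atkin_lehner_pullback N d (A, B, C, D) f =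
            atkin_lehner_pullback N d (A, B, C, D) (pullback p q r s f)"
      by (simp add: inv)
    also have "\<dots> = atkin_lehner_pullback N d (A', B', C', D') f"
      using pullback_pullback[OF det_AL det_real, of f] unfolding m3
      by (simp add: atkin_lehner_pullback_def k_def)
    finally show ?thesis .
  qed
  define E' where "E' = (SOME E. atkin_lehner_entries N d E)"
  have E': "atkin_lehner_entries N d E'"
    unfolding E'_def using assms(4) by (rule someI)
  obtain A B C D where "E = (A, B, C, D)" by (cases E)
  moreover obtain A' B' C' D' where "E' = (A', B', C', D')" by (cases E')
  ultimately have "atkin_lehner_pullback N d E' f = atkin_lehner_pullback N d E f"
    using indep[of A' B' C' D' A B C D] assms(4) E' by blast
  then show ?thesis by (simp add: atkin_lehner_def E'_def)
qed


section \<open>Generated subfields and equations\<close>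

definition is_subfield :: "'a :: field set \<Rightarrow> bool" where
  "is_subfield K \<longleftrightarrow> 0 \<in> K \<and> 1 \<in> K \<and>
     (\<forall>a\<in>K. \<forall>b\<in>K. a + b \<in> K \<and> a * b \<in> K) \<and> (\<forall>a\<in>K. - a \<in> K \<and> inverse a \<in> K)"

text \<open>\<open>\<rat>(S)\<close>: in characteristic 0, every subfield contains the rational numbers.\<close>

definition rat_adjoin :: "'a :: field_char_0 set \<Rightarrow> 'a set" where
  "rat_adjoin S = is_subfield hull S"

text \<open>
  \<open>\<rat>[X, Y, T]\<close> is encoded as \<open>\<rat>[X][Y][T]\<close>.
\<close>

type_synonym poly3 = "rat poly poly poly"

definition var_X :: poly3 where "var_X = [:[:[:0, 1:]:]:]"
definition var_Y :: poly3 where "var_Y = [:[:0, 1:]:]"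
definition var_T :: poly3 where "var_T = [:0, 1:]"

definition eval3 :: "'a :: field_char_0 \<Rightarrow> 'a \<Rightarrow> 'a \<Rightarrow> poly3 \<Rightarrow> 'a" where
  "eval3 x y t P =
     poly (map_poly (\<lambda>Q. poly (map_poly (\<lambda>R. poly (map_poly of_rat R) x) Q) y) P) t"

text \<open>
  The affine scheme \<open>P = Q = 0\<close> over \<open>\<rat>\<close> is integral and \<open>X, Y, T \<mapsto> x, y, t\<close>
  induces an isomorphism of its function field \<open>Frac (\<rat>[X, Y, T] / (P, Q))\<close> onto \<open>K\<close>.
  For \<open>K\<close> the function field of a curve, this says that the curve is birational over \<open>\<rat>\<close>
  to the one with equations \<open>P = Q = 0\<close>, via \<open>(x, y, t)\<close>.
\<close>

definition equations_for ::
    "'a :: field_char_0 set \<Rightarrow> 'a \<Rightarrow> 'a \<Rightarrow> 'a \<Rightarrow> poly3 \<Rightarrow> poly3 \<Rightarrow> bool" where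
  "equations_for K x y t P Q \<longleftrightarrow>
     {R. eval3 x y t R = 0} = {U * P + V * Q | U V. True} \<and>
     K = {eval3 x y t R / eval3 x y t S | R S. eval3 x y t S \<noteq> 0}"

end

theory Submission
  imports Defs "HOL-Probability.Characteristic_Functions" "HOL-Computational_Algebra.Fundamental_Theorem_Algebra"
begin

text \<open>
  With \<open>s = 2 z\<close>, let \<open>P = \<theta>\<^sub>3(s) \<theta>\<^sub>3(11 s)\<close>, \<open>N = \<theta>\<^sub>4(s) \<theta>\<^sub>4(11 s)\<close>, \<open>R = \<theta>\<^sub>2(s) \<theta>\<^sub>2(11 s)\<close>, and let
  \<open>Q\<close> be the theta series of \<open>x\<^sup>2 + x y + 3 y\<^sup>2\<close>. Then \<open>2 Q\<^sup>2 = P\<^sup>2 + N\<^sup>2 + R\<^sup>2\<close>, and the modular equation of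
  degree 11 reads \<open>(P - N - R)\<^sup>3 = 16 P N R\<close>. In terms of \<open>x = (P - N) / R\<close>, \<open>y = 2 (P + N) / R\<close> and
  \<open>T = 4 Q / R\<close> these identities become \<open>y\<^sup>2 = x\<^sup>3 + x\<^sup>2 + 3 x - 1\<close> and \<open>T\<^sup>2 = x\<^sup>3 + 5 x\<^sup>2 + 3 x + 7\<close>; the
  generator \<open>t\<close> is \<open>(2 + x) T\<close>. By Poisson summation \<open>SL\<^sub>2(\<int>)\<close> permutes \<open>P, - N, - R\<close> up to scalars, so
  \<open>x, y, T\<close> live on \<open>X\<^sub>0(44)\<close>; the modular equation holds because \<open>(P - N - R)\<^sup>3 / (P N R)\<close> is modular and
  bounded at all cusps, hence constant.

  The involution \<open>w\<^sub>1\<^sub>1\<close> fixes \<open>x, y\<close> and negates \<open>T\<close>, the translation \<open>z \<mapsto> z + 1/2\<close> fixes \<open>x\<close> and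
  negates \<open>y, T\<close>. Suppose that \<open>f\<close> is invariant under both, has no poles in the upper half plane and is
  bounded at the cusps \<open>a / c\<close> with \<open>4\<close> not dividing \<open>c\<close>. Then \<open>f\<close> is determined by its principal part at
  \<open>\<infinity>\<close>, a polynomial in \<open>q\<^sup>-\<^sup>2\<close>, and \<open>x\<close> has the leading term \<open>q\<^sup>-\<^sup>2\<close> up to a factor; so \<open>f\<close> is a polynomial
  in \<open>x\<close>. Poles in the upper half plane are cleared by factors \<open>x - x(z)\<close>, those at the cusps with \<open>4\<close>
  not dividing \<open>c\<close> by powers of \<open>x - 1\<close>. Splitting a function into isotypic parts for the four-group shows that it
  is a combination of \<open>1, y, T, y T\<close> over \<open>\<complex>(x)\<close>. If its \<open>q\<close>-expansion is rational, apply a \<open>\<rat>\<close>-linear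
  functional \<open>\<complex> \<rightarrow> \<rat>\<close> to the coefficients of this relation to replace \<open>\<complex>(x)\<close> by \<open>\<rat>(x)\<close>.
\<close>

section \<open>Poisson summation for Gaussians\<close>

text \<open>Every form is built from products of theta constants at s and 11 s, so the two
  square-root factors of an inversion merge into a weight one factor common to all four forms. In
  ratios only a permutation and a sign survive. A sign at 11 separates \<open>Q11\<close> from the
  other three: built from series of level 2, it meets the Gauss sum of \<open>8 * l\<close>, the
  others that of \<open>16 * l\<close>, and 2 is not a square modulo 11. Constancy and polynomiality
  rest on one Liouville theorem, obtained by multiplying over the finitely many translates under
  SL_2(Z). It works with growth rates at the cusps, so leading terms are all that is computed. At
  every cusp P - N - R decays, while only one of the three forms does; hence x - 1 = (P - N - R) / R
  vanishes wherever the form in the denominator survives, that is at the cusps with 4 not dividing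
  c. The cusps with 4 | c are infinity and 1/4; w exchanges them, so for a w-invariant function a
  bound at infinity is enough. The factor 2 + x in t changes the affine model, not the
  field.\<close>

lemma fourier_coeffs_zero_imp_zero:
  fixes f :: "real \<Rightarrow> real"
  assumes cont: "continuous_on UNIV f" and per: "\<And>x. f (x + 1) = f x"
    and coeff: "\<And>k::int. ((\<lambda>x. complex_of_real (f x) * cis (2 * pi * k * x)) has_integral 0) {0..1}"
  shows "f x = 0"
proof -
  have per_int: "f (x + of_int k) = f x" for x and k :: int
  proof (induction k rule: int_induct[where k=0])
    case (step1 i) then show ?case using per[of "x + of_int i"] by (simp add: algebra_simps)
  next
    case (step2 i) then show ?case using per[of "x + of_int (i - 1)"] by (simp add: algebra_simps)
  qed simp
  \<comment> \<open>The 1-periodic \<open>f\<close> descends to a function \<open>d\<close> on the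
    unit circle, where Stone-Weierstrass applies; polynomials there are trigonometric polynomials in
    x.\<close>
  define d where "d w = f (Arg w / (2 * pi))" for w
  have d_cis: "d (cis (2 * pi * x)) = f x" for x
  proof -
    have "cis (Arg (cis (2 * pi * x))) = cis (2 * pi * x)"
      using cis_Arg[of "cis (2 * pi * x)"] by (simp add: sgn_if sgn_div_norm)
    then obtain n :: int where "\<i> * complex_of_real (Arg (cis (2 * pi * x))) =
        \<i> * complex_of_real (2 * pi * x) + of_int (2 * n) * pi * \<i>"
      unfolding cis_conv_exp exp_eq by blast
    then have "Im (\<i> * complex_of_real (Arg (cis (2 * pi * x)))) =
        Im (\<i> * complex_of_real (2 * pi * x) + of_int (2 * n) * pi * \<i>)" by (rule arg_cong)
    then have "Arg (cis (2 * pi * x)) = 2 * pi * x + 2 * of_int n * pi" by simp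
    then have "Arg (cis (2 * pi * x)) / (2 * pi) = x + of_int n" by (simp add: field_simps)
    then show ?thesis by (simp add: d_def per_int)
  qed
  have d_alt: "d w = f (Arg2pi w / (2 * pi))" if "norm w = 1" for w
  proof -
    have "w = cis (2 * pi * (Arg2pi w / (2 * pi)))"
      using Arg2pi_eq[of w] that by (simp add: cis_conv_exp)
    then show ?thesis using d_cis by metis
  qed
  have contf: "continuous (at a within A) f" for a A
    using cont by (simp add: continuous_on_eq_continuous_within continuous_at_imp_continuous_at_within)
  have contd: "continuous_on (sphere 0 1) d"
    unfolding continuous_on_eq_continuous_within
  proof
    fix w :: complex assume w: "w \<in> sphere 0 1"
    show "continuous (at w within sphere 0 1) d"
    \<comment> \<open>\<open>Arg\<close> jumps on the negative axis and \<open>Arg2pi\<close> on the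
      positive one; by periodicity \<open>d\<close> can be computed with either, so each branch
      covers the cut of the other.\<close>
    proof (cases "w \<in> \<real>\<^sub>\<le>\<^sub>0")
      case False
      then have "continuous (at w within sphere 0 1) Arg"
        using continuous_at_Arg continuous_at_imp_continuous_at_within by blast
      then show ?thesis unfolding d_def
        by (intro continuous_within_compose2[OF _ contf] continuous_intros) auto
    next
      case True
      then have "w \<notin> \<real>\<^sub>\<ge>\<^sub>0" using w
        by (auto simp: nonneg_Reals_def nonpos_Reals_def)
      then have "continuous (at w within sphere 0 1) Arg2pi"
        using continuous_at_Arg2pi continuous_at_imp_continuous_at_within by blast
      then have "continuous (at w within sphere 0 1) (\<lambda>w. f (Arg2pi w / (2 * pi)))"
        by (intro continuous_within_compose2[OF _ contf] continuous_intros) auto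
      then show ?thesis
        by (rule continuous_transform_within[OF _ zero_less_one])
           (use w in \<open>auto simp: d_alt\<close>)
    qed
  qed
  \<comment> \<open>Stated for a weight g and all exponentials at once, so that the property
    survives multiplication by \<open>cis\<close> and hence, by induction, by any polynomial in
    \<open>cis (2 * pi * x)\<close>.\<close>
  define Q where "Q g \<longleftrightarrow> continuous_on UNIV g \<and>
     (\<forall>k::int. ((\<lambda>x. complex_of_real (f x) * g x * cis (2 * pi * k * x)) has_integral 0) {0..1})" for g :: "real \<Rightarrow> complex"
  have Q_add: "Q (\<lambda>x. g x + h x)" if "Q g" "Q h" for g h
    using that unfolding Q_def
    by (auto simp: algebra_simps intro!: continuous_intros has_integral_add[where k=0 and l=0, simplified])
  have Q_scale: "Q (\<lambda>x. c * g x)" if "Q g" for g c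
  proof -
    have "((\<lambda>x. c * (complex_of_real (f x) * g x * cis (2 * pi * k * x))) has_integral c * 0) {0..1}" for k :: int
      by (rule has_integral_mult_right) (use that in \<open>auto simp: Q_def\<close>)
    then show ?thesis using that unfolding Q_def
      by (auto simp: mult_ac intro!: continuous_intros)
  qed
  have Q_cis: "Q (\<lambda>x. g x * cis (2 * pi * of_int m * x))" if "Q g" for g and m :: int
    unfolding Q_def
  proof (intro conjI allI)
    fix k :: int
    have "((\<lambda>x. complex_of_real (f x) * g x * cis (2 * pi * of_int (m + k) * x)) has_integral 0) {0..1}"
      using that unfolding Q_def by blast
    then show "((\<lambda>x. complex_of_real (f x) * (g x * cis (2 * pi * of_int m * x)) * cis (2 * pi * of_int k * x)) has_integral 0) {0..1}"
      by (simp add: mult.assoc cis_mult algebra_simps)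
  qed (use that in \<open>auto simp: Q_def intro!: continuous_intros\<close>)
  have poly: "Q (\<lambda>x. g x * of_real (p (cis (2 * pi * x))))"
    if "real_polynomial_function p" "Q g" for p g
    using that
  proof (induction arbitrary: g)
    case (linear p)
    note Qg = linear.prems
    from linear.hyps interpret bounded_linear p .
    have lin: "p (cis t) = p 1 * cos t + p \<i> * sin t" for t
    proof -
      have "cis t = cos t *\<^sub>R 1 + sin t *\<^sub>R \<i>" by (simp add: complex_eq_iff)
      then show ?thesis by (metis add scaleR real_scaleR_def mult.commute)
    qed
    \<comment> \<open>A real linear form on a point of the circle is a combination of
      \<open>cis t\<close> and \<open>cis (- t)\<close>, that is of the frequencies 1 and
      -1.\<close>
    have eq: "complex_of_real (p (cis t)) = ((p 1 - \<i> * p \<i>) / 2) * cis t + ((p 1 + \<i> * p \<i>) / 2) * cis (-t)" for t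
      by (simp add: lin complex_eq_iff field_simps)
    have "Q (\<lambda>x. ((p 1 - \<i> * p \<i>) / 2) * (g x * cis (2 * pi * of_int 1 * x)) +
                 ((p 1 + \<i> * p \<i>) / 2) * (g x * cis (2 * pi * of_int (-1) * x)))"
      by (intro Q_add Q_scale Q_cis Qg)
    then show ?case by (simp add: eq algebra_simps)
  next
    case (const c)
    then show ?case using Q_scale[of g "of_real c"] by (simp add: mult.commute)
  next
    case (add p q)
    then show ?case using Q_add by (simp add: algebra_simps)
  next
    case (mult p q)
    show ?case using mult.IH(2)[OF mult.IH(1)[OF mult.prems]] by (simp add: mult_ac)
  qed
  have Q1: "Q (\<lambda>_. 1)" using coeff unfolding Q_def by (auto intro!: continuous_intros)
  have cont01: "continuous_on {0..1} f" using cont continuous_on_subset by blast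
  have intg: "(\<lambda>x. f x * f x) integrable_on {0..1}"
    by (intro integrable_continuous_interval continuous_intros cont01)
  \<comment> \<open>\<open>f\<close> is orthogonal to the approximating polynomial g, so the
    integral of f^2 equals that of f (f - g).\<close>
  have small: "integral {0..1} (\<lambda>x. f x * f x) \<le> e * integral {0..1} (\<lambda>x. \<bar>f x\<bar>)" if e: "e > 0" for e
  proof -
    obtain p where p: "real_polynomial_function p" "\<And>w. w \<in> sphere 0 1 \<Longrightarrow> \<bar>d w - p w\<bar> < e"
      using Stone_Weierstrass_real_polynomial_function[OF compact_sphere contd e] by blast
    define g where "g x = p (cis (2 * pi * x))" for x
    have g: "\<bar>f x - g x\<bar> < e" for x using p(2)[of "cis (2 * pi * x)"] by (simp add: g_def d_cis)
    have "Q (\<lambda>x. 1 * of_real (p (cis (2 * pi * x))))" by (rule poly[OF p(1) Q1])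
    then have *: "((\<lambda>x. complex_of_real (f x) * (1 * of_real (p (cis (2 * pi * x)))) * cis (2 * pi * of_int 0 * x)) has_integral 0) {0..1}"
      unfolding Q_def by blast
    have I1: "((\<lambda>x. complex_of_real (f x * g x)) has_integral complex_of_real 0) {0..1}"
      using * by (simp add: g_def)
    have I0: "((\<lambda>x. f x * g x) has_integral 0) {0..1}"
      using has_integral_linear[OF I1 bounded_linear_Re] by (simp add: o_def)
    have i3: "(\<lambda>x. e * \<bar>f x\<bar>) integrable_on {0..1}"
      by (intro integrable_continuous_interval continuous_intros cont01)
    have "integral {0..1} (\<lambda>x. f x * f x) = integral {0..1} (\<lambda>x. f x * f x - f x * g x)"
      using intg I0 by (simp add: integral_diff integral_unique has_integral_integrable)
    also have "\<dots> \<le> integral {0..1} (\<lambda>x. e * \<bar>f x\<bar>)"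
    proof (rule integral_le)
      show "(\<lambda>x. f x * f x - f x * g x) integrable_on {0..1}"
        using intg I0 by (intro integrable_diff) (auto intro: has_integral_integrable)
      show "f x * f x - f x * g x \<le> e * \<bar>f x\<bar>" for x
      proof -
        have "f x * f x - f x * g x \<le> \<bar>f x * (f x - g x)\<bar>" by (simp add: algebra_simps)
        also have "\<dots> = \<bar>f x\<bar> * \<bar>f x - g x\<bar>" by (simp add: abs_mult)
        also have "\<dots> \<le> \<bar>f x\<bar> * e" using g[of x] by (intro mult_left_mono) auto
        finally show ?thesis by (simp add: mult.commute)
      qed
    qed (fact i3)
    finally show ?thesis by simp
  qed
  have "integral {0..1} (\<lambda>x. f x * f x) \<le> 0"
  proof (rule field_le_epsilon)
    fix e :: real assume e: "e > 0"
    define I where "I = integral {0..1} (\<lambda>x. \<bar>f x\<bar>)"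
    have "I \<ge> 0" unfolding I_def by (rule integral_nonneg) (auto intro!: integrable_continuous_interval continuous_intros cont01)
    then have "e / (I + 1) * I \<le> e" using e by (simp add: field_simps)
    then show "integral {0..1} (\<lambda>x. f x * f x) \<le> 0 + e"
      using small[of "e / (I + 1)"] e \<open>I \<ge> 0\<close> unfolding I_def by fastforce
  qed
  moreover have "integral {0..1} (\<lambda>x. f x * f x) \<ge> 0" by (rule integral_nonneg[OF intg]) auto
  ultimately have "((\<lambda>x. f x * f x) has_integral 0) {0..1}" using intg by (simp add: has_integral_iff)
  then have z: "f x * f x = 0" if "x \<in> {0..1}" for x
    using has_integral_0_cbox_imp_0[of 0 1 "\<lambda>x. f x * f x" x] that cont01
    by (auto intro!: continuous_intros)
  have "x + of_int (- \<lfloor>x\<rfloor>) \<in> {0..1}" by (simp; linarith)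
  then show ?thesis using z[of "x + of_int (- \<lfloor>x\<rfloor>)"] per_int[of x "- \<lfloor>x\<rfloor>"] by simp
qed

text \<open>The Weierstrass M-test for unordered sums, along the filter of finite subsets. It
  supplies continuity and term-by-term integration in Poisson summation, and holomorphy of the theta
  series.\<close>

lemma infsum_uniform_limit:
  fixes f :: "'i \<Rightarrow> 'b \<Rightarrow> 'c :: banach"
  assumes bd: "\<And>i x. x \<in> A \<Longrightarrow> norm (f i x) \<le> M i" and M: "M summable_on I"
  shows "uniform_limit A (\<lambda>X x. \<Sum>i\<in>X. f i x) (\<lambda>x. \<Sum>\<^sub>\<infinity>i\<in>I. f i x) (finite_subsets_at_top I)"
proof (cases "A = {}")
  case False
  then obtain x0 where x0: "x0 \<in> A" by blast
  have M0: "M i \<ge> 0" for i using bd[OF x0, of i] norm_ge_zero order_trans by blast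
  show ?thesis
  proof (rule uniform_limitI)
    fix e :: real assume e: "e > 0"
    have "(sum M \<longlongrightarrow> infsum M I) (finite_subsets_at_top I)"
      using has_sum_infsum[OF M] by (simp add: has_sum_def)
    then have "\<forall>\<^sub>F X in finite_subsets_at_top I. dist (sum M X) (infsum M I) < e"
      using e by (rule tendstoD)
    moreover have "\<forall>\<^sub>F X in finite_subsets_at_top I. finite X \<and> X \<subseteq> I"
      by (rule eventually_finite_subsets_at_top_weakI) auto
    ultimately show "\<forall>\<^sub>F X in finite_subsets_at_top I. \<forall>x\<in>A. dist (\<Sum>i\<in>X. f i x) (\<Sum>\<^sub>\<infinity>i\<in>I. f i x) < e"
    proof eventually_elim
      case (elim X)
      then have X: "finite X" "X \<subseteq> I" by auto
      show ?case
      proof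
        fix x assume x: "x \<in> A"
        have MX: "M summable_on (I - X)" using M by (rule summable_on_subset_banach) auto
        have nf: "(\<lambda>i. norm (f i x)) summable_on I"
          by (rule summable_on_comparison_test[OF M]) (use bd x in auto)
        then have fs: "(\<lambda>i. f i x) summable_on I" by (rule abs_summable_summable)
        have "infsum (\<lambda>i. f i x) (I - X) = infsum (\<lambda>i. f i x) I - sum (\<lambda>i. f i x) X"
          using X fs by (simp add: infsum_Diff)
        then have "dist (\<Sum>i\<in>X. f i x) (\<Sum>\<^sub>\<infinity>i\<in>I. f i x) = norm (infsum (\<lambda>i. f i x) (I - X))"
          by (simp add: dist_norm norm_minus_commute)
        also have "\<dots> \<le> infsum M (I - X)"
          by (rule norm_infsum_le[of _ _ _ M])
             (use MX bd x fs summable_on_subset_banach[OF fs, of "I - X"] in \<open>auto intro: has_sum_infsum\<close>)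
        also have "infsum M (I - X) = infsum M I - sum M X" using X M by (simp add: infsum_Diff)
        also have "\<dots> < e" using elim by (simp add: dist_norm)
        finally show "dist (\<Sum>i\<in>X. f i x) (\<Sum>\<^sub>\<infinity>i\<in>I. f i x) < e" .
      qed
    qed
  qed
qed simp

lemma summable_on_exp_neg_square_int:
  assumes "c > 0"
  shows "(\<lambda>k::int. exp (- c * (of_int k)\<^sup>2) :: real) summable_on UNIV"
proof -
  have nat: "(\<lambda>n::nat. exp (- c * (of_nat n)\<^sup>2) :: real) summable_on UNIV"
  proof -
    have "summable (\<lambda>n::nat. exp (- c) ^ n)" using assms by (simp add: summable_geometric)
    then have "summable (\<lambda>n::nat. exp (- c * (of_nat n)\<^sup>2))"
    proof (rule summable_comparison_test')
      fix n :: nat assume "n \<ge> 0"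
      have "real n \<le> (real n)\<^sup>2" by (cases n) (auto simp: power2_eq_square)
      then have "- c * (real n)\<^sup>2 \<le> real n * (- c)" using assms by simp
      then show "norm (exp (- c * (real n)\<^sup>2)) \<le> exp (- c) ^ n"
        by (metis exp_of_nat_mult exp_le_cancel_iff norm_exp order_trans real_norm_def abs_exp_cancel)
    qed
    then show ?thesis by (subst summable_on_UNIV_nonneg_real_iff) auto
  qed
  have 1: "(\<lambda>k::int. exp (- c * (of_int k)\<^sup>2) :: real) summable_on (range int)"
    using nat by (subst summable_on_reindex) (auto simp: o_def)
  have 2: "(\<lambda>k::int. exp (- c * (of_int k)\<^sup>2) :: real) summable_on (range (\<lambda>n. - int n))"
    using nat by (subst summable_on_reindex) (auto simp: o_def inj_def)
  have "UNIV = range int \<union> (range (\<lambda>n. - int n) - range int)"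
    by (auto simp: image_iff) (metis int_cases2)
  moreover have "(\<lambda>k::int. exp (- c * (of_int k)\<^sup>2) :: real) summable_on (range int \<union> (range (\<lambda>n. - int n) - range int))"
    by (intro summable_on_Un_disjoint 1 summable_on_subset_banach[OF 2]) auto
  ultimately show ?thesis by simp
qed

text \<open>The characteristic function of the standard normal law is a Gaussian; the substitution x
  -> c x with c^2 = 2 pi y turns its density into exp(-pi y x^2), up to a constant.\<close>

lemma gaussian_fourier_transform:
  fixes y t :: real
  assumes y: "y > 0"
  shows "integrable lborel (\<lambda>x. exp (- pi * y * x\<^sup>2) * cis (2 * pi * t * x))"
    and "(LINT x|lborel. exp (- pi * y * x\<^sup>2) * cis (2 * pi * t * x)) =
           complex_of_real (exp (- pi * t\<^sup>2 / y) / sqrt y)"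
proof -
  define c where "c = sqrt (2 * pi * y)"
  have c: "c > 0" "c\<^sup>2 = 2 * pi * y" using y by (auto simp: c_def)
  define s where "s = 2 * pi * t / c"
  have int: "integrable lborel (\<lambda>x. std_normal_density x *\<^sub>R iexp (s * x))"
    by (rule Bochner_Integration.integrable_bound[OF integrable_std_normal_moment[of 0]])
       (auto simp: normal_density_nonneg)
  have "char std_normal_distribution s = (LINT x|lborel. std_normal_density x *\<^sub>R iexp (s * x))"
    unfolding char_def by (subst integral_density) (auto simp: normal_density_nonneg)
  then have val: "(LINT x|lborel. std_normal_density x *\<^sub>R iexp (s * x)) = exp (- s\<^sup>2 / 2)"
    by (simp add: char_std_normal_distribution)
  have eq: "std_normal_density (0 + c * x) *\<^sub>R iexp (s * (0 + c * x)) =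
      complex_of_real (1 / sqrt (2 * pi)) * (exp (- pi * y * x\<^sup>2) * cis (2 * pi * t * x))" for x
  proof -
    have "(c * x)\<^sup>2 / 2 = pi * y * x\<^sup>2" using c by (simp add: power_mult_distrib)
    moreover have "s * (c * x) = 2 * pi * t * x" using c by (simp add: s_def)
    moreover have "iexp (s * (0 + c * x)) = cis (s * (c * x))" by (simp add: cis_conv_exp)
    ultimately show ?thesis
      by (simp only:) (simp add: std_normal_density_def scaleR_conv_of_real)
  qed
  have "integrable lborel (\<lambda>x. std_normal_density (0 + c * x) *\<^sub>R iexp (s * (0 + c * x)))"
    by (rule lborel_integrable_real_affine[OF int]) (use c in auto)
  then have "integrable lborel (\<lambda>x. complex_of_real (1 / sqrt (2 * pi)) * (exp (- pi * y * x\<^sup>2) * cis (2 * pi * t * x)))"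
    unfolding eq .
  then show int': "integrable lborel (\<lambda>x. exp (- pi * y * x\<^sup>2) * cis (2 * pi * t * x))"
    using integrable_mult_right[of "complex_of_real (sqrt (2 * pi))"] by (force simp: mult_ac)
  have "(LINT x|lborel. std_normal_density x *\<^sub>R iexp (s * x)) =
        c *\<^sub>R (LINT x|lborel. std_normal_density (0 + c * x) *\<^sub>R iexp (s * (0 + c * x)))"
    using lborel_integral_real_affine[of c "\<lambda>x. std_normal_density x *\<^sub>R iexp (s * x)" 0] c by simp
  also have "\<dots> = c *\<^sub>R (complex_of_real (1 / sqrt (2 * pi)) * (LINT x|lborel. exp (- pi * y * x\<^sup>2) * cis (2 * pi * t * x)))"
    unfolding eq by simp
  also have "\<dots> = complex_of_real (sqrt y) * (LINT x|lborel. exp (- pi * y * x\<^sup>2) * cis (2 * pi * t * x))"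
  proof -
    have "c * (1 / sqrt (2 * pi)) = sqrt y" by (simp add: c_def real_sqrt_mult)
    then have "complex_of_real c * complex_of_real (1 / sqrt (2 * pi)) = complex_of_real (sqrt y)"
      by (metis of_real_mult)
    then show ?thesis by (simp only: scaleR_conv_of_real mult.assoc[symmetric])
  qed
  finally have "complex_of_real (sqrt y) * (LINT x|lborel. exp (- pi * y * x\<^sup>2) * cis (2 * pi * t * x)) = exp (- s\<^sup>2 / 2)"
    using val by simp
  moreover have "s\<^sup>2 / 2 = pi * t\<^sup>2 / y"
    using c y by (simp add: s_def power_divide power_mult_distrib) (simp add: power2_eq_square field_simps)
  ultimately have "complex_of_real (sqrt y) * (LINT x|lborel. exp (- pi * y * x\<^sup>2) * cis (2 * pi * t * x)) = exp (- pi * t\<^sup>2 / y)"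
    by simp
  then show "(LINT x|lborel. exp (- pi * y * x\<^sup>2) * cis (2 * pi * t * x)) =
           complex_of_real (exp (- pi * t\<^sup>2 / y) / sqrt y)"
    using y by (simp add: field_simps)
qed

lemma summable_on_gaussian_int:
  assumes "c > 0"
  shows "(\<lambda>n::int. exp (- c * (of_int n + a)\<^sup>2) :: real) summable_on UNIV"
proof (rule summable_on_comparison_test)
  show "(\<lambda>n::int. exp (c * a\<^sup>2) * exp (- (c / 2) * (of_int n)\<^sup>2)) summable_on UNIV"
    using assms by (intro summable_on_cmult_right summable_on_exp_neg_square_int) auto
  fix n :: int
  \<comment> \<open>Expanding this square gives (n + a)^2 >= n^2 / 2 - a^2, which removes the
    shift.\<close>
  have "0 \<le> (real_of_int n + 2 * a)\<^sup>2" by simp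
  then have "(real_of_int n)\<^sup>2 / 2 - a\<^sup>2 \<le> (real_of_int n + a)\<^sup>2"
    by (simp add: power2_eq_square algebra_simps)
  then have "- c * (real_of_int n + a)\<^sup>2 \<le> - c * ((real_of_int n)\<^sup>2 / 2 - a\<^sup>2)"
    using assms by simp
  then have "- c * (real_of_int n + a)\<^sup>2 \<le> c * a\<^sup>2 + - (c / 2) * (real_of_int n)\<^sup>2"
    by (simp add: algebra_simps)
  then show "exp (- c * (real_of_int n + a)\<^sup>2) \<le> exp (c * a\<^sup>2) * exp (- (c / 2) * (real_of_int n)\<^sup>2)"
    by (simp flip: exp_add)
qed auto

lemma filterlim_int_interval_finite_subsets:
  "filterlim (\<lambda>N. {- int N..<int N}) (finite_subsets_at_top UNIV) sequentially"
  unfolding filterlim_finite_subsets_at_top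
proof (intro allI impI)
  fix X :: "int set" assume "finite X \<and> X \<subseteq> UNIV"
  then obtain B where B: "\<And>x. x \<in> X \<Longrightarrow> \<bar>x\<bar> \<le> B"
    by (metis bdd_above_finite bdd_above.E finite_imageI imageI)
  show "\<forall>\<^sub>F N in sequentially. finite {- int N..<int N} \<and> X \<subseteq> {- int N..<int N} \<and> {- int N..<int N} \<subseteq> UNIV"
    using eventually_gt_at_top[of "nat (\<bar>B\<bar> + 1)"]
    by eventually_elim (use B in force)
qed

text \<open>Both sides are continuous 1-periodic functions of a. Their Fourier coefficients agree:
  on the right by term-by-term integration, on the left because the integrals over unit intervals
  add up to the Fourier transform of one Gaussian.\<close>

lemma poisson_gaussian:
  fixes y a :: real
  assumes y: "y > 0"
  shows "complex_of_real (\<Sum>\<^sub>\<infinity>n::int. exp (- pi * y * (of_int n + a)\<^sup>2)) =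
         complex_of_real (1 / sqrt y) * (\<Sum>\<^sub>\<infinity>k::int. exp (- pi * (of_int k)\<^sup>2 / y) * cis (2 * pi * k * a))"
proof -
  define e where "e k = exp (- pi * (real_of_int k)\<^sup>2 / y)" for k
  have e_eq: "e k = exp (- (pi / y) * (of_int k)\<^sup>2)" for k by (simp add: e_def)
  have e_sum: "e summable_on UNIV"
    unfolding e_eq using y by (intro summable_on_exp_neg_square_int) auto
  define L where "L x = (\<Sum>\<^sub>\<infinity>n::int. exp (- pi * y * (of_int n + x)\<^sup>2))" for x
  define R where "R x = (\<Sum>\<^sub>\<infinity>k::int. of_real (e k) * cis (2 * pi * k * x))" for x
  have R_lim: "uniform_limit A (\<lambda>X x. \<Sum>k\<in>X. of_real (e k) * cis (2 * pi * of_int k * x)) R (finite_subsets_at_top UNIV)" for A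
    unfolding R_def by (rule infsum_uniform_limit[where M=e]) (auto intro: e_sum simp: norm_mult e_def)
  \<comment> \<open>The vanishing criterion is for real functions; the even coefficients make
    \<open>R\<close> equal to its conjugate.\<close>
  have Im_R: "Im (R x) = 0" for x
  proof -
    have s: "(\<lambda>k. of_real (e k) * cis (2 * pi * of_int k * x)) summable_on UNIV"
      by (rule abs_summable_summable, rule summable_on_comparison_test[OF e_sum])
         (auto simp: norm_mult e_def)
    have "R x = (\<Sum>\<^sub>\<infinity>k::int. of_real (e (-k)) * cis (2 * pi * of_int (-k) * x))"
      unfolding R_def
      by (rule infsum_reindex_bij_witness[of _ uminus uminus]) auto
    also have "\<dots> = (\<Sum>\<^sub>\<infinity>k::int. cnj (of_real (e k) * cis (2 * pi * of_int k * x)))"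
      by (simp add: e_def cis_cnj)
    also have "\<dots> = cnj (R x)" unfolding R_def by (rule infsum_cnj)
    finally show ?thesis by (metis complex_cnj_cancel_iff complex_cnj cnj.simps(2) neg_equal_zero)
  qed
  have L_bd: "exp (- pi * y * (of_int n + x)\<^sup>2) \<le> exp (pi * y * B\<^sup>2) * exp (- (pi * y / 2) * (of_int n)\<^sup>2)"
    if "\<bar>x\<bar> \<le> B" for n :: int and x B :: real
  proof -
    have "x\<^sup>2 \<le> B\<^sup>2" using that by (metis abs_le_square_iff abs_of_nonneg abs_ge_zero order_trans)
    moreover have "0 \<le> (real_of_int n + 2 * x)\<^sup>2" by simp
    then have "(real_of_int n)\<^sup>2 / 2 - x\<^sup>2 \<le> (real_of_int n + x)\<^sup>2"
      by (simp add: power2_eq_square algebra_simps)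
    ultimately have "(real_of_int n)\<^sup>2 / 2 - B\<^sup>2 \<le> (real_of_int n + x)\<^sup>2" by linarith
    then have "(pi * y) * ((real_of_int n)\<^sup>2 / 2 - B\<^sup>2) \<le> (pi * y) * (real_of_int n + x)\<^sup>2"
      using y by (intro mult_left_mono) auto
    then have "- pi * y * (of_int n + x)\<^sup>2 \<le> pi * y * B\<^sup>2 + - (pi * y / 2) * (of_int n)\<^sup>2"
      by (simp add: algebra_simps)
    then show ?thesis by (simp flip: exp_add)
  qed
  have L_lim: "uniform_limit {-B..B} (\<lambda>X x. \<Sum>n\<in>X. exp (- pi * y * (of_int n + x)\<^sup>2)) L (finite_subsets_at_top UNIV)" for B
    unfolding L_def
  proof (rule infsum_uniform_limit)
    show "(\<lambda>n::int. exp (pi * y * B\<^sup>2) * exp (- (pi * y / 2) * (of_int n)\<^sup>2)) summable_on UNIV"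
      using y by (intro summable_on_cmult_right summable_on_exp_neg_square_int) auto
  qed (use L_bd in auto)
  have contR: "continuous_on UNIV R"
    by (rule uniform_limit_theorem[OF _ R_lim]) (auto intro!: always_eventually continuous_intros)
  have contL: "continuous_on UNIV L"
  proof -
    have "continuous_on {-B..B} L" for B
      by (rule uniform_limit_theorem[OF _ L_lim]) (auto intro!: always_eventually continuous_intros)
    note cont_int = this
    have "isCont L x" for x
    proof (rule continuous_on_interior[OF cont_int])
      show "x \<in> interior {-(\<bar>x\<bar> + 1)..\<bar>x\<bar> + 1}" by (simp add: interior_atLeastAtMost_real; linarith)
    qed
    then show ?thesis by (simp add: continuous_at_imp_continuous_on)
  qed
  have perL: "L (x + 1) = L x" for x
    unfolding L_def
    by (rule infsum_reindex_bij_witness[of _ "\<lambda>n. n - 1" "\<lambda>n. n + 1"]) (auto simp: algebra_simps)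
  have perR: "R (x + 1) = R x" for x
  proof -
    have "cis (2 * pi * of_int k * (x + 1)) = cis (2 * pi * of_int k * x)" for k :: int
    proof -
      have "cis (2 * pi * of_int k * (x + 1)) = cis (2 * pi * of_int k * x) * cis (2 * pi * of_int k)"
        by (simp add: cis_mult algebra_simps)
      then show ?thesis by (simp add: cis_multiple_2pi)
    qed
    then show ?thesis by (simp add: R_def)
  qed
  have coeffR: "((\<lambda>x. R x * cis (2 * pi * m * x)) has_integral of_real (e m)) {0..1}" for m :: int
  proof -
    have "uniform_limit {0..1} (\<lambda>X x. (\<Sum>k\<in>X. of_real (e k) * cis (2 * pi * of_int k * x)) * cis (2 * pi * m * x))
             (\<lambda>x. R x * cis (2 * pi * m * x)) (finite_subsets_at_top UNIV)"
    proof (rule uniform_lim_mult[OF R_lim uniform_limit_const])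
      have "compact (R ` {0..1})"
        by (intro compact_continuous_image continuous_on_subset[OF contR]) auto
      then show "bounded (R ` {0..1})" by (rule compact_imp_bounded)
      show "bounded ((\<lambda>x. cis (2 * pi * m * x)) ` {0..1})"
        by (intro compact_imp_bounded compact_continuous_image continuous_intros) auto
    qed
    then obtain I J where IJ: "\<And>X. ((\<lambda>x. (\<Sum>k\<in>X. of_real (e k) * cis (2 * pi * of_int k * x)) * cis (2 * pi * m * x)) has_integral I X) {0..1}"
      "((\<lambda>x. R x * cis (2 * pi * m * x)) has_integral J) {0..1}" "(I \<longlongrightarrow> J) (finite_subsets_at_top UNIV)"
      by (rule uniform_limit_integral) (auto intro!: continuous_intros)
    have one: "((\<lambda>x. cis (2 * pi * of_int k * x)) has_integral (if k = 0 then 1 else 0)) {0..1}" for k :: int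
    proof (cases "k = 0")
      case True then show ?thesis using has_integral_const_real[of "1::complex" 0 1] by simp
    next
      case False
      define c where "c = 2 * pi * of_int k * \<i>"
      have c: "c \<noteq> 0" using False by (simp add: c_def)
      have eq: "cis (2 * pi * of_int k * x) = exp (c * of_real x)" for x
        by (simp add: cis_conv_exp c_def mult_ac)
      have "((\<lambda>x. exp (c * of_real x)) has_integral exp (c * of_real 1) / c - exp (c * of_real 0) / c) {0..1}"
      proof (rule fundamental_theorem_of_calculus)
        show "((\<lambda>x. exp (c * of_real x) / c) has_vector_derivative exp (c * of_real x)) (at x within {0..1})" for x
          by (rule has_vector_derivative_real_field[where f="\<lambda>z. exp (c * z) / c"])
             (use c in \<open>auto intro!: derivative_eq_intros\<close>)
      qed auto
      then have "((\<lambda>x. cis (2 * pi * of_int k * x)) has_integral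
          cis (2 * pi * of_int k * 1) / c - cis (2 * pi * of_int k * 0) / c) {0..1}"
        unfolding eq .
      then show ?thesis using False by (simp add: cis_multiple_2pi)
    qed
    have "I X = of_real (e m)" if "- m \<in> X" "finite X" for X
    proof -
      have "((\<lambda>x. \<Sum>k\<in>X. of_real (e k) * cis (2 * pi * of_int (k + m) * x)) has_integral
              (\<Sum>k\<in>X. of_real (e k) * (if k + m = 0 then 1 else 0))) {0..1}"
        by (intro has_integral_sum has_integral_mult_right one that)
      note A = this
      have cis_split: "cis (2 * pi * of_int (k + m) * x) = cis (2 * pi * of_int k * x) * cis (2 * pi * m * x)" for k x
        by (simp add: cis_mult algebra_simps)
      then have "(\<lambda>x. \<Sum>k\<in>X. of_real (e k) * cis (2 * pi * of_int (k + m) * x)) =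
          (\<lambda>x. (\<Sum>k\<in>X. of_real (e k) * cis (2 * pi * of_int k * x)) * cis (2 * pi * m * x))"
        unfolding sum_distrib_right cis_split by (simp only: mult.assoc)
      note B = A[unfolded this]
      have "I X = (\<Sum>k\<in>X. of_real (e k) * (if k + m = 0 then 1 else 0))"
        by (rule has_integral_unique[OF IJ(1) B])
      also have "\<dots> = (\<Sum>k\<in>X. if k = - m then of_real (e m) else 0)"
        by (intro sum.cong) (auto simp: e_def)
      also have "\<dots> = of_real (e m)" using that by simp
      finally show ?thesis .
    qed
    then have "\<forall>\<^sub>F X in finite_subsets_at_top UNIV. I X = of_real (e m)"
      unfolding eventually_finite_subsets_at_top by (intro exI[of _ "{-m}"]) auto
    then have "(I \<longlongrightarrow> of_real (e m)) (finite_subsets_at_top UNIV)" by (rule tendsto_eventually)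
    then have "J = of_real (e m)" using IJ(3) tendsto_unique[of "finite_subsets_at_top UNIV" I] by auto
    then show ?thesis using IJ(2) by simp
  qed
  have coeffL: "((\<lambda>x. of_real (L x) * cis (2 * pi * m * x)) has_integral of_real (e m / sqrt y)) {0..1}" for m :: int
  proof -
    define g where "g x = of_real (exp (- pi * y * x\<^sup>2)) * cis (2 * pi * m * x)" for x
    have contg: "continuous_on A g" for A unfolding g_def by (intro continuous_intros)
    have "uniform_limit {0..1} (\<lambda>X x. (\<Sum>n\<in>X. exp (- pi * y * (of_int n + x)\<^sup>2))) L (finite_subsets_at_top UNIV)"
      by (rule uniform_limit_on_subset[OF L_lim[of 1]]) auto
    then have "uniform_limit {0..1} (\<lambda>X x. complex_of_real (\<Sum>n\<in>X. exp (- pi * y * (of_int n + x)\<^sup>2))) (\<lambda>x. of_real (L x)) (finite_subsets_at_top UNIV)"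
      by (rule bounded_linear.uniform_limit[OF bounded_linear_of_real])
    then have "uniform_limit {0..1} (\<lambda>X x. complex_of_real (\<Sum>n\<in>X. exp (- pi * y * (of_int n + x)\<^sup>2)) * cis (2 * pi * m * x))
             (\<lambda>x. of_real (L x) * cis (2 * pi * m * x)) (finite_subsets_at_top UNIV)"
    proof (rule uniform_lim_mult[OF _ uniform_limit_const])
      show "bounded ((\<lambda>x. complex_of_real (L x)) ` {0..1})"
        by (intro compact_imp_bounded compact_continuous_image continuous_intros continuous_on_subset[OF contL]) auto
      show "bounded ((\<lambda>x. cis (2 * pi * m * x)) ` {0..1})"
        by (intro compact_imp_bounded compact_continuous_image continuous_intros) auto
    qed
    then obtain I J where IJ: "\<And>X. ((\<lambda>x. complex_of_real (\<Sum>n\<in>X. exp (- pi * y * (of_int n + x)\<^sup>2)) * cis (2 * pi * m * x)) has_integral I X) {0..1}"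
      "((\<lambda>x. of_real (L x) * cis (2 * pi * m * x)) has_integral J) {0..1}" "(I \<longlongrightarrow> J) (finite_subsets_at_top UNIV)"
      by (rule uniform_limit_integral) (auto intro!: continuous_intros)
    have shift: "((\<lambda>x. g (x + of_int n)) has_integral integral {of_int n..of_int n + 1} g) {0..1}" for n :: int
    proof -
      have "(g has_integral integral {of_int n..of_int n + 1} g) (cbox (of_int n) (of_int n + 1))"
        unfolding cbox_interval by (intro integrable_integral integrable_continuous_interval contg)
      then show ?thesis
        using has_integral_affinity'[of g _ "of_int n" "of_int n + 1" 1 "of_int n"] by (simp add: cbox_interval)
    qed
    \<comment> \<open>The exponential has integer frequency, so translation by n moves only the
      Gaussian factor.\<close>
    have gn: "g (x + of_int n) = complex_of_real (exp (- pi * y * (of_int n + x)\<^sup>2)) * cis (2 * pi * m * x)" for x and n :: int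
    proof -
      have "cis (2 * pi * m * (x + of_int n)) = cis (2 * pi * m * x) * cis (2 * pi * of_int (m * n))"
        by (simp add: cis_mult algebra_simps)
      also have "cis (2 * pi * of_int (m * n)) = 1" by (rule cis_multiple_2pi) simp
      finally show ?thesis by (simp add: g_def add.commute)
    qed
    \<comment> \<open>Along the symmetric index sets the unfolded integrals telescope to an integral
      over an interval; these index sets are cofinal enough to identify the limit.\<close>
    have I_N: "I {- int N..<int N} = integral {- real N..real N} g" for N
    proof -
      have "((\<lambda>x. \<Sum>n\<in>{- int N..<int N}. g (x + of_int n)) has_integral (\<Sum>n\<in>{- int N..<int N}. integral {of_int n..of_int n + 1} g)) {0..1}"
        by (intro has_integral_sum shift) auto
      then have A: "((\<lambda>x. complex_of_real (\<Sum>n\<in>{- int N..<int N}. exp (- pi * y * (of_int n + x)\<^sup>2)) * cis (2 * pi * m * x))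
          has_integral (\<Sum>n\<in>{- int N..<int N}. integral {of_int n..of_int n + 1} g)) {0..1}"
        unfolding gn of_real_sum sum_distrib_right .
      have "I {- int N..<int N} = (\<Sum>n\<in>{- int N..<int N}. integral {of_int n..of_int n + 1} g)"
        by (rule has_integral_unique[OF IJ(1) A])
      also have "\<dots> = integral {- real N..real N} g"
      proof (induction N)
        case (Suc N)
        have ig: "g integrable_on {a..b}" for a b using contg by (rule integrable_continuous_interval)
        have "{- int (Suc N)..<int (Suc N)} = insert (- int (Suc N)) (insert (int N) {- int N..<int N})" by auto
        then have "(\<Sum>n\<in>{- int (Suc N)..<int (Suc N)}. integral {of_int n..of_int n + 1} g) =
           integral {- real (Suc N)..- real N} g + (integral {real N..real (Suc N)} g + integral {- real N..real N} g)"
          using Suc by (simp add: add.commute)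
        also have "\<dots> = (integral {- real (Suc N)..- real N} g + integral {- real N..real N} g) + integral {real N..real (Suc N)} g"
          by (simp only: ac_simps)
        also have "integral {- real (Suc N)..- real N} g + integral {- real N..real N} g = integral {- real (Suc N)..real N} g"
          by (rule Henstock_Kurzweil_Integration.integral_combine[OF _ _ ig]) auto
        also have "integral {- real (Suc N)..real N} g + integral {real N..real (Suc N)} g = integral {- real (Suc N)..real (Suc N)} g"
          by (rule Henstock_Kurzweil_Integration.integral_combine[OF _ _ ig]) auto
        finally show ?case .
      qed simp
      finally show ?thesis .
    qed
    have "(\<lambda>N. integral {- real N..real N} g) \<longlonglongrightarrow> (LINT x|lborel. g x)"
    proof -
      have intg: "integrable lborel g" using gaussian_fourier_transform(1)[OF y, of m] by (simp add: g_def[abs_def])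
      have "(\<lambda>N. LINT x|lborel. indicator {- real N..real N} x *\<^sub>R g x) \<longlonglongrightarrow> (LINT x|lborel. g x)"
      proof (rule integral_dominated_convergence[where w="\<lambda>x. norm (g x)"])
        show "AE x in lborel. (\<lambda>N. indicator {- real N..real N} x *\<^sub>R g x) \<longlonglongrightarrow> g x"
        proof (intro AE_I2 tendsto_eventually)
          fix x :: real
          show "\<forall>\<^sub>F N in sequentially. indicator {- real N..real N} x *\<^sub>R g x = g x"
            using eventually_ge_at_top[of "nat \<lceil>\<bar>x\<bar>\<rceil>"] by eventually_elim (auto simp: indicator_def nat_le_iff ceiling_le_iff; linarith)
        qed
      qed (use intg in \<open>auto simp: indicator_def\<close>)
      moreover have "(LINT x|lborel. indicator {- real N..real N} x *\<^sub>R g x) = integral {- real N..real N} g" for N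
        using set_borel_integral_eq_integral(2)[of "{- real N..real N}" g] intg
        by (simp add: set_lebesgue_integral_def set_integrable_def integrable_mult_indicator)
      ultimately show ?thesis by simp
    qed
    moreover have "(LINT x|lborel. g x) = of_real (e m / sqrt y)"
      using gaussian_fourier_transform(2)[OF y, of m] by (simp add: g_def e_def)
    moreover have "(\<lambda>N. integral {- real N..real N} g) \<longlonglongrightarrow> J"
      using filterlim_compose[OF IJ(3) filterlim_int_interval_finite_subsets] by (simp add: I_N)
    ultimately have "J = of_real (e m / sqrt y)" using LIMSEQ_unique by metis
    then show ?thesis using IJ(2) by simp
  qed
  define f where "f x = L x - (1 / sqrt y) * Re (R x)" for x
  have f_eq: "complex_of_real (f x) = of_real (L x) - of_real (1 / sqrt y) * R x" for x
    using Im_R[of x] by (simp add: f_def complex_eq_iff)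
  have "f a = 0"
  proof (rule fourier_coeffs_zero_imp_zero[of f a])
    show "continuous_on UNIV f" unfolding f_def by (intro continuous_intros contL contR)
    show "f (x + 1) = f x" for x by (simp add: f_def perL perR)
    fix k :: int
    have "((\<lambda>x. of_real (L x) * cis (2 * pi * k * x) - of_real (1 / sqrt y) * (R x * cis (2 * pi * k * x)))
       has_integral of_real (e k / sqrt y) - of_real (1 / sqrt y) * of_real (e k)) {0..1}"
      by (intro has_integral_diff has_integral_mult_right coeffL coeffR)
    then show "((\<lambda>x. complex_of_real (f x) * cis (2 * pi * k * x)) has_integral 0) {0..1}"
      by (simp add: f_eq algebra_simps)
  qed
  then have "of_real (L a) - of_real (1 / sqrt y) * R a = 0" using f_eq[of a] by simp
  then show ?thesis by (simp add: L_def R_def e_def)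
qed

section \<open>Theta constants\<close>

text \<open>This sums exp(pi i s k^2 / M) over the class of h modulo M. For fixed M the classes span
  a space on which inversion acts as the finite Fourier transform and, for even M, integer
  translations act diagonally.\<close>

definition theta :: "nat \<Rightarrow> int \<Rightarrow> complex \<Rightarrow> complex" where
  "theta M h s = (\<Sum>\<^sub>\<infinity>n::int. exp (\<i> * pi * s * (of_int (int M * n + h))\<^sup>2 / of_nat M))"

lemma norm_theta_term:
  assumes "M > 0"
  shows "norm (exp (\<i> * pi * s * (of_int (int M * n + h))\<^sup>2 / of_nat M)) =
           exp (- (pi * M * Im s) * (of_int n + h / M)\<^sup>2)"
proof -
  have "\<i> * pi * s * (of_int (int M * n + h))\<^sup>2 / of_nat M =
      complex_of_real (pi * (of_int (int M * n + h))\<^sup>2 / M) * (\<i> * s)"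
    by simp
  moreover have "Re (complex_of_real r * (\<i> * s)) = - r * Im s" for r by simp
  ultimately have "Re (\<i> * pi * s * (of_int (int M * n + h))\<^sup>2 / of_nat M) =
      - (pi * (of_int (int M * n + h))\<^sup>2 / M) * Im s" by presburger
  also have "of_int (int M * n + h) = M * (of_int n + h / M :: real)"
    using assms by (simp add: field_simps)
  also have "- (pi * (M * (of_int n + h / M :: real))\<^sup>2 / M) * Im s = - (pi * M * Im s) * (of_int n + h / M)\<^sup>2"
    using assms by (simp add: power2_eq_square)
  finally show ?thesis by (simp add: norm_exp_eq_Re)
qed

lemma theta_summable:
  assumes "M > 0" "Im s > 0"
  shows "(\<lambda>n. norm (exp (\<i> * pi * s * (of_int (int M * n + h))\<^sup>2 / of_nat M))) summable_on UNIV"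
  unfolding norm_theta_term[OF assms(1)] using assms by (intro summable_on_gaussian_int) auto

text \<open>Normal convergence near s: on the disc of radius Im s / 2 every term is dominated by its
  size at height Im s / 2.\<close>

lemma theta_holomorphic:
  assumes M: "M > 0"
  shows "theta M h holomorphic_on {s. Im s > 0}"
proof -
  have "theta M h field_differentiable at s" if s: "Im s > 0" for s
  proof -
    define r where "r = Im s / 2"
    have r: "r > 0" using s by (simp add: r_def)
    have Im: "Im w \<ge> r" if "w \<in> cball s r" for w
    proof -
      have "\<bar>Im (s - w)\<bar> \<le> r" using that abs_Im_le_cmod[of "s - w"] by (simp add: dist_norm)
      then show ?thesis by (simp add: r_def abs_if split: if_splits)
    qed
    have lim: "uniform_limit (cball s r)
        (\<lambda>X w. \<Sum>n\<in>X. exp (\<i> * pi * w * (of_int (int M * n + h))\<^sup>2 / of_nat M))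
        (theta M h) (finite_subsets_at_top UNIV)"
      unfolding theta_def
    proof (rule infsum_uniform_limit)
      show "(\<lambda>n::int. exp (- (pi * M * r) * (of_int n + h / M)\<^sup>2)) summable_on UNIV"
        using M r by (intro summable_on_gaussian_int) auto
      fix n :: int and w assume "w \<in> cball s r"
      then have "pi * M * r * (of_int n + h / M)\<^sup>2 \<le> pi * M * Im w * (of_int n + h / M)\<^sup>2"
        using Im by (intro mult_right_mono mult_left_mono) auto
      then show "norm (exp (\<i> * pi * w * (of_int (int M * n + h))\<^sup>2 / of_nat M)) \<le>
          exp (- (pi * M * r) * (of_int n + h / M)\<^sup>2)"
        unfolding norm_theta_term[OF M] by simp
    qed
    have "theta M h holomorphic_on ball s r"
    proof (rule holomorphic_uniform_limit[OF _ lim])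
      show "\<forall>\<^sub>F X in finite_subsets_at_top UNIV.
         continuous_on (cball s r) (\<lambda>w. \<Sum>n\<in>X. exp (\<i> * pi * w * (of_int (int M * n + h))\<^sup>2 / of_nat M)) \<and>
         (\<lambda>w. \<Sum>n\<in>X. exp (\<i> * pi * w * (of_int (int M * n + h))\<^sup>2 / of_nat M)) holomorphic_on ball s r"
        using M by (intro always_eventually allI conjI continuous_intros holomorphic_intros) auto
    qed auto
    then show ?thesis using r holomorphic_on_imp_differentiable_at[of _ "ball s r" s] by auto
  qed
  then show ?thesis
    by (auto simp: holomorphic_on_def intro: field_differentiable_at_within)
qed

lemma theta_add_period: "theta M (h + int M * k) s = theta M h s"
  unfolding theta_def
  by (rule infsum_reindex_bij_witness[of _ "\<lambda>n. n - k" "\<lambda>n. n + k"]) (auto simp: algebra_simps)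

lemma theta_cong: "int M dvd h - k \<Longrightarrow> theta M h s = theta M k s"
  by (metis theta_add_period dvd_def add.commute diff_add_cancel)

lemma theta_uminus: "theta M (- h) s = theta M h s"
proof -
  have "theta M (-h) s = (\<Sum>\<^sub>\<infinity>n::int. exp (\<i> * pi * s * (of_int (int M * (- n) + (- h)))\<^sup>2 / of_nat M))"
    unfolding theta_def by (rule infsum_reindex_bij_witness[of _ uminus uminus]) auto
  also have "\<dots> = (\<Sum>\<^sub>\<infinity>n::int. exp (\<i> * pi * s * (of_int (int M * n + h))\<^sup>2 / of_nat M))"
  proof (rule infsum_cong)
    fix n :: int
    have "(complex_of_int (int M * (- n) + (- h)))\<^sup>2 = (of_int (int M * n + h))\<^sup>2"
      by (simp add: power2_eq_square algebra_simps)
    then show "exp (\<i> * pi * s * (of_int (int M * (- n) + (- h)))\<^sup>2 / of_nat M) =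
       exp (\<i> * pi * s * (of_int (int M * n + h))\<^sup>2 / of_nat M)" by simp
  qed
  finally show ?thesis by (simp add: theta_def)
qed

lemma exp_2pi_i_int: "exp (2 * pi * \<i> * of_int k) = 1"
  by (simp add: exp_eq_1)

text \<open>(M n + h)^2 / M = M n^2 + 2 n h + h^2 / M, and for even M the first two summands are
  even integers.\<close>

lemma theta_add_int:
  assumes "M > 0" "even M"
  shows "theta M h (s + of_int k) = exp (\<i> * pi * of_int k * (of_int h)\<^sup>2 / of_nat M) * theta M h s"
proof -
  obtain m where m: "M = 2 * m" using assms by auto
  have "exp (\<i> * pi * (s + of_int k) * (of_int (int M * n + h))\<^sup>2 / of_nat M) =
        exp (\<i> * pi * of_int k * (of_int h)\<^sup>2 / of_nat M) * exp (\<i> * pi * s * (of_int (int M * n + h))\<^sup>2 / of_nat M)" for n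
  proof -
    have "\<i> * pi * (s + of_int k) * (of_int (int M * n + h))\<^sup>2 / of_nat M =
      \<i> * pi * of_int k * (of_int h)\<^sup>2 / of_nat M + \<i> * pi * s * (of_int (int M * n + h))\<^sup>2 / of_nat M
       + 2 * pi * \<i> * of_int (k * (int m * n\<^sup>2 + n * h))"
      using assms m by (simp add: field_simps power2_eq_square)
    then show ?thesis by (simp only: exp_add exp_2pi_i_int mult_1_right)
  qed
  then show ?thesis unfolding theta_def by (simp add: infsum_cmult_right')
qed

lemma has_sum_int_residues:
  fixes f :: "int \<Rightarrow> 'a :: banach"
  assumes "r > 0" "f summable_on UNIV"
  shows "infsum f UNIV = (\<Sum>w=0..<r. infsum (\<lambda>n. f (r * n + w)) UNIV)"
proof -
  have bij: "bij_betw (\<lambda>(w, n). r * n + w) ({0..<r} \<times> UNIV) UNIV"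
    by (rule bij_betw_byWitness[where f' = "\<lambda>k. (k mod r, k div r)"]) (use assms in auto)
  have "infsum f UNIV = infsum (\<lambda>(w, n). f (r * n + w)) ({0..<r} \<times> UNIV)"
    using infsum_reindex_bij_betw[OF bij, of f] by (simp add: case_prod_unfold)
  also have "\<dots> = infsum (\<lambda>w. infsum (\<lambda>n. f (r * n + w)) UNIV) {0..<r}"
  proof (rule infsum_Sigma'_banach[symmetric])
    show "(\<lambda>(w, n). f (r * n + w)) summable_on {0..<r} \<times> UNIV"
      using summable_on_reindex_bij_betw[OF bij, of f] assms(2) by (simp add: case_prod_unfold)
  qed
  finally show ?thesis by simp
qed

text \<open>Prepares the matrices of lower left entry 11: dividing the argument by 11 raises the
  level to \<open>11 * M\<close>. The shift by 8 l is invisible at level M dividing 4, so all that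
  it leaves is a quadratic phase in w modulo 11.\<close>

lemma theta_divide_eleven:
  assumes M: "M > 0" "M dvd 4" and s: "Im s > 0"
  shows "theta M u ((s + 8 * of_int l) / 11) =
    (\<Sum>w=0..<11. exp (2 * pi * \<i> * (of_int (4 * l * int M * w\<^sup>2) / 11)) * theta (11 * M) (int M * w - 11 * u) s)"
proof -
  have M3: "M = 1 \<or> M = 2 \<or> M = 4" using M dvd_imp_le[of M 4] by (cases "M = 3") auto
  \<comment> \<open>12 u is divisible by M, so u may be replaced by -11 u; the indices then take the
    form M w - 11 u, adapted to the Chinese remainder theorem.\<close>
  have "int M dvd u - (- 11 * u)" using M3 by auto
  then have "theta M u ((s + 8 * of_int l) / 11) = theta M (- 11 * u) ((s + 8 * of_int l) / 11)"
    by (rule theta_cong)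
  also have "\<dots> = (\<Sum>w=0..<11. \<Sum>\<^sub>\<infinity>n::int. exp (\<i> * pi * ((s + 8 * of_int l) / 11) * (of_int (int M * (11 * n + w) + (- 11 * u)))\<^sup>2 / of_nat M))"
    unfolding theta_def
    by (rule has_sum_int_residues, simp, rule abs_summable_summable, rule theta_summable) (use M s in auto)
  also have "\<dots> = (\<Sum>w=0..<11. exp (2 * pi * \<i> * (of_int (4 * l * int M * w\<^sup>2) / 11)) * theta (11 * M) (int M * w - 11 * u) s)"
  proof (rule sum.cong[OF refl])
    fix w :: int
    have "exp (\<i> * pi * ((s + 8 * of_int l) / 11) * (of_int (int M * (11 * n + w) + (- 11 * u)))\<^sup>2 / of_nat M) =
       exp (2 * pi * \<i> * (of_int (4 * l * int M * w\<^sup>2) / 11)) *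
       exp (\<i> * pi * s * (of_int (int (11 * M) * n + (int M * w - 11 * u)))\<^sup>2 / of_nat (11 * M))" for n
    proof -
      obtain m where m: "4 = M * m" using M by auto
      define X where "X = complex_of_int n"
      have m': "complex_of_nat M * of_nat m = 4" by (metis m of_nat_mult of_nat_numeral)
      have M0: "complex_of_nat M \<noteq> 0" using M by simp
      have m'': "4 / complex_of_nat M = of_nat m" using m' M0 by (simp add: field_simps)
      have "\<i> * pi * ((s + 8 * of_int l) / 11) * (of_int (int M * (11 * n + w) + (- 11 * u)))\<^sup>2 / of_nat M =
        2 * pi * \<i> * (of_int (4 * l * int M * w\<^sup>2) / 11) +
        \<i> * pi * s * (of_int (int (11 * M) * n + (int M * w - 11 * u)))\<^sup>2 / of_nat (11 * M) +
        2 * pi * \<i> * (of_int (4 * l * int M * (11 * n\<^sup>2 + 2 * n * w) - 8 * l * u * (11 * n + w)) +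
          of_int l * 11 * (of_int u)\<^sup>2 * (4 / complex_of_nat M))"
        using M0 by (simp add: field_simps power2_eq_square)
      also have "(of_int (4 * l * int M * (11 * n\<^sup>2 + 2 * n * w) - 8 * l * u * (11 * n + w)) +
          of_int l * 11 * (of_int u)\<^sup>2 * (4 / complex_of_nat M)) =
          of_int (4 * l * int M * (11 * n\<^sup>2 + 2 * n * w) - 8 * l * u * (11 * n + w) + l * 11 * u\<^sup>2 * int m)"
        unfolding m'' by simp
      finally show ?thesis by (simp only: exp_add exp_2pi_i_int mult_1_right)
    qed
    then show "(\<Sum>\<^sub>\<infinity>n::int. exp (\<i> * pi * ((s + 8 * of_int l) / 11) * (of_int (int M * (11 * n + w) + (- 11 * u)))\<^sup>2 / of_nat M)) =
       exp (2 * pi * \<i> * (of_int (4 * l * int M * w\<^sup>2) / 11)) * theta (11 * M) (int M * w - 11 * u) s"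
      unfolding theta_def by (simp only: infsum_cmult_right')
  qed
  finally show ?thesis .
qed

lemma csqrt_of_real_mult:
  assumes "a \<ge> 0"
  shows "csqrt (of_real a * z) = of_real (sqrt a) * csqrt z"
proof (rule csqrt_unique)
  show "(of_real (sqrt a) * csqrt z)\<^sup>2 = of_real a * z"
    using assms by (simp add: power_mult_distrib flip: of_real_power)
  have "0 < Re (csqrt z) \<or> Re (csqrt z) = 0 \<and> 0 \<le> Im (csqrt z)" by (rule csqrt_principal)
  then show "0 < Re (of_real (sqrt a) * csqrt z) \<or>
      Re (of_real (sqrt a) * csqrt z) = 0 \<and> 0 \<le> Im (of_real (sqrt a) * csqrt z)"
    using assms by (cases "a = 0") auto
qed

lemma Im_minus_inverse_pos: "Im s > 0 \<Longrightarrow> Im (- 1 / s) > 0"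
  by (simp add: Im_divide divide_less_0_iff sum_power2_gt_zero_iff complex_neq_0)

text \<open>Poisson summation with shift h / M; the frequencies are then grouped by their class
  modulo M, which produces theta series again.\<close>

lemma theta_imag_axis:
  assumes M: "M > 0" and y: "y > 0"
  shows "theta M h (- 1 / (\<i> * of_real y)) = of_real (sqrt y / sqrt M) *
           (\<Sum>k=0..<int M. exp (2 * pi * \<i> * (of_int (h * k) / of_nat M)) * theta M k (\<i> * of_real y))"
proof -
  have Y: "M / y > 0" using M y by simp
  have s: "- 1 / (\<i> * of_real y) = \<i> * of_real (1 / y)" using y by (simp add: field_simps)
  have "theta M h (- 1 / (\<i> * of_real y)) = (\<Sum>\<^sub>\<infinity>n::int. complex_of_real (exp (- pi * (M / y) * (of_int n + h / M)\<^sup>2)))"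
    unfolding theta_def s
  proof (rule infsum_cong)
    fix n :: int
    have "\<i> * pi * (\<i> * of_real (1 / y)) * (of_int (int M * n + h))\<^sup>2 / of_nat M =
       complex_of_real (- pi * (M / y) * (of_int n + h / M)\<^sup>2)"
      using M y by (simp add: field_simps power2_eq_square)
    then show "exp (\<i> * pi * (\<i> * of_real (1 / y)) * (of_int (int M * n + h))\<^sup>2 / of_nat M) =
       complex_of_real (exp (- pi * (M / y) * (of_int n + h / M)\<^sup>2))" by (simp only: exp_of_real)
  qed
  also have "\<dots> = complex_of_real (\<Sum>\<^sub>\<infinity>n::int. exp (- pi * (M / y) * (of_int n + h / M)\<^sup>2))"
  proof (rule infsumI, rule has_sum_of_real, rule has_sum_infsum)
    show "(\<lambda>n::int. exp (- pi * (M / y) * (of_int n + h / M)\<^sup>2)) summable_on UNIV"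
    proof -
      have "pi * (M / y) > 0" using Y by (intro mult_pos_pos) auto
      from summable_on_gaussian_int[OF this, of "h / M"] show ?thesis by simp
    qed
  qed
  also have "\<dots> = complex_of_real (1 / sqrt (M / y)) *
      (\<Sum>\<^sub>\<infinity>k::int. exp (- pi * (of_int k)\<^sup>2 / (M / y)) * cis (2 * pi * k * (h / M)))"
    by (rule poisson_gaussian[OF Y])
  also have "1 / sqrt (M / y) = sqrt y / sqrt M" by (simp add: real_sqrt_divide)
  also have "(\<Sum>\<^sub>\<infinity>k::int. complex_of_real (exp (- pi * (of_int k)\<^sup>2 / (M / y))) * cis (2 * pi * k * (h / M))) =
     (\<Sum>k=0..<int M. \<Sum>\<^sub>\<infinity>n::int. complex_of_real (exp (- pi * (of_int (int M * n + k))\<^sup>2 / (M / y))) * cis (2 * pi * of_int (int M * n + k) * (h / M)))"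
  proof (rule has_sum_int_residues)
    have eq: "exp (- pi * (of_int k)\<^sup>2 / (M / y)) = exp (- (pi * y / M) * (of_int k + 0)\<^sup>2)" for k :: int
      by simp
    show "(\<lambda>k::int. complex_of_real (exp (- pi * (of_int k)\<^sup>2 / (M / y))) * cis (2 * pi * k * (h / M))) summable_on UNIV"
      by (rule abs_summable_summable, unfold norm_mult norm_cis norm_of_real mult_1_right abs_exp_cancel eq, rule summable_on_gaussian_int)
         (use M y in auto)
  qed (use M in auto)
  also have "\<dots> = (\<Sum>k=0..<int M. exp (2 * pi * \<i> * (of_int (h * k) / of_nat M)) * theta M k (\<i> * of_real y))"
  proof (rule sum.cong[OF refl])
    fix k :: int
    have "complex_of_real (exp (- pi * (of_int (int M * n + k))\<^sup>2 / (M / y))) * cis (2 * pi * of_int (int M * n + k) * (h / M)) =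
       exp (2 * pi * \<i> * (of_int (h * k) / of_nat M)) * exp (\<i> * pi * (\<i> * of_real y) * (of_int (int M * n + k))\<^sup>2 / of_nat M)" for n
    proof -
      have "complex_of_real (- pi * (of_int (int M * n + k))\<^sup>2 / (M / y)) + \<i> * complex_of_real (2 * pi * of_int (int M * n + k) * (h / M)) =
        2 * pi * \<i> * (of_int (h * k) / of_nat M) + \<i> * pi * (\<i> * of_real y) * (of_int (int M * n + k))\<^sup>2 / of_nat M
          + 2 * pi * \<i> * of_int (h * n)"
        using M y by (simp add: field_simps power2_eq_square)
      then have "exp (complex_of_real (- pi * (of_int (int M * n + k))\<^sup>2 / (M / y))) * exp (\<i> * complex_of_real (2 * pi * of_int (int M * n + k) * (h / M))) =
         exp (2 * pi * \<i> * (of_int (h * k) / of_nat M)) * exp (\<i> * pi * (\<i> * of_real y) * (of_int (int M * n + k))\<^sup>2 / of_nat M)"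
        by (simp only: exp_2pi_i_int mult_1_right flip: exp_add) (simp only: exp_add exp_2pi_i_int mult_1_right)
      then show ?thesis by (simp only: cis_conv_exp exp_of_real)
    qed
    then show "(\<Sum>\<^sub>\<infinity>n::int. complex_of_real (exp (- pi * (of_int (int M * n + k))\<^sup>2 / (M / y))) * cis (2 * pi * of_int (int M * n + k) * (h / M))) =
       exp (2 * pi * \<i> * (of_int (h * k) / of_nat M)) * theta M k (\<i> * of_real y)"
      unfolding theta_def by (simp only: infsum_cmult_right')
  qed
  finally show ?thesis .
qed

text \<open>Both sides are holomorphic on the half plane and agree on the imaginary axis, where
  \<open>csqrt (- \<i> * s)\<close> is the positive root.\<close>

lemma theta_S:
  assumes M: "M > 0" and s: "Im s > 0"
  shows "theta M h (- 1 / s) = csqrt (- \<i> * s) / of_real (sqrt M) *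
           (\<Sum>k=0..<int M. exp (2 * pi * \<i> * (of_int (h * k) / of_nat M)) * theta M k s)"
proof -
  define H where "H = {s. Im s > 0}"
  define g where "g s = theta M h (- 1 / s) - csqrt (- \<i> * s) / of_real (sqrt M) *
           (\<Sum>k=0..<int M. exp (2 * pi * \<i> * (of_int (h * k) / of_nat M)) * theta M k s)" for s
  have H: "open H" "connected H" unfolding H_def
    by (simp_all add: open_upper_half_plane connected_upper_half_plane)
  have hol: "g holomorphic_on H"
  proof -
    have "(\<lambda>s. theta M h (- 1 / s)) holomorphic_on H"
      by (rule holomorphic_on_compose_gen[OF _ theta_holomorphic[OF M], unfolded o_def])
         (auto intro!: holomorphic_intros simp: H_def Im_minus_inverse_pos[simplified])
    moreover have "(\<lambda>s. csqrt (- \<i> * s)) holomorphic_on H"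
      by (intro holomorphic_intros) (auto simp: H_def complex_nonpos_Reals_iff complex_nonneg_Reals_iff)
    ultimately show ?thesis unfolding g_def H_def
      by (intro holomorphic_intros theta_holomorphic M)
         (use M in \<open>auto simp: complex_nonpos_Reals_iff complex_nonneg_Reals_iff\<close>)
  qed
  have zero: "g (\<i> * of_real y) = 0" if "y > 0" for y
  proof -
    have "csqrt (- \<i> * (\<i> * of_real y)) = of_real (sqrt y)"
      using that by (simp flip: mult.assoc)
    then show ?thesis using theta_imag_axis[OF M that, of h] by (simp add: g_def)
  qed
  have "g s = 0"
  proof (rule analytic_continuation[OF hol H, where U="(\<lambda>y. \<i> * of_real y) ` {0<..}" and \<xi>=\<i>])
    show "(\<lambda>y. \<i> * complex_of_real y) ` {0<..} \<subseteq> H" by (auto simp: H_def)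
    show "\<i> \<in> H" by (simp add: H_def)
    show "\<i> islimpt (\<lambda>y. \<i> * complex_of_real y) ` {0<..}"
      unfolding islimpt_approachable
    proof (intro allI impI)
      fix e :: real assume e: "e > 0"
      have "\<i> * complex_of_real (1 + e / 2) - \<i> = \<i> * complex_of_real (e / 2)" by (simp add: algebra_simps)
      then have "dist (\<i> * complex_of_real (1 + e / 2)) \<i> = e / 2"
        using e unfolding dist_norm by (simp only: norm_mult norm_of_real) simp
      then show "\<exists>x'\<in>(\<lambda>y. \<i> * complex_of_real y) ` {0<..}. x' \<noteq> \<i> \<and> dist x' \<i> < e"
        using e by (intro bexI[OF _ imageI[of "1 + e / 2"]]) auto
    qed
  qed (use zero s in \<open>auto simp: H_def\<close>)
  then show ?thesis by (simp add: g_def)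
qed

section \<open>Quadratic identities between the theta constants\<close>

lemma infsum_times_infsum:
  fixes f g :: "int \<Rightarrow> complex"
  assumes f: "(\<lambda>n. norm (f n)) summable_on UNIV" and g: "(\<lambda>n. norm (g n)) summable_on UNIV"
  shows "(\<lambda>(m, n). f m * g n) summable_on UNIV"
    and "infsum f UNIV * infsum g UNIV = infsum (\<lambda>(m, n). f m * g n) UNIV"
proof -
  have "(\<lambda>p. norm (case p of (m, n) \<Rightarrow> f m * g n)) summable_on (UNIV \<times> UNIV)"
  proof (rule Infinite_Sum.abs_summable_on_Sigma_iff[THEN iffD2], intro conjI ballI)
    show "(\<lambda>n. norm (case (m, n) of (m, n) \<Rightarrow> f m * g n)) summable_on UNIV" for m
      using g by (simp add: norm_mult summable_on_cmult_right)
    have "(\<lambda>m. norm (f m) * infsum (\<lambda>n. norm (g n)) UNIV) summable_on UNIV"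
      using f by (rule summable_on_cmult_left)
    then show "(\<lambda>m. norm (infsum (\<lambda>n. norm (case (m, n) of (m, n) \<Rightarrow> f m * g n)) UNIV)) summable_on UNIV"
      by (simp add: norm_mult infsum_cmult_right' abs_mult infsum_nonneg)
  qed
  then show s: "(\<lambda>(m, n). f m * g n) summable_on UNIV" by - (rule abs_summable_summable, simp)
  have "infsum (\<lambda>(m, n). f m * g n) (UNIV \<times> UNIV) = infsum (\<lambda>m. infsum (\<lambda>n. f m * g n) UNIV) UNIV"
    using infsum_Sigma'_banach[of "\<lambda>m n. f m * g n" UNIV "\<lambda>_. UNIV"] s by simp
  also have "\<dots> = infsum f UNIV * infsum g UNIV"
    by (simp only: infsum_cmult_right' infsum_cmult_left')
  finally show "infsum f UNIV * infsum g UNIV = infsum (\<lambda>(m, n). f m * g n) UNIV" by simp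
qed

text \<open>The lattice \<open>\<int>\<^sup>2\<close> splits into the pairs of equal and of different parity.\<close>

lemma infsum_rotate:
  fixes F :: "int \<times> int \<Rightarrow> complex"
  assumes "F summable_on UNIV"
  shows "infsum F UNIV = infsum (\<lambda>(k, l). F (k + l, k - l)) UNIV + infsum (\<lambda>(k, l). F (k + l + 1, k - l)) UNIV"
proof -
  let ?E = "{(m, n). even (m + n)} :: (int \<times> int) set" and ?O = "{(m, n). odd (m + n)} :: (int \<times> int) set"
  have bE: "bij_betw (\<lambda>(k, l). (k + l, k - l)) UNIV ?E"
    by (rule bij_betw_byWitness[where f' = "\<lambda>(m, n). ((m + n) div 2, (m - n) div 2)"]) (auto; presburger)+
  have bO: "bij_betw (\<lambda>(k, l). (k + l + 1, k - l)) UNIV ?O"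
    by (rule bij_betw_byWitness[where f' = "\<lambda>(m, n). ((m + n - 1) div 2, (m - n - 1) div 2)"])
       (auto; presburger)+
  have "UNIV = ?E \<union> ?O" by auto
  then have "infsum F UNIV = infsum F (?E \<union> ?O)" by simp
  also have "\<dots> = infsum F ?E + infsum F ?O"
    by (rule infsum_Un_disjoint) (auto intro: summable_on_subset_banach[OF assms])
  also have "infsum F ?E = infsum (\<lambda>(k, l). F (k + l, k - l)) UNIV"
    using infsum_reindex_bij_betw[OF bE, of F] by (simp add: case_prod_unfold)
  also have "infsum F ?O = infsum (\<lambda>(k, l). F (k + l + 1, k - l)) UNIV"
    using infsum_reindex_bij_betw[OF bO, of F] by (simp add: case_prod_unfold)
  finally show ?thesis .
qed

text \<open>This and the next two are the Jacobi theta constants, see \<open>th3_altdef\<close>;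
  written in residue classes modulo 4 they inherit their transformation laws from
  \<open>theta_S\<close> and \<open>theta_add_int\<close>.\<close>

definition th3 :: "complex \<Rightarrow> complex" where "th3 s = theta 4 0 s + theta 4 2 s"
definition th4 :: "complex \<Rightarrow> complex" where "th4 s = theta 4 0 s - theta 4 2 s"
definition th2 :: "complex \<Rightarrow> complex" where "th2 s = theta 4 1 s + theta 4 3 s"

lemma th2_eq: "th2 s = 2 * theta 4 1 s"
proof -
  have "theta 4 3 s = theta 4 (-1) s" by (rule theta_cong) simp
  then show ?thesis by (simp add: th2_def theta_uminus)
qed

text \<open>One family of terms serves all the series at hand: they differ in the scale of s and in
  the progression that the index runs through.\<close>

definition gauss_term :: "complex \<Rightarrow> int \<Rightarrow> complex" where
  "gauss_term s u = exp (\<i> * pi * s * (of_int u)\<^sup>2 / 2)"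

definition alt_sign :: "int \<Rightarrow> complex" where "alt_sign n = (if even n then 1 else - 1)"

lemma norm_alt_sign [simp]: "norm (alt_sign n) = 1"
  by (simp add: alt_sign_def)

lemma gauss_term_uminus: "gauss_term s (- u) = gauss_term s u"
  by (simp add: gauss_term_def)

lemma gauss_term_summable:
  assumes "Im s > 0" "a > 0"
  shows "(\<lambda>n. norm (gauss_term s (a * n + b))) summable_on UNIV"
proof -
  have "norm (gauss_term s (a * n + b)) = exp (- (pi * Im s * a\<^sup>2 / 2) * (of_int n + b / a)\<^sup>2)" for n
  proof -
    have "\<i> * pi * s * (of_int (a * n + b))\<^sup>2 / 2 = complex_of_real (pi * (of_int (a * n + b))\<^sup>2 / 2) * (\<i> * s)"
      by simp
    moreover have "Re (complex_of_real r * (\<i> * s)) = - r * Im s" for r by simp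
    ultimately have "Re (\<i> * pi * s * (of_int (a * n + b))\<^sup>2 / 2) = - (pi * (of_int (a * n + b))\<^sup>2 / 2) * Im s"
      by presburger
    also have "of_int (a * n + b) = a * (of_int n + b / a :: real)" using assms by (simp add: field_simps)
    finally show ?thesis using assms by (simp add: gauss_term_def norm_exp_eq_Re power_mult_distrib)
  qed
  then show ?thesis using assms by (simp only:) (intro summable_on_gaussian_int, auto)
qed

lemma
  assumes s: "Im s > 0"
  shows theta_2_0_altdef: "theta 2 0 s = (\<Sum>\<^sub>\<infinity>n. gauss_term s (2 * n))"
    and theta_2_1_altdef: "theta 2 1 s = (\<Sum>\<^sub>\<infinity>n. gauss_term s (2 * n + 1))"
    and th3_altdef: "th3 s = (\<Sum>\<^sub>\<infinity>n. gauss_term (2 * s) n)"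
    and th4_altdef: "th4 s = (\<Sum>\<^sub>\<infinity>n. alt_sign n * gauss_term (2 * s) n)"
    and th2_altdef: "th2 s = (\<Sum>\<^sub>\<infinity>n. gauss_term (s / 2) (2 * n + 1))"
proof -
  show "theta 2 0 s = (\<Sum>\<^sub>\<infinity>n. gauss_term s (2 * n))" "theta 2 1 s = (\<Sum>\<^sub>\<infinity>n. gauss_term s (2 * n + 1))"
    by (simp_all add: theta_def gauss_term_def)
  have s2: "Im (2 * s) > 0" "Im (s / 2) > 0" using s by auto
  have e4: "theta 4 0 s = (\<Sum>\<^sub>\<infinity>n. gauss_term (2 * s) (2 * n + 0))" "theta 4 2 s = (\<Sum>\<^sub>\<infinity>n. gauss_term (2 * s) (2 * n + 1))"
    unfolding theta_def gauss_term_def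
    by (rule infsum_cong, rule arg_cong[of _ _ exp], simp add: power2_eq_square field_simps)+
  have r2: "{0..<2::int} = {0, 1}" by auto
  have sm: "(\<lambda>n. gauss_term (2 * s) n) summable_on UNIV"
    using gauss_term_summable[OF s2(1), of 1 0] by - (rule abs_summable_summable, simp)
  have sm': "(\<lambda>n. alt_sign n * gauss_term (2 * s) n) summable_on UNIV"
    using gauss_term_summable[OF s2(1), of 1 0] by - (rule abs_summable_summable, simp add: norm_mult)
  show "th3 s = (\<Sum>\<^sub>\<infinity>n. gauss_term (2 * s) n)"
    using has_sum_int_residues[OF _ sm, of 2] by (simp add: th3_def e4 r2)
  show "th4 s = (\<Sum>\<^sub>\<infinity>n. alt_sign n * gauss_term (2 * s) n)"
    using has_sum_int_residues[OF _ sm', of 2] by (simp add: th4_def e4 r2 alt_sign_def infsum_uminus)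
  have q: "2 * (2 * n + 0) + 1 = int 4 * n + 1" "2 * (2 * n + 1) + 1 = int 4 * n + 3" for n by simp_all
  have e4': "theta 4 1 s = (\<Sum>\<^sub>\<infinity>n. gauss_term (s / 2) (2 * (2 * n + 0) + 1))" "theta 4 3 s = (\<Sum>\<^sub>\<infinity>n. gauss_term (s / 2) (2 * (2 * n + 1) + 1))"
    unfolding theta_def gauss_term_def q by simp_all
  have sm'': "(\<lambda>n. gauss_term (s / 2) (2 * n + 1)) summable_on UNIV"
    using gauss_term_summable[OF s2(2), of 2 1] by - (rule abs_summable_summable, simp)
  show "th2 s = (\<Sum>\<^sub>\<infinity>n. gauss_term (s / 2) (2 * n + 1))"
    unfolding th2_def e4'
    using has_sum_int_residues[OF _ sm'', of 2] by (simp add: r2)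
qed

text \<open>The parallelogram identity 2 (m^2 + n^2) = (m + n)^2 + (m - n)^2 in the
  exponents.\<close>

lemma gauss_term_rotate: "gauss_term (2 * s) m * gauss_term (2 * s) n = gauss_term s (m + n) * gauss_term s (m - n)"
proof -
  have "\<i> * pi * (2 * s) * (of_int m)\<^sup>2 / 2 + \<i> * pi * (2 * s) * (of_int n)\<^sup>2 / 2 =
     \<i> * pi * s * (of_int (m + n))\<^sup>2 / 2 + \<i> * pi * s * (of_int (m - n))\<^sup>2 / 2"
    by (simp add: power2_eq_square field_simps)
  then show ?thesis by (simp only: gauss_term_def flip: exp_add)
qed

lemma gauss_term_rotate':
  "gauss_term (s / 2) (2 * m + 1) * gauss_term (s / 2) (2 * n + 1) = gauss_term s (m + n + 1) * gauss_term s (m - n)"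
proof -
  have "\<i> * pi * (s / 2) * (of_int (2 * m + 1))\<^sup>2 / 2 + \<i> * pi * (s / 2) * (of_int (2 * n + 1))\<^sup>2 / 2 =
     \<i> * pi * s * (of_int (m + n + 1))\<^sup>2 / 2 + \<i> * pi * s * (of_int (m - n))\<^sup>2 / 2"
    by (simp add: power2_eq_square field_simps)
  then show ?thesis by (simp only: gauss_term_def flip: exp_add)
qed

text \<open>Each product is a double series over pairs of integers; passing to m + n and m - n
  separates the variables again, with one product of single series for each parity class.\<close>

lemma
  assumes s: "Im s > 0"
  shows th3_square: "(th3 s)\<^sup>2 = (theta 2 0 s)\<^sup>2 + (theta 2 1 s)\<^sup>2"
    and th4_square: "(th4 s)\<^sup>2 = (theta 2 0 s)\<^sup>2 - (theta 2 1 s)\<^sup>2"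
    and th2_square: "(th2 s)\<^sup>2 = 2 * theta 2 0 s * theta 2 1 s"
    and th3_times_th4: "th3 s * th4 s = (th4 (2 * s))\<^sup>2"
proof -
  let ?f = "gauss_term s"
  have s2: "Im (2 * s) > 0" "Im (s / 2) > 0" using s by auto
  have f0: "(\<lambda>n. norm (?f (2 * n))) summable_on UNIV" and f1: "(\<lambda>n. norm (?f (2 * n + 1))) summable_on UNIV"
    and f2: "(\<lambda>n. norm (?f (2 * n + 2))) summable_on UNIV"
    using gauss_term_summable[OF s, of 2 0] gauss_term_summable[OF s, of 2 1] gauss_term_summable[OF s, of 2 2] by auto
  have g: "(\<lambda>n. norm (gauss_term (2 * s) n)) summable_on UNIV"
    using gauss_term_summable[OF s2(1), of 1 0] by simp
  then have g': "(\<lambda>n. norm (alt_sign n * gauss_term (2 * s) n)) summable_on UNIV" by (simp add: norm_mult)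
  have h: "(\<lambda>n. norm (gauss_term (s / 2) (2 * n + 1))) summable_on UNIV"
    using gauss_term_summable[OF s2(2), of 2 1] by simp
  have a0: "(\<lambda>n. norm (alt_sign n * ?f (2 * n))) summable_on UNIV" and a1: "(\<lambda>n. norm (alt_sign n * ?f (2 * n + 1))) summable_on UNIV"
    using f0 f1 by (simp_all add: norm_mult)
  have t0: "theta 2 0 s = (\<Sum>\<^sub>\<infinity>n. ?f (2 * n))" and t1: "theta 2 1 s = (\<Sum>\<^sub>\<infinity>n. ?f (2 * n + 1))"
    using s by (simp_all add: theta_2_0_altdef theta_2_1_altdef)
  \<comment> \<open>The odd class in the square of \<open>th2\<close> produces the index 2 k + 2,
    hence this shifted form.\<close>
  have t2: "theta 2 0 s = (\<Sum>\<^sub>\<infinity>n. ?f (2 * n + 2))"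
    unfolding t0 by (rule infsum_reindex_bij_witness[of _ "\<lambda>n. n + 1" "\<lambda>n. n - 1"]) (auto simp: algebra_simps)
  have "(th3 s)\<^sup>2 = infsum (\<lambda>(m, n). gauss_term (2 * s) m * gauss_term (2 * s) n) UNIV"
    unfolding power2_eq_square th3_altdef[OF s] by (rule infsum_times_infsum(2)[OF g g])
  also have "\<dots> = infsum (\<lambda>(k, l). ?f (2 * k) * ?f (2 * l)) UNIV + infsum (\<lambda>(k, l). ?f (2 * k + 1) * ?f (2 * l + 1)) UNIV"
    unfolding infsum_rotate[OF infsum_times_infsum(1)[OF g g]] by (simp add: gauss_term_rotate case_prod_unfold)
  also have "\<dots> = (theta 2 0 s)\<^sup>2 + (theta 2 1 s)\<^sup>2"
    by (simp only: power2_eq_square t0 t1 infsum_times_infsum(2)[OF f0 f0] infsum_times_infsum(2)[OF f1 f1])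
  finally show "(th3 s)\<^sup>2 = (theta 2 0 s)\<^sup>2 + (theta 2 1 s)\<^sup>2" .
  have sgn: "alt_sign (k + l) * gauss_term (2 * s) (k + l) * (alt_sign (k - l) * gauss_term (2 * s) (k - l)) = ?f (2 * k) * ?f (2 * l)"
    "alt_sign (k + l + 1) * gauss_term (2 * s) (k + l + 1) * (alt_sign (k - l) * gauss_term (2 * s) (k - l)) = - (?f (2 * k + 1) * ?f (2 * l + 1))"
    "gauss_term (2 * s) (k + l) * (alt_sign (k - l) * gauss_term (2 * s) (k - l)) = (alt_sign k * ?f (2 * k)) * (alt_sign l * ?f (2 * l))"
    "gauss_term (2 * s) (k + l + 1) * (alt_sign (k - l) * gauss_term (2 * s) (k - l)) = (alt_sign k * ?f (2 * k + 1)) * (alt_sign l * ?f (2 * l + 1))" for k l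
    using gauss_term_rotate[of s "k + l" "k - l"] gauss_term_rotate[of s "k + l + 1" "k - l"]
    by (auto simp: alt_sign_def)
  have "(th4 s)\<^sup>2 = infsum (\<lambda>(m, n). alt_sign m * gauss_term (2 * s) m * (alt_sign n * gauss_term (2 * s) n)) UNIV"
    unfolding power2_eq_square th4_altdef[OF s] by (rule infsum_times_infsum(2)[OF g' g'])
  also have "\<dots> = infsum (\<lambda>(k, l). ?f (2 * k) * ?f (2 * l)) UNIV - infsum (\<lambda>(k, l). ?f (2 * k + 1) * ?f (2 * l + 1)) UNIV"
    unfolding infsum_rotate[OF infsum_times_infsum(1)[OF g' g']] by (simp add: sgn case_prod_unfold infsum_uminus)
  also have "\<dots> = (theta 2 0 s)\<^sup>2 - (theta 2 1 s)\<^sup>2"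
    by (simp only: power2_eq_square t0 t1 infsum_times_infsum(2)[OF f0 f0] infsum_times_infsum(2)[OF f1 f1])
  finally show "(th4 s)\<^sup>2 = (theta 2 0 s)\<^sup>2 - (theta 2 1 s)\<^sup>2" .
  have "(th2 s)\<^sup>2 = infsum (\<lambda>(m, n). gauss_term (s / 2) (2 * m + 1) * gauss_term (s / 2) (2 * n + 1)) UNIV"
    unfolding power2_eq_square th2_altdef[OF s] by (rule infsum_times_infsum(2)[OF h h])
  also have "\<dots> = infsum (\<lambda>(k, l). ?f (2 * k + 1) * ?f (2 * l)) UNIV + infsum (\<lambda>(k, l). ?f (2 * k + 2) * ?f (2 * l + 1)) UNIV"
  proof -
    have "gauss_term (s / 2) (2 * (k + l) + 1) * gauss_term (s / 2) (2 * (k - l) + 1) = ?f (2 * k + 1) * ?f (2 * l)"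
      "gauss_term (s / 2) (2 * (k + l + 1) + 1) * gauss_term (s / 2) (2 * (k - l) + 1) = ?f (2 * k + 2) * ?f (2 * l + 1)" for k l
      by (simp_all only: gauss_term_rotate') (simp_all add: algebra_simps)
    then show ?thesis
      unfolding infsum_rotate[OF infsum_times_infsum(1)[OF h h]] by (simp only: case_prod_unfold prod.case fst_conv snd_conv)
  qed
  also have "\<dots> = theta 2 1 s * theta 2 0 s + theta 2 0 s * theta 2 1 s"
    unfolding infsum_times_infsum(2)[OF f1 f0, symmetric] infsum_times_infsum(2)[OF f2 f1, symmetric] t0[symmetric] t1[symmetric] t2[symmetric] ..
  finally show "(th2 s)\<^sup>2 = 2 * theta 2 0 s * theta 2 1 s" by simp
  \<comment> \<open>The reflection n -> - n - 1 fixes the Gaussian and flips the sign, so the odd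
    class of the last product contributes nothing.\<close>
  have zero: "(\<Sum>\<^sub>\<infinity>n. alt_sign n * ?f (2 * n + 1)) = 0"
  proof -
    have "(\<Sum>\<^sub>\<infinity>n. alt_sign n * ?f (2 * n + 1)) = (\<Sum>\<^sub>\<infinity>n. alt_sign (- n - 1) * ?f (2 * (- n - 1) + 1))"
      by (rule infsum_reindex_bij_witness[of _ "\<lambda>n. - n - 1" "\<lambda>n. - n - 1"]) auto
    also have "\<dots> = (\<Sum>\<^sub>\<infinity>n. - (alt_sign n * ?f (2 * n + 1)))"
    proof (rule infsum_cong)
      fix n :: int
      have "2 * (- n - 1) + 1 = - (2 * n + 1)" by simp
      then show "alt_sign (- n - 1) * ?f (2 * (- n - 1) + 1) = - (alt_sign n * ?f (2 * n + 1))"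
        by (simp only: gauss_term_uminus) (simp add: alt_sign_def)
    qed
    finally show ?thesis by (simp add: infsum_uminus)
  qed
  have th4': "th4 (2 * s) = (\<Sum>\<^sub>\<infinity>n. alt_sign n * ?f (2 * n))"
    using th4_altdef[OF s2(1)] by (simp add: gauss_term_def power2_eq_square mult_ac)
  have "th3 s * th4 s = infsum (\<lambda>(m, n). gauss_term (2 * s) m * (alt_sign n * gauss_term (2 * s) n)) UNIV"
    unfolding th3_altdef[OF s] th4_altdef[OF s] by (rule infsum_times_infsum(2)[OF g g'])
  also have "\<dots> = infsum (\<lambda>(k, l). (alt_sign k * ?f (2 * k)) * (alt_sign l * ?f (2 * l))) UNIV + infsum (\<lambda>(k, l). (alt_sign k * ?f (2 * k + 1)) * (alt_sign l * ?f (2 * l + 1))) UNIV"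
    unfolding infsum_rotate[OF infsum_times_infsum(1)[OF g g']] by (simp only: sgn case_prod_unfold fst_conv snd_conv)
  also have "\<dots> = (th4 (2 * s))\<^sup>2"
    unfolding infsum_times_infsum(2)[OF a0 a0, symmetric] infsum_times_infsum(2)[OF a1 a1, symmetric] zero th4' by (simp add: power2_eq_square)
  finally show "th3 s * th4 s = (th4 (2 * s))\<^sup>2" .
qed

subsection \<open>Growth at the cusp\<close>

text \<open>An analytic measure of the order at infinity: for period h a pole of order m has rate 2
  pi m / h. It also applies to forms with fractional exponents and to functions not yet known to be
  periodic.\<close>

definition growth :: "real \<Rightarrow> (complex \<Rightarrow> complex) \<Rightarrow> bool" where
  "growth r f \<longleftrightarrow> (\<exists>c B. c \<ge> 0 \<and> B \<ge> 0 \<and> (\<forall>s. Im s > c \<longrightarrow> norm (f s) \<le> B * exp (r * Im s)))"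

lemma growthI:
  assumes "\<And>s. Im s > c \<Longrightarrow> norm (f s) \<le> B * exp (r * Im s)"
  shows "growth r f"
proof -
  have "norm (f s) \<le> \<bar>B\<bar> * exp (r * Im s)" if "Im s > \<bar>c\<bar>" for s
    using assms[of s] that by (smt (verit, best) exp_gt_zero mult_right_mono)
  then show ?thesis unfolding growth_def by (intro exI[of _ "\<bar>c\<bar>"] exI[of _ "\<bar>B\<bar>"]) auto
qed

lemma growthE:
  assumes "growth r f"
  obtains c B where "c \<ge> 0" "B \<ge> 0" "\<And>s. Im s > c \<Longrightarrow> norm (f s) \<le> B * exp (r * Im s)"
  using assms unfolding growth_def by blast

lemma growth_const: "growth 0 (\<lambda>_. k)"
  by (rule growthI[where c=0 and B="norm k"]) auto

lemma growth_mono: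
  assumes "growth r f" "r \<le> r'"
  shows "growth r' f"
proof -
  obtain c B where *: "c \<ge> 0" "B \<ge> 0" "\<And>s. Im s > c \<Longrightarrow> norm (f s) \<le> B * exp (r * Im s)"
    using assms(1) by (rule growthE) blast
  show ?thesis
  proof (rule growthI)
    fix s assume s: "Im s > c"
    have "B * exp (r * Im s) \<le> B * exp (r' * Im s)"
      using s * assms(2) by (intro mult_left_mono) auto
    then show "norm (f s) \<le> B * exp (r' * Im s)" using *(3)[OF s] by linarith
  qed
qed

lemma growth_add:
  assumes "growth r f" "growth r g"
  shows "growth r (\<lambda>s. f s + g s)"
proof -
  obtain c B where 1: "c \<ge> 0" "B \<ge> 0" "\<And>s. Im s > c \<Longrightarrow> norm (f s) \<le> B * exp (r * Im s)"
    using assms(1) by (rule growthE) blast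
  obtain c' B' where 2: "c' \<ge> 0" "B' \<ge> 0" "\<And>s. Im s > c' \<Longrightarrow> norm (g s) \<le> B' * exp (r * Im s)"
    using assms(2) by (rule growthE) blast
  show ?thesis
  proof (rule growthI)
    fix s assume "Im s > max c c'"
    then show "norm (f s + g s) \<le> (B + B') * exp (r * Im s)"
      using 1(3)[of s] 2(3)[of s] norm_triangle_ineq[of "f s" "g s"] by (simp add: distrib_right)
  qed
qed

lemma growth_mult:
  assumes "growth r f" "growth r' g"
  shows "growth (r + r') (\<lambda>s. f s * g s)"
proof -
  obtain c B where 1: "c \<ge> 0" "B \<ge> 0" "\<And>s. Im s > c \<Longrightarrow> norm (f s) \<le> B * exp (r * Im s)"
    using assms(1) by (rule growthE) blast
  obtain c' B' where 2: "c' \<ge> 0" "B' \<ge> 0" "\<And>s. Im s > c' \<Longrightarrow> norm (g s) \<le> B' * exp (r' * Im s)"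
    using assms(2) by (rule growthE) blast
  show ?thesis
  proof (rule growthI)
    fix s assume "Im s > max c c'"
    then have "norm (f s) * norm (g s) \<le> (B * exp (r * Im s)) * (B' * exp (r' * Im s))"
      using 1 2 by (intro mult_mono) auto
    then show "norm (f s * g s) \<le> (B * B') * exp ((r + r') * Im s)"
      by (simp only: norm_mult distrib_right exp_add) (simp add: mult_ac)
  qed
qed

lemma growth_cmult: "growth r f \<Longrightarrow> growth r (\<lambda>s. k * f s)"
  using growth_mult[OF growth_const] by fastforce

lemma growth_uminus: "growth r f \<Longrightarrow> growth r (\<lambda>s. - f s)"
  using growth_cmult[of r f "-1"] by simp

lemma growth_diff: "growth r f \<Longrightarrow> growth r g \<Longrightarrow> growth r (\<lambda>s. f s - g s)"
  using growth_add[of r f "\<lambda>s. - g s"] growth_uminus by simp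

lemma growth_power: "growth r f \<Longrightarrow> growth (real n * r) (\<lambda>s. f s ^ n)"
proof (induction n)
  case 0
  then show ?case using growth_const[of 1] by simp
next
  case (Suc n)
  then have "growth (r + real n * r) (\<lambda>s. f s * f s ^ n)" by (intro growth_mult) auto
  then show ?case by (simp add: algebra_simps)
qed

lemma growth_affine:
  assumes "growth r f" "a > 0"
  shows "growth (a * r) (\<lambda>s. f (of_real a * s + of_real b))"
proof -
  obtain c B where 1: "c \<ge> 0" "B \<ge> 0" "\<And>s. Im s > c \<Longrightarrow> norm (f s) \<le> B * exp (r * Im s)"
    using assms(1) by (rule growthE) blast
  show ?thesis
  proof (rule growthI)
    fix s :: complex assume "Im s > c / a"
    then have "Im (of_real a * s + of_real b) > c" using assms(2) by (simp add: field_simps)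
    then show "norm (f (of_real a * s + of_real b)) \<le> B * exp (a * r * Im s)"
      using 1(3)[of "of_real a * s + of_real b"] by (simp add: mult_ac)
  qed
qed

lemma growth_cong:
  assumes "growth r f" "\<And>s. Im s > c \<Longrightarrow> f s = g s"
  shows "growth r g"
proof -
  obtain c' B where 1: "c' \<ge> 0" "B \<ge> 0" "\<And>s. Im s > c' \<Longrightarrow> norm (f s) \<le> B * exp (r * Im s)"
    using assms(1) by (rule growthE) blast
  show ?thesis
  proof (rule growthI)
    fix s assume "Im s > max c c'"
    then show "norm (g s) \<le> B * exp (r * Im s)" using 1(3)[of s] assms(2)[of s] by simp
  qed
qed

lemma growth_exp: "growth (- (pi * r)) (\<lambda>s. exp (\<i> * pi * s * of_real r))"
proof (rule growthI[where c=0 and B=1])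
  fix s :: complex
  have "\<i> * pi * s * of_real r = of_real (pi * r) * (\<i> * s)" by simp
  then have "Re (\<i> * pi * s * of_real r) = - (pi * r) * Im s" by simp
  then show "norm (exp (\<i> * pi * s * of_real r)) \<le> 1 * exp (- (pi * r) * Im s)"
    by (simp add: norm_exp_eq_Re)
qed

text \<open>The exactly known size of g dominates the error f - g from some height on; every bound
  for an inverse comes from here.\<close>

lemma growth_lower:
  assumes "growth r (\<lambda>s. f s - g s)" "r < \<rho>" "A > 0" "\<And>s. norm (g s) = A * exp (\<rho> * Im s)"
  shows "\<exists>c\<ge>0. \<forall>s. Im s > c \<longrightarrow> norm (f s) \<ge> A / 2 * exp (\<rho> * Im s)"
proof -
  obtain c B where 1: "c \<ge> 0" "B \<ge> 0" "\<And>s. Im s > c \<Longrightarrow> norm (f s - g s) \<le> B * exp (r * Im s)"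
    using assms(1) by (rule growthE) blast
  \<comment> \<open>Beyond this height \<open>(\<rho> - r) * Im s\<close> exceeds 2 B / A, and exp u
    >= 1 + u shows that the error is at most half of g.\<close>
  define c' where "c' = max c (2 * B / A / (\<rho> - r))"
  show ?thesis
  proof (intro exI[of _ c'] conjI allI impI)
    show "c' \<ge> 0" using 1 by (simp add: c'_def)
    fix s :: complex assume s: "Im s > c'"
    then have "2 * B / A / (\<rho> - r) < Im s" by (simp add: c'_def)
    then have "(\<rho> - r) * Im s > 2 * B / A"
      using assms(2) pos_divide_less_eq[of "\<rho> - r" "2 * B / A" "Im s"] by (simp add: mult.commute)
    moreover have "exp ((\<rho> - r) * Im s) \<ge> 1 + (\<rho> - r) * Im s" by (rule exp_ge_add_one_self)
    ultimately have "exp ((\<rho> - r) * Im s) \<ge> 2 * B / A" by linarith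
    then have "B \<le> A / 2 * exp ((\<rho> - r) * Im s)" using assms(3) by (simp add: field_simps)
    then have "B * exp (r * Im s) \<le> A / 2 * exp ((\<rho> - r) * Im s) * exp (r * Im s)"
      by (intro mult_right_mono) auto
    also have "\<dots> = A / 2 * exp (\<rho> * Im s)"
      by (simp add: left_diff_distrib flip: exp_add mult.assoc)
    finally have "norm (f s - g s) \<le> A / 2 * exp (\<rho> * Im s)"
      using 1(3)[of s] s by (simp add: c'_def)
    moreover have "norm (g s) \<le> norm (f s) + norm (f s - g s)"
      using norm_triangle_ineq2[of "g s" "f s"] by (simp add: norm_minus_commute)
    ultimately show "norm (f s) \<ge> A / 2 * exp (\<rho> * Im s)"
      using assms(4)[of s] by (simp add: field_simps)
  qed
qed

lemma growth_inverse:
  assumes "growth r (\<lambda>s. f s - g s)" "r < \<rho>" "A > 0" "\<And>s. norm (g s) = A * exp (\<rho> * Im s)"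
  shows "growth (- \<rho>) (\<lambda>s. inverse (f s))"
proof -
  obtain c where c: "c \<ge> 0" "\<And>s. Im s > c \<Longrightarrow> norm (f s) \<ge> A / 2 * exp (\<rho> * Im s)"
    using growth_lower[OF assms] by blast
  show ?thesis
  proof (rule growthI)
    fix s assume s: "Im s > c"
    have "inverse (norm (f s)) \<le> inverse (A / 2 * exp (\<rho> * Im s))"
      using c(2)[OF s] assms(3) by (intro le_imp_inverse_le) auto
    also have "inverse (A / 2 * exp (\<rho> * Im s)) = 2 / A * exp (- \<rho> * Im s)"
      using assms(3) by (simp add: exp_minus field_simps)
    finally show "norm (inverse (f s)) \<le> 2 / A * exp (- \<rho> * Im s)" by (simp add: norm_inverse)
  qed
qed

text \<open>Of the decay of each term, the part at height 1 is spent on the summable majorant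
  \<open>g\<close>; the remaining Im s - 1 is estimated uniformly through the smallest index
  \<open>kmin\<close>.\<close>

lemma theta_tail:
  fixes kmin :: nat
  assumes M: "M > 0" and T: "\<And>n. n \<in> T \<Longrightarrow> int kmin \<le> \<bar>int M * n + h\<bar>"
  shows "growth (- (pi * (kmin\<^sup>2 / M))) (\<lambda>s. \<Sum>\<^sub>\<infinity>n\<in>T. exp (\<i> * pi * s * (of_int (int M * n + h))\<^sup>2 / of_nat M))"
proof (rule growthI)
  fix s :: complex assume s: "Im s > 1"
  define g where "g n = exp (- (pi * M) * (real_of_int n + h / M)\<^sup>2)" for n
  have g: "g summable_on UNIV" unfolding g_def using M by (intro summable_on_gaussian_int) auto
  define E where "E = exp (- (pi * kmin\<^sup>2 / M) * (Im s - 1))"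
  let ?f = "\<lambda>n. exp (\<i> * pi * s * (of_int (int M * n + h))\<^sup>2 / of_nat M)"
  have fs: "?f summable_on T"
    by (rule summable_on_subset_banach[OF abs_summable_summable[OF theta_summable[OF M, of s h]]]) (use s in auto)
  have "norm (infsum ?f T) \<le> infsum (\<lambda>n. E * g n) T"
  proof (rule norm_infsum_le)
    show "(?f has_sum infsum ?f T) T" using fs by (rule has_sum_infsum)
    have "(\<lambda>n. E * g n) summable_on T"
      by (rule summable_on_subset_banach[OF summable_on_cmult_right[OF g]]) auto
    then show "((\<lambda>n. E * g n) has_sum infsum (\<lambda>n. E * g n) T) T" by (rule has_sum_infsum)
    fix n assume "n \<in> T"
    then have "real_of_int (int kmin) \<le> real_of_int \<bar>int M * n + h\<bar>" using T of_int_le_iff by blast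
    then have k: "(real kmin)\<^sup>2 \<le> (real_of_int (int M * n + h))\<^sup>2"
      by (metis abs_le_square_iff abs_of_nat of_int_abs of_int_of_nat_eq)
    have q: "(real_of_int (int M * n + h))\<^sup>2 = M\<^sup>2 * (real_of_int n + h / M)\<^sup>2"
      using M by (simp add: power_mult_distrib[symmetric] field_simps)
    have "pi / M * (Im s - 1) * kmin\<^sup>2 \<le> pi / M * (Im s - 1) * (real_of_int (int M * n + h))\<^sup>2"
      using k s by (intro mult_left_mono) auto
    also have "\<dots> = (pi * M * (Im s - 1)) * (real_of_int n + h / M)\<^sup>2"
      unfolding q using M by (simp add: power2_eq_square)
    finally have "- (pi * M * Im s) * (real_of_int n + h / M)\<^sup>2 \<le>
        - (pi * kmin\<^sup>2 / M) * (Im s - 1) + - (pi * M) * (real_of_int n + h / M)\<^sup>2"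
      by (simp add: algebra_simps)
    then show "norm (?f n) \<le> E * g n"
      unfolding norm_theta_term[OF M] E_def g_def by (simp flip: exp_add)
  qed
  also have "\<dots> = E * infsum g T" by (rule infsum_cmult_right')
  also have "\<dots> \<le> E * infsum g UNIV"
    using g by (intro mult_left_mono infsum_mono_neutral) (auto simp: E_def g_def intro: summable_on_subset_banach[OF g])
  also have "\<dots> = (exp (pi * kmin\<^sup>2 / M) * infsum g UNIV) * exp (- (pi * (kmin\<^sup>2 / M)) * Im s)"
  proof -
    define q where "q = pi * (kmin\<^sup>2 / M)"
    have "E = exp (- q * (Im s - 1))" by (simp add: E_def q_def)
    also have "- q * (Im s - 1) = q + - q * Im s" by (simp add: algebra_simps)
    finally have E: "E = exp q * exp (- q * Im s)" by (simp only: exp_add)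
    show ?thesis unfolding E by (simp add: q_def)
  qed
  finally have "norm (infsum ?f T) \<le> (exp (pi * kmin\<^sup>2 / M) * infsum g UNIV) * exp (- (pi * (kmin\<^sup>2 / M)) * Im s)" .
  then show "norm (infsum ?f T) \<le> (exp (pi * kmin\<^sup>2 / M) * (\<Sum>\<^sub>\<infinity>n. exp (- (pi * M) * (real_of_int n + h / M)\<^sup>2))) * exp (- (pi * (kmin\<^sup>2 / M)) * Im s)"
    unfolding g_def .
qed

lemma theta_minus_leading:
  assumes M: "M > 0" and s: "Im s > 0"
  shows "theta M h s - exp (\<i> * pi * s * (of_int h)\<^sup>2 / of_nat M) =
    (\<Sum>\<^sub>\<infinity>n\<in>UNIV-{0}. exp (\<i> * pi * s * (of_int (int M * n + h))\<^sup>2 / of_nat M))"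
proof -
  have fs: "(\<lambda>n. exp (\<i> * pi * s * (of_int (int M * n + h))\<^sup>2 / of_nat M)) summable_on UNIV"
    by (rule abs_summable_summable[OF theta_summable[OF M s]])
  show ?thesis unfolding theta_def by (subst infsum_Diff[OF fs]) auto
qed

text \<open>The rates are - pi k^2 / M, with k of least absolute value in the class once the
  subtracted leading term is removed.\<close>

lemma theta_growth:
  shows "growth (- (4 * pi)) (\<lambda>s. theta 4 0 s - 1)" "growth (- pi) (theta 4 2)"
    "growth (- (9 / 4 * pi)) (\<lambda>s. theta 4 1 s - exp (\<i> * pi * s * of_real (1 / 4)))"
    "growth (- (2 * pi)) (\<lambda>s. theta 2 0 s - 1)" "growth (- (pi / 2)) (theta 2 1)"
proof -
  have ineqs: "n \<noteq> 0 \<Longrightarrow> 4 \<le> \<bar>4 * n\<bar>" "2 \<le> \<bar>4 * n + 2\<bar>" "n \<noteq> 0 \<Longrightarrow> 3 \<le> \<bar>4 * n + 1\<bar>"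
    "n \<noteq> 0 \<Longrightarrow> 2 \<le> \<bar>2 * n\<bar>" "1 \<le> \<bar>2 * n + 1\<bar>" for n :: int
    by presburger+
  have "growth (- (pi * (real (4\<^sup>2) / real 4))) (\<lambda>s. \<Sum>\<^sub>\<infinity>n\<in>UNIV-{0}. exp (\<i> * pi * s * (of_int (int 4 * n + 0))\<^sup>2 / of_nat 4))"
    by (rule theta_tail[where kmin=4]) (simp, use ineqs in auto)
  then have "growth (- (pi * (real (4\<^sup>2) / real 4))) (\<lambda>s. theta 4 0 s - 1)"
    by (rule growth_cong[where c=0]) (subst theta_minus_leading[symmetric], auto)
  then show "growth (- (4 * pi)) (\<lambda>s. theta 4 0 s - 1)" by (simp add: mult.commute)
  have "growth (- (pi * (real (2\<^sup>2) / real 4))) (\<lambda>s. \<Sum>\<^sub>\<infinity>n\<in>UNIV. exp (\<i> * pi * s * (of_int (int 4 * n + 2))\<^sup>2 / of_nat 4))"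
    by (rule theta_tail[where kmin=2]) (simp, use ineqs in auto)
  then show "growth (- pi) (theta 4 2)" unfolding theta_def by simp
  have "growth (- (pi * (real (3\<^sup>2) / real 4))) (\<lambda>s. \<Sum>\<^sub>\<infinity>n\<in>UNIV-{0}. exp (\<i> * pi * s * (of_int (int 4 * n + 1))\<^sup>2 / of_nat 4))"
    by (rule theta_tail[where kmin=3]) (simp, use ineqs in auto)
  then have "growth (- (pi * (real (3\<^sup>2) / real 4))) (\<lambda>s. theta 4 1 s - exp (\<i> * pi * s * of_real (1 / 4)))"
    by (rule growth_cong[where c=0]) (subst theta_minus_leading[symmetric], auto)
  then show "growth (- (9 / 4 * pi)) (\<lambda>s. theta 4 1 s - exp (\<i> * pi * s * of_real (1 / 4)))" by (simp add: mult.commute)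
  have "growth (- (pi * (real (2\<^sup>2) / real 2))) (\<lambda>s. \<Sum>\<^sub>\<infinity>n\<in>UNIV-{0}. exp (\<i> * pi * s * (of_int (int 2 * n + 0))\<^sup>2 / of_nat 2))"
    by (rule theta_tail[where kmin=2]) (simp, use ineqs in auto)
  then have "growth (- (pi * (real (2\<^sup>2) / real 2))) (\<lambda>s. theta 2 0 s - 1)"
    by (rule growth_cong[where c=0]) (subst theta_minus_leading[symmetric], auto)
  then show "growth (- (2 * pi)) (\<lambda>s. theta 2 0 s - 1)" by (simp add: mult.commute)
  have "growth (- (pi * (real (1\<^sup>2) / real 2))) (\<lambda>s. \<Sum>\<^sub>\<infinity>n\<in>UNIV. exp (\<i> * pi * s * (of_int (int 2 * n + 1))\<^sup>2 / of_nat 2))"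
    by (rule theta_tail[where kmin=1]) (simp, use ineqs in auto)
  then show "growth (- (pi / 2)) (theta 2 1)" unfolding theta_def by simp
qed

lemma
  shows th3_growth: "growth (- pi) (\<lambda>s. th3 s - 1)"
    and th4_growth: "growth (- pi) (\<lambda>s. th4 s - 1)"
    and th2_growth: "growth (- (9 / 4 * pi)) (\<lambda>s. th2 s - 2 * exp (\<i> * pi * s * of_real (1 / 4)))"
proof -
  have 0: "growth (- pi) (\<lambda>s. theta 4 0 s - 1)"
    using theta_growth(1) by (rule growth_mono) simp
  show "growth (- pi) (\<lambda>s. th3 s - 1)"
    using growth_add[OF 0 theta_growth(2)] by (simp add: th3_def algebra_simps)
  show "growth (- pi) (\<lambda>s. th4 s - 1)"
    using growth_diff[OF 0 theta_growth(2)] by (simp add: th4_def algebra_simps)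
  show "growth (- (9 / 4 * pi)) (\<lambda>s. th2 s - 2 * exp (\<i> * pi * s * of_real (1 / 4)))"
    using growth_cmult[OF theta_growth(3), of 2] by (simp add: th2_eq algebra_simps)
qed

subsection \<open>The theta constants have no zeros\<close>

lemma
  shows th3_add_int: "th3 (s + of_int k) = (if even k then th3 s else th4 s)"
    and th4_add_int: "th4 (s + of_int k) = (if even k then th4 s else th3 s)"
proof -
  have "exp (\<i> * pi * of_int k) = (if even k then 1 else - 1)"
  proof (cases "even k")
    case True
    then obtain m where "k = 2 * m" by blast
    then show ?thesis using exp_2pi_i_int[of m] by (simp add: mult_ac)
  next
    case False
    then obtain m where "k = 2 * m + 1" by (rule oddE)
    then have "\<i> * pi * of_int k = 2 * pi * \<i> * of_int m + pi * \<i>" by (simp add: algebra_simps)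
    then show ?thesis using False by (simp only: exp_add exp_2pi_i_int exp_pi_i) simp
  qed
  then have "theta 4 0 (s + of_int k) = theta 4 0 s" "theta 4 2 (s + of_int k) = (if even k then 1 else - 1) * theta 4 2 s"
    by (subst theta_add_int; simp)+
  then show "th3 (s + of_int k) = (if even k then th3 s else th4 s)" "th4 (s + of_int k) = (if even k then th4 s else th3 s)"
    by (simp_all add: th3_def th4_def)
qed

lemma Im_power_two_mult: "Im (2 ^ k * s) = 2 ^ k * Im s"
  by (induction k) (simp_all add: mult.assoc)

text \<open>By th3(s) th4(s) = th4(2 s)^2 a zero at s spreads to all 2^k s, whereas th4 tends to 1
  at infinity.\<close>

lemma th4_nonzero:
  assumes "Im s > 0"
  shows "th4 s \<noteq> 0"
proof
  assume z: "th4 s = 0"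
  have zk: "th4 (2 ^ k * s) = 0" for k
  proof (induction k)
    case (Suc k)
    have "Im (2 ^ k * s) > 0" using assms by (simp add: Im_power_two_mult)
    then have "(th4 (2 * (2 ^ k * s)))\<^sup>2 = 0" using Suc th3_times_th4[of "2 ^ k * s"] by simp
    then show ?case by (simp add: mult.assoc)
  qed (use z in simp)
  obtain c where c: "c \<ge> 0" "\<And>s. Im s > c \<Longrightarrow> norm (th4 s) \<ge> 1 / 2 * exp (0 * Im s)"
    using growth_lower[OF th4_growth, of 0 1] by auto
  obtain k :: nat where "c / Im s < 2 ^ k" using real_arch_pow[of 2 "c / Im s"] by auto
  then have "Im (2 ^ k * s) > c" using assms by (simp add: field_simps Im_power_two_mult)
  then show False using c(2)[of "2 ^ k * s"] zk[of k] by simp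
qed

lemma th3_nonzero: "Im s > 0 \<Longrightarrow> th3 s \<noteq> 0"
  using th4_nonzero[of "s + 1"] th4_add_int[of s 1] by simp

lemma
  assumes s: "Im s > 0"
  shows th3_double: "th3 (2 * s) = theta 2 0 s" and th2_double: "th2 (2 * s) = theta 2 1 s"
proof -
  have s2: "Im (2 * s) > 0" using s by simp
  have "gauss_term (2 * (2 * s)) n = gauss_term s (2 * n)" for n
    by (simp add: gauss_term_def power2_eq_square field_simps)
  then show "th3 (2 * s) = theta 2 0 s"
    using th3_altdef[OF s2] theta_2_0_altdef[OF s] by simp
  show "th2 (2 * s) = theta 2 1 s"
    using th2_altdef[OF s2] theta_2_1_altdef[OF s] by simp
qed

text \<open>The same doubling argument, with th2(s)^2 = 2 th3(2 s) th2(2 s) and the leading term 2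
  exp(pi i s / 4).\<close>

lemma th2_nonzero:
  assumes "Im s > 0"
  shows "th2 s \<noteq> 0"
proof
  assume z: "th2 s = 0"
  have zk: "th2 (2 ^ k * s) = 0" for k
  proof (induction k)
    case (Suc k)
    have k: "Im (2 ^ k * s) > 0" "Im (2 * (2 ^ k * s)) > 0" using assms by (simp_all add: Im_power_two_mult)
    then have "th3 (2 * (2 ^ k * s)) * th2 (2 * (2 ^ k * s)) = 0"
      using Suc th2_square[of "2 ^ k * s"] th3_double th2_double by simp
    then show ?case using th3_nonzero[OF k(2)] by (simp add: mult.assoc)
  qed (use z in simp)
  have n: "norm (2 * exp (\<i> * pi * s * of_real (1 / 4))) = 2 * exp (- (pi / 4) * Im s)" for s
    by (simp add: norm_mult norm_exp_eq_Re)
  obtain c where c: "c \<ge> 0" "\<And>s. Im s > c \<Longrightarrow> norm (th2 s) \<ge> 2 / 2 * exp (- (pi / 4) * Im s)"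
    using growth_lower[OF th2_growth, of "- (pi / 4)" 2] n by auto
  obtain k :: nat where "c / Im s < 2 ^ k" using real_arch_pow[of 2 "c / Im s"] by auto
  then have "Im (2 ^ k * s) > c" using assms by (simp add: field_simps Im_power_two_mult)
  then show False using c(2)[of "2 ^ k * s"] zk[of k] by simp
qed

subsection \<open>Gauss sums modulo 11\<close>

lemma sum_periodic_reindex:
  fixes F :: "int \<Rightarrow> complex" and g :: "'a \<Rightarrow> int"
  assumes per: "\<And>k. F (k mod n) = F k" and n: "n > 0"
    and A: "finite A" "int (card A) = n" and inj: "inj_on (\<lambda>x. g x mod n) A"
  shows "(\<Sum>k=0..<n. F k) = (\<Sum>x\<in>A. F (g x))"
proof -
  have "(\<lambda>x. g x mod n) ` A = {0..<n}"
  proof (rule card_subset_eq)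
    show "(\<lambda>x. g x mod n) ` A \<subseteq> {0..<n}" using n by auto
    show "card ((\<lambda>x. g x mod n) ` A) = card {0..<n}" using card_image[OF inj] A by simp
  qed simp
  then have "(\<Sum>k=0..<n. F k) = (\<Sum>x\<in>A. F (g x mod n))"
    using sum.reindex[OF inj, of F] by simp
  then show ?thesis by (simp add: per)
qed

lemma sum_periodic_shift:
  fixes F :: "int \<Rightarrow> complex"
  assumes per: "\<And>k. F (k mod n) = F k" and n: "n > 0"
  shows "(\<Sum>k=0..<n. F (k + v)) = (\<Sum>k=0..<n. F k)"
proof (rule sum_periodic_reindex[where F=F and n=n and g="\<lambda>x. x + v", OF per n, symmetric])
  show "inj_on (\<lambda>x. (x + v) mod n) {0..<n}"
  proof (rule inj_onI)
    fix x y assume xy: "x \<in> {0..<n}" "y \<in> {0..<n}" "(x + v) mod n = (y + v) mod n"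
    then have "n dvd (x + v) - (y + v)" by (metis mod_eq_dvd_iff)
    then have "n dvd x - y" by simp
    then have "x mod n = y mod n" by (metis mod_eq_dvd_iff)
    then show "x = y" using xy by simp
  qed
qed (use n in auto)

definition e11 :: "int \<Rightarrow> complex" where "e11 m = exp (2 * pi * \<i> * (of_int m / 11))"

lemma e11_add: "e11 (m + n) = e11 m * e11 n"
  by (simp add: e11_def add_divide_distrib distrib_left exp_add)

lemma e11_mult_11: "e11 (11 * m) = 1"
  using exp_2pi_i_int[of m] by (simp add: e11_def)

lemma e11_mod: "e11 (m mod 11) = e11 m"
proof -
  have "e11 m = e11 (m mod 11 + 11 * (m div 11))" by simp
  then show ?thesis by (simp only: e11_add e11_mult_11) simp
qed

lemma e11_cong: "11 dvd m - n \<Longrightarrow> e11 m = e11 n"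
  by (metis e11_mod mod_eq_dvd_iff)

definition gauss11 :: "int \<Rightarrow> complex" where
  "gauss11 a = (\<Sum>w=0..<11. e11 (a * w\<^sup>2))"

text \<open>With b = 2 a v modulo 11 one has a w^2 + b w = a (w + v)^2 - a v^2, and a sum over a
  full residue system ignores the shift by v.\<close>

lemma gauss11_complete_square:
  assumes "11 dvd 2 * a * v - b"
  shows "(\<Sum>w=0..<11. e11 (a * w\<^sup>2 + b * w)) = e11 (- a * v\<^sup>2) * gauss11 a"
proof -
  have "e11 (a * w\<^sup>2 + b * w) = e11 (- a * v\<^sup>2) * e11 (a * (w + v)\<^sup>2)" for w
  proof -
    obtain k where "2 * a * v - b = 11 * k" using assms by auto
    then have b: "b = 2 * a * v - 11 * k" by simp
    have "11 dvd (a * w\<^sup>2 + b * w) - (- a * v\<^sup>2 + a * (w + v)\<^sup>2)"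
      unfolding b by (simp add: power2_eq_square algebra_simps)
    then show ?thesis by (metis e11_cong e11_add)
  qed
  moreover have "(\<Sum>w=0..<11. e11 (a * (w + v)\<^sup>2)) = (\<Sum>w=0..<11. e11 (a * w\<^sup>2))"
  proof (rule sum_periodic_shift[where F="\<lambda>w. e11 (a * w\<^sup>2)"])
    show "e11 (a * (k mod 11)\<^sup>2) = e11 (a * k\<^sup>2)" for k
    proof (rule e11_cong)
      have "11 dvd k mod 11 - k" by (simp add: dvd_eq_mod_eq_0 mod_diff_left_eq)
      then have "11 dvd a * (k mod 11 + k) * (k mod 11 - k)" by simp
      then show "11 dvd a * (k mod 11)\<^sup>2 - a * k\<^sup>2" by (simp add: power2_eq_square algebra_simps)
    qed
  qed auto
  ultimately show ?thesis by (simp add: gauss11_def flip: sum_distrib_left)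
qed

text \<open>2 is not a square modulo 11.\<close>

lemma gauss11_double:
  assumes "\<not> 11 dvd a"
  shows "gauss11 (2 * a) = - gauss11 a"
proof -
  define E where "E m = e11 (a * m)" for m
  have E: "E m = E n" if "11 dvd m - n" for m n
    unfolding E_def by (rule e11_cong) (use that in \<open>simp add: right_diff_distrib[symmetric]\<close>)
  have "(\<Sum>m=0..<11. E (m + 1)) = (\<Sum>m=0..<11. E m)"
  proof (rule sum_periodic_shift)
    show "E (k mod 11) = E k" for k by (rule E) (simp add: dvd_eq_mod_eq_0 mod_diff_left_eq)
  qed simp
  moreover have "E (m + 1) = E m * e11 a" for m by (simp add: E_def distrib_left e11_add)
  ultimately have "(\<Sum>m=0..<11. E m) * e11 a = (\<Sum>m=0..<11. E m)" by (simp add: sum_distrib_right)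
  moreover have "e11 a \<noteq> 1"
  proof
    assume "e11 a = 1"
    then obtain n :: int where "2 * pi * (of_int a / 11) = of_int (2 * n) * pi"
      unfolding e11_def exp_eq_1 by auto
    then have "real_of_int a = of_int (11 * n)" by (simp add: field_simps)
    then have "a = 11 * n" by (simp only: of_int_eq_iff)
    then show False using assms by simp
  qed
  ultimately have zero: "(\<Sum>m=0..<11. E m) = 0" by auto
  have r11: "{0..<11::int} = {0,1,2,3,4,5,6,7,8,9,10}"
    by (rule set_eqI, simp, presburger)
  \<comment> \<open>The nonzero squares modulo 11 are 1, 3, 4, 5, 9, each hit twice; doubling gives
    the non-squares. So the two Gauss sums add up to twice the sum of all eleventh roots of unity,
    which is 0.\<close>
  have "gauss11 a = E 0 + E 1 + E 4 + E 9 + E 16 + E 25 + E 36 + E 49 + E 64 + E 81 + E 100"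
    unfolding gauss11_def r11 E_def by simp
  also have "\<dots> = E 0 + 2 * (E 1 + E 3 + E 4 + E 5 + E 9)"
    using E[of 16 5] E[of 25 3] E[of 36 3] E[of 49 5] E[of 64 9] E[of 81 4] E[of 100 1] by simp
  finally have 1: "gauss11 a = E 0 + 2 * (E 1 + E 3 + E 4 + E 5 + E 9)" .
  have "gauss11 (2 * a) = E 0 + E 2 + E 8 + E 18 + E 32 + E 50 + E 72 + E 98 + E 128 + E 162 + E 200"
    unfolding gauss11_def r11 E_def by (simp add: mult_ac)
  also have "\<dots> = E 0 + 2 * (E 2 + E 6 + E 7 + E 8 + E 10)"
    using E[of 18 7] E[of 32 10] E[of 50 6] E[of 72 6] E[of 98 10] E[of 128 7] E[of 162 8] E[of 200 2] by simp
  finally have "gauss11 (2 * a) + gauss11 a = 2 * (\<Sum>m=0..<11. E m)"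
    using 1 by (simp add: r11)
  then show ?thesis using zero by (simp add: add_eq_0_iff)
qed

text \<open>
  A matrix of lower left entry \<open>11\<close> acts on the theta constants; the Gauss sum is the only
  factor that depends on the matrix.
\<close>

lemma theta_S_eleven:
  assumes M: "M = 2 \<or> M = 4" and s: "Im s > 0" and l: "11 dvd 64 * l * l' + 1"
  shows "theta M u ((- 1 / s + 8 * of_int l) / 11) =
    csqrt (- \<i> * s) / of_real (sqrt (11 * M)) * gauss11 (4 * l * M) *
     (\<Sum>v=0..<int M. exp (2 * pi * \<i> * (of_int (11 * u * v) / of_nat M)) * theta M v ((s + 8 * of_int l') / 11))"
proof -
  have M0: "M > 0" "M dvd 4" "int M > 0" and cop: "coprime (int M) 11" "coprime 11 (int M)"
    using M by (auto simp: coprime_iff_gcd_eq_1 gcd_non_0_int)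
  have s': "Im (- 1 / s) > 0" by (rule Im_minus_inverse_pos[OF s])
  define c where "c = csqrt (- \<i> * s) / complex_of_real (sqrt (11 * M))"
  define eM where "eM k = exp (2 * pi * \<i> * (of_int k / of_nat M))" for k :: int
  define e where "e k = exp (2 * pi * \<i> * (of_int k / of_nat (11 * M)))" for k :: int
  have e_per: "e (h + int (11 * M) * k) = e h" for h k
  proof -
    have "2 * pi * \<i> * (of_int (h + int (11 * M) * k) / of_nat (11 * M)) = 2 * pi * \<i> * (of_int h / of_nat (11 * M)) + 2 * pi * \<i> * of_int k"
      using M0 by (simp add: field_simps)
    then show ?thesis by (simp only: e_def exp_add exp_2pi_i_int mult_1_right)
  qed
  \<comment> \<open>k = M w - 11 v runs through all classes modulo 11 M, as M and 11 are coprime; in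
    this form the indices match \<open>theta_divide_eleven\<close> before and after the
    inversion.\<close>
  have trans: "theta (11 * M) h (- 1 / s) = c * (\<Sum>v=0..<int M. \<Sum>w=0..<11. e (h * (int M * w - 11 * v)) * theta (11 * M) (int M * w - 11 * v) s)" for h
  proof -
    let ?F = "\<lambda>k. e (h * k) * theta (11 * M) k s"
    have "theta (11 * M) h (- 1 / s) = c * (\<Sum>k=0..<int (11 * M). ?F k)"
      using theta_S[of "11 * M" s h] M0 s by (simp add: c_def e_def)
    also have "(\<Sum>k=0..<int (11 * M). ?F k) = (\<Sum>x\<in>{0..<int M} \<times> {0..<11}. ?F ((\<lambda>(v, w). int M * w - 11 * v) x))"
    proof (rule sum_periodic_reindex)
      show "?F (k mod int (11 * M)) = ?F k" for k
      proof -
        have k: "k = k mod int (11 * M) + int (11 * M) * (k div int (11 * M))" by simp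
        have "e (h * k) = e (h * (k mod int (11 * M)) + int (11 * M) * (h * (k div int (11 * M))))"
          by (subst (1) k) (simp only: distrib_left mult.left_commute)
        moreover have "theta (11 * M) k s = theta (11 * M) (k mod int (11 * M)) s"
          by (subst (1) k) (rule theta_add_period)
        ultimately show ?thesis by (simp only: e_per)
      qed
      show "inj_on (\<lambda>x. (case x of (v, w) \<Rightarrow> int M * w - 11 * v) mod int (11 * M)) ({0..<int M} \<times> {0..<11})"
      proof (rule inj_onI, clarify)
        fix v w v' w' :: int
        assume r: "v \<in> {0..<int M}" "w \<in> {0..<11}" "v' \<in> {0..<int M}" "w' \<in> {0..<11}"
          and eq: "(int M * w - 11 * v) mod int (11 * M) = (int M * w' - 11 * v') mod int (11 * M)"
        have d: "int (11 * M) dvd (int M * w - 11 * v) - (int M * w' - 11 * v')"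
          using eq by (simp only: mod_eq_dvd_iff)
        then have d': "int (11 * M) dvd int M * (w - w') - 11 * (v - v')" by (simp add: algebra_simps)
        have "11 dvd int M * (w - w') - 11 * (v - v')" by (rule dvd_trans[OF _ d']) simp
        then have "11 dvd int M * (w - w')" by (metis dvd_diff_right_iff dvd_triv_left dvd_diffD dvd_add_right_iff diff_add_cancel)
        then have "11 dvd w - w'" using cop by (simp add: coprime_dvd_mult_right_iff)
        then have "w mod 11 = w' mod 11" by (simp add: mod_eq_dvd_iff)
        then have "w = w'" using r by simp
        moreover have "int M dvd int M * (w - w') - 11 * (v - v')" by (rule dvd_trans[OF _ d']) simp
        then have "int M dvd 11 * (v - v')" using \<open>w = w'\<close> by (simp del: minus_diff_eq)
        then have "int M dvd v - v'" using cop(1) coprime_dvd_mult_right_iff by blast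
        then have "v mod int M = v' mod int M" by (simp add: mod_eq_dvd_iff)
        then have "v = v'" using r by simp
        ultimately show "v = v' \<and> w = w'" by simp
      qed
    qed (use M0 in auto)
    finally show ?thesis by (simp add: sum.cartesian_product case_prod_unfold)
  qed
  have exps: "e ((int M * w - 11 * u) * (int M * w' - 11 * v)) = e11 (int M * w' * w) * eM (11 * u * v)" for w w' v
  proof -
    have "2 * pi * \<i> * (of_int ((int M * w - 11 * u) * (int M * w' - 11 * v)) / of_nat (11 * M)) =
       2 * pi * \<i> * (of_int (int M * w' * w) / 11) + 2 * pi * \<i> * (of_int (11 * u * v) / of_nat M)
       + 2 * pi * \<i> * of_int (- w * v - u * w')"
      using M0 by (simp add: field_simps)
    then show ?thesis by (simp only: e_def e11_def eM_def exp_add exp_2pi_i_int mult_1_right)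
  qed
  \<comment> \<open>The square is completed at -8 l' w', which is possible because 64 l l' = -1
    modulo 11. The remaining phase is exactly the one that belongs to the argument (s + 8 l') /
    11.\<close>
  have gs: "(\<Sum>w=0..<11. e11 (4 * l * int M * w\<^sup>2 + int M * w' * w)) = e11 (4 * l' * int M * w'\<^sup>2) * gauss11 (4 * l * M)" for w'
  proof -
    obtain k where k: "64 * l * l' + 1 = 11 * k" using l by auto
    have ll: "l * l' * 64 = 11 * k - 1" using k by simp
    have d1: "2 * (4 * l * int M) * (- 8 * l' * w') - int M * w' = 11 * (- k * int M * w')"
    proof -
      have "2 * (4 * l * int M) * (- 8 * l' * w') - int M * w' = - (l * l' * 64) * int M * w' - int M * w'" by simp
      also have "\<dots> = 11 * (- k * int M * w')" unfolding ll by (simp add: algebra_simps)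
      finally show ?thesis .
    qed
    have d2: "- (4 * l * int M) * (- 8 * l' * w')\<^sup>2 - 4 * l' * int M * w'\<^sup>2 = 11 * (- k * 4 * l' * int M * w'\<^sup>2)"
    proof -
      have "- (4 * l * int M) * (- 8 * l' * w')\<^sup>2 - 4 * l' * int M * w'\<^sup>2 = - (l * l' * 64) * (4 * l' * int M * w'\<^sup>2) - 4 * l' * int M * w'\<^sup>2"
        by (simp add: power2_eq_square)
      also have "\<dots> = 11 * (- k * 4 * l' * int M * w'\<^sup>2)" unfolding ll by (simp add: algebra_simps)
      finally show ?thesis .
    qed
    have "(\<Sum>w=0..<11. e11 (4 * l * int M * w\<^sup>2 + int M * w' * w)) = e11 (- (4 * l * int M) * (- 8 * l' * w')\<^sup>2) * gauss11 (4 * l * int M)"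
      by (rule gauss11_complete_square) (unfold d1, simp)
    also have "e11 (- (4 * l * int M) * (- 8 * l' * w')\<^sup>2) = e11 (4 * l' * int M * w'\<^sup>2)"
      by (rule e11_cong) (unfold d2, simp)
    finally show ?thesis .
  qed
  have div: "theta M v ((z + 8 * of_int k) / 11) = (\<Sum>w=0..<11. e11 (4 * k * int M * w\<^sup>2) * theta (11 * M) (int M * w - 11 * v) z)"
    if "Im z > 0" for v k z
    using theta_divide_eleven[OF M0(1,2) that, of v k] by (simp add: e11_def)
  have "theta M u ((- 1 / s + 8 * of_int l) / 11) =
     (\<Sum>w=0..<11. e11 (4 * l * int M * w\<^sup>2) * (c * (\<Sum>v=0..<int M. \<Sum>w'=0..<11. e11 (int M * w' * w) * eM (11 * u * v) * theta (11 * M) (int M * w' - 11 * v) s)))"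
    unfolding div[OF s'] trans exps ..
  also have "\<dots> = c * (\<Sum>w=0..<11. \<Sum>v=0..<int M. \<Sum>w'=0..<11. e11 (4 * l * int M * w\<^sup>2 + int M * w' * w) * eM (11 * u * v) * theta (11 * M) (int M * w' - 11 * v) s)"
    by (simp add: sum_distrib_left e11_add mult_ac)
  also have "(\<Sum>w=0..<11. \<Sum>v=0..<int M. \<Sum>w'=0..<11. e11 (4 * l * int M * w\<^sup>2 + int M * w' * w) * eM (11 * u * v) * theta (11 * M) (int M * w' - 11 * v) s) =
     (\<Sum>v=0..<int M. \<Sum>w=0..<11. \<Sum>w'=0..<11. e11 (4 * l * int M * w\<^sup>2 + int M * w' * w) * eM (11 * u * v) * theta (11 * M) (int M * w' - 11 * v) s)"
    by (rule sum.swap)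
  also have "\<dots> = (\<Sum>v=0..<int M. \<Sum>w'=0..<11. \<Sum>w=0..<11. e11 (4 * l * int M * w\<^sup>2 + int M * w' * w) * eM (11 * u * v) * theta (11 * M) (int M * w' - 11 * v) s)"
    by (intro sum.cong refl sum.swap)
  also have "\<dots> = (\<Sum>v=0..<int M. \<Sum>w'=0..<11. (e11 (4 * l' * int M * w'\<^sup>2) * gauss11 (4 * l * M)) * eM (11 * u * v) * theta (11 * M) (int M * w' - 11 * v) s)"
    by (simp only: gs flip: sum_distrib_right)
  also have "\<dots> = gauss11 (4 * l * M) * (\<Sum>v=0..<int M. eM (11 * u * v) * theta M v ((s + 8 * of_int l') / 11))"
    unfolding div[OF s] by (simp add: sum_distrib_left mult_ac)
  finally show ?thesis by (simp add: c_def eM_def mult_ac)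
qed

subsection \<open>Four weight one forms and their transformation behaviour\<close>

definition P11 :: "complex \<Rightarrow> complex" where "P11 s = th3 s * th3 (11 * s)"
definition N11 :: "complex \<Rightarrow> complex" where "N11 s = th4 s * th4 (11 * s)"
definition R11 :: "complex \<Rightarrow> complex" where "R11 s = th2 s * th2 (11 * s)"

text \<open>The theta series of \<open>x\<^sup>2 + x y + 3 y\<^sup>2\<close>, whose double is \<open>((2 x + y)\<^sup>2 + 11 y\<^sup>2) / 2\<close>.\<close>

definition Q11 :: "complex \<Rightarrow> complex" where
  "Q11 s = theta 2 0 s * theta 2 0 (11 * s) + theta 2 1 s * theta 2 1 (11 * s)"

text \<open>
  \<open>SL\<^sub>2(\<int>)\<close> permutes \<open>P11, - N11, - R11\<close> up to scalars, twisting them with a character; the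
  permutation is the action on the nonzero row vectors modulo 2.
\<close>

definition H11 :: "int \<Rightarrow> int \<Rightarrow> complex \<Rightarrow> complex" where
  "H11 p r s = (if even p then - R11 s else if even r then - N11 s else P11 s)"

text \<open>Write A, B for \<open>theta 2 0\<close>, \<open>theta 2 1\<close> at s and A', B' for
  those at 11 s. The three squares are (A^2 + B^2)(A'^2 + B'^2), (A^2 - B^2)(A'^2 - B'^2) and 4 A B
  A' B', with sum 2 (A A' + B B')^2.\<close>

lemma Q11_square:
  assumes "Im s > 0"
  shows "2 * (Q11 s)\<^sup>2 = (P11 s)\<^sup>2 + (N11 s)\<^sup>2 + (R11 s)\<^sup>2"
proof -
  have s: "Im (11 * s) > 0" using assms by simp
  show ?thesis
    unfolding P11_def N11_def R11_def Q11_def power_mult_distrib th3_square[OF assms] th3_square[OF s]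
      th4_square[OF assms] th4_square[OF s] th2_square[OF assms] th2_square[OF s]
    by (simp add: power2_eq_square algebra_simps)
qed

lemma
  assumes "Im s > 0"
  shows P11_nonzero: "P11 s \<noteq> 0" and N11_nonzero: "N11 s \<noteq> 0" and R11_nonzero: "R11 s \<noteq> 0"
  using assms th2_nonzero[of s] th2_nonzero[of "11 * s"] th3_nonzero[of s] th3_nonzero[of "11 * s"]
    th4_nonzero[of s] th4_nonzero[of "11 * s"] by (simp_all add: P11_def N11_def R11_def)

lemma H11_nonzero: "Im s > 0 \<Longrightarrow> H11 p r s \<noteq> 0"
  by (simp add: H11_def P11_nonzero N11_nonzero R11_nonzero)

lemma exp_pi_i_int: "exp (\<i> * pi * of_int k) = (if even k then 1 else - 1)"
proof (cases "even k")
  case True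
  then obtain m where "k = 2 * m" by blast
  then show ?thesis using exp_2pi_i_int[of m] by (simp add: mult_ac)
next
  case False
  then obtain m where "k = 2 * m + 1" by (rule oddE)
  then have "\<i> * pi * of_int k = 2 * pi * \<i> * of_int m + pi * \<i>" by (simp add: algebra_simps)
  then show ?thesis using False by (simp only: exp_add exp_2pi_i_int exp_pi_i) simp
qed

text \<open>The fractional exponents at s and 11 s add up to integers: (1 + 11) / 4 = 3 for
  \<open>R11\<close> and (1 + 11) / 2 = 6 for the second summand of \<open>Q11\<close>.\<close>

lemma
  shows P11_add_int: "P11 (s + of_int k) = (if even k then P11 s else N11 s)"
    and N11_add_int: "N11 (s + of_int k) = (if even k then N11 s else P11 s)"
    and R11_add_int: "R11 (s + of_int k) = (if even k then R11 s else - R11 s)"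
    and Q11_add_int: "Q11 (s + of_int k) = Q11 s"
proof -
  have eq: "11 * (s + of_int k) = 11 * s + of_int (11 * k)" by (simp add: distrib_left)
  show "P11 (s + of_int k) = (if even k then P11 s else N11 s)" "N11 (s + of_int k) = (if even k then N11 s else P11 s)"
    unfolding P11_def N11_def eq th3_add_int th4_add_int by auto
  have t4: "theta 4 1 (z + of_int m) = exp (\<i> * pi * of_int m / 4) * theta 4 1 z" for z m
    by (subst theta_add_int) simp_all
  have t2: "theta 2 0 (z + of_int m) = theta 2 0 z" "theta 2 1 (z + of_int m) = exp (\<i> * pi * of_int m / 2) * theta 2 1 z" for z m
    by (subst theta_add_int; simp)+
  have "exp (\<i> * pi * of_int k / 4) * exp (\<i> * pi * of_int (11 * k) / 4) = exp (\<i> * pi * of_int (3 * k))"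
    by (simp add: field_simps flip: exp_add)
  then have x4: "exp (\<i> * pi * of_int k / 4) * exp (\<i> * pi * of_int (11 * k) / 4) = (if even k then 1 else - 1)"
    by (simp only: exp_pi_i_int) simp
  have "R11 (s + of_int k) = (exp (\<i> * pi * of_int k / 4) * exp (\<i> * pi * of_int (11 * k) / 4)) * R11 s"
    unfolding R11_def eq th2_eq t4 by (simp only: ac_simps)
  then show "R11 (s + of_int k) = (if even k then R11 s else - R11 s)" unfolding x4 by simp
  have "exp (\<i> * pi * of_int k / 2) * exp (\<i> * pi * of_int (11 * k) / 2) = exp (\<i> * pi * of_int (6 * k))"
    by (simp add: field_simps flip: exp_add)
  then have x2: "exp (\<i> * pi * of_int k / 2) * exp (\<i> * pi * of_int (11 * k) / 2) = 1"
    by (simp only: exp_pi_i_int) simp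
  have "Q11 (s + of_int k) = theta 2 0 s * theta 2 0 (11 * s) + (exp (\<i> * pi * of_int k / 2) * exp (\<i> * pi * of_int (11 * k) / 2)) * (theta 2 1 s * theta 2 1 (11 * s))"
    unfolding Q11_def eq t2 by (simp only: ac_simps)
  then show "Q11 (s + of_int k) = Q11 s" unfolding x2 Q11_def by simp
qed

lemma H11_add_int:
  assumes "odd p \<or> odd r"
  shows "H11 p r (s + of_int k) = (if even k then H11 p r s else - H11 p (p * k + r) s)"
  using assms by (auto simp: H11_def P11_add_int N11_add_int R11_add_int)

lemma H11_cong: "even (p - p') \<Longrightarrow> even (r - r') \<Longrightarrow> H11 p r = H11 p' r'"
  by (auto simp: H11_def fun_eq_iff)

lemma exp_quarter_turns:
  "exp (2 * pi * \<i> * (of_int m / of_nat 2)) = (if even m then 1 else - 1)"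
  "exp (2 * pi * \<i> * (of_int m / of_nat 4)) = (if even m then if 4 dvd m then 1 else - 1 else if 4 dvd m - 1 then \<i> else - \<i>)"
proof -
  have "2 * pi * \<i> * (of_int m / of_nat 2) = \<i> * pi * of_int m" by simp
  then show "exp (2 * pi * \<i> * (of_int m / of_nat 2)) = (if even m then 1 else - 1)"
    by (simp only: exp_pi_i_int)
  define q where "q = m div 4"
  have q: "exp (2 * pi * \<i> * (of_int (4 * q + k) / of_nat 4)) = exp (\<i> * pi * of_int k / 2)" for k
  proof -
    have "2 * pi * \<i> * (of_int (4 * q + k) / of_nat 4) = 2 * pi * \<i> * of_int q + \<i> * pi * of_int k / 2"
      by (simp add: field_simps)
    then show ?thesis by (simp only: exp_add exp_2pi_i_int mult_1_left)
  qed
  have "exp (\<i> * complex_of_real (pi / 2)) = \<i>" by (simp only: cis_conv_exp[symmetric] cis_pi_half)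
  then have e1: "exp (\<i> * pi / 2) = \<i>" by simp
  have "\<i> * pi * of_int 3 / 2 = \<i> * pi * of_int 1 + \<i> * pi / 2" by (simp add: field_simps)
  then have e3: "exp (\<i> * pi * of_int 3 / 2) = - \<i>" by (simp only: exp_add exp_pi_i_int e1) simp
  have e2: "exp (\<i> * pi * of_int 2 / 2) = - 1" using exp_pi_i_int[of 1] by simp
  have "m = 4 * q + m mod 4" "m mod 4 = 0 \<or> m mod 4 = 1 \<or> m mod 4 = 2 \<or> m mod 4 = 3" by (auto simp: q_def)
  then consider "m = 4 * q + 0" | "m = 4 * q + 1" | "m = 4 * q + 2" | "m = 4 * q + 3" by force
  then show "exp (2 * pi * \<i> * (of_int m / of_nat 4)) = (if even m then if 4 dvd m then 1 else - 1 else if 4 dvd m - 1 then \<i> else - \<i>)"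
  proof cases
    case 1 then show ?thesis unfolding 1 q by simp
  next
    case 2 then show ?thesis unfolding 2 q using e1 by simp
  next
    case 3
    have "\<not> 4 dvd 4 * q + 2" by presburger
    then show ?thesis unfolding 3 q e2 by simp
  next
    case 4
    have "\<not> 4 dvd 4 * q + 3 - 1" by presburger
    then show ?thesis unfolding 4 q e3 by simp
  qed
qed

lemma ranges: "{0..<int 2} = {0, 1}" "{0..<int 4} = {0, 1, 2, 3}"
  by auto

lemma
  assumes s: "Im s > 0"
  shows th3_S: "th3 (- 1 / s) = csqrt (- \<i> * s) * th3 s"
    and th4_S: "th4 (- 1 / s) = csqrt (- \<i> * s) * th2 s"
    and th2_S: "th2 (- 1 / s) = csqrt (- \<i> * s) * th4 s"
proof -
  define r where "r = csqrt (- \<i> * s)"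
  have t: "theta 4 0 (- 1 / s) = r / 2 * (theta 4 0 s + theta 4 1 s + theta 4 2 s + theta 4 3 s)"
    "theta 4 1 (- 1 / s) = r / 2 * (theta 4 0 s + \<i> * theta 4 1 s - theta 4 2 s - \<i> * theta 4 3 s)"
    "theta 4 2 (- 1 / s) = r / 2 * (theta 4 0 s - theta 4 1 s + theta 4 2 s - theta 4 3 s)"
    "theta 4 3 (- 1 / s) = r / 2 * (theta 4 0 s - \<i> * theta 4 1 s - theta 4 2 s + \<i> * theta 4 3 s)"
    by (subst theta_S[OF _ s], simp, unfold exp_quarter_turns ranges r_def[symmetric], simp)+
  show "th3 (- 1 / s) = csqrt (- \<i> * s) * th3 s" "th4 (- 1 / s) = csqrt (- \<i> * s) * th2 s" "th2 (- 1 / s) = csqrt (- \<i> * s) * th4 s"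
    unfolding th3_def th4_def th2_def t r_def[symmetric] by (simp_all add: field_simps)
qed

text \<open>The phase is that of 11 u v = - u v modulo 4, so i and -i trade places compared with the
  plain inversion. The Jacobi combinations are symmetric in the classes 1 and 3 and do not see
  this.\<close>

lemma
  assumes s: "Im s > 0" and l: "11 dvd 64 * l * l' + 1"
  defines "z \<equiv> (- 1 / s + 8 * of_int l) / 11" and "z' \<equiv> (s + 8 * of_int l') / 11"
    and "C \<equiv> csqrt (- \<i> * s) / of_real (sqrt 11) * gauss11 (16 * l)"
  shows th3_S_eleven: "th3 z = C * th3 z'" and th4_S_eleven: "th4 z = C * th2 z'" and th2_S_eleven: "th2 z = C * th4 z'"
proof -
  define K where "K = csqrt (- \<i> * s) / complex_of_real (sqrt (real (11 * 4))) * gauss11 (4 * l * int 4)"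
  have s44: "complex_of_real (sqrt (real (11 * 4))) = 2 * of_real (sqrt 11)"
    using real_sqrt_mult[of 4 11] by simp
  have C: "C = 2 * K" unfolding K_def C_def s44 by (simp add: mult_ac)
  have t: "theta 4 0 z = K * (theta 4 0 z' + theta 4 1 z' + theta 4 2 z' + theta 4 3 z')"
    "theta 4 1 z = K * (theta 4 0 z' - \<i> * theta 4 1 z' - theta 4 2 z' + \<i> * theta 4 3 z')"
    "theta 4 2 z = K * (theta 4 0 z' - theta 4 1 z' + theta 4 2 z' - theta 4 3 z')"
    "theta 4 3 z = K * (theta 4 0 z' + \<i> * theta 4 1 z' - theta 4 2 z' - \<i> * theta 4 3 z')"
    unfolding z_def z'_def
    by (subst theta_S_eleven[OF _ s l], simp, unfold exp_quarter_turns ranges, simp add: K_def algebra_simps)+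
  show "th3 z = C * th3 z'" "th4 z = C * th2 z'" "th2 z = C * th4 z'"
    unfolding th3_def th4_def th2_def t C by (simp_all add: algebra_simps)
qed

text \<open>The factors of weight 1/2 from inversions at s and at s / 11 merge into one that is free
  of square roots of s.\<close>

lemma csqrt_div_eleven: "csqrt (- \<i> * s) * csqrt (- \<i> * (s / 11)) = - \<i> * s / of_real (sqrt 11)"
proof -
  have "- \<i> * (s / 11) = of_real (1 / 11) * (- \<i> * s)" by simp
  then have "csqrt (- \<i> * (s / 11)) = of_real (sqrt (1 / 11)) * csqrt (- \<i> * s)"
    by (simp only: csqrt_of_real_mult)
  then have "csqrt (- \<i> * s) * csqrt (- \<i> * (s / 11)) = of_real (sqrt (1 / 11)) * (csqrt (- \<i> * s))\<^sup>2"
    by (simp add: power2_eq_square)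
  then show ?thesis by (simp add: real_sqrt_divide)
qed

text \<open>Since 11 (- 1 / s) = - 1 / (s / 11), both theta factors undergo an inversion and
  exchange their roles; hence the argument s / 11 on the right.\<close>

lemma
  assumes s: "Im s > 0"
  defines "C \<equiv> - \<i> * s / of_real (sqrt 11)"
  shows H11_Fricke: "odd p \<or> odd r \<Longrightarrow> H11 p r (- 1 / s) = C * H11 r (- p) (s / 11)"
    and Q11_Fricke: "Q11 (- 1 / s) = C * Q11 (s / 11)"
proof -
  have s': "Im (s / 11) > 0" using s by simp
  have eq: "11 * (- 1 / s) = - 1 / (s / 11)" by simp
  have "P11 (- 1 / s) = C * P11 (s / 11)" "N11 (- 1 / s) = C * R11 (s / 11)" "R11 (- 1 / s) = C * N11 (s / 11)"
    unfolding P11_def N11_def R11_def eq th3_S[OF s] th3_S[OF s'] th4_S[OF s] th4_S[OF s'] th2_S[OF s] th2_S[OF s'] C_def csqrt_div_eleven[symmetric]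
    by simp_all
  then show "odd p \<or> odd r \<Longrightarrow> H11 p r (- 1 / s) = C * H11 r (- p) (s / 11)"
    by (auto simp: H11_def)
  have t: "theta 2 0 (- 1 / z) = csqrt (- \<i> * z) / of_real (sqrt 2) * (theta 2 0 z + theta 2 1 z)"
    "theta 2 1 (- 1 / z) = csqrt (- \<i> * z) / of_real (sqrt 2) * (theta 2 0 z - theta 2 1 z)" if "Im z > 0" for z
    using theta_S[of 2 z 0] theta_S[of 2 z 1] that unfolding exp_quarter_turns ranges by simp_all
  have sq2: "complex_of_real (sqrt 2) * complex_of_real (sqrt 2) = 2" by (simp flip: of_real_mult)
  define K1 where "K1 = csqrt (- \<i> * s) / complex_of_real (sqrt 2)"
  define K2 where "K2 = csqrt (- \<i> * (s / 11)) / complex_of_real (sqrt 2)"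
  have "Q11 (- 1 / s) = 2 * (K1 * K2) * Q11 (s / 11)"
    unfolding Q11_def eq t[OF s] t[OF s'] K1_def[symmetric] K2_def[symmetric] by (simp add: algebra_simps)
  also have "K1 * K2 = (csqrt (- \<i> * s) * csqrt (- \<i> * (s / 11))) / (complex_of_real (sqrt 2) * complex_of_real (sqrt 2))"
    by (simp add: K1_def K2_def)
  also have "2 * \<dots> = C"
    unfolding sq2 csqrt_div_eleven C_def by simp
  finally show "Q11 (- 1 / s) = C * Q11 (s / 11)" .
qed

text \<open>z is the image of z' under the matrix (8 l, - (64 l l' + 1) / 11; 11, - 8 l'). The
  factor at z brings a Gauss sum, the factor at 11 z a plain inversion. \<open>Q11\<close> is of
  level 2 and meets gauss11(8 l) = - gauss11(16 l), whence its extra sign.\<close>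

lemma
  assumes s: "Im s > 0" and l: "11 dvd 64 * l * l' + 1"
  defines "z \<equiv> (- 1 / s + 8 * of_int l) / 11" and "z' \<equiv> (s + 8 * of_int l') / 11"
    and "C \<equiv> - \<i> * s / of_real (sqrt 11) * gauss11 (16 * l)"
  shows H11_S_eleven: "odd p \<or> odd r \<Longrightarrow> H11 p r z = C * H11 r (- p) z'"
    and Q11_S_eleven: "Q11 z = - C * Q11 z'"
proof -
  have eq: "11 * z = - 1 / s + of_int (8 * l)" "11 * z' = s + of_int (8 * l')" by (simp_all add: z_def z'_def)
  have th: "th3 (11 * z) = csqrt (- \<i> * s) * th3 (11 * z')" "th4 (11 * z) = csqrt (- \<i> * s) * th2 (11 * z')" "th2 (11 * z) = csqrt (- \<i> * s) * th4 (11 * z')"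
  proof -
    have th2_per: "th2 (w + of_int (8 * m)) = th2 w" for w m
    proof -
      have "theta 4 1 (w + of_int (8 * m)) = exp (\<i> * pi * of_int (2 * m)) * theta 4 1 w"
        by (subst theta_add_int) (simp_all add: mult_ac)
      then show ?thesis by (simp only: th2_eq exp_pi_i_int) simp
    qed
    show "th3 (11 * z) = csqrt (- \<i> * s) * th3 (11 * z')" "th4 (11 * z) = csqrt (- \<i> * s) * th2 (11 * z')" "th2 (11 * z) = csqrt (- \<i> * s) * th4 (11 * z')"
      unfolding eq th3_add_int th4_add_int th2_per th3_S[OF s] th4_S[OF s] th2_S[OF s] by simp_all
  qed
  have sq: "csqrt (- \<i> * s) * csqrt (- \<i> * s) = - \<i> * s" by (simp flip: power2_eq_square)
  define C' where "C' = csqrt (- \<i> * s) / of_real (sqrt 11) * gauss11 (16 * l)"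
  have C': "C = C' * csqrt (- \<i> * s)"
  proof -
    have "C' * csqrt (- \<i> * s) = (csqrt (- \<i> * s) * csqrt (- \<i> * s)) / of_real (sqrt 11) * gauss11 (16 * l)"
      by (simp add: C'_def)
    then show ?thesis by (simp only: sq C_def)
  qed
  note th' = th3_S_eleven[OF s l, folded z_def z'_def C'_def] th4_S_eleven[OF s l, folded z_def z'_def C'_def]
    th2_S_eleven[OF s l, folded z_def z'_def C'_def]
  have "P11 z = C * P11 z'" "N11 z = C * R11 z'" "R11 z = C * N11 z'"
    unfolding P11_def N11_def R11_def th th' C' by (simp_all only: ac_simps)
  then show "odd p \<or> odd r \<Longrightarrow> H11 p r z = C * H11 r (- p) z'"
    by (auto simp: H11_def)
  have "\<not> 11 dvd l"
  proof
    assume "11 dvd l"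
    then have "11 dvd 64 * l * l'" by simp
    then have "(11::int) dvd 1" using l by (metis dvd_add_right_iff)
    then show False by simp
  qed
  then have "\<not> 11 dvd 8 * l" by presburger
  then have g: "gauss11 (8 * l) = - gauss11 (16 * l)" using gauss11_double[of "8 * l"] by simp
  have t: "theta 2 0 (11 * z) = csqrt (- \<i> * s) / of_real (sqrt 2) * (theta 2 0 (11 * z') + theta 2 1 (11 * z'))"
    "theta 2 1 (11 * z) = csqrt (- \<i> * s) / of_real (sqrt 2) * (theta 2 0 (11 * z') - theta 2 1 (11 * z'))"
  proof -
    have per: "theta 2 0 (w + of_int (8 * m)) = theta 2 0 w" "theta 2 1 (w + of_int (8 * m)) = theta 2 1 w" for w m
    proof -
      show "theta 2 0 (w + of_int (8 * m)) = theta 2 0 w" by (subst theta_add_int) simp_all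
      have "theta 2 1 (w + of_int (8 * m)) = exp (\<i> * pi * of_int (4 * m)) * theta 2 1 w"
        by (subst theta_add_int) (simp_all add: mult_ac)
      then show "theta 2 1 (w + of_int (8 * m)) = theta 2 1 w" by (simp only: exp_pi_i_int) simp
    qed
    show "theta 2 0 (11 * z) = csqrt (- \<i> * s) / of_real (sqrt 2) * (theta 2 0 (11 * z') + theta 2 1 (11 * z'))"
      "theta 2 1 (11 * z) = csqrt (- \<i> * s) / of_real (sqrt 2) * (theta 2 0 (11 * z') - theta 2 1 (11 * z'))"
      unfolding eq per using theta_S[of 2 s 0] theta_S[of 2 s 1] s unfolding exp_quarter_turns ranges by simp_all
  qed
  have t': "theta 2 0 z = csqrt (- \<i> * s) / of_real (sqrt 22) * gauss11 (8 * l) * (theta 2 0 z' + theta 2 1 z')"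
    "theta 2 1 z = csqrt (- \<i> * s) / of_real (sqrt 22) * gauss11 (8 * l) * (theta 2 0 z' - theta 2 1 z')"
    using theta_S_eleven[of 2 s l l' 0] theta_S_eleven[of 2 s l l' 1] s l unfolding exp_quarter_turns ranges z_def z'_def
    by simp_all
  have "sqrt 22 = sqrt 2 * sqrt 11" by (simp flip: real_sqrt_mult)
  then have sq2: "complex_of_real (sqrt 2) * complex_of_real (sqrt 22) = 2 * of_real (sqrt 11)"
    by (simp flip: of_real_mult) (simp add: mult.assoc[symmetric])
  define K1 where "K1 = csqrt (- \<i> * s) / of_real (sqrt 22) * gauss11 (8 * l)"
  define K2 where "K2 = csqrt (- \<i> * s) / complex_of_real (sqrt 2)"
  have "Q11 z = 2 * (K1 * K2) * Q11 z'"
    unfolding Q11_def t t' K1_def[symmetric] K2_def[symmetric] by (simp add: algebra_simps)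
  also have "K1 * K2 = (csqrt (- \<i> * s) * csqrt (- \<i> * s)) * gauss11 (8 * l) / (complex_of_real (sqrt 2) * complex_of_real (sqrt 22))"
    by (simp add: K1_def K2_def mult_ac)
  also have "2 * \<dots> = - C"
  proof -
    have "2 * (a * (- G) / (2 * w)) = - (a / w * G)" for a G w :: complex by simp
    then show ?thesis unfolding sq sq2 g C_def .
  qed
  finally show "Q11 z = - C * Q11 z'" .
qed

subsection \<open>Generation of the modular group\<close>

text \<open>Right multiplication by T, its inverse and S reaches everything: the Euclidean algorithm
  on the bottom row reduces c to 0, and S applied twice is minus the identity.\<close>

lemma SL2_int_induct [case_names one T Tinv S det]:
  fixes Pr :: "int \<Rightarrow> int \<Rightarrow> int \<Rightarrow> int \<Rightarrow> bool"
  assumes one: "Pr 1 0 0 1"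
    and T: "\<And>a b c d. a * d - b * c = 1 \<Longrightarrow> Pr a b c d \<Longrightarrow> Pr a (a + b) c (c + d)"
    and Tinv: "\<And>a b c d. a * d - b * c = 1 \<Longrightarrow> Pr a b c d \<Longrightarrow> Pr a (b - a) c (d - c)"
    and S: "\<And>a b c d. a * d - b * c = 1 \<Longrightarrow> Pr a b c d \<Longrightarrow> Pr b (- a) d (- c)"
    and det: "a * d - b * c = 1"
  shows "Pr a b c d"
proof -
  have Tpow: "Pr a (b + k * a) c (d + k * c)" if "Pr a b c d" "a * d - b * c = 1" for a b c d k
  proof (induction k rule: int_induct[where k=0])
    case (step1 i)
    have "a * (d + i * c) - (b + i * a) * c = 1" using that by (simp add: algebra_simps)
    from T[OF this step1(2)] show ?case by (simp add: algebra_simps)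
  next
    case (step2 i)
    have "a * (d + i * c) - (b + i * a) * c = 1" using that by (simp add: algebra_simps)
    from Tinv[OF this step2(2)] show ?case by (simp add: algebra_simps)
  qed (use that in simp)
  have neg: "Pr (- a) (- b) (- c) (- d)" if "Pr a b c d" "a * d - b * c = 1" for a b c d
    using S[OF _ S[OF that(2,1)]] that(2) by (simp add: algebra_simps)
  show ?thesis using det
  proof (induction "nat \<bar>c\<bar>" arbitrary: a b c d rule: less_induct)
    case less
    show ?case
    proof (cases "c = 0")
      case True
      then have "a * d = 1" using less.prems by simp
      then consider "a = 1" "d = 1" | "a = - 1" "d = - 1" by (auto simp: zmult_eq_1_iff)
      then show ?thesis
      proof cases
        case 1
        then show ?thesis using Tpow[OF one, of b] True by simp
      next
        case 2
        then show ?thesis using neg[OF Tpow[OF one, of "- b"]] True by simp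
      qed
    next
      case False
      define q where "q = d div c"
      define r where "r = d mod c"
      have d: "d = r + q * c" by (simp add: q_def r_def)
      have r: "\<bar>r\<bar> < \<bar>c\<bar>" using False by (simp add: r_def abs_mod_less)
      define b' where "b' = b - q * a"
      have det': "a * r - b' * c = 1" using less.prems by (simp add: d b'_def algebra_simps)
      have "Pr b' (- a) r (- c)"
        by (rule less.hyps) (use r det' in \<open>auto simp: algebra_simps\<close>)
      moreover have "b' * (- c) - (- a) * r = 1" using det' by (simp add: algebra_simps)
      ultimately have "Pr (- a) (- b') (- c) (- r)" using S by blast
      then have "Pr (- (- a)) (- (- b')) (- (- c)) (- (- r))" by (rule neg) (use det' in simp)
      then have "Pr a (b' + q * a) c (r + q * c)" using Tpow det' by simp
      then show ?thesis by (simp add: d b'_def)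
    qed
  qed
qed

subsection \<open>The transformation of the four forms under the modular group\<close>

text \<open>If 11 does not divide c, then s = 11 s' - l, and gamma s, 11 gamma s are unimodular
  images of 11 s' and s': the two theta factors of each form exchange roles. An even l prevents an
  additional permutation of the forms.\<close>

definition cusp_rel :: "int \<Rightarrow> int \<Rightarrow> complex \<Rightarrow> complex \<Rightarrow> bool" where
  "cusp_rel c d s s' \<longleftrightarrow> (if 11 dvd c then s' = s
     else \<exists>l. even l \<and> 11 dvd c * l - d \<and> s' = (s + of_int l) / 11)"

lemma cusp_rel_exists: "\<exists>s'. cusp_rel c d s s'"
proof (cases "11 dvd c")
  case False
  have "coprime (11::int) c"
  proof -
    have "prime (11::int)" by (simp add: prime_int_numeral_eq prime_nat_numeral_eq)
    then show ?thesis using False by (simp add: prime_imp_coprime)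
  qed
  then obtain u v where uv: "u * 11 + v * c = 1" by (metis bezout_int coprime_iff_gcd_eq_1)
  define l where "l = 12 * v * d"
  have vc: "v * c = 1 - u * 11" using uv by simp
  have "c * l - d = 12 * (v * c) * d - d" by (simp add: l_def)
  also have "\<dots> = 11 * (d - 12 * u * d)" unfolding vc by (simp add: algebra_simps)
  finally have "c * l - d = 11 * (d - 12 * u * d)" .
  then have "even l \<and> 11 dvd c * l - d" by (simp add: l_def)
  then have "cusp_rel c d s ((s + of_int l) / 11)" using False unfolding cusp_rel_def by auto
  then show ?thesis by blast
qed (auto simp: cusp_rel_def)

text \<open>The sign character of SL_2(Z / 2), which is the symmetric group on three letters: the
  even elements are the identity and the two elements of odd trace.\<close>

definition sgn2 :: "int \<Rightarrow> int \<Rightarrow> int \<Rightarrow> int \<Rightarrow> complex" where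
  "sgn2 a b c d = (if even b \<and> even c \<or> odd (a + d) then 1 else - 1)"

text \<open>Records whether the theta factors at s and 11 s exchange roles, which is the case
  distinction of \<open>cusp_rel\<close>.\<close>

definition sgn11 :: "int \<Rightarrow> complex" where
  "sgn11 c = (if 11 dvd c then 1 else - 1)"

text \<open>\<open>\<kappa>\<close> is the automorphy factor and varies with s. Only ratios of the
  four forms are used later, so its mere existence is recorded instead of a multiplier
  system.\<close>

definition modular_rel :: "int \<Rightarrow> int \<Rightarrow> int \<Rightarrow> int \<Rightarrow> bool" where
  "modular_rel a b c d \<longleftrightarrow> (\<forall>s s'. Im s > 0 \<longrightarrow> cusp_rel c d s s' \<longrightarrow> (\<exists>\<kappa>.
     (\<forall>p r. odd p \<or> odd r \<longrightarrow> H11 p r (moebius a b c d s) = \<kappa> * H11 (p * a + r * c) (p * b + r * d) s') \<and>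
     Q11 (moebius a b c d s) = \<kappa> * sgn2 a b c d * sgn11 c * Q11 s'))"

lemma modular_relD:
  assumes "modular_rel a b c d" "Im s > 0" "cusp_rel c d s s'"
  obtains \<kappa> where "\<And>p r. odd p \<or> odd r \<Longrightarrow> H11 p r (moebius a b c d s) = \<kappa> * H11 (p * a + r * c) (p * b + r * d) s'"
    "Q11 (moebius a b c d s) = \<kappa> * sgn2 a b c d * sgn11 c * Q11 s'"
  using assms unfolding modular_rel_def by blast

lemma det_parity:
  fixes a b c d :: int
  assumes det: "a * d - b * c = 1" and pr: "odd p \<or> odd r"
  shows "odd (p * a + r * c) \<or> odd (p * b + r * d)"
proof -
  have "odd (a * d - b * c)" using det by simp
  then show ?thesis using pr
    by (cases "even a"; cases "even b"; cases "even c"; cases "even d") auto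
qed

lemma modular_rel_shift:
  assumes det: "a * d - b * c = 1" and rel: "modular_rel a b c d" and k: "k = 1 \<or> k = - 1"
  shows "modular_rel a (b + k * a) c (d + k * c)"
  unfolding modular_rel_def
proof (intro allI impI)
  fix s s' assume s: "Im s > 0" and cr: "cusp_rel c (d + k * c) s s'"
  have odd_k: "odd k" using k by auto
  have sk: "Im (s + of_int k) > 0" using s by simp
  have m: "moebius a (b + k * a) c (d + k * c) s = moebius a b c d (s + of_int k)"
    by (simp add: moebius_def algebra_simps)
  have sg: "sgn2 a (b + k * a) c (d + k * c) = - sgn2 a b c d"
  proof -
    have "odd (a * d - b * c)" using det by simp
    then show ?thesis using k
      by (cases "even a"; cases "even b"; cases "even c"; cases "even d") (auto simp: sgn2_def)
  qed
  \<comment> \<open>Shifting s by k must shift s' by an odd integer. If 11 does not divide c, the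
    even number l + 10 k does this, because s + k + (l + 10 k) = s + l + 11 k.\<close>
  obtain s'' j where s'': "cusp_rel c d (s + of_int k) s''" "s'' = s' + of_int j" "odd j"
  proof (cases "11 dvd c")
    case True
    then show ?thesis using that[of "s + of_int k" k] cr odd_k by (simp add: cusp_rel_def)
  next
    case False
    then obtain l where l: "even l" "11 dvd c * l - (d + k * c)" "s' = (s + of_int l) / 11"
      using cr by (auto simp: cusp_rel_def)
    have "c * (l + 10 * k) - d = c * l - (d + k * c) + 11 * (c * k)" by (simp add: algebra_simps)
    moreover have "11 dvd c * l - (d + k * c) + 11 * (c * k)" by (intro dvd_add l(2)) simp
    ultimately have "11 dvd c * (l + 10 * k) - d" by presburger
    moreover have "even (l + 10 * k)" using l(1) by simp
    moreover have "(s + of_int k + of_int (l + 10 * k)) / 11 = s' + of_int k" by (simp add: l(3) field_simps)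
    ultimately have "cusp_rel c d (s + of_int k) (s' + of_int k)" using False unfolding cusp_rel_def by metis
    then show ?thesis using that odd_k by blast
  qed
  obtain \<kappa> where \<kappa>: "\<And>p r. odd p \<or> odd r \<Longrightarrow> H11 p r (moebius a b c d (s + of_int k)) = \<kappa> * H11 (p * a + r * c) (p * b + r * d) s''"
    "Q11 (moebius a b c d (s + of_int k)) = \<kappa> * sgn2 a b c d * sgn11 c * Q11 s''"
    using modular_relD[OF rel sk s''(1)] by blast
  show "\<exists>\<kappa>. (\<forall>p r. odd p \<or> odd r \<longrightarrow> H11 p r (moebius a (b + k * a) c (d + k * c) s) = \<kappa> * H11 (p * a + r * c) (p * (b + k * a) + r * (d + k * c)) s') \<and>
     Q11 (moebius a (b + k * a) c (d + k * c) s) = \<kappa> * sgn2 a (b + k * a) c (d + k * c) * sgn11 c * Q11 s'"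
  proof (intro exI[of _ "- \<kappa>"] conjI allI impI)
    fix p r :: int assume pr: "odd p \<or> odd r"
    have "H11 (p * a + r * c) (p * b + r * d) s'' = - H11 (p * a + r * c) ((p * a + r * c) * j + (p * b + r * d)) s'"
      using H11_add_int[OF det_parity[OF det pr]] s''(2,3) by simp
    also have "H11 (p * a + r * c) ((p * a + r * c) * j + (p * b + r * d)) = H11 (p * a + r * c) (p * (b + k * a) + r * (d + k * c))"
    proof (rule H11_cong)
      have "(p * a + r * c) * j + (p * b + r * d) - (p * (b + k * a) + r * (d + k * c)) = (p * a + r * c) * (j - k)"
        by (simp add: algebra_simps)
      then show "even ((p * a + r * c) * j + (p * b + r * d) - (p * (b + k * a) + r * (d + k * c)))"
        using s''(3) odd_k by simp
    qed simp
    finally show "H11 p r (moebius a (b + k * a) c (d + k * c) s) = - \<kappa> * H11 (p * a + r * c) (p * (b + k * a) + r * (d + k * c)) s'"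
      unfolding m using \<kappa>(1)[OF pr] by simp
  next
    show "Q11 (moebius a (b + k * a) c (d + k * c) s) = - \<kappa> * sgn2 a (b + k * a) c (d + k * c) * sgn11 c * Q11 s'"
      unfolding m sg using \<kappa>(2) s''(2) by (simp add: Q11_add_int)
  qed
qed

lemma H11_add_even: "even k \<Longrightarrow> H11 p r (s + of_int k) = H11 p r s"
  by (simp add: H11_def P11_add_int N11_add_int R11_add_int)

lemma modular_rel_S:
  assumes det: "a * d - b * c = 1" and rel: "modular_rel a b c d"
  shows "modular_rel b (- a) d (- c)"
  unfolding modular_rel_def
proof (intro allI impI)
  fix s s' assume s: "Im s > 0" and cr: "cusp_rel d (- c) s s'"
  have s0: "s \<noteq> 0" using s by auto
  have sS: "Im (- 1 / s) > 0" by (rule Im_minus_inverse_pos[OF s])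
  have m: "moebius b (- a) d (- c) s = moebius a b c d (- 1 / s)"
  proof -
    have eq: "x * (- 1 / s) + y = (y * s + - x) / s" for x y using s0 by (simp add: field_simps)
    have "moebius a b c d (- 1 / s) = ((of_int b * s + - of_int a) / s) / ((of_int d * s + - of_int c) / s)"
      unfolding moebius_def of_real_of_int_eq eq ..
    then show ?thesis using s0 by (simp add: moebius_def)
  qed
  have sg: "sgn2 b (- a) d (- c) = - sgn2 a b c d"
  proof -
    have "odd (a * d - b * c)" using det by simp
    then show ?thesis by (cases "even a"; cases "even b"; cases "even c"; cases "even d") (simp_all add: sgn2_def)
  qed
  \<comment> \<open>Three cases: 11 divides c (inversion at s), 11 divides d (inversion at 11 s), or
    neither (Gauss sums). Only the last has \<open>\<epsilon>\<close> = -1, which makes up for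
    \<open>sgn11\<close> taking the same value at c and d.\<close>
  have key: "\<exists>s'' C \<epsilon>. cusp_rel c d (- 1 / s) s'' \<and> \<epsilon> * sgn11 c = - sgn11 d \<and>
      (\<forall>p r. odd p \<or> odd r \<longrightarrow> H11 p r s'' = C * H11 r (- p) s') \<and> Q11 s'' = \<epsilon> * C * Q11 s'"
  proof (cases "11 dvd c")
    case c: True
    have nd: "\<not> 11 dvd d"
    proof
      assume "11 dvd d"
      then have "11 dvd a * d - b * c" using c by simp
      then show False using det by simp
    qed
    then obtain l where l: "even l" "11 dvd d * l - (- c)" "s' = (s + of_int l) / 11"
      using cr by (auto simp: cusp_rel_def)
    have "11 dvd d * l" using l(2) c by (simp add: dvd_add_left_iff)
    moreover have "prime (11::int)" by (simp add: prime_int_numeral_eq prime_nat_numeral_eq)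
    ultimately have "11 dvd l" using nd by (simp add: prime_dvd_mult_iff)
    then obtain k where k: "l = 11 * k" by blast
    then have ek: "even k" and s': "s' = s / 11 + of_int k" using l by (auto simp: field_simps)
    have "H11 p r (- 1 / s) = (- \<i> * s / of_real (sqrt 11)) * H11 r (- p) s'" if "odd p \<or> odd r" for p r
      unfolding s' H11_add_even[OF ek] by (rule H11_Fricke[OF s that])
    moreover have "Q11 (- 1 / s) = 1 * (- \<i> * s / of_real (sqrt 11)) * Q11 s'"
      unfolding s' Q11_add_int using Q11_Fricke[OF s] by simp
    moreover have "cusp_rel c d (- 1 / s) (- 1 / s)" using c by (simp add: cusp_rel_def)
    moreover have "1 * sgn11 c = - sgn11 d" using c nd by (simp add: sgn11_def)
    ultimately show ?thesis by blast
  next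
    case c: False
    show ?thesis
    proof (cases "11 dvd d")
      case d: True
      then have s': "s' = s" using cr by (simp add: cusp_rel_def)
      have s11: "Im (11 * s) > 0" using s by simp
      have eq: "- 1 / (11 * s) = (- 1 / s + of_int 0) / 11" using s0 by (simp add: field_simps)
      have "cusp_rel c d (- 1 / s) (- 1 / (11 * s))" unfolding cusp_rel_def eq using c d by (auto intro!: exI[of _ 0])
      moreover have "H11 p r (- 1 / (11 * s)) = (- \<i> * (11 * s) / of_real (sqrt 11)) * H11 r (- p) s'" if "odd p \<or> odd r" for p r
        using H11_Fricke[OF s11 that] by (simp add: s')
      moreover have "Q11 (- 1 / (11 * s)) = 1 * (- \<i> * (11 * s) / of_real (sqrt 11)) * Q11 s'"
        using Q11_Fricke[OF s11] by (simp add: s')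
      moreover have "1 * sgn11 c = - sgn11 d" using c d by (simp add: sgn11_def)
      ultimately show ?thesis by blast
    next
      case d: False
      then obtain l where l: "even l" "11 dvd d * l - (- c)" "s' = (s + of_int l) / 11"
        using cr by (auto simp: cusp_rel_def)
      have p11: "prime (11::int)" by (simp add: prime_int_numeral_eq prime_nat_numeral_eq)
      have "\<not> 11 dvd l"
      proof
        assume "11 dvd l"
        then have "11 dvd d * l" by simp
        moreover have "11 dvd d * l + c" using l(2) by simp
        ultimately have "11 dvd c" by (simp only: dvd_add_right_iff)
        then show False using c by simp
      qed
      then have "coprime 11 l" using p11 by (simp add: prime_imp_coprime)
      then obtain u m where um: "u * 11 + m * l = 1" by (metis bezout_int coprime_iff_gcd_eq_1)
      \<comment> \<open>7 is the inverse of 8 modulo 11 and m that of l. So modulo 11 one has 8 n' =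
        l and 64 n n' = -1, and 8 n c = d because c = - d l.\<close>
      define n where "n = - 7 * m"
      define n' where "n' = 7 * l"
      have ml: "m * l = 1 - 11 * u" using um by simp
      have nn: "11 dvd 64 * n * n' + 1"
      proof -
        have "64 * n * n' + 1 = 1 - 3136 * (m * l)" by (simp add: n_def n'_def)
        also have "\<dots> = 11 * (3136 * u - 285)" unfolding ml by simp
        finally show ?thesis by (simp only: dvd_triv_left)
      qed
      have cn: "11 dvd c * (8 * n) - d"
      proof -
        obtain w where w: "d * l + c = 11 * w" using l(2) by auto
        then have cw: "c = 11 * w - d * l" by simp
        have "c * (8 * n) - d = (11 * w - d * l) * (8 * n) - d" by (subst cw) (rule refl)
        also have "\<dots> = - 56 * 11 * w * m + 56 * d * (m * l) - d" by (simp add: n_def algebra_simps)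
        also have "\<dots> = 11 * (- 56 * w * m + 5 * d - 56 * d * u)" unfolding ml by (simp add: algebra_simps)
        finally show ?thesis by simp
      qed
      define z where "z = (- 1 / s + 8 * of_int n) / 11"
      have "even (8 * n) \<and> 11 dvd c * (8 * n) - d \<and> z = (- 1 / s + of_int (8 * n)) / 11"
        using cn by (simp add: z_def)
      then have 1: "cusp_rel c d (- 1 / s) z" unfolding cusp_rel_def if_not_P[OF c] by blast
      have z': "(s + 8 * of_int n') / 11 = s' + of_int (5 * l)" by (simp add: l(3) n'_def field_simps)
      have e5: "even (5 * l)" using l(1) by simp
      define C where "C = - \<i> * s / of_real (sqrt 11) * gauss11 (16 * n)"
      have 2: "H11 p r z = C * H11 r (- p) s'" if "odd p \<or> odd r" for p r
        using H11_S_eleven[OF s nn that] unfolding z' H11_add_even[OF e5] by (simp add: z_def C_def)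
      have 3: "Q11 z = (- 1) * C * Q11 s'"
        using Q11_S_eleven[OF s nn] unfolding z' Q11_add_int by (simp add: z_def C_def)
      have 4: "- 1 * sgn11 c = - sgn11 d" using c d by (simp add: sgn11_def)
      show ?thesis using 1 2 3 4 by blast
    qed
  qed
  then obtain s'' C \<epsilon> where k: "cusp_rel c d (- 1 / s) s''" "\<epsilon> * sgn11 c = - sgn11 d"
      "\<And>p r. odd p \<or> odd r \<Longrightarrow> H11 p r s'' = C * H11 r (- p) s'" "Q11 s'' = \<epsilon> * C * Q11 s'" by blast
  obtain \<kappa> where \<kappa>: "\<And>p r. odd p \<or> odd r \<Longrightarrow> H11 p r (moebius a b c d (- 1 / s)) = \<kappa> * H11 (p * a + r * c) (p * b + r * d) s''"
    "Q11 (moebius a b c d (- 1 / s)) = \<kappa> * sgn2 a b c d * sgn11 c * Q11 s''"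
    using modular_relD[OF rel sS k(1)] by blast
  show "\<exists>\<kappa>. (\<forall>p r. odd p \<or> odd r \<longrightarrow> H11 p r (moebius b (- a) d (- c) s) = \<kappa> * H11 (p * b + r * d) (p * (- a) + r * (- c)) s') \<and>
     Q11 (moebius b (- a) d (- c) s) = \<kappa> * sgn2 b (- a) d (- c) * sgn11 d * Q11 s'"
  proof (intro exI[of _ "\<kappa> * C"] conjI allI impI)
    fix p r :: int assume pr: "odd p \<or> odd r"
    have "H11 (p * a + r * c) (p * b + r * d) s'' = C * H11 (p * b + r * d) (- (p * a + r * c)) s'"
      by (rule k(3)[OF det_parity[OF det pr]])
    also have "- (p * a + r * c) = p * (- a) + r * (- c)" by simp
    finally show "H11 p r (moebius b (- a) d (- c) s) = \<kappa> * C * H11 (p * b + r * d) (p * (- a) + r * (- c)) s'"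
      unfolding m using \<kappa>(1)[OF pr] by simp
  next
    have "\<kappa> * sgn2 a b c d * sgn11 c * Q11 s'' = \<kappa> * C * (sgn2 a b c d * (\<epsilon> * sgn11 c)) * Q11 s'"
      unfolding k(4) by simp
    also have "\<dots> = \<kappa> * C * sgn2 b (- a) d (- c) * sgn11 d * Q11 s'"
      unfolding k(2) sg by simp
    finally show "Q11 (moebius b (- a) d (- c) s) = \<kappa> * C * sgn2 b (- a) d (- c) * sgn11 d * Q11 s'"
      unfolding m using \<kappa>(2) by simp
  qed
qed

theorem modular_rel:
  assumes "a * d - b * c = 1"
  shows "modular_rel a b c d"
proof (induction a b c d rule: SL2_int_induct)
  case one
  show ?case unfolding modular_rel_def
    by (auto simp: cusp_rel_def moebius_def sgn2_def sgn11_def intro!: exI[of _ 1])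
next
  case (T a b c d)
  then show ?case using modular_rel_shift[of a d b c 1] by (simp add: add.commute[of a b] add.commute[of c d])
next
  case (Tinv a b c d)
  then show ?case using modular_rel_shift[of a d b c "-1"] by simp
next
  case (S a b c d)
  then show ?case by (rule modular_rel_S)
next
  case det
  then show ?case using assms by simp
qed

section \<open>Meromorphic functions on the upper half plane\<close>

lemma holomorphic_imp_meromorphic_uhp: "\<phi> holomorphic_on upper_half_plane \<Longrightarrow> \<phi> meromorphic_on upper_half_plane"
  by (simp add: analytic_on_imp_meromorphic_on analytic_on_open open_upper_half_plane)

lemma mero_eq_refl: "\<phi> meromorphic_on upper_half_plane \<Longrightarrow> mero_eq \<phi> \<phi>"
  by (simp add: mero_eq_def)

lemma mero_uhp_cases:
  obtains \<phi> where "\<phi> meromorphic_on upper_half_plane" "f = abs_mero_uhp \<phi>"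
proof -
  have "mero_eq (rep_mero_uhp f) (rep_mero_uhp f)" "abs_mero_uhp (rep_mero_uhp f) = f"
    by (rule Quotient3_rep_reflp[OF Quotient3_mero_uhp], rule Quotient3_abs_rep[OF Quotient3_mero_uhp])
  then show ?thesis using that unfolding mero_eq_def by metis
qed

lemma mero_uhp_eq_iff:
  assumes "\<phi> meromorphic_on upper_half_plane" "\<psi> meromorphic_on upper_half_plane"
  shows "abs_mero_uhp \<phi> = abs_mero_uhp \<psi> \<longleftrightarrow> (\<forall>z. Im z > 0 \<longrightarrow> (\<forall>\<^sub>F w in at z. \<phi> w = \<psi> w))"
proof -
  have "abs_mero_uhp \<phi> = abs_mero_uhp \<psi> \<longleftrightarrow> mero_eq \<phi> \<psi>"
    using Quotient3_rel[OF Quotient3_mero_uhp, of \<phi> \<psi>] mero_eq_refl assms by blast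
  then show ?thesis
    using assms by (simp add: mero_eq_def eventually_cosparse_open_eq[OF open_upper_half_plane])
qed

lemma
  assumes "\<phi> meromorphic_on upper_half_plane" "\<psi> meromorphic_on upper_half_plane"
  shows mero_uhp_add: "abs_mero_uhp \<phi> + abs_mero_uhp \<psi> = abs_mero_uhp (\<lambda>z. \<phi> z + \<psi> z)"
    and mero_uhp_diff: "abs_mero_uhp \<phi> - abs_mero_uhp \<psi> = abs_mero_uhp (\<lambda>z. \<phi> z - \<psi> z)"
    and mero_uhp_mult: "abs_mero_uhp \<phi> * abs_mero_uhp \<psi> = abs_mero_uhp (\<lambda>z. \<phi> z * \<psi> z)"
  using assms by (simp_all add: plus_mero_uhp.abs_eq minus_mero_uhp.abs_eq times_mero_uhp.abs_eq mero_eq_refl)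

lemma
  assumes "\<phi> meromorphic_on upper_half_plane"
  shows mero_uhp_inverse: "inverse (abs_mero_uhp \<phi>) = abs_mero_uhp (\<lambda>z. inverse (\<phi> z))"
    and mero_uhp_pullback: "a * d - b * c > 0 \<Longrightarrow> pullback a b c d (abs_mero_uhp \<phi>) = abs_mero_uhp (\<lambda>z. \<phi> (moebius a b c d z))"
  using assms by (simp_all add: inverse_mero_uhp.abs_eq pullback.abs_eq mero_eq_refl)

definition cst :: "complex \<Rightarrow> mero_uhp" where "cst k = abs_mero_uhp (\<lambda>_. k)"

lemma cst_0 [simp]: "cst 0 = 0" and cst_1 [simp]: "cst 1 = 1"
  by (simp_all add: cst_def zero_mero_uhp_def one_mero_uhp_def)

lemma cst_add: "cst (a + b) = cst a + cst b" and cst_mult: "cst (a * b) = cst a * cst b"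
  by (simp_all add: cst_def mero_uhp_add mero_uhp_mult meromorphic_on_const)

lemma cst_uminus: "cst (- a) = - cst a"
  using cst_add[of a "- a"] by (simp add: eq_neg_iff_add_eq_0 add.commute)

lemma cst_diff: "cst (a - b) = cst a - cst b"
  using cst_add[of a "- b"] by (simp add: cst_uminus)

lemma cst_eq_iff [simp]: "cst a = cst b \<longleftrightarrow> a = b"
proof
  assume "cst a = cst b"
  then have "\<forall>z. Im z > 0 \<longrightarrow> (\<forall>\<^sub>F w in at z. a = b)"
    unfolding cst_def by (subst (asm) mero_uhp_eq_iff) (rule meromorphic_on_const)+
  then have "\<forall>\<^sub>F w in at \<i>. a = b" by (rule allE[of _ \<i>]) simp
  then show "a = b" by simp
qed simp

lemma cst_eq_0_iff [simp]: "cst a = 0 \<longleftrightarrow> a = 0"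
  using cst_eq_iff[of a 0] by simp

lemma cst_inverse: "cst (inverse a) = inverse (cst a)"
proof (cases "a = 0")
  case False
  have "cst (inverse a) * cst a = 1" using False by (simp flip: cst_mult)
  then show ?thesis using inverse_unique[of "cst a" "cst (inverse a)"] by (simp add: mult.commute)
qed simp

lemma cst_of_nat: "cst (of_nat n) = of_nat n"
  by (induction n) (simp_all add: cst_add)

lemma cst_of_int: "cst (of_int n) = of_int n"
  by (cases n) (simp_all add: cst_of_nat cst_uminus cst_diff)

lemma cst_of_rat: "cst (of_rat r) = of_rat r"
proof (cases r)
  case (Fract a b)
  then show ?thesis
    by (simp add: of_rat_rat cst_mult cst_of_int divide_inverse cst_inverse)
qed

lemma cst_numeral [simp]: "cst (numeral n) = numeral n"
  using cst_of_nat[of "numeral n"] by simp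

subsection \<open>Regular functions\<close>

definition regular :: "mero_uhp \<Rightarrow> bool" where
  "regular f \<longleftrightarrow> (\<exists>\<phi>. \<phi> holomorphic_on upper_half_plane \<and> f = abs_mero_uhp \<phi>)"

lemma holomorphic_uhp_eqI:
  assumes "\<phi> holomorphic_on upper_half_plane" "\<psi> holomorphic_on upper_half_plane"
    "abs_mero_uhp \<phi> = abs_mero_uhp \<psi>" "Im z > 0"
  shows "\<phi> z = \<psi> z"
proof -
  have "\<forall>\<^sub>F w in at z. \<phi> w = \<psi> w"
    using assms mero_uhp_eq_iff holomorphic_imp_meromorphic_uhp by blast
  moreover have "isCont \<phi> z" "isCont \<psi> z"
    using assms holomorphic_on_imp_continuous_on continuous_on_eq_continuous_at[OF open_upper_half_plane] by blast+
  ultimately have "(\<psi> \<longlongrightarrow> \<phi> z) (at z)" "(\<psi> \<longlongrightarrow> \<psi> z) (at z)"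
    by (auto simp: isCont_def dest: Lim_transform_eventually)
  then show ?thesis using tendsto_unique[OF trivial_limit_at] by blast
qed

lemma regular_cst: "regular (cst k)"
  unfolding regular_def cst_def by (intro exI[of _ "\<lambda>_. k"]) auto

lemma
  assumes "regular f" "regular g"
  shows regular_add: "regular (f + g)"
proof -
  obtain \<phi> \<psi> where *: "\<phi> holomorphic_on upper_half_plane" "f = abs_mero_uhp \<phi>"
    "\<psi> holomorphic_on upper_half_plane" "g = abs_mero_uhp \<psi>" using assms unfolding regular_def by blast
  note m = *(1,3)[THEN holomorphic_imp_meromorphic_uhp]
  show ?thesis
    unfolding *(2,4) regular_def mero_uhp_add[OF m]
    by (rule exI, rule conjI[OF _ refl], intro holomorphic_intros *)
qed

lemma moebius_holomorphic:
  assumes "a * d - b * c > 0"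
  shows "moebius a b c d holomorphic_on upper_half_plane"
  using moebius_analytic[OF assms] by (simp add: analytic_on_open open_upper_half_plane)

lemma holomorphic_moebius:
  assumes "a * d - b * c > 0" "\<phi> holomorphic_on upper_half_plane"
  shows "(\<lambda>z. \<phi> (moebius a b c d z)) holomorphic_on upper_half_plane"
  by (rule holomorphic_on_compose_gen[OF moebius_holomorphic[OF assms(1)] assms(2), unfolded o_def])
     (use Im_moebius_pos[OF assms(1)] in auto)

lemma regular_pullback:
  assumes "a * d - b * c > 0" "regular f"
  shows "regular (pullback a b c d f)"
proof -
  obtain \<phi> where \<phi>: "\<phi> holomorphic_on upper_half_plane" "f = abs_mero_uhp \<phi>"
    using assms(2) unfolding regular_def by blast
  show ?thesis
    unfolding \<phi>(2) mero_uhp_pullback[OF holomorphic_imp_meromorphic_uhp[OF \<phi>(1)] assms(1)] regular_def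
    using holomorphic_moebius[OF assms(1) \<phi>(1)] by blast
qed

lemma pullback_hom:
  assumes "a * d - b * c > 0"
  shows "pullback a b c d (f + g) = pullback a b c d f + pullback a b c d g"
    and "pullback a b c d (f - g) = pullback a b c d f - pullback a b c d g"
    and "pullback a b c d (f * g) = pullback a b c d f * pullback a b c d g"
    and "pullback a b c d (inverse f) = inverse (pullback a b c d f)"
    and "pullback a b c d (cst k) = cst k"
proof -
  obtain \<phi> where f: "\<phi> meromorphic_on upper_half_plane" "f = abs_mero_uhp \<phi>" by (rule mero_uhp_cases)
  obtain \<psi> where g: "\<psi> meromorphic_on upper_half_plane" "g = abs_mero_uhp \<psi>" by (rule mero_uhp_cases)
  note m = meromorphic_on_moebius[OF assms f(1)] meromorphic_on_moebius[OF assms g(1)]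
  note pb = mero_uhp_pullback[OF _ assms]
  show "pullback a b c d (f + g) = pullback a b c d f + pullback a b c d g"
    unfolding f(2) g(2) mero_uhp_add[OF f(1) g(1)] pb[OF f(1)] pb[OF g(1)] mero_uhp_add[OF m]
    by (rule pb) (intro meromorphic_intros f g)
  show "pullback a b c d (f - g) = pullback a b c d f - pullback a b c d g"
    unfolding f(2) g(2) mero_uhp_diff[OF f(1) g(1)] pb[OF f(1)] pb[OF g(1)] mero_uhp_diff[OF m]
    by (rule pb) (intro meromorphic_intros f g)
  show "pullback a b c d (f * g) = pullback a b c d f * pullback a b c d g"
    unfolding f(2) g(2) mero_uhp_mult[OF f(1) g(1)] pb[OF f(1)] pb[OF g(1)] mero_uhp_mult[OF m]
    by (rule pb) (intro meromorphic_intros f g)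
  show "pullback a b c d (inverse f) = inverse (pullback a b c d f)"
    unfolding f(2) mero_uhp_inverse[OF f(1)] pb[OF f(1)] mero_uhp_inverse[OF m(1)]
    by (rule pb) (intro meromorphic_intros f)
  show "pullback a b c d (cst k) = cst k"
    unfolding cst_def by (rule pb) (rule meromorphic_on_const)
qed

subsection \<open>Expansions at the cusp infinity\<close>

definition nome :: "nat \<Rightarrow> complex \<Rightarrow> complex" where
  "nome h z = exp (2 * of_real pi * \<i> * z / of_nat h)"

lemma norm_nome: "norm (nome h z) = exp (- 2 * pi * Im z / h)"
proof -
  have "2 * of_real pi * \<i> * z / of_nat h = of_real (2 * pi / h) * (\<i> * z)" by simp
  then have "Re (2 * of_real pi * \<i> * z / of_nat h) = - (2 * pi / h) * Im z" by simp
  then show ?thesis by (simp add: nome_def norm_exp_eq_Re)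
qed

lemma nome_nonzero [simp]: "nome h z \<noteq> 0"
  by (simp add: nome_def)

lemma nome_holomorphic [holomorphic_intros]: "nome h holomorphic_on A"
  unfolding nome_def by (cases "h = 0") (auto intro!: holomorphic_intros)

lemma nome_eventually:
  assumes "eventually P (at 0)" "h > 0"
  shows "\<exists>c\<ge>0. \<forall>z. Im z > c \<longrightarrow> P (nome h z)"
proof -
  obtain e where e: "e > 0" "\<And>q. q \<noteq> 0 \<Longrightarrow> norm q < e \<Longrightarrow> P q"
    using assms(1) by (auto simp: eventually_at dist_norm)
  define c where "c = max 0 (- ln e * h / (2 * pi))"
  have "P (nome h z)" if "Im z > c" for z
  proof (rule e(2))
    have "Im z > - ln e * h / (2 * pi)" using that by (simp add: c_def)
    then have "- 2 * pi * Im z / h < ln e" using assms(2) by (simp add: field_simps)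
    then have "exp (- 2 * pi * Im z / h) < e" using e(1) by (metis exp_less_cancel_iff exp_ln)
    then show "norm (nome h z) < e" by (simp add: norm_nome)
  qed simp
  then show ?thesis by (intro exI[of _ c]) (auto simp: c_def)
qed

lemma open_Im_gt: "open {z. Im z > c}"
  by (rule open_halfspace_Im_gt)

text \<open>A Laurent expansion only sees the germ at 0, so any function G with expansion F may
  replace the evaluated series; sums, products and inverses are then inherited from Laurent
  expansions.\<close>

lemma has_q_expansion_altdef:
  assumes "\<phi> meromorphic_on upper_half_plane" "h > 0"
  shows "has_q_expansion h (abs_mero_uhp \<phi>) F \<longleftrightarrow>
    (\<exists>G. G has_laurent_expansion F \<and> (\<exists>c\<ge>0. \<forall>z. Im z > c \<longrightarrow> (\<forall>\<^sub>F w in at z. \<phi> w = G (nome h w))))"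
proof -
  have "has_q_expansion h (abs_mero_uhp \<phi>) F \<longleftrightarrow> fls_conv_radius F > 0 \<and>
     (\<exists>c\<ge>0. \<forall>z. Im z > c \<longrightarrow> (\<forall>\<^sub>F w in at z. \<phi> w = eval_fls F (nome h w)))"
    using assms by (simp add: has_q_expansion.abs_eq[OF mero_eq_refl] nome_def
        eventually_cosparse_open_eq[OF open_Im_gt])
  also have "\<dots> \<longleftrightarrow> (\<exists>G. G has_laurent_expansion F \<and> (\<exists>c\<ge>0. \<forall>z. Im z > c \<longrightarrow> (\<forall>\<^sub>F w in at z. \<phi> w = G (nome h w))))"
  proof safe
    fix c assume "fls_conv_radius F > 0" "c \<ge> 0" "\<forall>z. Im z > c \<longrightarrow> (\<forall>\<^sub>F w in at z. \<phi> w = eval_fls F (nome h w))"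
    then show "\<exists>G. G has_laurent_expansion F \<and> (\<exists>c\<ge>0. \<forall>z. Im z > c \<longrightarrow> (\<forall>\<^sub>F w in at z. \<phi> w = G (nome h w)))"
      by (intro exI[of _ "eval_fls F"] conjI exI[of _ c]) (simp_all add: has_laurent_expansion_def)
  next
    fix G c assume G: "G has_laurent_expansion F" and c: "c \<ge> 0" "\<forall>z. Im z > c \<longrightarrow> (\<forall>\<^sub>F w in at z. \<phi> w = G (nome h w))"
    have "eventually (\<lambda>z. eval_fls F z = G z) (at 0)" using G by (simp add: has_laurent_expansion_def)
    from nome_eventually[OF this assms(2)] obtain c' where c': "c' \<ge> 0" "\<And>z. Im z > c' \<Longrightarrow> eval_fls F (nome h z) = G (nome h z)"
      by blast
    have "\<forall>\<^sub>F w in at z. \<phi> w = eval_fls F (nome h w)" if "Im z > max c c'" for z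
    proof -
      have "\<forall>\<^sub>F w in at z. w \<in> {w. Im w > c'}"
        by (rule eventually_at_in_open') (use that open_Im_gt in auto)
      moreover have "\<forall>\<^sub>F w in at z. \<phi> w = G (nome h w)" using c(2) that by auto
      ultimately show ?thesis by eventually_elim (use c'(2) in auto)
    qed
    then show "\<exists>c\<ge>0. \<forall>z. Im z > c \<longrightarrow> (\<forall>\<^sub>F w in at z. \<phi> w = eval_fls F (nome h w))"
      using c(1) by (intro exI[of _ "max c c'"]) auto
    show "fls_conv_radius F > 0" using G by (simp add: has_laurent_expansion_def)
  qed
  finally show ?thesis .
qed

lemma has_q_expansionE:
  assumes "has_q_expansion h (abs_mero_uhp \<phi>) F" "\<phi> meromorphic_on upper_half_plane" "h > 0"
  obtains G c where "G has_laurent_expansion F" "c \<ge> 0" "\<And>z. Im z > c \<Longrightarrow> \<forall>\<^sub>F w in at z. \<phi> w = G (nome h w)"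
  using assms(1) unfolding has_q_expansion_altdef[OF assms(2,3)] by blast

lemma
  assumes "has_q_expansion h f F" "has_q_expansion h g G" "h > 0"
  shows has_q_expansion_add: "has_q_expansion h (f + g) (F + G)"
    and has_q_expansion_mult: "has_q_expansion h (f * g) (F * G)"
proof -
  obtain \<phi> where f: "\<phi> meromorphic_on upper_half_plane" "f = abs_mero_uhp \<phi>" by (rule mero_uhp_cases)
  obtain \<psi> where g: "\<psi> meromorphic_on upper_half_plane" "g = abs_mero_uhp \<psi>" by (rule mero_uhp_cases)
  obtain A c where A: "A has_laurent_expansion F" "c \<ge> 0" "\<And>z. Im z > c \<Longrightarrow> \<forall>\<^sub>F w in at z. \<phi> w = A (nome h w)"
    using has_q_expansionE[OF assms(1)[unfolded f(2)] f(1) assms(3)] by blast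
  obtain B d where B: "B has_laurent_expansion G" "d \<ge> 0" "\<And>z. Im z > d \<Longrightarrow> \<forall>\<^sub>F w in at z. \<psi> w = B (nome h w)"
    using has_q_expansionE[OF assms(2)[unfolded g(2)] g(1) assms(3)] by blast
  have ev: "\<forall>\<^sub>F w in at z. \<phi> w + \<psi> w = A (nome h w) + B (nome h w)"
     "\<forall>\<^sub>F w in at z. \<phi> w * \<psi> w = A (nome h w) * B (nome h w)" if "Im z > max c d" for z
    using A(3)[of z] B(3)[of z] that by (auto elim: eventually_elim2)
  show "has_q_expansion h (f + g) (F + G)"
    unfolding f(2) g(2) mero_uhp_add[OF f(1) g(1)]
    by (subst has_q_expansion_altdef, intro meromorphic_intros f g, rule assms(3),
        intro exI[of _ "\<lambda>q. A q + B q"] conjI has_laurent_expansion_add A(1) B(1) exI[of _ "max c d"] allI impI ev)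
       (use A(2) B(2) in auto)
  show "has_q_expansion h (f * g) (F * G)"
    unfolding f(2) g(2) mero_uhp_mult[OF f(1) g(1)]
    by (subst has_q_expansion_altdef, intro meromorphic_intros f g, rule assms(3),
        intro exI[of _ "\<lambda>q. A q * B q"] conjI has_laurent_expansion_mult A(1) B(1) exI[of _ "max c d"] allI impI ev)
       (use A(2) B(2) in auto)
qed

lemma has_q_expansion_inverse:
  assumes "has_q_expansion h f F" "h > 0"
  shows "has_q_expansion h (inverse f) (inverse F)"
proof -
  obtain \<phi> where f: "\<phi> meromorphic_on upper_half_plane" "f = abs_mero_uhp \<phi>" by (rule mero_uhp_cases)
  obtain A c where A: "A has_laurent_expansion F" "c \<ge> 0" "\<And>z. Im z > c \<Longrightarrow> \<forall>\<^sub>F w in at z. \<phi> w = A (nome h w)"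
    using has_q_expansionE[OF assms(1)[unfolded f(2)] f(1) assms(2)] by blast
  have ev: "\<forall>\<^sub>F w in at z. inverse (\<phi> w) = inverse (A (nome h w))" if "Im z > c" for z
    using A(3)[OF that] by eventually_elim simp
  show ?thesis
    unfolding f(2) mero_uhp_inverse[OF f(1)]
    by (subst has_q_expansion_altdef, intro meromorphic_intros f, rule assms(2),
        intro exI[of _ "\<lambda>q. inverse (A q)"] conjI has_laurent_expansion_inverse A(1) exI[of _ c] allI impI ev)
       (use A(2) in auto)
qed

lemma has_q_expansion_cst: "h > 0 \<Longrightarrow> has_q_expansion h (cst k) (fls_const k)"
  unfolding cst_def
  by (subst has_q_expansion_altdef)
     (auto intro!: meromorphic_intros exI[of _ "\<lambda>_. k"] exI[of _ 0])

lemma has_q_expansion_sum: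
  assumes "\<And>i. i \<in> A \<Longrightarrow> has_q_expansion h (f i) (F i)" "h > 0"
  shows "has_q_expansion h (sum f A) (sum F A)"
  using assms(1)
proof (induction A rule: infinite_finite_induct)
  case (insert x A)
  then show ?case by (simp add: has_q_expansion_add assms(2))
qed (use has_q_expansion_cst[OF assms(2), of 0] in simp_all)

lemma has_q_expansion_power:
  assumes "has_q_expansion h f F" "h > 0"
  shows "has_q_expansion h (f ^ n) (F ^ n)"
  using has_q_expansion_cst[OF assms(2), of 1] by (induction n) (auto intro!: has_q_expansion_mult assms)

text \<open>The identity theorem: on the connected half plane a meromorphic function vanishes off a
  sparse set or avoids 0 off a sparse set.\<close>

lemma zero_if_eventually_zero:
  assumes "\<phi> meromorphic_on upper_half_plane" "Im z > 0" "\<forall>\<^sub>F w in at z. \<phi> w = 0"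
  shows "abs_mero_uhp \<phi> = 0"
proof -
  have "(\<forall>\<^sub>\<approx>z\<in>upper_half_plane. \<phi> z = 0) \<or> (\<forall>\<^sub>\<approx>z\<in>upper_half_plane. \<phi> z \<noteq> 0)"
    using meromorphic_imp_constant_or_avoid[OF assms(1) open_upper_half_plane connected_upper_half_plane, of 0] by auto
  then show ?thesis
  proof
    assume "\<forall>\<^sub>\<approx>z\<in>upper_half_plane. \<phi> z = 0"
    then show ?thesis using assms(1)
      by (simp add: zero_mero_uhp_def mero_uhp_eq_iff meromorphic_on_const eventually_cosparse_open_eq[OF open_upper_half_plane])
  next
    assume "\<forall>\<^sub>\<approx>z\<in>upper_half_plane. \<phi> z \<noteq> 0"
    then have "\<forall>\<^sub>F w in at z. \<phi> w \<noteq> 0"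
      using assms(2) by (simp add: eventually_cosparse_open_eq[OF open_upper_half_plane])
    with assms(3) have "\<forall>\<^sub>F w in at z. False" by eventually_elim simp
    then show ?thesis by simp
  qed
qed

lemma has_q_expansion_zero_imp:
  assumes "has_q_expansion h f 0" "h > 0"
  shows "f = 0"
proof -
  obtain \<phi> where f: "\<phi> meromorphic_on upper_half_plane" "f = abs_mero_uhp \<phi>" by (rule mero_uhp_cases)
  obtain A c where A: "A has_laurent_expansion 0" "c \<ge> 0" "\<And>z. Im z > c \<Longrightarrow> \<forall>\<^sub>F w in at z. \<phi> w = A (nome h w)"
    using has_q_expansionE[OF assms(1)[unfolded f(2)] f(1) assms(2)] by blast
  have "eventually (\<lambda>q. A q = 0) (at 0)" using A(1) by (auto simp: has_laurent_expansion_def elim: eventually_mono)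
  from nome_eventually[OF this assms(2)] obtain c' where c': "c' \<ge> 0" "\<And>z. Im z > c' \<Longrightarrow> A (nome h z) = 0"
    by blast
  define z where "z = \<i> * of_real (max c c' + 1)"
  have z: "Im z > c" "Im z > c'" "Im z > 0" using A(2) c'(1) by (auto simp: z_def)
  have "\<forall>\<^sub>F w in at z. w \<in> {w. Im w > c'}"
    by (rule eventually_at_in_open') (use z open_Im_gt in auto)
  with A(3)[OF z(1)] have "\<forall>\<^sub>F w in at z. \<phi> w = 0" by eventually_elim (use c'(2) in auto)
  then show ?thesis using zero_if_eventually_zero[OF f(1) z(3)] f(2) by simp
qed

lemma zero_has_q_expansion_imp:
  assumes "has_q_expansion h 0 F" "h > 0"
  shows "F = 0"
proof (rule ccontr)
  assume F: "F \<noteq> 0"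
  obtain A c where A: "A has_laurent_expansion F" "c \<ge> 0" "\<And>z. Im z > c \<Longrightarrow> \<forall>\<^sub>F w in at z. 0 = A (nome h w)"
    using has_q_expansionE[OF assms(1)[unfolded zero_mero_uhp_def] meromorphic_on_const assms(2)] by blast
  have "eventually (\<lambda>q. A q \<noteq> 0) (at 0)" using A(1) F by (rule has_laurent_expansion_nonzero_imp_eventually_nonzero)
  from nome_eventually[OF this assms(2)] obtain c' where c': "c' \<ge> 0" "\<And>z. Im z > c' \<Longrightarrow> A (nome h z) \<noteq> 0"
    by blast
  define z where "z = \<i> * of_real (max c c' + 1)"
  have z: "Im z > c" "Im z > c'" by (auto simp: z_def)
  have "\<forall>\<^sub>F w in at z. w \<in> {w. Im w > c'}"
    by (rule eventually_at_in_open') (use z open_Im_gt in auto)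
  with A(3)[OF z(1)] have "\<forall>\<^sub>F w in at z. False" by eventually_elim (use c'(2) in force)
  then show False by simp
qed

lemma periodic_add_int:
  assumes per: "\<And>z. Im z > 0 \<Longrightarrow> \<phi> (z + of_nat h) = \<phi> z" and z: "Im z > 0"
  shows "\<phi> (z + of_nat h * of_int k) = \<phi> z"
proof (induction k rule: int_induct[where k=0])
  case (step1 i)
  then show ?case using per[of "z + of_nat h * of_int i"] z by (simp add: algebra_simps)
next
  case (step2 i)
  then show ?case using per[of "z + of_nat h * of_int (i - 1)"] z by (simp add: algebra_simps)
qed simp

text \<open>A periodic function descends to the punctured disc, and growth of a finite rate excludes
  an essential singularity at 0.\<close>

lemma has_q_expansion_if_growth:
  assumes hol: "\<phi> holomorphic_on upper_half_plane" and h: "h > 0"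
    and per: "\<And>z. Im z > 0 \<Longrightarrow> \<phi> (z + of_nat h) = \<phi> z" and gr: "growth r \<phi>"
  shows "\<exists>F. has_q_expansion h (abs_mero_uhp \<phi>) F"
proof -
  define G where "G q = \<phi> (of_nat h * Ln q / (2 * pi * \<i>))" for q
  have Im_pos: "Im (of_nat h * w / (2 * pi * \<i>)) > 0" if "norm (exp w) < 1" for w
  proof -
    have "Re w < 0" using that by (simp add: norm_exp_eq_Re)
    moreover have "of_nat h * w / (2 * pi * \<i>) = complex_of_real (h / (2 * pi)) * (- \<i> * w)"
      by (simp add: field_simps)
    then have "Im (of_nat h * w / (2 * pi * \<i>)) = - (h / (2 * pi)) * Re w" by simp
    moreover have "h / (2 * pi) > 0" using h by simp
    ultimately show ?thesis by (simp only: mult_minus_left neg_0_less_iff_less mult_pos_neg)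
  qed
  have branch: "\<phi> (of_nat h * w / (2 * pi * \<i>)) = G (exp w)" if w: "norm (exp w) < 1" for w
  proof -
    have "exp (Ln (exp w)) = exp w" by simp
    then obtain n :: int where n: "Ln (exp w) = w + of_int (2 * n) * pi * \<i>" unfolding exp_eq by blast
    have "of_nat h * Ln (exp w) / (2 * pi * \<i>) = of_nat h * w / (2 * pi * \<i>) + of_nat h * of_int n"
      unfolding n by (simp add: field_simps)
    then show ?thesis unfolding G_def using periodic_add_int[of \<phi> h, OF per Im_pos[OF w]] by simp
  qed
  have G_nome: "G (nome h z) = \<phi> z" if z: "Im z > 0" for z
  proof -
    have "nome h z = exp (2 * of_real pi * \<i> * z / of_nat h)" by (simp add: nome_def)
    moreover have "norm (nome h z) < 1" using z h by (simp add: norm_nome)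
    ultimately have "G (nome h z) = \<phi> (of_nat h * (2 * of_real pi * \<i> * z / of_nat h) / (2 * pi * \<i>))"
      using branch by metis
    then show ?thesis using h by simp
  qed
  have hol_G: "G holomorphic_on ball 0 1 - {0}"
  proof (rule holomorphic_onI, rule field_differentiable_at_within)
    fix p assume p: "p \<in> ball 0 1 - {0::complex}"
    \<comment> \<open>Near p the quotient q / p stays off the cut, so Ln (q / p) + Ln p is a local
      logarithm; by periodicity every branch of the logarithm gives the same
      \<open>G\<close>.\<close>
    define U where "U = ball 0 1 \<inter> ball p (norm p)"
    have U: "open U" "p \<in> U" using p by (auto simp: U_def)
    have nz: "q / p \<notin> \<real>\<^sub>\<le>\<^sub>0 \<and> q \<noteq> 0" if "q \<in> U" for q
    proof -
      have "norm (p - q) < norm p" using that by (simp add: U_def dist_norm)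
      moreover have "1 - q / p = (p - q) / p" using p by (simp add: diff_divide_distrib)
      ultimately have "norm (1 - q / p) < 1" using p by (simp add: norm_divide)
      then have "Re (1 - q / p) < 1" using complex_Re_le_cmod[of "1 - q / p"] by linarith
      then have "Re (q / p) > 0" by simp
      then show ?thesis by (auto simp: complex_nonpos_Reals_iff)
    qed
    define g where "g q = \<phi> (of_nat h * (Ln (q / p) + Ln p) / (2 * pi * \<i>))" for q
    have ex: "exp (Ln (q / p) + Ln p) = q" if "q \<in> U" for q
      using nz[OF that] p by (simp add: exp_add)
    have "g holomorphic_on U"
      unfolding g_def
    proof (rule holomorphic_on_compose_gen[OF _ hol, unfolded o_def])
      show "(\<lambda>q. of_nat h * (Ln (q / p) + Ln p) / (2 * pi * \<i>)) holomorphic_on U"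
        by (intro holomorphic_intros) (use nz p in auto)
      show "(\<lambda>q. of_nat h * (Ln (q / p) + Ln p) / (2 * pi * \<i>)) ` U \<subseteq> upper_half_plane"
      proof (rule image_subsetI)
        fix q assume "q \<in> U"
        then have "norm (exp (Ln (q / p) + Ln p)) < 1" using ex by (simp add: U_def)
        from Im_pos[OF this] show "of_nat h * (Ln (q / p) + Ln p) / (2 * pi * \<i>) \<in> upper_half_plane" by (rule CollectI)
      qed
    qed
    then have "g field_differentiable at p" using U holomorphic_on_imp_differentiable_at by blast
    have "\<forall>\<^sub>F q in nhds p. g q = G q"
    proof -
      have "\<forall>\<^sub>F q in nhds p. q \<in> U" using U by (rule eventually_nhds_in_open)
      then show ?thesis
      proof eventually_elim
        case (elim q)
        then have A: "norm (exp (Ln (q / p) + Ln p)) < 1" using ex by (simp add: U_def)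
        show ?case unfolding g_def branch[OF A] ex[OF elim] ..
      qed
    qed
    note eq = this
    from \<open>g field_differentiable at p\<close> obtain D where "(g has_field_derivative D) (at p)"
      unfolding field_differentiable_def by blast
    then have "(G has_field_derivative D) (at p)" by (subst (asm) DERIV_cong_ev[OF refl eq refl])
    then show "G field_differentiable at p" unfolding field_differentiable_def by blast
  qed
  obtain c B where cB: "c \<ge> 0" "B \<ge> 0" "\<And>s. Im s > c \<Longrightarrow> norm (\<phi> s) \<le> B * exp (r * Im s)"
    using gr by (rule growthE) blast
  obtain n :: nat where n: "r * h / (2 * pi) \<le> n" using real_arch_simple by blast
  \<comment> \<open>The power q^n absorbs the growth, and the one further factor q forces the limit
    0.\<close>
  define f1 where "f1 q = q ^ Suc n * G q" for q
  have bound: "norm (f1 (nome h z)) \<le> B * norm (nome h z)" if z: "Im z > c" for z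
  proof -
    have "r \<le> 2 * pi * n / h" using n h by (simp add: field_simps)
    then have "r * Im z \<le> 2 * pi * n / h * Im z" using z cB(1) by (intro mult_right_mono) auto
    then have "exp (r * Im z) \<le> exp (2 * pi * n / h * Im z)" by simp
    also have "exp (2 * pi * n / h * Im z) * norm (nome h z) ^ n = 1"
      by (simp add: norm_nome flip: exp_of_nat_mult exp_add)
    then have "exp (2 * pi * n / h * Im z) = 1 / norm (nome h z) ^ n" by (simp add: field_simps)
    finally have e: "exp (r * Im z) * norm (nome h z) ^ n \<le> 1" by (simp add: field_simps)
    have "norm (f1 (nome h z)) = norm (nome h z) * (norm (nome h z) ^ n * norm (\<phi> z))"
      using G_nome[of z] z cB(1) by (simp add: f1_def norm_mult norm_power)
    also have "\<dots> \<le> norm (nome h z) * (norm (nome h z) ^ n * (B * exp (r * Im z)))"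
      using cB(3)[OF z] by (intro mult_left_mono) auto
    also have "\<dots> = norm (nome h z) * B * (exp (r * Im z) * norm (nome h z) ^ n)" by simp
    also have "\<dots> \<le> norm (nome h z) * B * 1" using e cB(2) by (intro mult_left_mono) auto
    finally show ?thesis by (simp add: mult.commute)
  qed
  have "(f1 \<longlongrightarrow> 0) (at 0)"
  proof (rule Lim_null_comparison)
    show "((\<lambda>q. B * norm q) \<longlongrightarrow> 0) (at (0::complex))" by (auto intro!: tendsto_eq_intros)
    define e where "e = exp (- 2 * pi * c / h)"
    show "\<forall>\<^sub>F q in at 0. norm (f1 q) \<le> B * norm q"
      unfolding eventually_at
    proof (intro exI[of _ e] conjI ballI impI)
      fix q :: complex assume "q \<noteq> 0 \<and> dist q 0 < e"
      then have q: "q \<noteq> 0" "norm q < e" by auto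
      define z where "z = of_nat h * Ln q / (2 * pi * \<i>)"
      have nz: "nome h z = q" using h q(1) by (simp add: nome_def z_def)
      then have "exp (- 2 * pi * Im z / h) < exp (- 2 * pi * c / h)" using q(2) norm_nome[of h z] by (simp add: e_def)
      then have "Im z > c" using h by (simp add: field_simps)
      from bound[OF this] show "norm (f1 q) \<le> B * norm q" unfolding nz .
    qed (simp add: e_def)
  qed
  then have "not_essential f1 0" by (auto simp: not_essential_def)
  moreover have "f1 holomorphic_on ball 0 1 - {0}" unfolding f1_def by (intro holomorphic_intros hol_G)
  then have "isolated_singularity_at f1 0" by (intro isolated_singularity_at_holomorphic[of _ "ball 0 1"]) auto
  ultimately have "f1 meromorphic_on {0}" by (simp add: meromorphic_at_iff)
  then have "(\<lambda>q. f1 q / q ^ Suc n) meromorphic_on {0}" by (intro meromorphic_intros)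
  then obtain F where "(\<lambda>q. f1 (0 + q) / (0 + q) ^ Suc n) has_laurent_expansion F"
    unfolding meromorphic_on_def by blast
  then have F: "(\<lambda>q. f1 q / q ^ Suc n) has_laurent_expansion F" by simp
  have "\<forall>\<^sub>F w in at z. \<phi> w = f1 (nome h w) / nome h w ^ Suc n" if "Im z > 0" for z
  proof -
    have "\<forall>\<^sub>F w in at z. w \<in> {w. Im w > 0}"
      by (rule eventually_at_in_open') (use that open_Im_gt in auto)
    then show ?thesis by eventually_elim (use G_nome in \<open>simp add: f1_def\<close>)
  qed
  then show ?thesis
    unfolding has_q_expansion_altdef[OF holomorphic_imp_meromorphic_uhp[OF hol] h] using F by blast
qed

lemma q_expansion_asymp:
  assumes "G has_laurent_expansion F" "F \<noteq> 0"
  obtains C C' where "C > 0" "C' > 0"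
    "eventually (\<lambda>q. norm (G q) \<le> C * norm q powi fls_subdegree F) (at 0)"
    "eventually (\<lambda>q. norm (G q) \<ge> C' * norm q powi fls_subdegree F) (at 0)"
proof -
  have as: "G \<sim>[at 0] (\<lambda>z. fls_nth F (fls_subdegree F) * z powi fls_subdegree F)"
    using has_laurent_expansion_imp_asymp_equiv_0[OF assms(1)] by blast
  define a where "a = norm (fls_nth F (fls_subdegree F))"
  have a: "a > 0" using assms(2) by (simp add: a_def)
  obtain C where C: "C > 0" "eventually (\<lambda>q. norm (G q) \<le> C * norm (fls_nth F (fls_subdegree F) * q powi fls_subdegree F)) (at 0)"
    using asymp_equiv_imp_bigo[OF as] by (elim landau_o.bigE) auto
  obtain D where D: "D > 0" "eventually (\<lambda>q. norm (fls_nth F (fls_subdegree F) * q powi fls_subdegree F) \<le> D * norm (G q)) (at 0)"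
    using asymp_equiv_imp_bigo[OF asymp_equiv_symI[OF as]] by (elim landau_o.bigE) auto
  show ?thesis
  proof (rule that)
    show "C * a > 0" "a / D > 0" using C D a by auto
    show "eventually (\<lambda>q. norm (G q) \<le> C * a * norm q powi fls_subdegree F) (at 0)"
      using C(2) by eventually_elim (simp add: a_def norm_mult norm_power_int)
    show "eventually (\<lambda>q. norm (G q) \<ge> a / D * norm q powi fls_subdegree F) (at 0)"
      using D(2) by eventually_elim (use D(1) in \<open>simp add: a_def norm_mult norm_power_int field_simps\<close>)
  qed
qed

lemma norm_nome_powi: "norm (nome h z) powi n = exp (- (2 * pi * n / h) * Im z)"
proof -
  have "norm (nome h z) powi n = exp (of_int n * (- 2 * pi * Im z / h))"
    by (simp only: norm_nome exp_power_int)
  then show ?thesis by (simp add: field_simps)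
qed

text \<open>The expansion describes the function off isolated points only; continuity carries the
  bound over to all points. Together with \<open>subdegree_ge_if_growth\<close> this is the
  dictionary between orders and growth rates.\<close>

lemma growth_if_has_q_expansion:
  assumes hol: "\<phi> holomorphic_on upper_half_plane" and h: "h > 0"
    and F: "has_q_expansion h (abs_mero_uhp \<phi>) F" "F \<noteq> 0"
  shows "growth (- (2 * pi * fls_subdegree F / h)) \<phi>"
proof -
  obtain G c where G: "G has_laurent_expansion F" "c \<ge> 0" "\<And>z. Im z > c \<Longrightarrow> \<forall>\<^sub>F w in at z. \<phi> w = G (nome h w)"
    using has_q_expansionE[OF F(1) holomorphic_imp_meromorphic_uhp[OF hol] h] by blast
  obtain C where C: "C > 0" "eventually (\<lambda>q. norm (G q) \<le> C * norm q powi fls_subdegree F) (at 0)"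
    using q_expansion_asymp[OF G(1) F(2)] by metis
  from nome_eventually[OF C(2) h] obtain c' where
    c': "c' \<ge> 0" "\<And>z. Im z > c' \<Longrightarrow> norm (G (nome h z)) \<le> C * norm (nome h z) powi fls_subdegree F" by blast
  show ?thesis
  proof (rule growthI)
    fix z assume z: "Im z > max c c'"
    have "\<forall>\<^sub>F w in at z. w \<in> {w. Im w > c'}"
      by (rule eventually_at_in_open') (use z open_Im_gt in auto)
    moreover have "\<forall>\<^sub>F w in at z. \<phi> w = G (nome h w)" using G(3) z by simp
    ultimately have ev: "\<forall>\<^sub>F w in at z. norm (\<phi> w) \<le> C * exp (- (2 * pi * fls_subdegree F / h) * Im w)"
      by eventually_elim (use c'(2) norm_nome_powi in auto)
    have "isCont \<phi> z"
      using holomorphic_on_imp_differentiable_at[OF hol open_upper_half_plane, of z] z G(2)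
      by (simp add: field_differentiable_imp_continuous_at)
    then have "((\<lambda>w. norm (\<phi> w)) \<longlongrightarrow> norm (\<phi> z)) (at z)" by (intro tendsto_norm) (simp add: isCont_def)
    moreover have "((\<lambda>w. C * exp (- (2 * pi * fls_subdegree F / h) * Im w)) \<longlongrightarrow> C * exp (- (2 * pi * fls_subdegree F / h) * Im z)) (at z)"
      by (intro tendsto_intros)
    ultimately show "norm (\<phi> z) \<le> C * exp (- (2 * pi * fls_subdegree F / h) * Im z)"
      using ev tendsto_le[OF trivial_limit_at] by blast
  qed
qed

lemma subdegree_ge_if_growth:
  assumes hol: "\<phi> holomorphic_on upper_half_plane" and h: "h > 0"
    and F: "has_q_expansion h (abs_mero_uhp \<phi>) F" "F \<noteq> 0" and gr: "growth r \<phi>"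
  shows "2 * pi * fls_subdegree F \<ge> - r * h"
proof (rule ccontr)
  assume "\<not> ?thesis"
  then have lt: "r < - (2 * pi * fls_subdegree F / h)" using h by (simp add: field_simps)
  obtain G c where G: "G has_laurent_expansion F" "c \<ge> 0" "\<And>z. Im z > c \<Longrightarrow> \<forall>\<^sub>F w in at z. \<phi> w = G (nome h w)"
    using has_q_expansionE[OF F(1) holomorphic_imp_meromorphic_uhp[OF hol] h] by blast
  obtain C where C: "C > 0" "eventually (\<lambda>q. norm (G q) \<ge> C * norm q powi fls_subdegree F) (at 0)"
    using q_expansion_asymp[OF G(1) F(2)] by metis
  from nome_eventually[OF C(2) h] obtain c' where
    c': "c' \<ge> 0" "\<And>z. Im z > c' \<Longrightarrow> norm (G (nome h z)) \<ge> C * norm (nome h z) powi fls_subdegree F" by blast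
  obtain c2 B where B: "c2 \<ge> 0" "B \<ge> 0" "\<And>s. Im s > c2 \<Longrightarrow> norm (\<phi> s) \<le> B * exp (r * Im s)"
    using gr by (rule growthE) blast
  define \<sigma> where "\<sigma> = - (2 * pi * fls_subdegree F / h)"
  have le: "C * exp (\<sigma> * y) \<le> B * exp (r * y)" if y: "y > max c (max c' c2)" for y
  proof -
    define z where "z = \<i> * of_real y"
    define m where "m = max c' c2"
    have "\<forall>\<^sub>F w in at z. w \<in> {w. Im w > m}"
      by (rule eventually_at_in_open'[OF open_Im_gt]) (use y in \<open>simp add: z_def m_def\<close>)
    moreover have "\<forall>\<^sub>F w in at z. \<phi> w = G (nome h w)" using G(3) y by (simp add: z_def)
    ultimately have ev: "\<forall>\<^sub>F w in at z. C * exp (\<sigma> * Im w) \<le> B * exp (r * Im w)"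
    proof eventually_elim
      case (elim w)
      then show ?case using c'(2)[of w] B(3)[of w] norm_nome_powi[of h w] by (simp add: \<sigma>_def m_def)
    qed
    have "((\<lambda>w. C * exp (\<sigma> * Im w)) \<longlongrightarrow> C * exp (\<sigma> * Im z)) (at z)"
      "((\<lambda>w. B * exp (r * Im w)) \<longlongrightarrow> B * exp (r * Im z)) (at z)" by (intro tendsto_intros)+
    then have "C * exp (\<sigma> * Im z) \<le> B * exp (r * Im z)"
      using ev tendsto_le[OF trivial_limit_at] by blast
    then show ?thesis by (simp add: z_def)
  qed
  have gap: "\<sigma> - r > 0" using lt by (simp add: \<sigma>_def)
  define y where "y = max (max c (max c' c2)) (B / C / (\<sigma> - r)) + 1"
  have "B / C / (\<sigma> - r) < y" by (simp add: y_def)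
  then have "B / C < y * (\<sigma> - r)" by (simp only: pos_divide_less_eq[OF gap])
  then have "B / C < (\<sigma> - r) * y" by (simp only: mult.commute)
  also have "\<dots> \<le> exp ((\<sigma> - r) * y)" using exp_ge_add_one_self[of "(\<sigma> - r) * y"] by linarith
  finally have "B < C * exp ((\<sigma> - r) * y)" using C(1) by (simp add: field_simps)
  then have "B * exp (r * y) < C * exp ((\<sigma> - r) * y) * exp (r * y)" by simp
  also have "\<dots> = C * exp (\<sigma> * y)" by (simp add: left_diff_distrib exp_diff)
  finally have "B * exp (r * y) < C * exp (\<sigma> * y)" .
  moreover have "y \<ge> max c (max c' c2) + 1" unfolding y_def by (simp only: add_le_cancel_right max.cobounded1)
  then have "y > max c (max c' c2)" by linarith
  from le[OF this] have "C * exp (\<sigma> * y) \<le> B * exp (r * y)" .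
  ultimately show False by linarith
qed

subsection \<open>Growth of regular functions\<close>

text \<open>A bound on a holomorphic representative, so that regularity is included; by
  \<open>holomorphic_uhp_eqI\<close> the representative is unique on the half plane.\<close>

definition mgrowth :: "real \<Rightarrow> mero_uhp \<Rightarrow> bool" where
  "mgrowth r f \<longleftrightarrow> (\<exists>\<phi>. \<phi> holomorphic_on upper_half_plane \<and> f = abs_mero_uhp \<phi> \<and> growth r \<phi>)"

lemma mgrowth_imp_regular: "mgrowth r f \<Longrightarrow> regular f"
  by (auto simp: mgrowth_def regular_def)

lemma mgrowth_cst: "mgrowth 0 (cst k)"
  unfolding mgrowth_def cst_def by (intro exI[of _ "\<lambda>_. k"]) (auto intro: growth_const)

lemma mgrowth_mono: "mgrowth r f \<Longrightarrow> r \<le> r' \<Longrightarrow> mgrowth r' f"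
  unfolding mgrowth_def using growth_mono by blast

lemma mgrowth_add:
  assumes "mgrowth r f" "mgrowth r g"
  shows "mgrowth r (f + g)"
proof -
  obtain \<phi> \<psi> where *: "\<phi> holomorphic_on upper_half_plane" "f = abs_mero_uhp \<phi>" "growth r \<phi>"
    "\<psi> holomorphic_on upper_half_plane" "g = abs_mero_uhp \<psi>" "growth r \<psi>" using assms unfolding mgrowth_def by blast
  note m = *(1,4)[THEN holomorphic_imp_meromorphic_uhp]
  show ?thesis unfolding *(2,5) mgrowth_def mero_uhp_add[OF m]
    by (intro exI[of _ "\<lambda>z. \<phi> z + \<psi> z"] conjI refl holomorphic_intros growth_add *)
qed

lemma mgrowth_mult:
  assumes "mgrowth r f" "mgrowth r' g"
  shows "mgrowth (r + r') (f * g)"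
proof -
  obtain \<phi> \<psi> where *: "\<phi> holomorphic_on upper_half_plane" "f = abs_mero_uhp \<phi>" "growth r \<phi>"
    "\<psi> holomorphic_on upper_half_plane" "g = abs_mero_uhp \<psi>" "growth r' \<psi>" using assms unfolding mgrowth_def by blast
  note m = *(1,4)[THEN holomorphic_imp_meromorphic_uhp]
  show ?thesis unfolding *(2,5) mgrowth_def mero_uhp_mult[OF m]
    by (intro exI[of _ "\<lambda>z. \<phi> z * \<psi> z"] conjI refl holomorphic_intros growth_mult *)
qed

lemma mgrowth_cmult: "mgrowth r f \<Longrightarrow> mgrowth r (cst k * f)"
  using mgrowth_mult[OF mgrowth_cst] by fastforce

lemma mgrowth_diff: "mgrowth r f \<Longrightarrow> mgrowth r g \<Longrightarrow> mgrowth r (f - g)"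
  using mgrowth_add[OF _ mgrowth_cmult[of r g "-1"], of f] by (simp add: cst_uminus)

lemma mgrowth_power: "mgrowth r f \<Longrightarrow> mgrowth (real n * r) (f ^ n)"
proof (induction n)
  case (Suc n)
  then have "mgrowth (r + real n * r) (f * f ^ n)" by (intro mgrowth_mult) auto
  then show ?case by (simp add: algebra_simps)
qed (use mgrowth_cst[of 1] in simp)

lemma mgrowth_prod:
  assumes "\<And>x. x \<in> A \<Longrightarrow> mgrowth 0 (f x)"
  shows "mgrowth 0 (prod f A)"
  using assms
proof (induction A rule: infinite_finite_induct)
  case (insert x A)
  then show ?case using mgrowth_mult[of 0 "f x" 0 "prod f A"] by simp
qed (use mgrowth_cst[of 1] in simp_all)

lemma mgrowth_affine:
  assumes "mgrowth r f" "a > 0" "d > 0"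
  shows "mgrowth (a / d * r) (pullback a b 0 d f)"
proof -
  obtain \<phi> where *: "\<phi> holomorphic_on upper_half_plane" "f = abs_mero_uhp \<phi>" "growth r \<phi>"
    using assms unfolding mgrowth_def by blast
  have det: "a * d - b * 0 > 0" using assms by simp
  have m: "moebius a b 0 d z = of_real (a / d) * z + of_real (b / d)" for z
    using assms by (simp add: moebius_def add_divide_distrib)
  have "growth (a / d * r) (\<lambda>z. \<phi> (moebius a b 0 d z))"
    unfolding m using growth_affine[OF *(3), of "a / d" "b / d"] assms by simp
  then show ?thesis
    unfolding mgrowth_def *(2) mero_uhp_pullback[OF holomorphic_imp_meromorphic_uhp[OF *(1)] det]
    using holomorphic_moebius[OF det *(1)] by blast
qed

lemma mgrowth_if_has_q_expansion:
  assumes "regular f" "h > 0" "has_q_expansion h f F" "F \<noteq> 0"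
  shows "mgrowth (- (2 * pi * fls_subdegree F / h)) f"
  using assms growth_if_has_q_expansion unfolding regular_def mgrowth_def by blast

lemma subdegree_ge_if_mgrowth:
  assumes "mgrowth r f" "h > 0" "has_q_expansion h f F" "F \<noteq> 0"
  shows "2 * pi * fls_subdegree F \<ge> - r * h"
  using assms subdegree_ge_if_growth unfolding mgrowth_def by blast

section \<open>A Liouville theorem for modular functions\<close>

lemma moebius_moebius:
  assumes "a * d - b * c > 0" "a' * d' - b' * c' > 0" "Im z > 0"
  shows "moebius a' b' c' d' (moebius a b c d z) = moebius (a' * a + b' * c) (a' * b + b' * d) (c' * a + d' * c) (c' * b + d' * d) z"
proof -
  define w where "w = complex_of_real c * z + of_real d"
  define u where "u = complex_of_real a * z + of_real b"
  have w: "w \<noteq> 0" using moebius_denom_nz[OF assms(1,3)] by (simp add: w_def)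
  have "of_real a' * (u / w) + of_real b' = (of_real a' * u + of_real b' * w) / w"
    "of_real c' * (u / w) + of_real d' = (of_real c' * u + of_real d' * w) / w"
    using w by (simp_all add: field_simps)
  then have "moebius a' b' c' d' (u / w) = (of_real a' * u + of_real b' * w) / (of_real c' * u + of_real d' * w)"
    using w by (simp add: moebius_def)
  then show ?thesis by (simp add: moebius_def u_def w_def algebra_simps)
qed

section \<open>The action of SL_2(Z) and cosets of Gamma_0(N)\<close>

definition unimod :: "int \<Rightarrow> int \<Rightarrow> int \<Rightarrow> int \<Rightarrow> bool" where
  "unimod a b c d \<longleftrightarrow> a * d - b * c = 1"

definition act :: "int \<Rightarrow> int \<Rightarrow> int \<Rightarrow> int \<Rightarrow> mero_uhp \<Rightarrow> mero_uhp" where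
  "act a b c d = pullback a b c d"

lemma det_real_iff: "real_of_int a * of_int d - of_int b * of_int c = 1 \<longleftrightarrow> a * d - b * c = 1"
  by (metis of_int_1 of_int_diff of_int_eq_iff of_int_mult)

lemma unimod_real: "unimod a b c d \<Longrightarrow> real_of_int a * of_int d - of_int b * of_int c > 0"
  unfolding unimod_def by (metis of_int_1 of_int_diff of_int_mult zero_less_one)

lemma unimod_mult:
  assumes "unimod a b c d" "unimod a' b' c' d'"
  shows "unimod (a' * a + b' * c) (a' * b + b' * d) (c' * a + d' * c) (c' * b + d' * d)"
proof -
  have "(a' * a + b' * c) * (c' * b + d' * d) - (a' * b + b' * d) * (c' * a + d' * c) = (a * d - b * c) * (a' * d' - b' * c')"
    by (simp add: algebra_simps)
  then show ?thesis using assms by (simp add: unimod_def)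
qed

lemma unimod_inverse: "unimod a b c d \<Longrightarrow> unimod d (- b) (- c) a"
  by (simp add: unimod_def algebra_simps)

lemma act_act:
  assumes "unimod a b c d" "unimod a' b' c' d'"
  shows "act a b c d (act a' b' c' d' f) = act (a' * a + b' * c) (a' * b + b' * d) (c' * a + d' * c) (c' * b + d' * d) f"
  using pullback_pullback[OF unimod_real[OF assms(1)] unimod_real[OF assms(2)], of f] by (simp add: act_def)

lemma act_hom:
  assumes "unimod a b c d"
  shows "act a b c d (f + g) = act a b c d f + act a b c d g"
    and "act a b c d (f - g) = act a b c d f - act a b c d g"
    and "act a b c d (f * g) = act a b c d f * act a b c d g"
    and "act a b c d (inverse f) = inverse (act a b c d f)"
    and "act a b c d (cst k) = cst k"
  unfolding act_def by (rule pullback_hom[OF unimod_real[OF assms]])+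

lemma act_prod:
  assumes "unimod a b c d"
  shows "act a b c d (prod f A) = (\<Prod>x\<in>A. act a b c d (f x))"
  using act_hom(3)[OF assms] act_hom(5)[OF assms, of 1]
  by (induction A rule: infinite_finite_induct) simp_all

lemma act_power:
  assumes "unimod a b c d"
  shows "act a b c d (f ^ n) = act a b c d f ^ n"
  using act_hom(3)[OF assms] act_hom(5)[OF assms, of 1] by (induction n) simp_all

lemma act_one: "act 1 0 0 1 f = f"
proof -
  obtain \<phi> where f: "\<phi> meromorphic_on upper_half_plane" "f = abs_mero_uhp \<phi>" by (rule mero_uhp_cases)
  have "moebius 1 0 0 1 = (\<lambda>z. z)" by (simp add: moebius_def fun_eq_iff)
  then show ?thesis unfolding f(2) act_def by (subst mero_uhp_pullback[OF f(1)]) simp_all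
qed

lemma regular_act: "unimod a b c d \<Longrightarrow> regular f \<Longrightarrow> regular (act a b c d f)"
  unfolding act_def by (rule regular_pullback[OF unimod_real])

lemma X0_fieldD:
  assumes "f \<in> X0_field N"
  shows "unimod a b c d \<Longrightarrow> int N dvd c \<Longrightarrow> act a b c d f = f"
    and "unimod a b c d \<Longrightarrow> \<exists>h>0. \<exists>F. has_q_expansion h (act a b c d f) F"
proof -
  have conj: "(\<forall>(a :: int) (b :: int) (c :: int) (d :: int).
        a * d - b * c = 1 \<and> int N dvd c \<longrightarrow> pullback a b c d f = f) \<and>
     (\<forall>(a :: int) (b :: int) (c :: int) (d :: int). a * d - b * c = 1 \<longrightarrow>
        (\<exists>h>0. \<exists>F. has_q_expansion h (pullback a b c d f) F))"
    using assms by (simp only: X0_field_def mem_Collect_eq)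
  show "unimod a b c d \<Longrightarrow> int N dvd c \<Longrightarrow> act a b c d f = f"
    unfolding act_def unimod_def by (rule conj[THEN conjunct1, rule_format]) simp
  show "unimod a b c d \<Longrightarrow> \<exists>h>0. \<exists>F. has_q_expansion h (act a b c d f) F"
    unfolding act_def unimod_def by (rule conj[THEN conjunct2, rule_format]) (simp only: det_real_iff)
qed

lemma X0_fieldI:
  assumes "\<And>a b c d. unimod a b c d \<Longrightarrow> int N dvd c \<Longrightarrow> act a b c d f = f"
    and "\<And>a b c d. unimod a b c d \<Longrightarrow> \<exists>h>0. \<exists>F. has_q_expansion h (act a b c d f) F"
  shows "f \<in> X0_field N"
  unfolding X0_field_def mem_Collect_eq
  using assms unfolding act_def unimod_def det_real_iff by simp

text \<open>Cosets of \<open>\<Gamma>\<^sub>0(N)\<close> are determined by the bottom row modulo \<open>N\<close> up to proportionality.\<close>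

lemma act_eq_if_bottom_row:
  assumes f: "f \<in> X0_field N" and u: "unimod a b c d" "unimod a' b' c' d'" and dvd: "int N dvd c * d' - d * c'"
  shows "act a b c d f = act a' b' c' d' f"
proof -
  let ?p = "a * d' + b * (- c')" and ?q = "a * (- b') + b * a'" and ?r = "c * d' + d * (- c')" and ?s = "c * (- b') + d * a'"
  have "unimod ?p ?q ?r ?s" by (rule unimod_mult[OF unimod_inverse[OF u(2)] u(1)])
  moreover have "int N dvd ?r" using dvd by simp
  ultimately have "act ?p ?q ?r ?s f = f" using X0_fieldD(1)[OF f] by blast
  then have "act a' b' c' d' f = act a' b' c' d' (act ?p ?q ?r ?s f)" by simp
  also have "\<dots> = act (?p * a' + ?q * c') (?p * b' + ?q * d') (?r * a' + ?s * c') (?r * b' + ?s * d') f"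
    by (rule act_act[OF u(2) \<open>unimod ?p ?q ?r ?s\<close>])
  also have "?p * a' + ?q * c' = a * (a' * d' - b' * c')" by (simp add: algebra_simps)
  also have "?p * b' + ?q * d' = b * (a' * d' - b' * c')" by (simp add: algebra_simps)
  also have "?r * a' + ?s * c' = c * (a' * d' - b' * c')" by (simp add: algebra_simps)
  also have "?r * b' + ?s * d' = d * (a' * d' - b' * c')" by (simp add: algebra_simps)
  also have "a' * d' - b' * c' = 1" using u(2) by (simp add: unimod_def)
  finally show ?thesis by simp
qed

definition translates :: "mero_uhp \<Rightarrow> mero_uhp set" where
  "translates f = {act a b c d f | a b c d. unimod a b c d}"

text \<open>Bottom rows modulo N take finitely many values and determine the action on the function
  field, so one matrix per value suffices.\<close>

lemma finite_representatives:
  assumes N: "N > 0"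
  obtains X :: "(int \<times> int \<times> int \<times> int) set" where "finite X"
    "\<And>a b c d. (a, b, c, d) \<in> X \<Longrightarrow> unimod a b c d"
    "\<And>a b c d. unimod a b c d \<Longrightarrow> \<exists>a' b' c' d'. (a', b', c', d') \<in> X \<and> int N dvd c * d' - d * c' \<and>
       (\<forall>f \<in> X0_field N. act a b c d f = act a' b' c' d' f)"
proof -
  define S where "S = {(a, b, c, d). unimod a b c d}"
  define res :: "int \<times> int \<times> int \<times> int \<Rightarrow> int \<times> int" where "res = (\<lambda>(a, b, c, d). (c mod int N, d mod int N))"
  have fin: "finite (res ` S)"
    by (rule finite_subset[of _ "{0..<int N} \<times> {0..<int N}"]) (use N in \<open>auto simp: res_def\<close>)
  define pick where "pick r = (SOME x. x \<in> S \<and> res x = r)" for r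
  have pick: "pick r \<in> S \<and> res (pick r) = r" if r: "r \<in> res ` S" for r
    unfolding pick_def using someI_ex[of "\<lambda>x. x \<in> S \<and> res x = r"] r by blast
  show ?thesis
  proof (rule that[of "pick ` res ` S"])
    show "finite (pick ` res ` S)" using fin by simp
    show "unimod a b c d" if x: "(a, b, c, d) \<in> pick ` res ` S" for a b c d
    proof -
      from x obtain r where "r \<in> res ` S" "(a, b, c, d) = pick r" by blast
      then have "(a, b, c, d) \<in> S" using pick by metis
      then show ?thesis by (simp add: S_def)
    qed
    fix a b c d assume u: "unimod a b c d"
    then have r: "res (a, b, c, d) \<in> res ` S" by (simp add: S_def)
    obtain a' b' c' d' where p: "pick (res (a, b, c, d)) = (a', b', c', d')" by (cases "pick (res (a, b, c, d))")
    have u': "unimod a' b' c' d'" and eq: "c' mod N = c mod N" "d' mod N = d mod N"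
      using pick[OF r] unfolding p by (auto simp: S_def res_def)
    have "(c * d' - d * c') mod N = (c * d - d * c) mod N"
      by (intro mod_diff_cong mod_mult_cong refl) (use eq in simp_all)
    then have dvd: "int N dvd c * d' - d * c'" by (simp add: dvd_eq_mod_eq_0 mult.commute)
    moreover have "(a', b', c', d') \<in> pick ` res ` S" using r p by force
    ultimately show "\<exists>a' b' c' d'. (a', b', c', d') \<in> pick ` res ` S \<and> int N dvd c * d' - d * c' \<and>
       (\<forall>f \<in> X0_field N. act a b c d f = act a' b' c' d' f)"
      using act_eq_if_bottom_row[OF _ u u'] by blast
  qed
qed

lemma finite_translates:
  assumes "f \<in> X0_field N" "N > 0"
  shows "finite (translates f)"
proof -
  obtain X :: "(int \<times> int \<times> int \<times> int) set" where X: "finite X"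
    "\<And>a b c d. unimod a b c d \<Longrightarrow> \<exists>a' b' c' d'. (a', b', c', d') \<in> X \<and> int N dvd c * d' - d * c' \<and>
       (\<forall>f \<in> X0_field N. act a b c d f = act a' b' c' d' f)"
    using finite_representatives[OF assms(2)] by metis
  have "translates f \<subseteq> (\<lambda>(a, b, c, d). act a b c d f) ` X"
    unfolding translates_def using X(2) assms(1) by force
  then show ?thesis using X(1) finite_surj by blast
qed

text \<open>A crude fundamental box: after translation to |Re z| <= 1/2, a point of height below 1/2
  has |z|^2 <= 1/2, so inversion at least doubles its height. The induction is on the number of
  doublings that bring the height to 1/2.\<close>

lemma exists_high_translate:
  assumes "Im z > 0"
  shows "\<exists>a b c d. unimod a b c d \<and> \<bar>Re (moebius a b c d z)\<bar> \<le> 1 / 2 \<and> Im (moebius a b c d z) \<ge> 1 / 2"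
proof -
  have "\<forall>z. Im z > 0 \<and> Im z * 2 ^ n \<ge> 1 / 2 \<longrightarrow> (\<exists>a b c d. unimod a b c d \<and> \<bar>Re (moebius a b c d z)\<bar> \<le> 1 / 2 \<and> Im (moebius a b c d z) \<ge> 1 / 2)" for n
  proof (induction n)
    case 0
    show ?case
    proof (intro allI impI)
      fix z assume z: "Im z > 0 \<and> Im z * 2 ^ 0 \<ge> 1 / 2"
      have "unimod 1 (- round (Re z)) 0 1" by (simp add: unimod_def)
      moreover have "moebius (real_of_int 1) (real_of_int (- round (Re z))) (real_of_int 0) (real_of_int 1) z = z - of_int (round (Re z))"
        by (simp add: moebius_def)
      moreover have "\<bar>Re (z - of_int (round (Re z)))\<bar> \<le> 1 / 2"
        using of_int_round_abs_le[of "Re z"] by (simp add: abs_minus_commute)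
      ultimately show "\<exists>a b c d. unimod a b c d \<and> \<bar>Re (moebius a b c d z)\<bar> \<le> 1 / 2 \<and> Im (moebius a b c d z) \<ge> 1 / 2"
        using z by - (rule exI[of _ 1], rule exI[of _ "- round (Re z)"], rule exI[of _ 0], rule exI[of _ 1], simp)
    qed
  next
    case (Suc n)
    show ?case
    proof (intro allI impI)
      fix z assume z: "Im z > 0 \<and> Im z * 2 ^ Suc n \<ge> 1 / 2"
      define k where "k = round (Re z)"
      define z1 where "z1 = z - of_int k"
      have re: "\<bar>Re z1\<bar> \<le> 1 / 2"
        using of_int_round_abs_le[of "Re z"] by (simp add: z1_def k_def abs_minus_commute)
      show "\<exists>a b c d. unimod a b c d \<and> \<bar>Re (moebius a b c d z)\<bar> \<le> 1 / 2 \<and> Im (moebius a b c d z) \<ge> 1 / 2"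
      proof (cases "Im z \<ge> 1 / 2")
        case True
        have "unimod 1 (- k) 0 1" by (simp add: unimod_def)
        moreover have "moebius (real_of_int 1) (real_of_int (- k)) (real_of_int 0) (real_of_int 1) z = z1"
          by (simp add: moebius_def z1_def)
        ultimately show ?thesis using re True
          by - (rule exI[of _ 1], rule exI[of _ "- k"], rule exI[of _ 0], rule exI[of _ 1], simp add: z1_def)
      next
        case False
        have im1: "Im z1 = Im z" by (simp add: z1_def)
        define z2 where "z2 = moebius 0 (- 1) 1 (- k) z"
        have z2: "z2 = - 1 / z1" by (simp add: z2_def moebius_def z1_def)
        have u: "unimod 0 (- 1) 1 (- k)" by (simp add: unimod_def)
        have Im2: "Im z2 > 0" unfolding z2 using z im1 by (intro Im_minus_inverse_pos) simp
        have n1: "(cmod z1)\<^sup>2 \<le> 1 / 2"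
        proof -
          have "\<bar>Re z1\<bar>\<^sup>2 \<le> (1 / 2)\<^sup>2" "\<bar>Im z1\<bar>\<^sup>2 \<le> (1 / 2)\<^sup>2" using re False z im1 by (intro power_mono; simp)+
          then show ?thesis by (simp add: cmod_power2 power_divide)
        qed
        have n0: "(cmod z1)\<^sup>2 > 0" using z im1 by auto
        have "Im z2 = Im z / (cmod z1)\<^sup>2" unfolding z2 im1[symmetric] by (simp add: Im_divide cmod_power2)
        also have "\<dots> \<ge> Im z / (1 / 2)" using n0 n1 z by (intro divide_left_mono) auto
        finally have "Im z2 \<ge> 2 * Im z" by simp
        then have "2 * Im z * 2 ^ n \<le> Im z2 * 2 ^ n" by (intro mult_right_mono) auto
        moreover have "1 / 2 \<le> 2 * Im z * 2 ^ n" using z by (simp add: mult_ac)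
        ultimately have "Im z2 * 2 ^ n \<ge> 1 / 2" by linarith
        then obtain a b c d where abcd: "unimod a b c d" "\<bar>Re (moebius a b c d z2)\<bar> \<le> 1 / 2" "Im (moebius a b c d z2) \<ge> 1 / 2"
          using Suc.IH Im2 by blast
        have "moebius a b c d z2 = moebius (real_of_int (a * 0 + b * 1)) (real_of_int (a * (- 1) + b * (- k))) (real_of_int (c * 0 + d * 1)) (real_of_int (c * (- 1) + d * (- k))) z"
          using moebius_moebius[OF unimod_real[OF u] unimod_real[OF abcd(1)], of z] z unfolding z2_def by simp
        then show ?thesis using abcd unimod_mult[OF u abcd(1)] by metis
      qed
    qed
  qed
  moreover obtain n :: nat where "1 / (2 * Im z) < 2 ^ n" using real_arch_pow[of 2 "1 / (2 * Im z)"] by auto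
  then have "Im z * 2 ^ n \<ge> 1 / 2" using assms by (simp add: field_simps)
  ultimately show ?thesis using assms by blast
qed

text \<open>Above some height Y the modulus stays below its value at z0, and every point can be
  moved into a compact box or above Y; so the maximum is attained. The maximum principle makes the
  function constant, against the decay.\<close>

lemma invariant_decaying_zero:
  assumes hol: "\<phi> holomorphic_on upper_half_plane"
    and inv: "\<And>a b c d z. unimod a b c d \<Longrightarrow> Im z > 0 \<Longrightarrow> \<phi> (moebius a b c d z) = \<phi> z"
    and gr: "growth (- e) \<phi>" and e: "e > 0" and z0: "Im z0 > 0"
  shows "\<phi> z0 = 0"
proof (rule ccontr)
  assume nz: "\<phi> z0 \<noteq> 0"
  obtain c B where cB: "c \<ge> 0" "B \<ge> 0" "\<And>s. Im s > c \<Longrightarrow> norm (\<phi> s) \<le> B * exp (- e * Im s)"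
    using gr by (rule growthE) blast
  obtain Y where Y: "Y > c" "\<And>s. Im s \<ge> Y \<Longrightarrow> norm (\<phi> s) < norm (\<phi> z0)"
  proof
    define Y where "Y = max c (B / norm (\<phi> z0) / e) + 1"
    show "Y > c" by (simp add: Y_def)
    fix s assume s: "Im s \<ge> Y"
    then have "B / norm (\<phi> z0) / e < Im s" by (simp add: Y_def)
    then have "B / norm (\<phi> z0) < Im s * e" by (simp only: pos_divide_less_eq[OF e])
    then have "B / norm (\<phi> z0) < e * Im s" by (simp only: mult.commute)
    also have "\<dots> \<le> exp (e * Im s)" using exp_ge_add_one_self[of "e * Im s"] by linarith
    finally have "B < norm (\<phi> z0) * exp (e * Im s)" using nz by (simp add: pos_divide_less_eq mult.commute)
    then have "B * exp (- e * Im s) < norm (\<phi> z0)" by (simp add: exp_minus field_simps)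
    moreover have "norm (\<phi> s) \<le> B * exp (- e * Im s)" using s by (intro cB(3)) (simp add: Y_def)
    ultimately show "norm (\<phi> s) < norm (\<phi> z0)" by linarith
  qed
  define K where "K = cbox (Complex (- 1 / 2) (1 / 2)) (Complex (1 / 2) Y)"
  have K: "z \<in> K \<longleftrightarrow> \<bar>Re z\<bar> \<le> 1 / 2 \<and> 1 / 2 \<le> Im z \<and> Im z \<le> Y" for z
    by (auto simp: K_def in_cbox_complex_iff)
  have KH: "K \<subseteq> upper_half_plane" using K by auto
  have red: "\<exists>w. (w \<in> K \<or> Im w \<ge> Y) \<and> \<phi> w = \<phi> z" if zpos: "Im z > 0" for z
  proof -
    obtain a b c d where "unimod a b c d" "\<bar>Re (moebius a b c d z)\<bar> \<le> 1 / 2" "Im (moebius a b c d z) \<ge> 1 / 2"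
      using exists_high_translate[OF zpos] by blast
    then show ?thesis using inv[of a b c d z] zpos by (intro exI[of _ "moebius a b c d z"]) (auto simp: K)
  qed
  obtain w0 where w0: "w0 \<in> K" "\<phi> w0 = \<phi> z0" using red[OF z0] Y(2) by force
  have contK: "continuous_on K (\<lambda>z. norm (\<phi> z))"
    using continuous_on_subset[OF holomorphic_on_imp_continuous_on[OF hol] KH] by (intro continuous_on_norm)
  obtain m where m: "m \<in> K" "\<And>z. z \<in> K \<Longrightarrow> norm (\<phi> z) \<le> norm (\<phi> m)"
  proof -
    have "compact K" "K \<noteq> {}" using w0 by (auto simp: K_def)
    from continuous_attains_sup[OF this contK] show ?thesis using that by blast
  qed
  have max: "norm (\<phi> z) \<le> norm (\<phi> m)" if zpos: "z \<in> upper_half_plane" for z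
  proof -
    obtain w where "w \<in> K \<or> Im w \<ge> Y" "\<phi> w = \<phi> z" using red[of z] zpos by auto
    then show ?thesis using m(2)[of w] m(2)[OF w0(1)] w0(2) Y(2)[of w] by force
  qed
  have "\<phi> constant_on upper_half_plane"
    by (rule maximum_modulus_principle[OF hol open_upper_half_plane connected_upper_half_plane open_upper_half_plane order_refl, of m])
       (use m KH max in auto)
  then have "\<phi> (\<i> * of_real (max Y 1)) = \<phi> z0" using z0 by (auto simp: constant_on_def)
  then show False using Y(2)[of "\<i> * of_real (max Y 1)"] by simp
qed

text \<open>Subtract the constant term L at infinity and multiply over all translates: the product
  is invariant under SL_2(Z), every factor is bounded and f - L decays. So the product vanishes, and
  some translate of f equals L.\<close>

theorem X0_field_liouville:
  assumes f: "f \<in> X0_field N" and N: "N > 0"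
    and gr: "\<And>a b c d. unimod a b c d \<Longrightarrow> mgrowth 0 (act a b c d f)"
  shows "\<exists>k. f = cst k"
proof -
  have u1: "unimod 1 0 0 1" by (simp add: unimod_def)
  have gf: "mgrowth 0 f" using gr[OF u1] by (simp add: act_one)
  then have reg: "regular f" by (rule mgrowth_imp_regular)
  obtain h F where F: "h > 0" "has_q_expansion h f F" using X0_fieldD(2)[OF f u1] by (auto simp: act_one)
  define L where "L = fls_nth F 0"
  define G where "G = F + fls_const (- L)"
  have G: "has_q_expansion h (f + cst (- L)) G"
    unfolding G_def by (intro has_q_expansion_add F has_q_expansion_cst)
  show ?thesis
  proof (cases "G = 0")
    case True
    then have "f + cst (- L) = 0" using G F(1) has_q_expansion_zero_imp by blast
    then show ?thesis by (intro exI[of _ L]) (simp add: cst_uminus)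
  next
    case False
    have regG: "regular (f + cst (- L))" by (intro regular_add reg regular_cst)
    have sub: "fls_subdegree G \<ge> 1"
    proof -
      have "fls_nth G n = 0" if "n < 1" for n
      proof (cases "n = 0")
        case True then show ?thesis by (simp add: G_def L_def)
      next
        case n: False
        have "fls_nth F n = 0"
        proof (cases "F = 0")
          case F0: False
          then have "2 * pi * fls_subdegree F \<ge> - 0 * h" using subdegree_ge_if_mgrowth[OF gf F(1,2)] by simp
          then have "fls_subdegree F \<ge> 0" by (auto simp: zero_le_mult_iff pi_gt_zero[folded not_le])
          then show ?thesis using n that by (intro fls_eq0_below_subdegree) linarith
        qed simp
        then show ?thesis using n by (simp add: G_def)
      qed
      then show ?thesis by (meson False fls_subdegree_geI)
    qed
    define e where "e = 2 * pi / h"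
    have e: "e > 0" using F(1) by (simp add: e_def)
    have gG: "mgrowth (- e) (f + cst (- L))"
    proof (rule mgrowth_mono[OF mgrowth_if_has_q_expansion[OF regG F(1) G False]])
      have "2 * pi / h * 1 \<le> 2 * pi / h * of_int (fls_subdegree G)" using sub F(1) by (intro mult_left_mono) auto
      then show "- (2 * pi * fls_subdegree G / h) \<le> - e" by (simp add: e_def)
    qed
    define A where "A = translates f"
    have finA: "finite A" unfolding A_def by (rule finite_translates[OF f N])
    have fA: "f \<in> A" unfolding A_def translates_def using u1 act_one[of f] by force
    define Pr where "Pr = (\<Prod>g\<in>A. g + cst (- L))"
    have grA: "mgrowth 0 g" if "g \<in> A" for g using that gr by (auto simp: A_def translates_def)
    have "Pr = (f + cst (- L)) * (\<Prod>g\<in>A - {f}. g + cst (- L))"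
      unfolding Pr_def by (rule prod.remove[OF finA fA])
    moreover have "mgrowth (- e + 0) ((f + cst (- L)) * (\<Prod>g\<in>A - {f}. g + cst (- L)))"
      by (intro mgrowth_mult gG mgrowth_prod mgrowth_add grA mgrowth_cst) simp
    ultimately have gPr: "mgrowth (- e) Pr" by simp
    then obtain \<phi> where \<phi>: "\<phi> holomorphic_on upper_half_plane" "Pr = abs_mero_uhp \<phi>" "growth (- e) \<phi>"
      unfolding mgrowth_def by blast
    \<comment> \<open>SL_2(Z) permutes the finite set of translates, hence the factors of the
      product.\<close>
    have actPr: "act a b c d Pr = Pr" if u: "unimod a b c d" for a b c d
    proof -
      have uinv: "unimod d (- b) (- c) a" by (rule unimod_inverse[OF u])
      have inv1: "act d (- b) (- c) a (act a b c d g) = g" for g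
      proof -
        have "act d (- b) (- c) a (act a b c d g) = act (a * d - b * c) 0 0 (a * d - b * c) g"
          using act_act[OF uinv u, of g] by (simp add: algebra_simps)
        then show ?thesis using u act_one by (simp add: unimod_def)
      qed
      have inj: "inj_on (act a b c d) A" by (rule inj_on_inverseI[of _ "act d (- b) (- c) a"]) (rule inv1)
      have sub: "act a b c d ` A \<subseteq> A"
      proof (rule image_subsetI)
        fix g assume "g \<in> A"
        then obtain a' b' c' d' where g: "unimod a' b' c' d'" "g = act a' b' c' d' f" unfolding A_def translates_def by blast
        show "act a b c d g \<in> A" unfolding g(2) act_act[OF u g(1)] A_def translates_def
          using unimod_mult[OF u g(1)] by blast
      qed
      have img: "act a b c d ` A = A" by (rule endo_inj_surj[OF finA sub inj])
      have "act a b c d Pr = (\<Prod>g\<in>A. act a b c d g + cst (- L))"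
        unfolding Pr_def act_prod[OF u] act_hom[OF u] ..
      also have "\<dots> = (\<Prod>g\<in>act a b c d ` A. g + cst (- L))" by (simp add: prod.reindex[OF inj])
      also have "\<dots> = Pr" unfolding img Pr_def ..
      finally show ?thesis .
    qed
    have inv: "\<phi> (moebius a b c d z) = \<phi> z" if u: "unimod a b c d" and z: "Im z > 0" for a b c d z
    proof (rule holomorphic_uhp_eqI[OF holomorphic_moebius[OF unimod_real[OF u] \<phi>(1)] \<phi>(1) _ z])
      show "abs_mero_uhp (\<lambda>z. \<phi> (moebius a b c d z)) = abs_mero_uhp \<phi>"
        using actPr[OF u] unfolding act_def \<phi>(2)
        by (simp add: mero_uhp_pullback[OF holomorphic_imp_meromorphic_uhp[OF \<phi>(1)] unimod_real[OF u]])
    qed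
    have "\<phi> z = 0" if "Im z > 0" for z
      by (rule invariant_decaying_zero[OF \<phi>(1) inv \<phi>(3) e that])
    then have "\<forall>\<^sub>F w in at \<i>. \<phi> w = 0"
      using eventually_at_in_open'[OF open_upper_half_plane, of \<i>] by (auto elim: eventually_mono)
    then have "Pr = 0" unfolding \<phi>(2)
      by (intro zero_if_eventually_zero[of _ \<i>] holomorphic_imp_meromorphic_uhp \<phi>) simp_all
    then obtain g where g: "g \<in> A" "g + cst (- L) = 0" unfolding Pr_def using finA by auto
    then obtain a b c d where u: "unimod a b c d" "g = act a b c d f" unfolding A_def translates_def by blast
    have gL: "act a b c d f = cst L" using g(2) u(2) by (simp add: cst_uminus)
    have uinv: "unimod d (- b) (- c) a" by (rule unimod_inverse[OF u(1)])
    have "act d (- b) (- c) a (act a b c d f) = act (a * d - b * c) 0 0 (a * d - b * c) f"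
      using act_act[OF uinv u(1), of f] by (simp add: algebra_simps)
    then have "f = act d (- b) (- c) a (cst L)" using u(1) act_one gL by (simp add: unimod_def)
    then show ?thesis using act_hom(5)[OF uinv] by blast
  qed
qed

section \<open>The functions generating the function field of \<open>X\<^sub>0(44)\<close>\<close>

lemma
  shows P11_holomorphic: "P11 holomorphic_on upper_half_plane"
    and N11_holomorphic: "N11 holomorphic_on upper_half_plane"
    and R11_holomorphic: "R11 holomorphic_on upper_half_plane"
    and Q11_holomorphic: "Q11 holomorphic_on upper_half_plane"
proof -
  have th: "theta M h holomorphic_on upper_half_plane" "(\<lambda>s. theta M h (11 * s)) holomorphic_on upper_half_plane" if "M > 0" for M h
    using theta_holomorphic[OF that, of h]
    by (auto intro!: holomorphic_on_compose_gen[of "\<lambda>s. 11 * s" _ _ "{s. Im s > 0}", unfolded o_def] holomorphic_intros)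
  show "P11 holomorphic_on upper_half_plane" "N11 holomorphic_on upper_half_plane"
    "R11 holomorphic_on upper_half_plane" "Q11 holomorphic_on upper_half_plane"
    unfolding P11_def N11_def R11_def Q11_def th2_def th3_def th4_def
    by (intro holomorphic_intros th; simp)+
qed

definition Sig11 :: "complex \<Rightarrow> complex" where "Sig11 s = P11 s - N11 s - R11 s"

lemma growth_eleven:
  assumes "growth r f" "r \<le> 0"
  shows "growth r (\<lambda>s. f (11 * s))"
  using growth_mono[of "11 * r" "\<lambda>s. f (11 * s)" r] growth_affine[OF assms(1), of 11 0] assms(2) by simp

lemma growth_prod_minus_1:
  assumes f: "growth r (\<lambda>s. f s - 1)" and g: "growth r (\<lambda>s. g s - 1)" and r: "r \<le> 0"
  shows "growth r (\<lambda>s. f s * g s - 1)"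
proof -
  have "growth (r + r) (\<lambda>s. (f s - 1) * (g s - 1))" by (rule growth_mult[OF f g])
  then have "growth r (\<lambda>s. (f s - 1) * (g s - 1))" by (rule growth_mono) (use r in simp)
  from growth_add[OF this growth_add[OF f g]] show ?thesis by (simp add: algebra_simps)
qed

text \<open>The leading term of \<open>R11\<close> is 2 exp(pi i s / 4) times 2 exp(11 pi i s / 4);
  P and N tend to 1, so \<open>R11\<close> is the only one of the three that decays.\<close>

lemma
  shows P11_growth: "growth (- pi) (\<lambda>s. P11 s - 1)" and N11_growth: "growth (- pi) (\<lambda>s. N11 s - 1)"
    and R11_growth: "growth (- (5 * pi)) (\<lambda>s. R11 s - 4 * exp (\<i> * pi * s * of_real 3))"
    and Q11_growth: "growth 0 Q11"
proof -
  show "growth (- pi) (\<lambda>s. P11 s - 1)" "growth (- pi) (\<lambda>s. N11 s - 1)"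
    unfolding P11_def N11_def
    by (intro growth_prod_minus_1 growth_eleven[where f="\<lambda>s. th3 s - 1"] growth_eleven[where f="\<lambda>s. th4 s - 1"] th3_growth th4_growth; simp)+
  define E where "E s = 2 * exp (\<i> * pi * s * of_real (1 / 4))" for s
  have th2: "growth (- (9 / 4 * pi)) (\<lambda>s. th2 s - E s)" unfolding E_def by (rule th2_growth)
  have E: "growth (- (pi / 4)) E" unfolding E_def using growth_cmult[OF growth_exp[of "1 / 4"], of 2] by simp
  have th2': "growth (- (99 / 4 * pi)) (\<lambda>s. th2 (11 * s) - E (11 * s))" and E': "growth (- (11 / 4 * pi)) (\<lambda>s. E (11 * s))"
    using growth_affine[OF th2, of 11 0] growth_affine[OF E, of 11 0] by simp_all
  have "growth (- (9 / 4 * pi) + - (99 / 4 * pi)) (\<lambda>s. (th2 s - E s) * (th2 (11 * s) - E (11 * s)))"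
    "growth (- (9 / 4 * pi) + - (11 / 4 * pi)) (\<lambda>s. (th2 s - E s) * E (11 * s))"
    "growth (- (pi / 4) + - (99 / 4 * pi)) (\<lambda>s. E s * (th2 (11 * s) - E (11 * s)))"
    by (intro growth_mult th2 th2' E E')+
  then have "growth (- (5 * pi)) (\<lambda>s. (th2 s - E s) * (th2 (11 * s) - E (11 * s)))"
    "growth (- (5 * pi)) (\<lambda>s. (th2 s - E s) * E (11 * s))"
    "growth (- (5 * pi)) (\<lambda>s. E s * (th2 (11 * s) - E (11 * s)))"
    by (auto elim!: growth_mono)
  then have "growth (- (5 * pi)) (\<lambda>s. (th2 s - E s) * (th2 (11 * s) - E (11 * s)) + ((th2 s - E s) * E (11 * s) + E s * (th2 (11 * s) - E (11 * s))))"
    by (intro growth_add)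
  moreover have "(th2 s - E s) * (th2 (11 * s) - E (11 * s)) + ((th2 s - E s) * E (11 * s) + E s * (th2 (11 * s) - E (11 * s))) =
      R11 s - 4 * exp (\<i> * pi * s * of_real 3)" for s
  proof -
    have "E s * E (11 * s) = 4 * exp (\<i> * pi * s * of_real (1 / 4) + \<i> * pi * (11 * s) * of_real (1 / 4))"
      by (simp only: E_def exp_add) simp
    also have "\<i> * pi * s * of_real (1 / 4) + \<i> * pi * (11 * s) * of_real (1 / 4) = \<i> * pi * s * of_real 3"
      by (simp add: field_simps)
    finally show ?thesis by (simp add: R11_def algebra_simps)
  qed
  ultimately show "growth (- (5 * pi)) (\<lambda>s. R11 s - 4 * exp (\<i> * pi * s * of_real 3))" by simp
  have t: "growth 0 (theta 2 0)" "growth 0 (theta 2 1)"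
  proof -
    have "growth 0 (\<lambda>s. theta 2 0 s - 1)" using theta_growth(4) by (rule growth_mono) simp
    from growth_add[OF this growth_const[of 1]] show "growth 0 (theta 2 0)" by simp
    show "growth 0 (theta 2 1)" using theta_growth(5) by (rule growth_mono) simp
  qed
  have "growth (0 + 0) (\<lambda>s. theta 2 0 s * theta 2 0 (11 * s))" "growth (0 + 0) (\<lambda>s. theta 2 1 s * theta 2 1 (11 * s))"
    by (intro growth_mult growth_eleven t order_refl)+
  then show "growth 0 Q11" unfolding Q11_def by (intro growth_add) simp_all
qed

lemma
  shows P11_growth_0: "growth 0 P11" and N11_growth_0: "growth 0 N11" and R11_growth_3: "growth (- (3 * pi)) R11"
    and inverse_P11_growth: "growth 0 (\<lambda>s. inverse (P11 s))" and inverse_N11_growth: "growth 0 (\<lambda>s. inverse (N11 s))"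
    and inverse_R11_growth: "growth (3 * pi) (\<lambda>s. inverse (R11 s))"
    and Sig11_growth: "growth (- pi) Sig11"
proof -
  have "growth 0 (\<lambda>s. P11 s - 1)" using P11_growth by (rule growth_mono) simp
  from growth_add[OF this growth_const[of 1]] show "growth 0 P11" by simp
  have "growth 0 (\<lambda>s. N11 s - 1)" using N11_growth by (rule growth_mono) simp
  from growth_add[OF this growth_const[of 1]] show "growth 0 N11" by simp
  have "growth (- (3 * pi)) (\<lambda>s. R11 s - 4 * exp (\<i> * pi * s * of_real 3))" using R11_growth by (rule growth_mono) simp
  moreover have "growth (- (3 * pi)) (\<lambda>s. 4 * exp (\<i> * pi * s * of_real 3))"
    using growth_cmult[OF growth_exp[of 3], of 4] by (simp add: mult.commute)
  ultimately have "growth (- (3 * pi)) (\<lambda>s. R11 s - 4 * exp (\<i> * pi * s * of_real 3) + 4 * exp (\<i> * pi * s * of_real 3))"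
    by (rule growth_add)
  then show R: "growth (- (3 * pi)) R11" by simp
  show "growth 0 (\<lambda>s. inverse (P11 s))" "growth 0 (\<lambda>s. inverse (N11 s))"
    using growth_inverse[OF P11_growth, of 0 1] growth_inverse[OF N11_growth, of 0 1] by simp_all
  have nrm: "norm (4 * exp (\<i> * pi * s * of_real 3)) = 4 * exp (- (3 * pi) * Im s)" for s
    by (simp add: norm_mult norm_exp_eq_Re)
  show "growth (3 * pi) (\<lambda>s. inverse (R11 s))"
    using growth_inverse[OF R11_growth, of "- (3 * pi)" 4] nrm by simp
  have "growth (- pi) R11" using R by (rule growth_mono) simp
  from growth_diff[OF growth_diff[OF P11_growth N11_growth] this] show "growth (- pi) Sig11"
    by (simp add: Sig11_def[abs_def])
qed

lemma H11_growth: "growth 0 (H11 p r)"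
proof -
  have "growth 0 R11" using R11_growth_3 by (rule growth_mono) simp
  then show ?thesis
    using growth_uminus[OF \<open>growth 0 R11\<close>] growth_uminus[OF N11_growth_0] P11_growth_0
    unfolding H11_def by (cases "even p"; cases "even r") simp_all
qed

lemma inverse_H11_growth: "growth (if even p then 3 * pi else 0) (\<lambda>s. inverse (H11 p r s))"
  using growth_uminus[OF inverse_R11_growth] growth_uminus[OF inverse_N11_growth] inverse_P11_growth
  unfolding H11_def by (cases "even p"; cases "even r") simp_all

text \<open>Two vectors independent modulo 2 and their sum are the three nonzero vectors modulo 2,
  so the left sides are symmetric functions of P, -N, -R.\<close>

lemma H11_sum:
  assumes "odd (p * q' - r * p')"
  shows "H11 p r s + H11 p' q' s + H11 (p + p') (r + q') s = Sig11 s"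
    and "H11 p r s * H11 p' q' s * H11 (p + p') (r + q') s = P11 s * N11 s * R11 s"
  using assms by (cases "even p"; cases "even q'"; cases "even r"; cases "even p'"; simp add: H11_def Sig11_def)+

text \<open>For even c, the argument 2 z turns a matrix into (a, 2 b; c / 2, d), which is trivial
  modulo 2 as soon as 4 divides c. This is how the level becomes 44.\<close>

definition x44 :: "complex \<Rightarrow> complex" where "x44 z = (P11 (2 * z) - N11 (2 * z)) / R11 (2 * z)"
definition y44 :: "complex \<Rightarrow> complex" where "y44 z = 2 * (P11 (2 * z) + N11 (2 * z)) / R11 (2 * z)"
definition t44 :: "complex \<Rightarrow> complex" where "t44 z = 4 * Q11 (2 * z) / R11 (2 * z)"
text \<open>The modular equation says that this function is the constant 16.\<close>

definition e44 :: "complex \<Rightarrow> complex" where "e44 z = Sig11 (2 * z) ^ 3 / (P11 (2 * z) * N11 (2 * z) * R11 (2 * z))"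

lemma
  shows x44_holomorphic: "x44 holomorphic_on upper_half_plane"
    and y44_holomorphic: "y44 holomorphic_on upper_half_plane"
    and t44_holomorphic: "t44 holomorphic_on upper_half_plane"
    and e44_holomorphic: "e44 holomorphic_on upper_half_plane"
proof -
  have c: "(\<lambda>z. f (2 * z)) holomorphic_on upper_half_plane" if "f holomorphic_on upper_half_plane" for f
    by (rule holomorphic_on_compose_gen[OF _ that, unfolded o_def]) (auto intro!: holomorphic_intros)
  note cs = c[OF P11_holomorphic] c[OF N11_holomorphic] c[OF R11_holomorphic] c[OF Q11_holomorphic]
  show "x44 holomorphic_on upper_half_plane" "y44 holomorphic_on upper_half_plane"
    "t44 holomorphic_on upper_half_plane" "e44 holomorphic_on upper_half_plane"
    unfolding x44_def y44_def t44_def e44_def Sig11_def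
    by (intro holomorphic_intros cs; simp add: R11_nonzero P11_nonzero N11_nonzero)+
qed

text \<open>diag(2, 1) times the matrix is unimodular times upper triangular. For even c the
  triangular factor is diag(2, 1) again, for odd c it is (1, e; 0, 2) with e chosen to make d - c e
  even.\<close>

lemma moebius_double:
  assumes u: "unimod a b c d"
  obtains a' b' c' d' :: int and \<alpha> \<beta> :: real where "unimod a' b' c' d'" "\<alpha> \<ge> 1 / 2"
    "\<And>z. Im z > 0 \<Longrightarrow> 2 * moebius a b c d z = moebius a' b' c' d' (of_real \<alpha> * z + of_real \<beta>)"
    "even c' \<longleftrightarrow> 4 dvd c" "even c \<Longrightarrow> a' = a \<and> b' = 2 * b \<and> c = 2 * c' \<and> d' = d \<and> \<alpha> = 2 \<and> \<beta> = 0"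
proof (cases "even c")
  case True
  then obtain c' where c': "c = 2 * c'" by blast
  show ?thesis
  proof (rule that[of a "2 * b" c' d 2 0])
    show "unimod a (2 * b) c' d" using u c' by (simp add: unimod_def)
    show "2 * moebius a b c d z = moebius a (2 * b) c' d (of_real 2 * z + of_real 0)" for z
      by (simp add: moebius_def c' algebra_simps)
    show "even c' \<longleftrightarrow> 4 dvd c" unfolding c' by presburger
  qed (use c' in auto)
next
  case False
  define e :: int where "e = (if even d then 0 else 1)"
  have "even (d - c * e)" using False by (simp add: e_def)
  then obtain d' where d': "d - c * e = 2 * d'" by blast
  have n4: "\<not> 4 dvd c" using False by presburger
  show ?thesis
  proof (rule that[of "2 * a" "b - a * e" c d' "1 / 2" "e / 2"])
    have "2 * a * d' - (b - a * e) * c = a * (2 * d') - b * c + a * e * c" by (simp add: algebra_simps)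
    also have "\<dots> = a * d - b * c" unfolding d'[symmetric] by (simp add: algebra_simps)
    finally show "unimod (2 * a) (b - a * e) c d'" using u by (simp add: unimod_def)
    fix z
    have dd: "complex_of_int d = of_int c * of_int e + 2 * of_int d'" using arg_cong[OF d', of complex_of_int] by (simp add: algebra_simps)
    have num: "complex_of_int (2 * a) * (of_real (1 / 2) * z + of_real (e / 2)) + of_int (b - a * e) = of_int a * z + of_int b"
      by (simp add: algebra_simps)
    have den: "complex_of_int c * (of_real (1 / 2) * z + of_real (e / 2)) + of_int d' = (of_int c * z + of_int d) / 2"
      by (simp add: dd field_simps)
    show "2 * moebius a b c d z = moebius (real_of_int (2 * a)) (real_of_int (b - a * e)) (real_of_int c) (real_of_int d') (of_real (1 / 2) * z + of_real (e / 2))"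
      unfolding moebius_def of_real_of_int_eq num den by simp
  qed (use False n4 in auto)
qed

text \<open>
  Doubling the argument and passing to \<open>11 s\<close> both turn \<open>\<gamma>\<close> into a unimodular times a triangular
  matrix; \<open>\<alpha> z + \<beta>\<close> is the action of the product of the two triangular factors.
\<close>

lemma functions_at_cusp:
  assumes u: "unimod a b c d"
  obtains \<alpha> \<beta> :: real and p q r s :: int and \<epsilon> :: complex
  where "\<alpha> \<ge> 1 / 22" "even r \<longleftrightarrow> 4 dvd c" "odd (p * s - q * r)" "\<epsilon> = 1 \<or> \<epsilon> = - 1"
    "\<And>z. Im z > 0 \<Longrightarrow> x44 (moebius a b c d z) = - (H11 (p + r) (q + s) (of_real \<alpha> * z + of_real \<beta>) + H11 p q (of_real \<alpha> * z + of_real \<beta>)) / H11 r s (of_real \<alpha> * z + of_real \<beta>)"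
    "\<And>z. Im z > 0 \<Longrightarrow> y44 (moebius a b c d z) = - 2 * (H11 (p + r) (q + s) (of_real \<alpha> * z + of_real \<beta>) - H11 p q (of_real \<alpha> * z + of_real \<beta>)) / H11 r s (of_real \<alpha> * z + of_real \<beta>)"
    "\<And>z. Im z > 0 \<Longrightarrow> t44 (moebius a b c d z) = - 4 * \<epsilon> * Q11 (of_real \<alpha> * z + of_real \<beta>) / H11 r s (of_real \<alpha> * z + of_real \<beta>)"
    "\<And>z. Im z > 0 \<Longrightarrow> e44 (moebius a b c d z) = Sig11 (of_real \<alpha> * z + of_real \<beta>) ^ 3 / (P11 (of_real \<alpha> * z + of_real \<beta>) * N11 (of_real \<alpha> * z + of_real \<beta>) * R11 (of_real \<alpha> * z + of_real \<beta>))"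
    "44 dvd c \<Longrightarrow> p = a \<and> q = 2 * b \<and> c = 2 * r \<and> s = d \<and> \<alpha> = 2 \<and> \<beta> = 0 \<and> \<epsilon> = 1"
proof -
  obtain p q r s :: int and \<alpha>0 \<beta>0 :: real where 1: "unimod p q r s" "\<alpha>0 \<ge> 1 / 2"
    "\<And>z. Im z > 0 \<Longrightarrow> 2 * moebius a b c d z = moebius p q r s (of_real \<alpha>0 * z + of_real \<beta>0)"
    "even r \<longleftrightarrow> 4 dvd c" "even c \<Longrightarrow> p = a \<and> q = 2 * b \<and> c = 2 * r \<and> s = d \<and> \<alpha>0 = 2 \<and> \<beta>0 = 0"
    using moebius_double[OF u] by metis
  obtain \<alpha> \<beta> :: real where 2: "\<alpha> \<ge> 1 / 22" "\<And>z. cusp_rel r s (of_real \<alpha>0 * z + of_real \<beta>0) (of_real \<alpha> * z + of_real \<beta>)"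
    "11 dvd r \<Longrightarrow> \<alpha> = \<alpha>0 \<and> \<beta> = \<beta>0"
  proof (cases "11 dvd r")
    case True
    then show ?thesis using that[of \<alpha>0 \<beta>0] 1(2) by (simp add: cusp_rel_def)
  next
    case False
    \<comment> \<open>l depends on the bottom row only, so the value found at 0 serves all
      z.\<close>
    obtain s' where "cusp_rel r s 0 s'" using cusp_rel_exists by blast
    then obtain l where l: "even l" "11 dvd r * l - s" using False by (auto simp: cusp_rel_def)
    have "cusp_rel r s (of_real \<alpha>0 * z + of_real \<beta>0) (of_real (\<alpha>0 / 11) * z + of_real ((\<beta>0 + l) / 11))" for z
      unfolding cusp_rel_def if_not_P[OF False] using l by (intro exI[of _ l]) (simp add: field_simps)
    then show ?thesis using that[of "\<alpha>0 / 11" "(\<beta>0 + l) / 11"] 1(2) False by simp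
  qed
  define \<epsilon> where "\<epsilon> = sgn2 p q r s * sgn11 r"
  have rel: "modular_rel p q r s" using 1(1) by (intro modular_rel) (simp add: unimod_def)
  have odd_det: "odd (p * s - q * r)" using 1(1) by (simp add: unimod_def)
  have key: "\<exists>\<kappa>. \<kappa> \<noteq> 0 \<and> P11 (2 * moebius a b c d z) = \<kappa> * H11 (p + r) (q + s) (of_real \<alpha> * z + of_real \<beta>) \<and>
     N11 (2 * moebius a b c d z) = - \<kappa> * H11 p q (of_real \<alpha> * z + of_real \<beta>) \<and>
     R11 (2 * moebius a b c d z) = - \<kappa> * H11 r s (of_real \<alpha> * z + of_real \<beta>) \<and>
     Q11 (2 * moebius a b c d z) = \<kappa> * \<epsilon> * Q11 (of_real \<alpha> * z + of_real \<beta>)" if z: "Im z > 0" for z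
  proof -
    have z0: "Im (of_real \<alpha>0 * z + of_real \<beta>0) > 0" using 1(2) z by simp
    obtain \<kappa> where \<kappa>: "\<And>p' r'. odd p' \<or> odd r' \<Longrightarrow> H11 p' r' (moebius p q r s (of_real \<alpha>0 * z + of_real \<beta>0)) = \<kappa> * H11 (p' * p + r' * r) (p' * q + r' * s) (of_real \<alpha> * z + of_real \<beta>)"
      "Q11 (moebius p q r s (of_real \<alpha>0 * z + of_real \<beta>0)) = \<kappa> * sgn2 p q r s * sgn11 r * Q11 (of_real \<alpha> * z + of_real \<beta>)"
      using modular_relD[OF rel z0 2(2)] by blast
    have "\<kappa> \<noteq> 0"
    proof
      assume "\<kappa> = 0"
      then have "H11 1 1 (moebius p q r s (of_real \<alpha>0 * z + of_real \<beta>0)) = 0" using \<kappa>(1)[of 1 1] by simp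
      then show False using H11_nonzero[OF Im_moebius_pos[OF unimod_real[OF 1(1)] z0]] by blast
    qed
    then show ?thesis
      using \<kappa>(1)[of 1 1] \<kappa>(1)[of 1 0] \<kappa>(1)[of 0 1] \<kappa>(2) unfolding 1(3)[OF z, symmetric] \<epsilon>_def
      by (intro exI[of _ \<kappa>]) (simp add: H11_def[of 1 1] H11_def[of 1 0] H11_def[of 0 1] equation_minus_iff[of "N11 _"] equation_minus_iff[of "R11 _"] minus_equation_iff[of "N11 _"] minus_equation_iff[of "R11 _"])
  qed
  have s\<alpha>: "Im (of_real \<alpha> * z + of_real \<beta>) > 0" if "Im z > 0" for z using 2(1) that by simp
  show ?thesis
  proof (rule that[where \<alpha>=\<alpha> and \<beta>=\<beta> and p=p and q=q and r=r and s=s and \<epsilon>=\<epsilon>])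
    show "\<epsilon> = 1 \<or> \<epsilon> = - 1" by (auto simp: \<epsilon>_def sgn2_def sgn11_def)
    fix z assume z: "Im z > 0"
    obtain \<kappa> where k: "\<kappa> \<noteq> 0" "P11 (2 * moebius a b c d z) = \<kappa> * H11 (p + r) (q + s) (of_real \<alpha> * z + of_real \<beta>)"
     "N11 (2 * moebius a b c d z) = - \<kappa> * H11 p q (of_real \<alpha> * z + of_real \<beta>)"
     "R11 (2 * moebius a b c d z) = - \<kappa> * H11 r s (of_real \<alpha> * z + of_real \<beta>)"
     "Q11 (2 * moebius a b c d z) = \<kappa> * \<epsilon> * Q11 (of_real \<alpha> * z + of_real \<beta>)" using key[OF z] by blast
    have nz: "H11 r s (of_real \<alpha> * z + of_real \<beta>) \<noteq> 0" by (rule H11_nonzero[OF s\<alpha>[OF z]])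
    show "x44 (moebius a b c d z) = - (H11 (p + r) (q + s) (of_real \<alpha> * z + of_real \<beta>) + H11 p q (of_real \<alpha> * z + of_real \<beta>)) / H11 r s (of_real \<alpha> * z + of_real \<beta>)"
      "y44 (moebius a b c d z) = - 2 * (H11 (p + r) (q + s) (of_real \<alpha> * z + of_real \<beta>) - H11 p q (of_real \<alpha> * z + of_real \<beta>)) / H11 r s (of_real \<alpha> * z + of_real \<beta>)"
      "t44 (moebius a b c d z) = - 4 * \<epsilon> * Q11 (of_real \<alpha> * z + of_real \<beta>) / H11 r s (of_real \<alpha> * z + of_real \<beta>)"
      unfolding x44_def y44_def t44_def k(2-) using k(1) nz by (simp_all add: field_simps)
    have "Sig11 (2 * moebius a b c d z) = \<kappa> * (H11 p q (of_real \<alpha> * z + of_real \<beta>) + H11 r s (of_real \<alpha> * z + of_real \<beta>) + H11 (p + r) (q + s) (of_real \<alpha> * z + of_real \<beta>))"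
      unfolding Sig11_def k(2-) by (simp add: algebra_simps)
    then have S: "Sig11 (2 * moebius a b c d z) = \<kappa> * Sig11 (of_real \<alpha> * z + of_real \<beta>)"
      by (simp only: H11_sum(1)[OF odd_det])
    have "P11 (2 * moebius a b c d z) * N11 (2 * moebius a b c d z) * R11 (2 * moebius a b c d z) = \<kappa> ^ 3 * (H11 p q (of_real \<alpha> * z + of_real \<beta>) * H11 r s (of_real \<alpha> * z + of_real \<beta>) * H11 (p + r) (q + s) (of_real \<alpha> * z + of_real \<beta>))"
      unfolding k(2-) by (simp add: power3_eq_cube)
    then have Pr: "P11 (2 * moebius a b c d z) * N11 (2 * moebius a b c d z) * R11 (2 * moebius a b c d z) = \<kappa> ^ 3 * (P11 (of_real \<alpha> * z + of_real \<beta>) * N11 (of_real \<alpha> * z + of_real \<beta>) * R11 (of_real \<alpha> * z + of_real \<beta>))"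
      by (simp only: H11_sum(2)[OF odd_det])
    show "e44 (moebius a b c d z) = Sig11 (of_real \<alpha> * z + of_real \<beta>) ^ 3 / (P11 (of_real \<alpha> * z + of_real \<beta>) * N11 (of_real \<alpha> * z + of_real \<beta>) * R11 (of_real \<alpha> * z + of_real \<beta>))"
      unfolding e44_def S Pr using k(1) by (simp add: power_mult_distrib)
  next
    assume "44 dvd c"
    then have ev: "even c" by auto
    have "11 dvd r" using 1(5)[OF ev] \<open>44 dvd c\<close> by presburger
    moreover have "even r" using 1(4) \<open>44 dvd c\<close> by presburger
    ultimately show "p = a \<and> q = 2 * b \<and> c = 2 * r \<and> s = d \<and> \<alpha> = 2 \<and> \<beta> = 0 \<and> \<epsilon> = 1"
      using 1(5)[OF ev] 2(3) by (simp add: \<epsilon>_def sgn2_def sgn11_def)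
  qed (use 1 2 odd_det in auto)
qed

lemma abs_mero_uhp_cong:
  assumes "\<phi> holomorphic_on upper_half_plane" "\<And>z. Im z > 0 \<Longrightarrow> \<phi> z = \<psi> z"
  shows "abs_mero_uhp \<phi> = abs_mero_uhp \<psi>"
proof (subst mero_uhp_eq_iff)
  show "\<phi> meromorphic_on upper_half_plane" by (rule holomorphic_imp_meromorphic_uhp[OF assms(1)])
  have "\<psi> holomorphic_on upper_half_plane"
    by (rule holomorphic_transform[OF assms(1)]) (use assms(2) in auto)
  then show "\<psi> meromorphic_on upper_half_plane" by (rule holomorphic_imp_meromorphic_uhp)
  show "\<forall>z. Im z > 0 \<longrightarrow> (\<forall>\<^sub>F w in at z. \<phi> w = \<psi> w)"
  proof (intro allI impI)
    fix z assume "Im z > 0"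
    then have "\<forall>\<^sub>F w in at z. w \<in> upper_half_plane"
      by (intro eventually_at_in_open'[OF open_upper_half_plane]) auto
    then show "\<forall>\<^sub>F w in at z. \<phi> w = \<psi> w" by eventually_elim (use assms(2) in auto)
  qed
qed

lemma act_abs_mero_uhp:
  assumes "\<phi> holomorphic_on upper_half_plane" "unimod a b c d"
  shows "act a b c d (abs_mero_uhp \<phi>) = abs_mero_uhp (\<lambda>z. \<phi> (moebius a b c d z))"
  unfolding act_def by (rule mero_uhp_pullback[OF holomorphic_imp_meromorphic_uhp[OF assms(1)] unimod_real[OF assms(2)]])

text \<open>Growth yields an expansion once a period is known, and N is a period at every cusp
  because gamma T^N gamma^-1 lies in Gamma_0(N).\<close>

lemma X0_fieldI_growth:
  assumes hol: "\<psi> holomorphic_on upper_half_plane" and N: "N > 0"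
    and inv: "\<And>a b c d z. unimod a b c d \<Longrightarrow> int N dvd c \<Longrightarrow> Im z > 0 \<Longrightarrow> \<psi> (moebius a b c d z) = \<psi> z"
    and gr: "\<And>a b c d. unimod a b c d \<Longrightarrow> \<exists>r. growth r (\<lambda>z. \<psi> (moebius a b c d z))"
  shows "abs_mero_uhp \<psi> \<in> X0_field N"
proof (rule X0_fieldI)
  fix a b c d :: int assume u: "unimod a b c d"
  have hol': "(\<lambda>z. \<psi> (moebius a b c d z)) holomorphic_on upper_half_plane"
    by (rule holomorphic_moebius[OF unimod_real[OF u] hol])
  show "act a b c d (abs_mero_uhp \<psi>) = abs_mero_uhp \<psi>" if "int N dvd c"
    unfolding act_abs_mero_uhp[OF hol u] by (rule abs_mero_uhp_cong[OF hol']) (use inv[OF u that] in auto)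
  obtain r where r: "growth r (\<lambda>z. \<psi> (moebius a b c d z))" using gr[OF u] by blast
  have "\<exists>F. has_q_expansion N (abs_mero_uhp (\<lambda>z. \<psi> (moebius a b c d z))) F"
  proof (rule has_q_expansion_if_growth[OF hol' N _ r])
    fix z assume z: "Im z > 0"
    have m: "Im (moebius a b c d z) > 0" by (rule Im_moebius_pos[OF unimod_real[OF u] z])
    define n where "n = int N"
    \<comment> \<open>The entries of gamma T^n gamma^-1.\<close>
    have ud: "unimod (1 - a * c * n) (a * a * n) (- c * c * n) (1 + a * c * n)" by (simp add: unimod_def algebra_simps)
    have ad: "a * d = 1 + b * c" using u by (simp add: unimod_def)
    have e: "(1 - a * c * n) * a + a * a * n * c = a" "(1 - a * c * n) * b + a * a * n * d = b + a * n"
       "- c * c * n * a + (1 + a * c * n) * c = c" "- c * c * n * b + (1 + a * c * n) * d = d + c * n"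
    proof -
      have "(1 - a * c * n) * b + a * a * n * d = b + a * n * (a * d - b * c)" by (simp add: algebra_simps)
      then show "(1 - a * c * n) * b + a * a * n * d = b + a * n" by (simp add: ad)
      have "- c * c * n * b + (1 + a * c * n) * d = d + c * n * (a * d - b * c)" by (simp add: algebra_simps)
      then show "- c * c * n * b + (1 + a * c * n) * d = d + c * n" by (simp add: ad)
    qed (simp_all add: algebra_simps)
    have "moebius a b c d (z + of_nat N) = moebius (real_of_int a) (real_of_int (b + a * n)) (real_of_int c) (real_of_int (d + c * n)) z"
      by (simp add: moebius_def n_def algebra_simps)
    also have "\<dots> = moebius (real_of_int (1 - a * c * n)) (real_of_int (a * a * n)) (real_of_int (- c * c * n)) (real_of_int (1 + a * c * n)) (moebius a b c d z)"
      unfolding moebius_moebius[OF unimod_real[OF u] unimod_real[OF ud] z] by (simp only: of_int_mult[symmetric] of_int_add[symmetric] e)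
    finally have "\<psi> (moebius a b c d (z + of_nat N)) = \<psi> (moebius (real_of_int (1 - a * c * n)) (real_of_int (a * a * n)) (real_of_int (- c * c * n)) (real_of_int (1 + a * c * n)) (moebius a b c d z))"
      by (rule arg_cong)
    also have "\<dots> = \<psi> (moebius a b c d z)" by (rule inv[OF ud _ m]) (simp add: n_def)
    finally show "\<psi> (moebius a b c d (z + of_nat N)) = \<psi> (moebius a b c d z)" .
  qed
  then show "\<exists>h>0. \<exists>F. has_q_expansion h (act a b c d (abs_mero_uhp \<psi>)) F"
    unfolding act_abs_mero_uhp[OF hol u] by (intro exI[of _ N] conjI N)
qed

lemma growth_zero_const:
  assumes "growth r (\<lambda>_. k)" "r < 0"
  shows "k = 0"
proof (rule ccontr)
  assume k: "k \<noteq> 0"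
  have "growth r (\<lambda>_. 0 - (- k))" using assms(1) by simp
  from growth_lower[OF this, of 0 "norm k"] assms(2) k
  obtain c where "c \<ge> 0" "\<And>s. Im s > c \<Longrightarrow> norm (0::complex) \<ge> norm k / 2 * exp (0 * Im s)" by auto
  from this(2)[of "\<i> * of_real (c + 1)"] k show False by simp
qed

lemma growth_div_H11:
  assumes "growth r f" "\<alpha> > 0"
  shows "growth (\<alpha> * (r + (if even p then 3 * pi else 0))) (\<lambda>z. f (of_real \<alpha> * z + of_real \<beta>) / H11 p q (of_real \<alpha> * z + of_real \<beta>))"
  using growth_affine[OF growth_mult[OF assms(1) inverse_H11_growth[of p q]] assms(2), of \<beta>] by (simp add: divide_inverse)

abbreviation "X44 \<equiv> abs_mero_uhp x44"
abbreviation "Y44 \<equiv> abs_mero_uhp y44"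
abbreviation "T44 \<equiv> abs_mero_uhp t44"

text \<open>At the cusp x - 1 is - \<open>Sig11\<close> / \<open>H11 r s\<close>. If 4 does not
  divide c, then r is odd and the denominator is P or -N, which does not decay; \<open>Sig11\<close>
  does, and \<open>\<alpha> \<ge> 1 / 22\<close> gives the rate. For \<open>e44\<close> the decay 3
  pi of the cube of \<open>Sig11\<close> balances the growth of 1 / \<open>R11\<close> at every
  cusp.\<close>

lemma cusp_growth:
  assumes u: "unimod a b c d"
  shows "\<exists>r. growth r (\<lambda>z. x44 (moebius a b c d z))" "\<exists>r. growth r (\<lambda>z. y44 (moebius a b c d z))"
    "\<exists>r. growth r (\<lambda>z. t44 (moebius a b c d z))" "growth 0 (\<lambda>z. e44 (moebius a b c d z))"
    "\<not> 4 dvd c \<Longrightarrow> growth (- (pi / 22)) (\<lambda>z. x44 (moebius a b c d z) - 1)"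
    "\<not> 4 dvd c \<Longrightarrow> growth 0 (\<lambda>z. y44 (moebius a b c d z))"
    "\<not> 4 dvd c \<Longrightarrow> growth 0 (\<lambda>z. t44 (moebius a b c d z))"
proof -
  obtain \<alpha> \<beta> :: real and p q r s :: int and \<epsilon> :: complex where *: "\<alpha> \<ge> 1 / 22" "even r \<longleftrightarrow> 4 dvd c" "odd (p * s - q * r)" "\<epsilon> = 1 \<or> \<epsilon> = - 1"
    "\<And>z. Im z > 0 \<Longrightarrow> x44 (moebius a b c d z) = - (H11 (p + r) (q + s) (of_real \<alpha> * z + of_real \<beta>) + H11 p q (of_real \<alpha> * z + of_real \<beta>)) / H11 r s (of_real \<alpha> * z + of_real \<beta>)"
    "\<And>z. Im z > 0 \<Longrightarrow> y44 (moebius a b c d z) = - 2 * (H11 (p + r) (q + s) (of_real \<alpha> * z + of_real \<beta>) - H11 p q (of_real \<alpha> * z + of_real \<beta>)) / H11 r s (of_real \<alpha> * z + of_real \<beta>)"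
    "\<And>z. Im z > 0 \<Longrightarrow> t44 (moebius a b c d z) = - 4 * \<epsilon> * Q11 (of_real \<alpha> * z + of_real \<beta>) / H11 r s (of_real \<alpha> * z + of_real \<beta>)"
    "\<And>z. Im z > 0 \<Longrightarrow> e44 (moebius a b c d z) = Sig11 (of_real \<alpha> * z + of_real \<beta>) ^ 3 / (P11 (of_real \<alpha> * z + of_real \<beta>) * N11 (of_real \<alpha> * z + of_real \<beta>) * R11 (of_real \<alpha> * z + of_real \<beta>))"
    by (rule functions_at_cusp[OF u]) blast
  have \<alpha>: "\<alpha> > 0" using *(1) by simp
  define k where "k = (if even r then 3 * pi else 0)"
  note div = growth_div_H11[OF _ \<alpha>, of _ _ r \<beta> s, folded k_def]
  have gx: "growth (\<alpha> * (0 + k)) (\<lambda>z. x44 (moebius a b c d z))"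
    by (rule growth_cong[OF div[OF growth_uminus[OF growth_add[OF H11_growth[of "p + r" "q + s"] H11_growth[of p q]]]], of 0]) (simp add: *(5))
  then show "\<exists>r. growth r (\<lambda>z. x44 (moebius a b c d z))" by blast
  have gy: "growth (\<alpha> * (0 + k)) (\<lambda>z. y44 (moebius a b c d z))"
    by (rule growth_cong[OF div[OF growth_cmult[OF growth_diff[OF H11_growth[of "p + r" "q + s"] H11_growth[of p q]], of "- 2"]], of 0]) (simp add: *(6))
  then show "\<exists>r. growth r (\<lambda>z. y44 (moebius a b c d z))" by blast
  have gt: "growth (\<alpha> * (0 + k)) (\<lambda>z. t44 (moebius a b c d z))"
    by (rule growth_cong[OF div[OF growth_cmult[OF Q11_growth, of "- 4 * \<epsilon>"]], of 0]) (simp add: *(7))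
  then show "\<exists>r. growth r (\<lambda>z. t44 (moebius a b c d z))" by blast
  have "growth (3 * (- pi) + (0 + 0 + 3 * pi)) (\<lambda>s. Sig11 s ^ 3 * (inverse (P11 s) * inverse (N11 s) * inverse (R11 s)))"
    using growth_power[OF Sig11_growth, of 3]
    by (intro growth_mult inverse_P11_growth inverse_N11_growth inverse_R11_growth) simp
  then have "growth 0 (\<lambda>s. Sig11 s ^ 3 * (inverse (P11 s) * inverse (N11 s) * inverse (R11 s)))" by simp
  from growth_affine[OF this \<alpha>, of \<beta>] show "growth 0 (\<lambda>z. e44 (moebius a b c d z))"
    by (simp, elim growth_cong[of _ _ 0]) (simp add: *(8) divide_inverse)
  assume n4: "\<not> 4 dvd c"
  then have k0: "k = 0" using *(2) by (simp add: k_def)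
  show "growth 0 (\<lambda>z. y44 (moebius a b c d z))" "growth 0 (\<lambda>z. t44 (moebius a b c d z))"
    using gy gt k0 by simp_all
  have "growth (\<alpha> * (- pi)) (\<lambda>z. x44 (moebius a b c d z) - 1)"
  proof (rule growth_cong[of _ _ 0])
    show "growth (\<alpha> * (- pi)) (\<lambda>z. - Sig11 (of_real \<alpha> * z + of_real \<beta>) / H11 r s (of_real \<alpha> * z + of_real \<beta>))"
      using div[OF growth_uminus[OF Sig11_growth]] k0 by simp
    fix z :: complex assume z: "Im z > 0"
    then have "Im (of_real \<alpha> * z + of_real \<beta>) > 0" using \<alpha> by simp
    then have nz: "H11 r s (of_real \<alpha> * z + of_real \<beta>) \<noteq> 0" by (rule H11_nonzero)
    show "- Sig11 (of_real \<alpha> * z + of_real \<beta>) / H11 r s (of_real \<alpha> * z + of_real \<beta>) = x44 (moebius a b c d z) - 1"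
      unfolding *(5)[OF z] H11_sum(1)[OF *(3), symmetric] using nz by (simp add: field_simps)
  qed
  then show "growth (- (pi / 22)) (\<lambda>z. x44 (moebius a b c d z) - 1)"
    by (rule growth_mono) (use *(1) in simp)
qed

text \<open>Here a and d are odd while 2 b and c / 2 are even, so the permutation of the forms is
  trivial, and 11 | c makes the sign trivial as well.\<close>

lemma gamma0_invariance:
  assumes u: "unimod a b c d" and c: "44 dvd c" and z: "Im z > 0"
  shows "x44 (moebius a b c d z) = x44 z" "y44 (moebius a b c d z) = y44 z" "t44 (moebius a b c d z) = t44 z"
    "e44 (moebius a b c d z) = e44 z"
proof -
  obtain \<alpha> \<beta> :: real and p q r s :: int and \<epsilon> :: complex where *:
    "\<And>z. Im z > 0 \<Longrightarrow> x44 (moebius a b c d z) = - (H11 (p + r) (q + s) (of_real \<alpha> * z + of_real \<beta>) + H11 p q (of_real \<alpha> * z + of_real \<beta>)) / H11 r s (of_real \<alpha> * z + of_real \<beta>)"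
    "\<And>z. Im z > 0 \<Longrightarrow> y44 (moebius a b c d z) = - 2 * (H11 (p + r) (q + s) (of_real \<alpha> * z + of_real \<beta>) - H11 p q (of_real \<alpha> * z + of_real \<beta>)) / H11 r s (of_real \<alpha> * z + of_real \<beta>)"
    "\<And>z. Im z > 0 \<Longrightarrow> t44 (moebius a b c d z) = - 4 * \<epsilon> * Q11 (of_real \<alpha> * z + of_real \<beta>) / H11 r s (of_real \<alpha> * z + of_real \<beta>)"
    "\<And>z. Im z > 0 \<Longrightarrow> e44 (moebius a b c d z) = Sig11 (of_real \<alpha> * z + of_real \<beta>) ^ 3 / (P11 (of_real \<alpha> * z + of_real \<beta>) * N11 (of_real \<alpha> * z + of_real \<beta>) * R11 (of_real \<alpha> * z + of_real \<beta>))"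
    "44 dvd c \<Longrightarrow> p = a \<and> q = 2 * b \<and> c = 2 * r \<and> s = d \<and> \<alpha> = 2 \<and> \<beta> = 0 \<and> \<epsilon> = 1"
    by (rule functions_at_cusp[OF u]) blast
  have v: "p = a" "q = 2 * b" "c = 2 * r" "s = d" "\<alpha> = 2" "\<beta> = 0" "\<epsilon> = 1" using *(5)[OF c] by auto
  have "even r" using c v(3) by presburger
  have "odd (a * d - b * c)" using u by (simp add: unimod_def)
  then have "odd a" "odd d" using v(3) by auto
  then have H: "H11 (p + r) (q + s) = P11" "H11 p q = (\<lambda>z. - N11 z)" "H11 r s = (\<lambda>z. - R11 z)"
    using \<open>even r\<close> by (auto simp: v H11_def fun_eq_iff)
  show "x44 (moebius a b c d z) = x44 z" "y44 (moebius a b c d z) = y44 z" "t44 (moebius a b c d z) = t44 z"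
    "e44 (moebius a b c d z) = e44 z"
    unfolding *(1)[OF z] *(2)[OF z] *(3)[OF z] *(4)[OF z] H v(5-7)
    by (cases "R11 (2 * z) = 0"; simp add: x44_def y44_def t44_def e44_def field_simps)+
qed

lemma X44_in_X0_field: "X44 \<in> X0_field 44"
  by (rule X0_fieldI_growth[OF x44_holomorphic _ _ cusp_growth(1)]) (simp_all add: gamma0_invariance)

lemma Y44_in_X0_field: "Y44 \<in> X0_field 44"
  by (rule X0_fieldI_growth[OF y44_holomorphic _ _ cusp_growth(2)]) (simp_all add: gamma0_invariance)

lemma T44_in_X0_field: "T44 \<in> X0_field 44"
  by (rule X0_fieldI_growth[OF t44_holomorphic _ _ cusp_growth(3)]) (simp_all add: gamma0_invariance)

subsection \<open>The modular equation of degree 11\<close>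

text \<open>The indices n = 0 and n = -1 both give the square 4 and form the leading term; the next
  square is 36, and 36 / 4 = 9.\<close>

lemma theta_4_2_growth: "growth (- (9 * pi)) (\<lambda>s. theta 4 2 s - 2 * exp (\<i> * pi * s))"
proof -
  have ineq: "n \<in> UNIV - {0, - 1} \<Longrightarrow> 6 \<le> \<bar>4 * n + 2\<bar>" for n :: int by auto
  have "growth (- (pi * (real (6\<^sup>2) / real 4))) (\<lambda>s. \<Sum>\<^sub>\<infinity>n\<in>UNIV-{0,-1}. exp (\<i> * pi * s * (of_int (int 4 * n + 2))\<^sup>2 / of_nat 4))"
    by (rule theta_tail[where kmin=6]) (simp, use ineq in auto)
  then have "growth (- (pi * (real (6\<^sup>2) / real 4))) (\<lambda>s. theta 4 2 s - 2 * exp (\<i> * pi * s))"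
  proof (rule growth_cong[of _ _ 0])
    fix s assume s: "Im s > 0"
    have fs: "(\<lambda>n. exp (\<i> * pi * s * (of_int (int 4 * n + 2))\<^sup>2 / of_nat 4)) summable_on UNIV"
      by (rule abs_summable_summable[OF theta_summable[OF _ s]]) simp
    show "(\<Sum>\<^sub>\<infinity>n\<in>UNIV-{0,-1}. exp (\<i> * pi * s * (of_int (int 4 * n + 2))\<^sup>2 / of_nat 4)) = theta 4 2 s - 2 * exp (\<i> * pi * s)"
      unfolding theta_def by (subst infsum_Diff[OF fs]) auto
  qed
  then show ?thesis by (simp add: mult.commute)
qed

text \<open>By Liouville \<open>e44\<close> is constant, and its value is read off at infinity: with
  E = exp(pi i s) the numerator is (4 E)^3 and the denominator 4 E^3, up to terms of faster
  decay.\<close>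

theorem modular_equation_11:
  assumes "Im s > 0"
  shows "(P11 s - N11 s - R11 s) ^ 3 = 16 * P11 s * N11 s * R11 s"
proof -
  define E where "E s = exp (\<i> * pi * s * of_real 1)" for s
  have E: "growth (- pi) E" unfolding E_def using growth_exp[of 1] by simp
  have E3: "E s ^ 3 = exp (\<i> * pi * s * of_real 3)" for s
    by (simp add: E_def mult_ac flip: exp_of_nat_mult)
  have b2: "growth (- (3 * pi)) (\<lambda>s. theta 4 2 (11 * s))"
    using growth_affine[OF theta_growth(2), of 11 0] by (auto elim!: growth_mono)
  have b0: "growth (- (3 * pi)) (\<lambda>s. theta 4 0 (11 * s) - 1)"
    using growth_affine[OF theta_growth(1), of 11 0] by (auto elim!: growth_mono)
  have a2: "growth (- (3 * pi)) (\<lambda>s. theta 4 2 s - 2 * E s)"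
    using growth_mono[OF theta_4_2_growth, of "- (3 * pi)"] by (simp add: E_def)
  have a0: "growth 0 (theta 4 0)"
    using growth_add[OF growth_mono[OF theta_growth(1), of 0] growth_const[of 1]] by simp
  have b0': "growth 0 (\<lambda>s. theta 4 0 (11 * s))"
    using growth_affine[OF a0, of 11 0] by simp
  have "growth (0 + - (3 * pi)) (\<lambda>s. theta 4 0 s * theta 4 2 (11 * s))"
    "growth (- (3 * pi) + 0) (\<lambda>s. (theta 4 2 s - 2 * E s) * theta 4 0 (11 * s))"
    "growth (- pi + - (3 * pi)) (\<lambda>s. E s * (theta 4 0 (11 * s) - 1))"
    by (intro growth_mult a0 b2 a2 b0' E b0)+
  then have "growth (- (3 * pi)) (\<lambda>s. theta 4 0 s * theta 4 2 (11 * s))"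
    "growth (- (3 * pi)) (\<lambda>s. (theta 4 2 s - 2 * E s) * theta 4 0 (11 * s))"
    "growth (- (3 * pi)) (\<lambda>s. E s * (theta 4 0 (11 * s) - 1))"
    by (auto elim!: growth_mono)
  \<comment> \<open>In terms of the classes 0 and 2 modulo 4, P - N is twice the sum of the two
    mixed products of values at s and 11 s. Splitting off 4 E leaves summands of rate - 3 pi, among
    them \<open>R11\<close>.\<close>
  then have "growth (- (3 * pi)) (\<lambda>s. 2 * (theta 4 0 s * theta 4 2 (11 * s)) + 2 * ((theta 4 2 s - 2 * E s) * theta 4 0 (11 * s)) + 4 * (E s * (theta 4 0 (11 * s) - 1)) - R11 s)"
    by (intro growth_add growth_diff growth_cmult R11_growth_3)
  moreover have "2 * (theta 4 0 s * theta 4 2 (11 * s)) + 2 * ((theta 4 2 s - 2 * E s) * theta 4 0 (11 * s)) + 4 * (E s * (theta 4 0 (11 * s) - 1)) - R11 s = Sig11 s - 4 * E s" for s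
    by (simp add: Sig11_def P11_def N11_def th3_def th4_def algebra_simps)
  ultimately have S: "growth (- (3 * pi)) (\<lambda>s. Sig11 s - 4 * E s)" by simp
  \<comment> \<open>a^3 - b^3 = (a - b)(a^2 + a b + b^2) with a = \<open>Sig11\<close> and b = 4 E;
    the quadratic factor contributes - 2 pi, and - 4 pi of the total is kept.\<close>
  have "growth (- (3 * pi) + (- pi + - pi)) (\<lambda>s. (Sig11 s - 4 * E s) * (Sig11 s * Sig11 s + 4 * (E s * Sig11 s) + 16 * (E s * E s)))"
    by (intro growth_mult[OF S] growth_add growth_cmult growth_mult Sig11_growth E)
  then have S3: "growth (- (4 * pi)) (\<lambda>s. Sig11 s ^ 3 - 64 * E s ^ 3)"
    by (auto elim!: growth_mono simp: algebra_simps power3_eq_cube)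
  have PN: "growth (- pi) (\<lambda>s. P11 s * N11 s - 1)" by (rule growth_prod_minus_1[OF P11_growth N11_growth]) simp
  have R: "growth (- (4 * pi)) (\<lambda>s. R11 s - 4 * E s ^ 3)"
    using growth_mono[OF R11_growth, of "- (4 * pi)"] by (simp add: E3)
  have "growth (- pi + - (3 * pi)) (\<lambda>s. (P11 s * N11 s - 1) * R11 s)" by (intro growth_mult PN R11_growth_3)
  then have "growth (- (4 * pi)) (\<lambda>s. (P11 s * N11 s - 1) * R11 s)" by simp
  from growth_diff[OF S3 growth_cmult[OF growth_add[OF this R], of 16]]
  have "growth (- (4 * pi)) (\<lambda>s. Sig11 s ^ 3 - 16 * (P11 s * N11 s * R11 s))" by (simp add: algebra_simps)
  moreover have "growth (0 + 0 + 3 * pi) (\<lambda>s. inverse (P11 s) * inverse (N11 s) * inverse (R11 s))"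
    by (intro growth_mult inverse_P11_growth inverse_N11_growth inverse_R11_growth)
  ultimately have "growth (- (4 * pi) + (0 + 0 + 3 * pi)) (\<lambda>s. (Sig11 s ^ 3 - 16 * (P11 s * N11 s * R11 s)) * (inverse (P11 s) * inverse (N11 s) * inverse (R11 s)))"
    by (rule growth_mult)
  then have "growth (- pi) (\<lambda>s. (Sig11 s ^ 3 - 16 * (P11 s * N11 s * R11 s)) * (inverse (P11 s) * inverse (N11 s) * inverse (R11 s)))" by simp
  from growth_affine[OF this, of 2 0]
  have g: "growth (- (2 * pi)) (\<lambda>z. e44 z - 16)"
    by (simp, elim growth_cong[of _ _ 0]) (simp add: e44_def field_simps P11_nonzero N11_nonzero R11_nonzero)
  have mem: "abs_mero_uhp e44 \<in> X0_field 44"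
    by (rule X0_fieldI_growth[OF e44_holomorphic ]) (simp_all add: gamma0_invariance, use cusp_growth(4) in blast)
  have "mgrowth 0 (act a b c d (abs_mero_uhp e44))" if "unimod a b c d" for a b c d
    unfolding mgrowth_def act_abs_mero_uhp[OF e44_holomorphic that]
    using holomorphic_moebius[OF unimod_real[OF that] e44_holomorphic] cusp_growth(4)[OF that] by blast
  from X0_field_liouville[OF mem _ this] obtain k where k: "abs_mero_uhp e44 = cst k" by auto
  have e: "e44 z = k" if "Im z > 0" for z
    by (rule holomorphic_uhp_eqI[OF e44_holomorphic holomorphic_on_const _ that]) (use k in \<open>simp add: cst_def\<close>)
  have "growth (- (2 * pi)) (\<lambda>_. k - 16)" by (rule growth_cong[OF g, of 0]) (simp add: e)
  then have "k - 16 = 0" by (rule growth_zero_const) simp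
  then have "e44 (s / 2) = 16" using e[of "s / 2"] assms by simp
  then show ?thesis
    using P11_nonzero[OF assms] N11_nonzero[OF assms] R11_nonzero[OF assms]
    by (simp add: e44_def Sig11_def field_simps)
qed

text \<open>Divided by R^3 the modular equation reads (x - 1)^3 = 16 P N / R^2, and 16 P N = 4 (P +
  N)^2 - 4 (P - N)^2 turns the right side into y^2 - 4 x^2. Likewise 16 Q^2 / R^2 = y^2 + 4 x^2 +
  8.\<close>

lemma
  assumes "Im z > 0"
  shows y44_square: "y44 z ^ 2 = x44 z ^ 3 + x44 z ^ 2 + 3 * x44 z - 1"
    and t44_square: "t44 z ^ 2 = x44 z ^ 3 + 5 * x44 z ^ 2 + 3 * x44 z + 7"
proof -
  define p n r q where "p = P11 (2 * z)" and "n = N11 (2 * z)" and "r = R11 (2 * z)" and "q = Q11 (2 * z)"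
  have s: "Im (2 * z) > 0" using assms by simp
  have r: "r \<noteq> 0" using R11_nonzero[OF s] by (simp add: r_def)
  have m: "(p - n - r) ^ 3 = 16 * p * n * r" using modular_equation_11[OF s] by (simp add: p_def n_def r_def)
  have q: "2 * q ^ 2 = p ^ 2 + n ^ 2 + r ^ 2" using Q11_square[OF s] by (simp add: p_def n_def r_def q_def)
  have x: "x44 z = (p - n) / r" and y: "y44 z = 2 * (p + n) / r" and t: "t44 z = 4 * q / r"
    by (simp_all add: x44_def y44_def t44_def p_def n_def r_def q_def)
  have "y44 z ^ 2 - (x44 z ^ 3 + x44 z ^ 2 + 3 * x44 z - 1) = (16 * p * n * r - (p - n - r) ^ 3) / r ^ 3"
    unfolding x y using r by (simp add: field_simps power2_eq_square power3_eq_cube)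
  then show Y: "y44 z ^ 2 = x44 z ^ 3 + x44 z ^ 2 + 3 * x44 z - 1" unfolding m by simp
  have "t44 z ^ 2 = 8 * (2 * q ^ 2) / r ^ 2" unfolding t by (simp add: power2_eq_square)
  also have "\<dots> = y44 z ^ 2 + 4 * x44 z ^ 2 + 8"
    unfolding x y q using r by (simp add: field_simps power2_eq_square)
  finally show "t44 z ^ 2 = x44 z ^ 3 + 5 * x44 z ^ 2 + 3 * x44 z + 7" unfolding Y by simp
qed

subsection \<open>Tame functions\<close>

lemma pullback_scale:
  assumes "a * d - b * c > 0" "k \<noteq> 0"
  shows "pullback (k * a) (k * b) (k * c) (k * d) f = pullback a b c d f"
proof -
  obtain \<phi> where f: "\<phi> meromorphic_on upper_half_plane" "f = abs_mero_uhp \<phi>" by (rule mero_uhp_cases)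
  have "k * a * (k * d) - k * b * (k * c) = k ^ 2 * (a * d - b * c)" by (simp add: power2_eq_square algebra_simps)
  then have det: "k * a * (k * d) - k * b * (k * c) > 0" using assms by simp
  have "moebius (k * a) (k * b) (k * c) (k * d) z = moebius a b c d z" for z
  proof -
    have "of_real (k * u) * z + of_real (k * v) = of_real k * (of_real u * z + of_real v)" for u v
      by (simp add: algebra_simps)
    then show ?thesis using assms(2) by (simp only: moebius_def) simp
  qed
  then have "moebius (k * a) (k * b) (k * c) (k * d) = moebius a b c d" by (simp add: fun_eq_iff)
  then show ?thesis unfolding f(2) mero_uhp_pullback[OF f(1) det] mero_uhp_pullback[OF f(1) assms(1)] by simp
qed

text \<open>Poles are confined to the cusps with 4 | c. Invariance under w and under z -> z + 1/2 is
  kept apart, so that the tame functions form a ring stable under both operators.\<close>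

definition tame :: "mero_uhp \<Rightarrow> bool" where
  "tame f \<longleftrightarrow> (\<forall>a b c d. unimod a b c d \<longrightarrow> (44 dvd c \<longrightarrow> act a b c d f = f) \<and>
     (\<exists>r. mgrowth r (act a b c d f)) \<and> (\<not> 4 dvd c \<longrightarrow> mgrowth 0 (act a b c d f)))"

lemma tameI:
  assumes "\<And>a b c d. unimod a b c d \<Longrightarrow> 44 dvd c \<Longrightarrow> act a b c d f = f"
    and "\<And>a b c d. unimod a b c d \<Longrightarrow> \<exists>r. mgrowth r (act a b c d f)"
    and "\<And>a b c d. unimod a b c d \<Longrightarrow> \<not> 4 dvd c \<Longrightarrow> mgrowth 0 (act a b c d f)"
  shows "tame f"
  unfolding tame_def using assms by blast

lemma tameD:
  assumes "tame f" "unimod a b c d"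
  shows "44 dvd c \<Longrightarrow> act a b c d f = f" "\<exists>r. mgrowth r (act a b c d f)" "\<not> 4 dvd c \<Longrightarrow> mgrowth 0 (act a b c d f)"
  using assms unfolding tame_def by blast+

lemma mgrowth_add_ex: "\<exists>r. mgrowth r f \<Longrightarrow> \<exists>r. mgrowth r g \<Longrightarrow> \<exists>r. mgrowth r (f + g)"
  by (meson mgrowth_add mgrowth_mono max.cobounded1 max.cobounded2)

lemma tame_cst: "tame (cst k)"
  by (rule tameI) (auto simp: act_hom intro: mgrowth_cst)

lemma tame_add: "tame f \<Longrightarrow> tame g \<Longrightarrow> tame (f + g)"
  by (rule tameI) (simp_all add: act_hom tameD mgrowth_add mgrowth_add_ex)

lemma tame_mult:
  assumes "tame f" "tame g"
  shows "tame (f * g)"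
proof (rule tameI)
  fix a b c d :: int assume u: "unimod a b c d"
  show "44 dvd c \<Longrightarrow> act a b c d (f * g) = f * g"
    using tameD(1)[OF assms(1) u] tameD(1)[OF assms(2) u] by (simp add: act_hom[OF u])
  show "\<exists>r. mgrowth r (act a b c d (f * g))"
    using tameD(2)[OF assms(1) u] tameD(2)[OF assms(2) u] mgrowth_mult by (fastforce simp: act_hom[OF u])
  show "\<not> 4 dvd c \<Longrightarrow> mgrowth 0 (act a b c d (f * g))"
    using mgrowth_mult[OF tameD(3)[OF assms(1) u] tameD(3)[OF assms(2) u]] by (simp add: act_hom[OF u])
qed

lemma tame_power: "tame f \<Longrightarrow> tame (f ^ n)"
  by (induction n) (use tame_cst[of 1] in \<open>auto intro: tame_mult\<close>)

lemma tame_imp_X0_field: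
  assumes f: "tame f"
  shows "f \<in> X0_field 44"
proof -
  have u1: "unimod 1 0 0 1" by (simp add: unimod_def)
  obtain \<psi> where \<psi>: "\<psi> holomorphic_on upper_half_plane" "f = abs_mero_uhp \<psi>"
    using tameD(2)[OF f u1] unfolding act_one mgrowth_def by blast
  show ?thesis unfolding \<psi>(2)
  proof (rule X0_fieldI_growth[OF \<psi>(1)])
    fix a b c d :: int assume u: "unimod a b c d"
    have hol: "(\<lambda>z. \<psi> (moebius a b c d z)) holomorphic_on upper_half_plane"
      by (rule holomorphic_moebius[OF unimod_real[OF u] \<psi>(1)])
    note act = act_abs_mero_uhp[OF \<psi>(1) u]
    show "\<psi> (moebius a b c d z) = \<psi> z" if "int 44 dvd c" "Im z > 0" for z
      by (rule holomorphic_uhp_eqI[OF hol \<psi>(1) _ that(2)]) (use tameD(1)[OF f u] that \<psi>(2) act in simp)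
    obtain r \<phi> where r: "\<phi> holomorphic_on upper_half_plane" "abs_mero_uhp (\<lambda>z. \<psi> (moebius a b c d z)) = abs_mero_uhp \<phi>" "growth r \<phi>"
      using tameD(2)[OF f u] unfolding mgrowth_def \<psi>(2) act by blast
    have "growth r (\<lambda>z. \<psi> (moebius a b c d z))"
    proof (rule growth_cong[OF r(3), of 0])
      fix z :: complex assume "Im z > 0"
      then show "\<phi> z = \<psi> (moebius a b c d z)" using holomorphic_uhp_eqI[OF hol r(1,2)] by simp
    qed
    then show "\<exists>r. growth r (\<lambda>z. \<psi> (moebius a b c d z))" by blast
  qed simp
qed

lemma tame_abs_mero_uhp:
  assumes "\<psi> holomorphic_on upper_half_plane" "abs_mero_uhp \<psi> \<in> X0_field 44"
    and "\<And>a b c d. unimod a b c d \<Longrightarrow> \<exists>r. growth r (\<lambda>z. \<psi> (moebius a b c d z))"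
    and "\<And>a b c d. unimod a b c d \<Longrightarrow> \<not> 4 dvd c \<Longrightarrow> growth 0 (\<lambda>z. \<psi> (moebius a b c d z))"
  shows "tame (abs_mero_uhp \<psi>)"
proof (rule tameI)
  fix a b c d :: int assume u: "unimod a b c d"
  note act = act_abs_mero_uhp[OF assms(1) u] and hol = holomorphic_moebius[OF unimod_real[OF u] assms(1)]
  show "44 dvd c \<Longrightarrow> act a b c d (abs_mero_uhp \<psi>) = abs_mero_uhp \<psi>" using X0_fieldD(1)[OF assms(2) u] by simp
  show "\<exists>r. mgrowth r (act a b c d (abs_mero_uhp \<psi>))"
    using assms(3)[OF u] hol unfolding act mgrowth_def by blast
  show "\<not> 4 dvd c \<Longrightarrow> mgrowth 0 (act a b c d (abs_mero_uhp \<psi>))"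
    using assms(4)[OF u] hol unfolding act mgrowth_def by blast
qed

lemma X44_cusp:
  assumes "unimod a b c d" "\<not> 4 dvd c"
  shows "mgrowth (- (pi / 22)) (act a b c d (X44 - 1))"
proof -
  have "act a b c d (X44 - 1) = abs_mero_uhp (\<lambda>z. x44 (moebius a b c d z)) - abs_mero_uhp (\<lambda>_. 1)"
    using act_hom(5)[OF assms(1), of 1] by (simp add: act_hom[OF assms(1)] act_abs_mero_uhp[OF x44_holomorphic assms(1)] flip: cst_def)
  also have "\<dots> = abs_mero_uhp (\<lambda>z. x44 (moebius a b c d z) - 1)"
    by (rule mero_uhp_diff)
      (intro holomorphic_imp_meromorphic_uhp holomorphic_moebius[OF unimod_real[OF assms(1)] x44_holomorphic] holomorphic_intros)+
  finally show ?thesis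
    unfolding mgrowth_def using cusp_growth(5)[OF assms] holomorphic_moebius[OF unimod_real[OF assms(1)] x44_holomorphic]
    by (intro exI[of _ "\<lambda>z. x44 (moebius a b c d z) - 1"] conjI holomorphic_intros)
qed

lemma growth_0_x44:
  assumes "unimod a b c d" "\<not> 4 dvd c"
  shows "growth 0 (\<lambda>z. x44 (moebius a b c d z))"
  using growth_add[OF growth_mono[OF cusp_growth(5)[OF assms], of 0] growth_const[of 1]] by simp

lemma tame_X44: "tame X44"
  by (rule tame_abs_mero_uhp[OF x44_holomorphic X44_in_X0_field cusp_growth(1) growth_0_x44])

lemma tame_Y44: "tame Y44"
  by (rule tame_abs_mero_uhp[OF y44_holomorphic Y44_in_X0_field cusp_growth(2) cusp_growth(6)])

lemma tame_T44: "tame T44"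
  by (rule tame_abs_mero_uhp[OF t44_holomorphic T44_in_X0_field cusp_growth(3) cusp_growth(7)])

section \<open>Pullback along integer matrices that normalise Gamma_0(44)\<close>

lemma triangular_decomposition:
  fixes m1 m2 m3 m4 :: int
  assumes det: "m1 * m4 - m2 * m3 > 0"
  obtains p q r s a b d where "unimod p q r s" "a > 0" "d > 0" "m1 = p * a" "m3 = r * a" "m2 = p * b + q * d" "m4 = r * b + s * d"
proof -
  define a where "a = gcd m1 m3"
  have a: "a > 0" using det by (auto simp: a_def)
  obtain p r where pr: "m1 = p * a" "m3 = r * a" unfolding a_def by (metis dvd_div_mult_self gcd_dvd1 gcd_dvd2)
  have "gcd p r * a = a" using a pr by (metis a_def abs_of_pos gcd_mult_right abs_gcd_int gcd_mult_distrib_int mult.commute)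
  then have "gcd p r = 1" using a by simp
  then obtain u v where uv: "u * p + v * r = 1" by (metis bezout_int)
  have un: "unimod p (- v) r u" using uv by (simp add: unimod_def mult.commute)
  define b d where "b = u * m2 + v * m4" and "d = p * m4 - r * m2"
  have "a * d > 0" using det by (simp add: pr d_def algebra_simps)
  then have "d > 0" using a by (simp add: zero_less_mult_iff)
  moreover have "p * b + - v * d = (u * p + v * r) * m2" "r * b + u * d = (u * p + v * r) * m4"
    by (simp_all add: b_def d_def algebra_simps)
  ultimately show ?thesis using that[OF un a _ pr] uv by auto
qed

lemma act_pullback:
  fixes m1 m2 m3 m4 :: int
  assumes det: "m1 * m4 - m2 * m3 > 0" and u: "unimod a b c d"
  shows "act a b c d (pullback m1 m2 m3 m4 f) = pullback (m1 * a + m2 * c) (m1 * b + m2 * d) (m3 * a + m4 * c) (m3 * b + m4 * d) f"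
proof -
  have "real_of_int m1 * m4 - real_of_int m2 * m3 > 0"
    using det by (metis of_int_0_less_iff of_int_diff of_int_mult)
  from pullback_pullback[OF unimod_real[OF u] this] show ?thesis by (simp add: act_def)
qed

lemma pullback_act:
  fixes a b c d :: int and m1 m2 m3 m4 :: real
  assumes det: "m1 * m4 - m2 * m3 > 0" and u: "unimod a b c d"
  shows "pullback m1 m2 m3 m4 (act a b c d f) = pullback (a * m1 + b * m3) (a * m2 + b * m4) (c * m1 + d * m3) (c * m2 + d * m4) f"
  using pullback_pullback[OF det unimod_real[OF u]] by (simp add: act_def)

text \<open>Up to a triangular substitution, which only rescales growth rates, a cusp of the pulled
  back function is a cusp of f.\<close>

lemma act_pullback_triangular:
  fixes m1 m2 m3 m4 :: int
  assumes det: "m1 * m4 - m2 * m3 > 0" and u: "unimod a b c d"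
  obtains p q r s e g h :: int where "unimod p q r s" "e > 0" "h > 0" "m1 * a + m2 * c = p * e" "m3 * a + m4 * c = r * e"
    "act a b c d (pullback m1 m2 m3 m4 f) = pullback e g 0 h (act p q r s f)"
proof -
  have "(m1 * a + m2 * c) * (m3 * b + m4 * d) - (m1 * b + m2 * d) * (m3 * a + m4 * c) = (m1 * m4 - m2 * m3) * (a * d - b * c)"
    by (simp add: algebra_simps)
  then have pos: "(m1 * a + m2 * c) * (m3 * b + m4 * d) - (m1 * b + m2 * d) * (m3 * a + m4 * c) > 0"
    using det u by (simp add: unimod_def)
  obtain p q r s e g h :: int where v: "unimod p q r s" "e > 0" "h > 0"
    and eq: "m1 * a + m2 * c = p * e" "m3 * a + m4 * c = r * e" "m1 * b + m2 * d = p * g + q * h" "m3 * b + m4 * d = r * g + s * h"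
    by (rule triangular_decomposition[OF pos])
  have eqr: "real_of_int (m1 * a + m2 * c) = real_of_int p * e" "real_of_int (m3 * a + m4 * c) = real_of_int r * e"
    "real_of_int (m1 * b + m2 * d) = real_of_int p * g + real_of_int q * h" "real_of_int (m3 * b + m4 * d) = real_of_int r * g + real_of_int s * h"
    by (simp_all only: eq of_int_add of_int_mult)
  have "real_of_int e * real_of_int h - real_of_int g * 0 > 0" using v by simp
  from pullback_act[OF this v(1), of f]
  have act: "act a b c d (pullback m1 m2 m3 m4 f) = pullback e g 0 h (act p q r s f)"
    unfolding act_pullback[OF det u] eqr by simp
  then show ?thesis by (rule that[OF v eq(1,2)])
qed

text \<open>\<open>conj\<close> says that the matrix conjugates Gamma_0(44) into itself, written
  without inverses; \<open>cusps\<close> says that a cusp whose denominator is not divisible by 4 is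
  sent to another such cusp.\<close>

lemma tame_pullback:
  fixes m1 m2 m3 m4 :: int
  assumes f: "tame f" and det: "m1 * m4 - m2 * m3 > 0"
    and conj: "\<And>a b c d. unimod a b c d \<Longrightarrow> 44 dvd c \<Longrightarrow> \<exists>p q r s. unimod p q r s \<and> 44 dvd r \<and>
       m1 * a + m2 * c = p * m1 + q * m3 \<and> m1 * b + m2 * d = p * m2 + q * m4 \<and>
       m3 * a + m4 * c = r * m1 + s * m3 \<and> m3 * b + m4 * d = r * m2 + s * m4"
    and cusps: "\<And>a c p r e. m1 * a + m2 * c = p * e \<Longrightarrow> m3 * a + m4 * c = r * e \<Longrightarrow> odd a \<or> odd c \<Longrightarrow> odd p \<or> odd r \<Longrightarrow> 4 dvd r \<Longrightarrow> 4 dvd c"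
  shows "tame (pullback m1 m2 m3 m4 f)"
proof (rule tameI)
  fix a b c d :: int assume u: "unimod a b c d"
  have detr: "real_of_int m1 * m4 - real_of_int m2 * m3 > 0"
    using det by (metis of_int_0_less_iff of_int_diff of_int_mult)
  show "act a b c d (pullback m1 m2 m3 m4 f) = pullback m1 m2 m3 m4 f" if c: "44 dvd c"
  proof -
    obtain p q r s where v: "unimod p q r s" "44 dvd r" and eq:
       "m1 * a + m2 * c = p * m1 + q * m3" "m1 * b + m2 * d = p * m2 + q * m4"
       "m3 * a + m4 * c = r * m1 + s * m3" "m3 * b + m4 * d = r * m2 + s * m4" using conj[OF u c] by blast
    have eqr: "real_of_int (m1 * a + m2 * c) = real_of_int p * m1 + real_of_int q * m3"
      "real_of_int (m1 * b + m2 * d) = real_of_int p * m2 + real_of_int q * m4"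
      "real_of_int (m3 * a + m4 * c) = real_of_int r * m1 + real_of_int s * m3"
      "real_of_int (m3 * b + m4 * d) = real_of_int r * m2 + real_of_int s * m4"
      by (simp_all only: eq of_int_add of_int_mult)
    have "pullback m1 m2 m3 m4 f = pullback m1 m2 m3 m4 (act p q r s f)" using tameD(1)[OF f v] by simp
    then show ?thesis unfolding act_pullback[OF det u] pullback_act[OF detr v(1)] eqr by (rule sym)
  qed
  obtain p q r s e g h :: int where v: "unimod p q r s" "e > 0" "h > 0" and eq: "m1 * a + m2 * c = p * e" "m3 * a + m4 * c = r * e"
    and act: "act a b c d (pullback m1 m2 m3 m4 f) = pullback e g 0 h (act p q r s f)"
    by (rule act_pullback_triangular[OF det u])
  show "\<exists>r. mgrowth r (act a b c d (pullback m1 m2 m3 m4 f))"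
    using tameD(2)[OF f v(1)] mgrowth_affine[of _ _ "real_of_int e" "real_of_int h" "real_of_int g"] v(2,3) unfolding act by fastforce
  show "mgrowth 0 (act a b c d (pullback m1 m2 m3 m4 f))" if "\<not> 4 dvd c"
  proof -
    have "odd a \<or> odd c" "odd p \<or> odd r" using u v(1) unfolding unimod_def by (metis dvd_diff dvd_mult2 odd_one dvd_mult)+
    then have "\<not> 4 dvd r" using cusps[OF eq(1,2)] that by blast
    from mgrowth_affine[OF tameD(3)[OF f v(1) this], of "real_of_int e" "real_of_int h" "real_of_int g"] v(2,3)
    show ?thesis unfolding act by simp
  qed
qed

text \<open>
  \<open>wop\<close> is \<open>w\<^sub>1\<^sub>1\<^sup>*\<close> for the entries \<open>(- 1, - 3, 1, 1)\<close>, up to the scalar \<open>1 / \<surd>11\<close>; \<open>sop\<close> is the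
  translation by \<open>1 / 2\<close>, which normalises \<open>\<Gamma>\<^sub>0(44)\<close> because \<open>4\<close> divides \<open>44\<close>.
\<close>

definition wop :: "mero_uhp \<Rightarrow> mero_uhp" where "wop = pullback (- 11) (- 3) 44 11"
definition sop :: "mero_uhp \<Rightarrow> mero_uhp" where "sop = pullback 2 1 0 2"

lemma
  shows wop_hom: "wop (f + g) = wop f + wop g" "wop (f - g) = wop f - wop g" "wop (f * g) = wop f * wop g"
      "wop (inverse f) = inverse (wop f)" "wop (cst k) = cst k"
    and sop_hom: "sop (f + g) = sop f + sop g" "sop (f - g) = sop f - sop g" "sop (f * g) = sop f * sop g"
      "sop (inverse f) = inverse (sop f)" "sop (cst k) = cst k"
  unfolding wop_def sop_def by (rule pullback_hom; simp)+

lemma tame_wop: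
  assumes "tame f"
  shows "tame (wop f)"
proof -
  have "tame (pullback (of_int (- 11)) (of_int (- 3)) (of_int 44) (of_int 11) f)"
  proof (rule tame_pullback[OF assms])
    fix a b c d :: int assume u: "unimod a b c d" and "44 dvd c"
    then obtain c' where c': "c = 44 * c'" by blast
    \<comment> \<open>The entries of W gamma W^-1 for W = (-11, -3; 44, 11).\<close>
    let ?p = "- 11 * a - 132 * c' + 44 * b + 12 * d" and ?q = "- 3 * a - 36 * c' + 11 * b + 3 * d"
    let ?r = "44 * a + 484 * c' - 176 * b - 44 * d" and ?s = "12 * a + 132 * c' - 44 * b - 11 * d"
    have "?p * ?s - ?q * ?r = a * d - b * c" by (simp add: c' algebra_simps)
    then have "unimod ?p ?q ?r ?s" using u by (simp add: unimod_def)
    moreover have "44 dvd ?r" by presburger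
    ultimately show "\<exists>p q r s. unimod p q r s \<and> 44 dvd r \<and>
       - 11 * a + - 3 * c = p * - 11 + q * 44 \<and> - 11 * b + - 3 * d = p * - 3 + q * 11 \<and>
       44 * a + 11 * c = r * - 11 + s * 44 \<and> 44 * b + 11 * d = r * - 3 + s * 11"
      by (intro exI[of _ ?p] exI[of _ ?q] exI[of _ ?r] exI[of _ ?s]) (simp add: c' algebra_simps)
  next
    fix a c p r e :: int assume eq: "44 * a + 11 * c = r * e" and "4 dvd r"
    then have "4 dvd 44 * a + 11 * c" by simp
    then show "4 dvd c" by presburger
  qed simp
  then show ?thesis by (simp add: wop_def)
qed

lemma tame_sop:
  assumes "tame f"
  shows "tame (sop f)"
proof -
  have "tame (pullback (of_int 2) (of_int 1) (of_int 0) (of_int 2) f)"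
  proof (rule tame_pullback[OF assms])
    fix a b c d :: int assume u: "unimod a b c d" and "44 dvd c"
    then obtain c' where c': "c = 44 * c'" by blast
    have "odd (a * d - b * c)" using u by (simp add: unimod_def)
    then have "odd a" "odd d" using c' by auto
    then have "even (d - a)" by simp
    then obtain k where k: "d = a + 2 * k" by (metis dvdE diff_eq_eq add.commute)
    \<comment> \<open>The conjugate by the translation by 1/2. Its upper right entry b + (d - a) / 2
      - c / 4 is an integer because a, d are odd and 4 divides c.\<close>
    let ?p = "a + 22 * c'" and ?q = "b + k - 11 * c'" and ?s = "d - 22 * c'"
    have "?p * ?s - ?q * c = a * d - b * c" by (simp add: c' k algebra_simps)
    then have "unimod ?p ?q c ?s" using u by (simp add: unimod_def)
    then show "\<exists>p q r s. unimod p q r s \<and> 44 dvd r \<and>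
       2 * a + 1 * c = p * 2 + q * 0 \<and> 2 * b + 1 * d = p * 1 + q * 2 \<and>
       0 * a + 2 * c = r * 2 + s * 0 \<and> 0 * b + 2 * d = r * 1 + s * 2"
      by (intro exI[of _ ?p] exI[of _ ?q] exI[of _ c] exI[of _ ?s]) (simp add: c' k)
  next
    fix a c p r e :: int
    assume eq: "2 * a + 1 * c = p * e" "0 * a + 2 * c = r * e" and ac: "odd a \<or> odd c" and pr: "odd p \<or> odd r" and r: "4 dvd r"
    obtain r' where r': "r = 4 * r'" using r by blast
    have c: "c = 2 * (r' * e)" using eq(2) r' by simp
    have "odd p" using pr r' by simp
    moreover have "even (p * e)" using c by (simp flip: eq(1))
    ultimately have "even e" by simp
    then show "4 dvd c" unfolding c by auto
  qed simp
  then show ?thesis by (simp add: sop_def)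
qed

text \<open>W^2 is the scalar -11, two half translations make a translation by 1, and the two
  matrices commute up to scalars and the element (23, 6; 88, 23) of Gamma_0(44).\<close>

lemma
  assumes "tame f"
  shows wop_wop: "wop (wop f) = f" and sop_sop: "sop (sop f) = f" and wop_sop: "wop (sop f) = sop (wop f)"
proof -
  have "wop (wop f) = pullback (- 11 * 1) (- 11 * 0) (- 11 * 0) (- 11 * 1) f"
    unfolding wop_def by (subst pullback_pullback) simp_all
  also have "\<dots> = act 1 0 0 1 f" by (subst pullback_scale) (simp_all add: act_def)
  finally show "wop (wop f) = f" by (simp add: act_one)
  have u: "unimod 1 1 0 1" by (simp add: unimod_def)
  have "sop (sop f) = pullback (4 * 1) (4 * 1) (4 * 0) (4 * 1) f"
    unfolding sop_def by (subst pullback_pullback) simp_all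
  also have "\<dots> = act 1 1 0 1 f" by (subst pullback_scale) (simp_all add: act_def)
  finally show "sop (sop f) = f" using tameD(1)[OF assms u] by simp
  have v: "unimod 23 6 88 23" by (simp add: unimod_def)
  have "sop (wop f) = pullback (- 22) (- 17) 88 66 f"
    unfolding wop_def sop_def by (subst pullback_pullback) simp_all
  also have "\<dots> = pullback (- 22) (- 17) 88 66 (act 23 6 88 23 f)" using tameD(1)[OF assms v] by simp
  also have "\<dots> = pullback 22 5 88 22 f" by (subst pullback_act[OF _ v]) simp_all
  also have "\<dots> = wop (sop f)" unfolding wop_def sop_def by (subst pullback_pullback) simp_all
  finally show "wop (sop f) = sop (wop f)" by simp
qed

text \<open>z + 1/2 shifts the argument 2 z by 1, which swaps P and N, negates R and fixes
  Q.\<close>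

lemma
  assumes z: "Im z > 0"
  shows x44_half: "x44 (moebius 2 1 0 2 z) = x44 z" and y44_half: "y44 (moebius 2 1 0 2 z) = - y44 z"
    and t44_half: "t44 (moebius 2 1 0 2 z) = - t44 z"
proof -
  have e: "2 * moebius 2 1 0 2 z = 2 * z + of_int 1" by (simp add: moebius_def field_simps)
  show "x44 (moebius 2 1 0 2 z) = x44 z" "y44 (moebius 2 1 0 2 z) = - y44 z" "t44 (moebius 2 1 0 2 z) = - t44 z"
    unfolding x44_def y44_def t44_def e P11_add_int N11_add_int R11_add_int Q11_add_int
    using R11_nonzero[of "2 * z"] z by (simp_all add: field_simps)
qed

text \<open>2 W z = gamma (22 z) with gamma = (-1, -6; 2, 11). As 11 does not divide 2 and l = 0 is
  admissible, the comparison point is 2 z. gamma is trivial modulo 2, so the forms stay in place and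
  only Q picks up \<open>sgn11 2\<close> = -1.\<close>

lemma
  assumes z: "Im z > 0"
  shows x44_w: "x44 (moebius (- 11) (- 3) 44 11 z) = x44 z" and y44_w: "y44 (moebius (- 11) (- 3) 44 11 z) = y44 z"
    and t44_w: "t44 (moebius (- 11) (- 3) 44 11 z) = - t44 z"
proof -
  have rel: "modular_rel (- 1) (- 6) 2 11" by (rule modular_rel) simp
  have s: "Im (22 * z) > 0" "Im (2 * z) > 0" using z by simp_all
  have "cusp_rel 2 11 (22 * z) (2 * z)" unfolding cusp_rel_def by (auto intro!: exI[of _ 0])
  from modular_relD[OF rel s(1) this] obtain \<kappa> where \<kappa>:
    "\<And>p r. odd p \<or> odd r \<Longrightarrow> H11 p r (moebius (of_int (- 1)) (of_int (- 6)) (of_int 2) (of_int 11) (22 * z)) = \<kappa> * H11 (p * - 1 + r * 2) (p * - 6 + r * 11) (2 * z)"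
    "Q11 (moebius (of_int (- 1)) (of_int (- 6)) (of_int 2) (of_int 11) (22 * z)) = \<kappa> * sgn2 (- 1) (- 6) 2 11 * sgn11 2 * Q11 (2 * z)" by blast
  have e: "moebius (of_int (- 1)) (of_int (- 6)) (of_int 2) (of_int 11) (22 * z) = 2 * moebius (- 11) (- 3) 44 11 z"
    by (simp add: moebius_def algebra_simps)
  define W where "W = 2 * moebius (- 11) (- 3) 44 11 z"
  have "Im (moebius (- 11) (- 3) 44 11 z) > 0" by (rule Im_moebius_pos[OF _ z]) simp
  then have "Im W > 0" by (simp add: W_def)
  have v: "P11 W = \<kappa> * P11 (2 * z)" "N11 W = \<kappa> * N11 (2 * z)" "R11 W = \<kappa> * R11 (2 * z)" "Q11 W = - \<kappa> * Q11 (2 * z)"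
    using \<kappa>(1)[of 1 1] \<kappa>(1)[of 1 0] \<kappa>(1)[of 0 1] \<kappa>(2) unfolding e W_def[symmetric]
    by (simp_all add: H11_def sgn2_def sgn11_def)
  have "\<kappa> \<noteq> 0" using R11_nonzero[OF \<open>Im W > 0\<close>] v(3) by auto
  then show "x44 (moebius (- 11) (- 3) 44 11 z) = x44 z" "y44 (moebius (- 11) (- 3) 44 11 z) = y44 z" "t44 (moebius (- 11) (- 3) 44 11 z) = - t44 z"
    unfolding x44_def y44_def t44_def W_def[symmetric] v using R11_nonzero[OF s(2)] by (simp_all add: field_simps)
qed

lemma abs_mero_uhp_uminus: "\<phi> meromorphic_on upper_half_plane \<Longrightarrow> abs_mero_uhp (\<lambda>z. - \<phi> z) = - abs_mero_uhp \<phi>"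
  using mero_uhp_diff[of "\<lambda>_. 0" \<phi>] cst_0 holomorphic_imp_meromorphic_uhp[OF holomorphic_on_const] by (simp add: cst_def)

lemma
  shows sop_generators: "sop X44 = X44" "sop Y44 = - Y44" "sop T44 = - T44"
    and wop_generators: "wop X44 = X44" "wop Y44 = Y44" "wop T44 = - T44"
proof -
  note mer = holomorphic_imp_meromorphic_uhp[OF x44_holomorphic] holomorphic_imp_meromorphic_uhp[OF y44_holomorphic] holomorphic_imp_meromorphic_uhp[OF t44_holomorphic]
  have s: "(2::real) * 2 - 1 * 0 > 0" and w: "(- 11::real) * 11 - (- 3) * 44 > 0" by simp_all
  note hs = holomorphic_moebius[OF s x44_holomorphic] holomorphic_moebius[OF s y44_holomorphic] holomorphic_moebius[OF s t44_holomorphic]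
  note hw = holomorphic_moebius[OF w x44_holomorphic] holomorphic_moebius[OF w y44_holomorphic] holomorphic_moebius[OF w t44_holomorphic]
  show "sop X44 = X44" unfolding sop_def mero_uhp_pullback[OF mer(1) s] by (rule abs_mero_uhp_cong[OF hs(1) x44_half])
  show "sop Y44 = - Y44" unfolding sop_def mero_uhp_pullback[OF mer(2) s] abs_mero_uhp_uminus[OF mer(2), symmetric] by (rule abs_mero_uhp_cong[OF hs(2) y44_half])
  show "sop T44 = - T44" unfolding sop_def mero_uhp_pullback[OF mer(3) s] abs_mero_uhp_uminus[OF mer(3), symmetric] by (rule abs_mero_uhp_cong[OF hs(3) t44_half])
  show "wop X44 = X44" unfolding wop_def mero_uhp_pullback[OF mer(1) w] by (rule abs_mero_uhp_cong[OF hw(1) x44_w])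
  show "wop Y44 = Y44" unfolding wop_def mero_uhp_pullback[OF mer(2) w] by (rule abs_mero_uhp_cong[OF hw(2) y44_w])
  show "wop T44 = - T44" unfolding wop_def mero_uhp_pullback[OF mer(3) w] abs_mero_uhp_uminus[OF mer(3), symmetric] by (rule abs_mero_uhp_cong[OF hw(3) t44_w])
qed

lemma atkin_lehner_44:
  assumes "f \<in> X0_field 44"
  shows "atkin_lehner 44 11 f = wop f"
proof -
  have "atkin_lehner_entries 44 11 (- 1, - 3, 1, 1)" by (simp add: atkin_lehner_entries_def)
  from atkin_lehner_eq[OF _ _ assms this]
  have "atkin_lehner 44 11 f = pullback (- (11 / sqrt 11)) (- (3 / sqrt 11)) (44 / sqrt 11) (11 / sqrt 11) f"
    by (simp add: atkin_lehner_pullback_def)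
  also have "\<dots> = pullback (1 / sqrt 11 * - 11) (1 / sqrt 11 * - 3) (1 / sqrt 11 * 44) (1 / sqrt 11 * 11) f" by simp
  also have "\<dots> = wop f" unfolding wop_def by (rule pullback_scale) simp_all
  finally show ?thesis .
qed

section \<open>Evaluation of polynomials through a homomorphism on the coefficients\<close>

lemma
  fixes h :: "'a :: comm_ring_1 \<Rightarrow> 'b :: comm_ring_1"
  assumes h: "h 0 = 0" "\<And>a b. h (a + b) = h a + h b" "\<And>a b. h (a * b) = h a * h b"
  shows poly_map_poly_add: "poly (map_poly h (p + q)) x = poly (map_poly h p) x + poly (map_poly h q) x"
    and poly_map_poly_mult: "poly (map_poly h (p * q)) x = poly (map_poly h p) x * poly (map_poly h q) x"
proof -
  have pCons: "poly (map_poly h (pCons a p)) x = h a + x * poly (map_poly h p) x" for a p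
    by (simp add: map_poly_pCons h(1))
  have add: "poly (map_poly h (p + q)) x = poly (map_poly h p) x + poly (map_poly h q) x" for p q
    by (induction p q rule: poly_induct2) (simp_all add: pCons h(2) algebra_simps)
  then show "poly (map_poly h (p + q)) x = poly (map_poly h p) x + poly (map_poly h q) x" .
  have smult: "poly (map_poly h (smult a q)) x = h a * poly (map_poly h q) x" for a q
    by (induction q) (simp_all add: pCons h(3) algebra_simps)
  show "poly (map_poly h (p * q)) x = poly (map_poly h p) x * poly (map_poly h q) x"
    by (induction p) (simp_all add: pCons add smult h(1) algebra_simps)
qed

lemma poly_map_poly_altdef:
  fixes h :: "'a :: comm_ring_1 \<Rightarrow> 'b :: comm_ring_1"
  assumes "h 0 = 0"
  shows "poly (map_poly h p) x = (\<Sum>i\<le>degree p. h (coeff p i) * x ^ i)"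
proof -
  have "degree (map_poly h p) \<le> degree p" by (rule degree_le) (simp add: coeff_map_poly assms coeff_eq_0)
  then have sub: "{..degree (map_poly h p)} \<subseteq> {..degree p}" by simp
  have "poly (map_poly h p) x = (\<Sum>i\<le>degree (map_poly h p). coeff (map_poly h p) i * x ^ i)" by (rule poly_altdef)
  also have "\<dots> = (\<Sum>i\<le>degree p. h (coeff p i) * x ^ i)"
    by (rule sum.mono_neutral_cong_left[OF _ sub]) (auto simp: assms coeff_eq_0 simp flip: coeff_map_poly[of h, OF assms])
  finally show ?thesis .
qed

subsection \<open>\<open>X44\<close> is a Hauptmodul\<close>

definition evx :: "complex poly \<Rightarrow> mero_uhp" where "evx p = poly (map_poly cst p) X44"

lemma
  shows evx_add: "evx (p + q) = evx p + evx q" and evx_mult: "evx (p * q) = evx p * evx q"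
    and evx_const: "evx [:k:] = cst k" and evx_monom: "evx (monom k n) = cst k * X44 ^ n"
  unfolding evx_def
  by (rule poly_map_poly_add poly_map_poly_mult; simp add: cst_add cst_mult)+
     (simp_all add: map_poly_pCons map_poly_monom poly_monom)

lemma evx_X: "evx [:a, 1:] = X44 + cst a"
  unfolding evx_def by (simp add: map_poly_pCons add.commute)

lemma evx_0: "evx 0 = 0"
  by (simp add: evx_def)

lemma evx_power: "evx (p ^ n) = evx p ^ n"
  by (induction n) (use evx_const[of 1] in \<open>simp_all add: evx_mult one_pCons\<close>)

lemma mgrowth_neg_cst:
  assumes "mgrowth r (cst k)" "r < 0"
  shows "k = 0"
proof -
  obtain \<phi> where \<phi>: "\<phi> holomorphic_on upper_half_plane" "cst k = abs_mero_uhp \<phi>" "growth r \<phi>"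
    using assms(1) unfolding mgrowth_def by blast
  have "growth r (\<lambda>_. k)"
    by (rule growth_cong[OF \<phi>(3), of 0])
       (use holomorphic_uhp_eqI[OF holomorphic_on_const \<phi>(1), of k] \<phi>(2) in \<open>simp add: cst_def\<close>)
  then show ?thesis using assms(2) by (rule growth_zero_const)
qed

text \<open>x - 1 decays at the cusp 0, so a constant x would be 1. Then P - N - R = 0, and the
  modular equation would force P N R = 0.\<close>

lemma X44_not_const: "X44 \<noteq> cst k"
proof
  assume X: "X44 = cst k"
  have u: "unimod 0 (- 1) 1 0" by (simp add: unimod_def)
  have "X44 - 1 = cst (k - 1)" by (simp add: X cst_diff)
  then have "act 0 (- 1) 1 0 (X44 - 1) = cst (k - 1)" using act_hom(5)[OF u] by simp
  then have "mgrowth (- (pi / 22)) (cst (k - 1))" using X44_cusp[OF u] by simp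
  then have "k - 1 = 0" by (rule mgrowth_neg_cst) simp
  then have "x44 \<i> = 1"
    using holomorphic_uhp_eqI[OF x44_holomorphic holomorphic_on_const, of k \<i>] X by (simp add: cst_def)
  moreover have s: "Im (2 * \<i>) > 0" by simp
  ultimately have "P11 (2 * \<i>) - N11 (2 * \<i>) - R11 (2 * \<i>) = 0"
    using R11_nonzero[OF s] by (simp add: x44_def field_simps)
  then show False using modular_equation_11[OF s] P11_nonzero[OF s] N11_nonzero[OF s] R11_nonzero[OF s] by simp
qed

text \<open>Over the complex numbers a nonconstant polynomial has a linear factor, and X - z does
  not vanish at the nonconstant \<open>X44\<close>; induct on the degree.\<close>

lemma evx_eq_0_iff: "evx p = 0 \<longleftrightarrow> p = 0"
proof
  assume e: "evx p = 0"
  show "p = 0"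
  proof (rule ccontr)
    assume "p \<noteq> 0"
    with e show False
    proof (induction "degree p" arbitrary: p)
      case 0
      then obtain k where "p = [:k:]" by (metis degree_eq_zeroE)
      then show ?case using 0 by (simp add: evx_const)
    next
      case (Suc n)
      obtain z where "poly p z = 0" using fundamental_theorem_of_algebra_alt[of p] Suc(2)
        by (metis degree_pCons_0 nat.distinct(1))
      then obtain q where q: "p = [:- z, 1:] * q" by (metis poly_eq_0_iff_dvd dvdE)
      have "evx [:- z, 1:] = X44 - cst z" by (simp add: evx_X cst_uminus)
      then have "evx [:- z, 1:] \<noteq> 0" using X44_not_const by simp
      then have "evx q = 0" using Suc(3) unfolding q evx_mult by simp
      moreover have q0: "q \<noteq> 0" using Suc(4) q by auto
      moreover have "degree p = Suc (degree q)" unfolding q using q0 by (subst degree_mult_eq) auto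
      then have "degree q = n" using Suc(2) by simp
      ultimately show ?case using Suc(1)[of q] by simp
    qed
  qed
qed (simp add: evx_0)

text \<open>Among the cusps with 4 | c, those with 11 not dividing c are carried to infinity by w.
  Invariance therefore spreads the bound at infinity to all of them.\<close>

lemma liouville_w_invariant:
  assumes f: "tame f" "wop f = f" "mgrowth 0 f"
  shows "\<exists>k. f = cst k"
proof (rule X0_field_liouville[OF tame_imp_X0_field[OF f(1)]])
  fix a b c d :: int assume u: "unimod a b c d"
  show "mgrowth 0 (act a b c d f)"
  proof (cases "4 dvd c")
    case False
    then show ?thesis by (rule tameD(3)[OF f(1) u])
  next
    case c4: True
    show ?thesis
    proof (cases "11 dvd c")
      case True
      then have "44 dvd c" using c4 by presburger
      then show ?thesis using tameD(1)[OF f(1) u] f(3) by simp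
    next
      case c11: False
      have "(- 11::int) * 11 - (- 3) * 44 > 0" by simp
      then obtain p q r s e g h :: int where
        v: "unimod p q r s" "e > 0" "h > 0" and eq: "- 11 * a + - 3 * c = p * e" "44 * a + 11 * c = r * e"
        and "act a b c d (pullback (of_int (- 11)) (of_int (- 3)) (of_int 44) (of_int 11) f) = pullback e g 0 h (act p q r s f)"
        by (rule act_pullback_triangular[OF _ u])
      then have act: "act a b c d (wop f) = pullback e g 0 h (act p q r s f)" by (simp add: wop_def)
      have "odd (a * d - b * c)" using u by (simp add: unimod_def)
      \<comment> \<open>e turns out to be prime to 44, while 44 divides r e; so the unimodular
        factor lies in Gamma_0(44) and acts trivially on f.\<close>
      then have "odd (- 11 * a + - 3 * c)" using c4 by auto
      then have e2: "odd e" unfolding eq by simp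
      have "\<not> 11 dvd e"
      proof
        assume "11 dvd e"
        then have "11 dvd - 11 * a + - 3 * c" unfolding eq by simp
        then show False using c11 by presburger
      qed
      moreover have "prime (11::int)" by (simp add: prime_int_numeral_eq prime_nat_numeral_eq)
      moreover have "11 dvd r * e" unfolding eq(2)[symmetric] by presburger
      ultimately have "11 dvd r" by (simp add: prime_dvd_mult_iff)
      have "4 dvd r * e" unfolding eq(2)[symmetric] using c4 by presburger
      moreover have "coprime 4 e" using e2 by (metis coprime_left_2_iff_odd coprime_power_left_iff numeral_Bit0_eq_double power2_eq_square mult_2)
      ultimately have "4 dvd r" by (simp add: coprime_dvd_mult_left_iff)
      then have "44 dvd r" using \<open>11 dvd r\<close> by presburger
      then have "act a b c d f = pullback e g 0 h f" using act f(2) tameD(1)[OF f(1) v(1)] by simp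
      then show ?thesis using mgrowth_affine[OF f(3), of "real_of_int e" "real_of_int h" "real_of_int g"] v by simp
    qed
  qed
qed simp

lemma periodic_has_q_expansion:
  assumes "mgrowth r f" "pullback 1 1 0 1 f = f"
  shows "\<exists>F. has_q_expansion 1 f F"
proof -
  obtain \<phi> where \<phi>: "\<phi> holomorphic_on upper_half_plane" "f = abs_mero_uhp \<phi>" "growth r \<phi>"
    using assms(1) unfolding mgrowth_def by blast
  have det: "(1::real) * 1 - 1 * 0 > 0" by simp
  have "abs_mero_uhp (\<lambda>z. \<phi> (moebius 1 1 0 1 z)) = abs_mero_uhp \<phi>"
    using assms(2) mero_uhp_pullback[OF holomorphic_imp_meromorphic_uhp[OF \<phi>(1)] det] by (simp add: \<phi>(2))
  from holomorphic_uhp_eqI[OF holomorphic_moebius[OF det \<phi>(1)] \<phi>(1) this]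
  have "\<phi> (z + of_nat 1) = \<phi> z" if "Im z > 0" for z using that by (simp add: moebius_def)
  from has_q_expansion_if_growth[OF \<phi>(1) _ this \<phi>(3)] show ?thesis by (simp add: \<phi>(2))
qed

text \<open>This is f(z / 2): invariance under z -> z + 1/2 becomes period 1, so the pole order of f
  in q^2 is counted in q.\<close>

definition halve :: "mero_uhp \<Rightarrow> mero_uhp" where "halve = pullback 1 0 0 2"

lemma halve_hom: "halve (f + g) = halve f + halve g" "halve (f - g) = halve f - halve g" "halve (f * g) = halve f * halve g"
    "halve (cst k) = cst k" "halve (f ^ n) = halve f ^ n"
proof -
  have det: "(1::real) * 2 - 0 * 0 > 0" by simp
  show "halve (f + g) = halve f + halve g" "halve (f - g) = halve f - halve g" "halve (cst k) = cst k"
    unfolding halve_def by (rule pullback_hom[OF det])+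
  have mult: "halve (f * g) = halve f * halve g" for f g unfolding halve_def by (rule pullback_hom[OF det])
  then show "halve (f * g) = halve f * halve g" .
  have "halve 1 = 1" using pullback_hom(5)[OF det, of 1] by (simp add: halve_def)
  then show "halve (f ^ n) = halve f ^ n" by (induction n) (simp_all add: mult)
qed

lemma mgrowth_halve_iff: "mgrowth r (halve f) \<longleftrightarrow> mgrowth (2 * r) f"
proof
  assume "mgrowth r (halve f)"
  from mgrowth_affine[OF this, of 2 1 0] have "mgrowth (2 * r) (pullback 2 0 0 1 (halve f))" by simp
  also have "pullback 2 0 0 1 (halve f) = pullback (2 * 1) (2 * 0) (2 * 0) (2 * 1) f"
    unfolding halve_def by (subst pullback_pullback) simp_all
  also have "\<dots> = act 1 0 0 1 f" by (subst pullback_scale) (simp_all add: act_def)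
  finally show "mgrowth (2 * r) f" by (simp add: act_one)
next
  assume "mgrowth (2 * r) f"
  from mgrowth_affine[OF this, of 1 2 0] show "mgrowth r (halve f)" by (simp add: halve_def)
qed

lemma halve_periodic:
  assumes "sop f = f"
  shows "pullback 1 1 0 1 (halve f) = halve f"
proof -
  have "halve (sop f) = pullback (2 * 1) (2 * 1) (2 * 0) (2 * 2) f"
    unfolding halve_def sop_def by (subst pullback_pullback) simp_all
  also have "\<dots> = pullback 1 1 0 2 f" by (subst pullback_scale) simp_all
  also have "\<dots> = pullback 1 1 0 1 (halve f)" unfolding halve_def by (subst pullback_pullback) simp_all
  finally show ?thesis using assms by simp
qed

lemma X44_growth: "mgrowth (4 * pi) X44"
proof -
  have PN: "growth (- pi) (\<lambda>s. P11 s - N11 s)" using growth_diff[OF P11_growth N11_growth] by simp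
  have "growth (- pi + 3 * pi) (\<lambda>s. (P11 s - N11 s) * inverse (R11 s))"
    by (intro growth_mult PN inverse_R11_growth)
  from growth_affine[OF this, of 2 0] have "growth (4 * pi) x44"
    by (simp add: x44_def[abs_def] divide_inverse)
  then show ?thesis unfolding mgrowth_def using x44_holomorphic by blast
qed

text \<open>The growth bound leaves room for at most a simple pole, and without any pole
  \<open>X44\<close> would be constant by \<open>liouville_w_invariant\<close>. The order is thus
  exact although no coefficient is computed.\<close>

lemma halve_X44_expansion:
  obtains F where "has_q_expansion 1 (halve X44) F" "fls_subdegree F = - 1"
proof -
  have gX: "mgrowth (2 * pi) (halve X44)" using X44_growth by (simp add: mgrowth_halve_iff)
  obtain F where F: "has_q_expansion 1 (halve X44) F"
    using periodic_has_q_expansion[OF gX halve_periodic[OF sop_generators(1)]] by blast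
  have "\<not> mgrowth 0 X44" using liouville_w_invariant[OF tame_X44 wop_generators(1)] X44_not_const by blast
  then have n0: "\<not> mgrowth 0 (halve X44)" by (simp add: mgrowth_halve_iff)
  have F0: "F \<noteq> 0"
  proof
    assume "F = 0"
    then have "halve X44 = cst 0" using has_q_expansion_zero_imp[of 1 "halve X44"] F by simp
    then show False using n0 mgrowth_cst[of 0] by simp
  qed
  have "2 * pi * fls_subdegree F \<ge> - (2 * pi) * real 1" by (rule subdegree_ge_if_mgrowth[OF gX _ F F0]) simp
  then have "2 * pi * (real_of_int (fls_subdegree F) + 1) \<ge> 0" by (simp add: algebra_simps)
  then have "real_of_int (fls_subdegree F) + 1 \<ge> 0" using pi_gt_zero by (auto simp: zero_le_mult_iff)
  then have ge: "fls_subdegree F \<ge> - 1" by linarith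
  have "fls_subdegree F < 0"
  proof (rule ccontr)
    assume "\<not> fls_subdegree F < 0"
    then have "- (2 * pi * fls_subdegree F / real 1) \<le> 0" by simp
    from mgrowth_mono[OF mgrowth_if_has_q_expansion[OF mgrowth_imp_regular[OF gX] _ F F0] this] n0 show False by simp
  qed
  then show ?thesis using that[OF F] ge by simp
qed

text \<open>Each step cancels the top polar coefficient by a multiple of \<open>X44 ^ Suc n\<close>
  and lowers the pole order of the halved function by one; without poles Liouville applies.\<close>

lemma hauptmodul:
  assumes "tame f" "wop f = f" "sop f = f" "mgrowth (4 * pi * real n) f"
  shows "\<exists>p. f = evx p"
  using assms
proof (induction n arbitrary: f)
  case 0
  then obtain k where "f = cst k" using liouville_w_invariant[of f] by auto
  then show ?case by (metis evx_const)
next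
  case (Suc n)
  obtain G where G: "has_q_expansion 1 (halve X44) G" "fls_subdegree G = - 1" by (rule halve_X44_expansion)
  have gf: "mgrowth (2 * pi * real (Suc n)) (halve f)" using Suc.prems(4) by (simp only: mgrowth_halve_iff) (simp add: mult.assoc)
  obtain F where F: "has_q_expansion 1 (halve f) F" using periodic_has_q_expansion[OF gf halve_periodic[OF Suc.prems(3)]] by blast
  have F0: "fls_nth F j = 0" if "j < - int (Suc n)" for j
  proof (cases "F = 0")
    case False
    have "2 * pi * fls_subdegree F \<ge> - (2 * pi * real (Suc n)) * real 1" by (rule subdegree_ge_if_mgrowth[OF gf _ F False]) simp
    then have "2 * pi * (real_of_int (fls_subdegree F) + real (Suc n)) \<ge> 0" by (simp add: algebra_simps)
    then have "real_of_int (fls_subdegree F) + real (Suc n) \<ge> 0" using pi_gt_zero by (auto simp: zero_le_mult_iff)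
    then have "fls_subdegree F \<ge> - int (Suc n)" by linarith
    then show ?thesis using that by simp
  qed simp
  have Gn: "fls_subdegree (G ^ Suc n) = - int (Suc n)" using G(2) fls_subdegree_pow[of G "Suc n"] by simp
  have "G \<noteq> 0" using G(2) by auto
  then have "G ^ Suc n \<noteq> 0" by simp
  then have lead: "fls_nth (G ^ Suc n) (- int (Suc n)) \<noteq> 0" using Gn nth_fls_subdegree_nonzero by metis
  define k where "k = fls_nth F (- int (Suc n)) / fls_nth (G ^ Suc n) (- int (Suc n))"
  define g where "g = f - cst k * X44 ^ Suc n"
  define H where "H = F + fls_const (- k) * G ^ Suc n"
  have H: "has_q_expansion 1 (halve g) H"
  proof -
    have "has_q_expansion 1 (halve f + cst (- k) * halve X44 ^ Suc n) H"
      unfolding H_def by (intro has_q_expansion_add has_q_expansion_mult has_q_expansion_cst has_q_expansion_power F G) simp_all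
    moreover have "halve g = halve f + cst (- k) * halve X44 ^ Suc n"
      unfolding g_def halve_hom cst_uminus by simp
    ultimately show ?thesis by simp
  qed
  have Hz: "fls_nth H j = 0" if "j < - int n" for j
  proof (cases "j = - int (Suc n)")
    case True
    then show ?thesis using lead by (simp add: H_def k_def del: power_Suc)
  next
    case False
    then have j: "j < - int (Suc n)" using that by simp
    then have "fls_nth (G ^ Suc n) j = 0" using Gn by (metis fls_eq0_below_subdegree)
    then show ?thesis using F0[OF j] by (simp add: H_def del: power_Suc)
  qed
  have gX: "mgrowth (real (Suc n) * (2 * pi)) (halve X44 ^ Suc n)"
    by (rule mgrowth_power) (use X44_growth in \<open>simp add: mgrowth_halve_iff\<close>)
  have "mgrowth (2 * pi * real (Suc n)) (halve f - cst k * halve X44 ^ Suc n)"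
    by (rule mgrowth_diff[OF gf mgrowth_cmult]) (use gX in \<open>simp add: mult.commute\<close>)
  then have reg: "regular (halve g)" unfolding g_def halve_hom by (rule mgrowth_imp_regular)
  have "mgrowth (2 * pi * real n) (halve g)"
  proof (cases "H = 0")
    case True
    then have "halve g = cst 0" using has_q_expansion_zero_imp[of 1 "halve g"] H by simp
    moreover have "0 \<le> 2 * pi * real n" by simp
    ultimately show ?thesis using mgrowth_mono[OF mgrowth_cst[of 0]] by metis
  next
    case False
    have "fls_subdegree H \<ge> - int n" by (rule fls_subdegree_geI[OF False Hz])
    then have "real_of_int (fls_subdegree H) \<ge> - real n" by linarith
    then have "2 * pi * - real n \<le> 2 * pi * real_of_int (fls_subdegree H)" by (intro mult_left_mono) simp_all
    then have "- (2 * pi * fls_subdegree H / real 1) \<le> 2 * pi * real n" by simp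
    from mgrowth_mono[OF mgrowth_if_has_q_expansion[OF reg _ H False] this] show ?thesis by simp
  qed
  then have gr: "mgrowth (4 * pi * real n) g" by (simp only: mgrowth_halve_iff) (simp add: mult.assoc)
  have tg: "tame g"
    using tame_add[OF Suc.prems(1) tame_mult[OF tame_cst[of "- k"] tame_power[OF tame_X44, of "Suc n"]]]
    by (simp add: g_def cst_uminus del: power_Suc)
  have pow: "wop (X44 ^ m) = X44 ^ m" "sop (X44 ^ m) = X44 ^ m" for m
    using wop_hom(5)[of 1] sop_hom(5)[of 1] by (induction m) (simp_all add: wop_hom sop_hom wop_generators sop_generators)
  have "\<exists>p. g = evx p"
    by (rule Suc.IH[OF tg _ _ gr]) (simp_all add: g_def wop_hom sop_hom pow Suc.prems del: power_Suc)
  then obtain p where "g = evx p" ..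
  then have "f = evx (p + monom k (Suc n))" by (simp add: evx_add evx_monom g_def diff_eq_eq del: power_Suc)
  then show ?case ..
qed

lemma
  shows Y44_square: "Y44 ^ 2 = evx [:- 1, 3, 1, 1:]" and T44_square: "T44 ^ 2 = evx [:7, 3, 5, 1:]"
proof -
  note mer = holomorphic_imp_meromorphic_uhp[OF x44_holomorphic] holomorphic_imp_meromorphic_uhp[OF y44_holomorphic] holomorphic_imp_meromorphic_uhp[OF t44_holomorphic]
  have cm: "(\<lambda>_. k) meromorphic_on upper_half_plane" for k by (rule meromorphic_on_const)
  have hol: "(\<lambda>z. y44 z * y44 z) holomorphic_on upper_half_plane" "(\<lambda>z. t44 z * t44 z) holomorphic_on upper_half_plane"
    by (intro holomorphic_intros y44_holomorphic t44_holomorphic)+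
  have cubic: "evx [:a, b, c, 1:] = abs_mero_uhp (\<lambda>z. a + x44 z * (b + x44 z * (c + x44 z * 1)))" for a b c
    unfolding evx_def by (simp add: map_poly_pCons del: cst_1) (simp add: cst_def mero_uhp_add mero_uhp_mult mer cm meromorphic_intros del: cst_1)
  show "Y44 ^ 2 = evx [:- 1, 3, 1, 1:]"
    unfolding cubic power2_eq_square mero_uhp_mult[OF mer(2) mer(2)]
    by (rule abs_mero_uhp_cong[OF hol(1)]) (use y44_square in \<open>simp add: power2_eq_square power3_eq_cube algebra_simps\<close>)
  show "T44 ^ 2 = evx [:7, 3, 5, 1:]"
    unfolding cubic power2_eq_square mero_uhp_mult[OF mer(3) mer(3)]
    by (rule abs_mero_uhp_cong[OF hol(2)]) (use t44_square in \<open>simp add: power2_eq_square power3_eq_cube algebra_simps\<close>)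
qed

definition avg :: "mero_uhp \<Rightarrow> mero_uhp" where
  "avg g = cst (1 / 4) * (g + wop g + (sop g + sop (wop g)))"

lemma avg_eq_evx:
  assumes "tame g"
  shows "\<exists>p. avg g = evx p"
proof -
  have t: "tame (avg g)"
    unfolding avg_def by (intro tame_mult tame_cst tame_add tame_wop tame_sop assms)
  obtain r where r: "mgrowth r (avg g)" using tameD(2)[OF t, of 1 0 0 1] by (auto simp: act_one unimod_def)
  obtain n :: nat where n: "r / (4 * pi) \<le> real n" using real_arch_simple by blast
  have "wop (sop g) = sop (wop g)" "wop (wop g) = g" "sop (sop g) = g" "wop (sop (wop g)) = sop g" "sop (sop (wop g)) = wop g"
    using assms by (simp_all add: wop_sop wop_wop sop_sop tame_wop tame_sop)
  then have inv: "wop (avg g) = avg g" "sop (avg g) = avg g"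
    by (simp_all add: avg_def wop_hom sop_hom algebra_simps)
  have "mgrowth (4 * pi * real n) (avg g)" by (rule mgrowth_mono[OF r]) (use n in \<open>simp add: field_simps\<close>)
  from hauptmodul[OF t inv this] show ?thesis .
qed

lemma Y44_nonzero: "Y44 \<noteq> 0" and T44_nonzero: "T44 \<noteq> 0"
  using Y44_square T44_square by (auto simp: evx_eq_0_iff)

text \<open>1, Y, T and Y T belong to the four distinct characters of the four-group. The averages
  of their products with f are polynomials in \<open>X44\<close>, and orthogonality of characters
  recovers f from them; multiplication by Y^2 T^2 avoids denominators.\<close>

lemma tame_relation:
  assumes f: "tame f"
  shows "\<exists>q0 q1 q2 q3 q4. q0 \<noteq> 0 \<and> evx q0 * f = evx q1 + evx q2 * Y44 + evx q3 * T44 + evx q4 * Y44 * T44"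
proof -
  obtain p0 where p0: "avg f = evx p0" using avg_eq_evx[OF f] by blast
  obtain p1 where p1: "avg (f * Y44) = evx p1" using avg_eq_evx[OF tame_mult[OF f tame_Y44]] by blast
  obtain p2 where p2: "avg (f * T44) = evx p2" using avg_eq_evx[OF tame_mult[OF f tame_T44]] by blast
  obtain p3 where p3: "avg (f * (Y44 * T44)) = evx p3" using avg_eq_evx[OF tame_mult[OF f tame_mult[OF tame_Y44 tame_T44]]] by blast
  define k where "k = cst (1 / 4)"
  have "cst 4 * k = 1" unfolding k_def by (subst cst_mult[symmetric]) simp
  then have k: "k * 4 = 1" by (simp add: mult.commute)
  have avg: "avg f * (Y44 ^ 2 * T44 ^ 2) + avg (f * Y44) * (Y44 * T44 ^ 2) + avg (f * T44) * (T44 * Y44 ^ 2) + avg (f * (Y44 * T44)) * (Y44 * T44)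
      = (k * 4) * (f * (Y44 ^ 2 * T44 ^ 2))"
    unfolding avg_def k_def[symmetric] wop_hom sop_hom wop_generators sop_generators
    by (simp add: algebra_simps power2_eq_square)
  let ?c = "[:- 1, 3, 1, 1:] :: complex poly" and ?d = "[:7, 3, 5, 1:] :: complex poly"
  have "evx (?c * ?d) * f = evx (p0 * ?c * ?d) + evx (p1 * ?d) * Y44 + evx (p2 * ?c) * T44 + evx p3 * Y44 * T44"
    using avg unfolding k p0 p1 p2 p3 evx_mult Y44_square[symmetric] T44_square[symmetric] by (simp add: algebra_simps)
  moreover have "?c * ?d \<noteq> 0" by simp
  ultimately show ?thesis by blast
qed

subsection \<open>The field structure\<close>

text \<open>Two functions may come with different widths at the same cusp; the product of the widths
  serves both.\<close>

lemma has_q_expansion_widen: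
  assumes "has_q_expansion h f F" "h > 0" "k > 0"
  shows "\<exists>F'. has_q_expansion (h * k) f F'"
proof -
  obtain \<phi> where f: "\<phi> meromorphic_on upper_half_plane" "f = abs_mero_uhp \<phi>" by (rule mero_uhp_cases)
  obtain A c where A: "A has_laurent_expansion F" "c \<ge> 0" "\<And>z. Im z > c \<Longrightarrow> \<forall>\<^sub>F w in at z. \<phi> w = A (nome h w)"
    using has_q_expansionE assms f by metis
  have "A meromorphic_on {0}" using A(1) unfolding meromorphic_on_def by auto
  then have "(\<lambda>q. A (q ^ k)) meromorphic_on {0}"
    by (rule meromorphic_on_compose[where A="{0}"]) (use assms in \<open>auto intro!: analytic_intros\<close>)
  then obtain F' where "(\<lambda>q. A (q ^ k)) has_laurent_expansion F'" unfolding meromorphic_on_def by auto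
  moreover have "nome (h * k) w ^ k = nome h w" for w
    using assms unfolding nome_def by (subst exp_of_nat_mult[symmetric]) (simp add: field_simps)
  ultimately have "has_q_expansion (h * k) (abs_mero_uhp \<phi>) F'"
    using A assms by (subst has_q_expansion_altdef[OF f(1)]) (auto intro!: exI[of _ "\<lambda>q. A (q ^ k)"] exI[of _ c])
  then show ?thesis using f(2) by blast
qed

lemma
  assumes f: "f \<in> X0_field N" and g: "g \<in> X0_field N"
  shows X0_field_add: "f + g \<in> X0_field N" and X0_field_mult: "f * g \<in> X0_field N"
proof -
  have common: "\<exists>h>0. (\<exists>F. has_q_expansion h (act a b c d f) F) \<and> (\<exists>G. has_q_expansion h (act a b c d g) G)" if u: "unimod a b c d" for a b c d
  proof -
    obtain h F where F: "h > 0" "has_q_expansion h (act a b c d f) F" using X0_fieldD(2)[OF f u] by blast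
    obtain k G where G: "k > 0" "has_q_expansion k (act a b c d g) G" using X0_fieldD(2)[OF g u] by blast
    show ?thesis
      using has_q_expansion_widen[OF F(2,1) G(1)] has_q_expansion_widen[OF G(2,1) F(1)] F(1) G(1)
      by (intro exI[of _ "h * k"]) (simp add: mult.commute)
  qed
  show "f + g \<in> X0_field N"
  proof (rule X0_fieldI)
    fix a b c d :: int assume u: "unimod a b c d"
    show "int N dvd c \<Longrightarrow> act a b c d (f + g) = f + g"
      using X0_fieldD(1)[OF f u] X0_fieldD(1)[OF g u] by (simp add: act_hom[OF u])
    show "\<exists>h>0. \<exists>F. has_q_expansion h (act a b c d (f + g)) F"
      unfolding act_hom[OF u] using common[OF u] has_q_expansion_add by blast
  qed
  show "f * g \<in> X0_field N"
  proof (rule X0_fieldI)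
    fix a b c d :: int assume u: "unimod a b c d"
    show "int N dvd c \<Longrightarrow> act a b c d (f * g) = f * g"
      using X0_fieldD(1)[OF f u] X0_fieldD(1)[OF g u] by (simp add: act_hom[OF u])
    show "\<exists>h>0. \<exists>F. has_q_expansion h (act a b c d (f * g)) F"
      unfolding act_hom[OF u] using common[OF u] has_q_expansion_mult by blast
  qed
qed

lemma X0_field_cst: "cst k \<in> X0_field N"
  by (rule X0_fieldI) (auto simp: act_hom intro!: exI[of _ "1::nat"] has_q_expansion_cst)

lemma X0_field_inverse:
  assumes f: "f \<in> X0_field N"
  shows "inverse f \<in> X0_field N"
proof (rule X0_fieldI)
  fix a b c d :: int assume u: "unimod a b c d"
  show "int N dvd c \<Longrightarrow> act a b c d (inverse f) = inverse f"
    using X0_fieldD(1)[OF f u] by (simp add: act_hom[OF u])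
  show "\<exists>h>0. \<exists>F. has_q_expansion h (act a b c d (inverse f)) F"
    unfolding act_hom[OF u] using X0_fieldD(2)[OF f u] has_q_expansion_inverse by blast
qed

subsection \<open>Clearing poles\<close>

text \<open>Values at single points carry no information about a class of functions, hence the
  condition on the limit of a representative.\<close>

definition reg_at :: "mero_uhp \<Rightarrow> complex \<Rightarrow> bool" where
  "reg_at f z \<longleftrightarrow> (\<exists>\<phi> k. \<phi> meromorphic_on upper_half_plane \<and> f = abs_mero_uhp \<phi> \<and> \<phi> \<midarrow>z\<rightarrow> k)"

lemma reg_at_mult_regular:
  assumes "regular g" "reg_at f z" "Im z > 0"
  shows "reg_at (g * f) z"
proof -
  obtain \<phi> k where f: "\<phi> meromorphic_on upper_half_plane" "f = abs_mero_uhp \<phi>" "\<phi> \<midarrow>z\<rightarrow> k" using assms(2) unfolding reg_at_def by blast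
  obtain \<psi> where g: "\<psi> holomorphic_on upper_half_plane" "g = abs_mero_uhp \<psi>" using assms(1) unfolding regular_def by blast
  have "isCont \<psi> z"
    using holomorphic_on_imp_continuous_on[OF g(1)] open_upper_half_plane assms(3) by (simp add: continuous_on_eq_continuous_at)
  then have "\<psi> \<midarrow>z\<rightarrow> \<psi> z" by (simp add: isCont_def)
  from tendsto_mult[OF this f(3)] show ?thesis
    unfolding reg_at_def f(2) g(2) mero_uhp_mult[OF holomorphic_imp_meromorphic_uhp[OF g(1)] f(1)]
    using f(1) holomorphic_imp_meromorphic_uhp[OF g(1)] by (intro exI[of _ "\<lambda>z. \<psi> z * \<phi> z"] exI[of _ "\<psi> z * k"]) (auto intro!: meromorphic_intros)
qed

lemma reg_at_act:
  assumes "reg_at f (moebius a b c d z)" "unimod a b c d" "Im z > 0"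
  shows "reg_at (act a b c d f) z"
proof -
  obtain \<phi> k where f: "\<phi> meromorphic_on upper_half_plane" "f = abs_mero_uhp \<phi>" "\<phi> \<midarrow>moebius a b c d z\<rightarrow> k" using assms(1) unfolding reg_at_def by blast
  note det = unimod_real[OF assms(2)]
  show ?thesis
    unfolding reg_at_def f(2) act_def mero_uhp_pullback[OF f(1) det]
    using meromorphic_on_moebius[OF det f(1)] filterlim_compose[OF f(3) filterlim_moebius_at[OF det assms(3)]] by blast
qed

lemma regular_if_reg_at:
  assumes "\<And>z. Im z > 0 \<Longrightarrow> reg_at f z"
  shows "regular f"
proof -
  obtain \<phi> where f: "\<phi> meromorphic_on upper_half_plane" "f = abs_mero_uhp \<phi>" by (rule mero_uhp_cases)
  have iso: "isolated_singularity_at \<phi> z" if "Im z > 0" for z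
    using f(1) that by (intro meromorphic_on_isolated_singularity) (auto intro: meromorphic_on_subset)
  have an: "remove_sings \<phi> analytic_on {z}" if z: "Im z > 0" for z
  proof -
    obtain \<psi> k where g: "\<psi> meromorphic_on upper_half_plane" "f = abs_mero_uhp \<psi>" "\<psi> \<midarrow>z\<rightarrow> k" using assms[OF z] unfolding reg_at_def by blast
    have "\<forall>\<^sub>F w in at z. \<psi> w = \<phi> w" using mero_uhp_eq_iff[OF g(1) f(1)] f(2) g(2) z by simp
    then have "\<phi> \<midarrow>z\<rightarrow> k" using g(3) by (rule Lim_transform_eventually[rotated])
    then show ?thesis by (rule remove_sings_analytic_at[OF iso[OF z]])
  qed
  have "remove_sings \<phi> analytic_on upper_half_plane" using an analytic_on_analytic_at[of "remove_sings \<phi>" upper_half_plane] by simp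
  then have hol: "remove_sings \<phi> holomorphic_on upper_half_plane" by (rule analytic_imp_holomorphic)
  have "f = abs_mero_uhp (remove_sings \<phi>)"
    unfolding f(2) mero_uhp_eq_iff[OF f(1) holomorphic_imp_meromorphic_uhp[OF hol]]
    by (intro allI impI, rule eventually_mono[OF eventually_remove_sings_eq_at[OF iso]]) auto
  then show ?thesis using hol unfolding regular_def by blast
qed

text \<open>Laurent orders are compared: m exceeds the pole order, and the m-th power of a function
  vanishing at z has order at least m. As m is positive, an identically vanishing function is
  covered too.\<close>

lemma pole_cancellation:
  assumes \<phi>: "\<phi> meromorphic_on upper_half_plane" and \<psi>: "\<psi> holomorphic_on upper_half_plane" and z: "Im z > 0" "\<psi> z = 0"
  obtains m k where "(\<lambda>w. \<psi> w ^ m * \<phi> w) \<midarrow>z\<rightarrow> k"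
proof -
  obtain F where F: "(\<lambda>w. \<phi> (z + w)) has_laurent_expansion F" using \<phi> z unfolding meromorphic_on_def by auto
  have "\<psi> analytic_on {z}" using \<psi> z by (simp add: analytic_at open_upper_half_plane exI[of _ upper_half_plane])
  from has_laurent_expansion_fps[OF analytic_at_imp_has_fps_expansion[OF this]]
  have G: "(\<lambda>w. \<psi> (z + w)) has_laurent_expansion fps_to_fls (fps_expansion \<psi> z)" .
  define G where "G = fps_expansion \<psi> z"
  have G0: "fps_nth G 0 = 0" by (simp add: G_def fps_expansion_def z)
  define m where "m = Suc (nat \<bar>fls_subdegree F\<bar>)"
  have E: "(\<lambda>w. \<psi> (z + w) ^ m * \<phi> (z + w)) has_laurent_expansion fps_to_fls G ^ m * F"
    unfolding G_def by (intro has_laurent_expansion_mult has_laurent_expansion_power G F)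
  have "fls_subdegree (fps_to_fls G ^ m * F) \<ge> 0"
  proof (cases "G = 0 \<or> F = 0")
    case True
    then show ?thesis by (auto simp: m_def)
  next
    case False
    then have "subdegree G \<ge> 1" using G0 by (metis One_nat_def less_one linorder_not_less nth_subdegree_nonzero)
    then have "int m * int (subdegree G) \<ge> int m * 1" by (intro mult_left_mono) simp_all
    moreover have "int m \<ge> - fls_subdegree F" by (simp add: m_def)
    moreover have "fls_subdegree (fps_to_fls G ^ m * F) = int m * int (subdegree G) + fls_subdegree F"
      using False by (simp add: fls_subdegree_pow fls_subdegree_fls_to_fps del: power_Suc of_nat_Suc)
    ultimately show ?thesis by linarith
  qed
  from has_laurent_expansion_imp_tendsto[OF E this] show ?thesis by (rule that)
qed

text \<open>The expansion makes f regular above some height; the rest of the box is compact and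
  contains finitely many poles.\<close>

lemma finite_bad_points:
  assumes q: "has_q_expansion h f F" "h > 0"
  shows "finite {z. \<bar>Re z\<bar> \<le> 1 / 2 \<and> Im z \<ge> 1 / 2 \<and> \<not> reg_at f z}"
proof -
  obtain \<phi> where f: "\<phi> meromorphic_on upper_half_plane" "f = abs_mero_uhp \<phi>" by (rule mero_uhp_cases)
  obtain A c where A: "A has_laurent_expansion F" "c \<ge> 0" "\<And>z. Im z > c \<Longrightarrow> \<forall>\<^sub>F w in at z. \<phi> w = A (nome h w)"
    using has_q_expansionE q f by metis
  have "isolated_singularity_at A 0" using A(1) by (rule has_laurent_expansion_isolated_0)
  then have "\<forall>\<^sub>F q in at 0. A analytic_on {q}" by (simp add: isolated_singularity_at_altdef)
  from nome_eventually[OF this q(2)] obtain c' where c': "\<And>z. Im z > c' \<Longrightarrow> A analytic_on {nome h z}" by blast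
  define Y where "Y = max c c'"
  have reg_high: "reg_at f z" if "Im z > Y" for z
  proof -
    have "isCont A (nome h z)" using c' that by (simp add: Y_def analytic_at_imp_isCont)
    moreover have "isCont (nome h) z"
      using holomorphic_on_imp_continuous_on[OF nome_holomorphic[of h UNIV]] by (simp add: continuous_on_eq_continuous_at)
    ultimately have "isCont (\<lambda>w. A (nome h w)) z" by (rule isCont_o2[rotated])
    then have "(\<lambda>w. A (nome h w)) \<midarrow>z\<rightarrow> A (nome h z)" by (simp add: isCont_def)
    moreover have "\<forall>\<^sub>F w in at z. A (nome h w) = \<phi> w" using A(3)[of z] that by (auto simp: Y_def elim: eventually_mono)
    ultimately have "\<phi> \<midarrow>z\<rightarrow> A (nome h z)" by (rule Lim_transform_eventually)
    then show ?thesis unfolding reg_at_def using f by blast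
  qed
  define K where "K = cbox (Complex (- 1 / 2) (1 / 2)) (Complex (1 / 2) Y)"
  have K: "z \<in> K \<longleftrightarrow> \<bar>Re z\<bar> \<le> 1 / 2 \<and> 1 / 2 \<le> Im z \<and> Im z \<le> Y" for z
    by (auto simp: K_def in_cbox_complex_iff abs_le_iff)
  have "eventually (\<lambda>z. \<phi> analytic_on {z}) (cosparse upper_half_plane)" by (rule meromorphic_on_imp_analytic_cosparse[OF f(1)])
  then have "{z. \<not> \<phi> analytic_on {z}} sparse_in upper_half_plane" by (simp add: eventually_cosparse)
  then have "{z. \<not> \<phi> analytic_on {z}} sparse_in K" by (rule sparse_in_subset) (auto simp: K)
  then have "finite (K \<inter> {z. \<not> \<phi> analytic_on {z}})" by (rule sparse_in_compact_finite) (simp add: K_def)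
  then show ?thesis
  proof (rule finite_subset[rotated], intro subsetI)
    fix z assume "z \<in> {z. \<bar>Re z\<bar> \<le> 1 / 2 \<and> Im z \<ge> 1 / 2 \<and> \<not> reg_at f z}"
    then have z: "\<bar>Re z\<bar> \<le> 1 / 2" "Im z \<ge> 1 / 2" "\<not> reg_at f z" by auto
    have "\<not> \<phi> analytic_on {z}"
    proof
      assume "\<phi> analytic_on {z}"
      then have "\<phi> \<midarrow>z\<rightarrow> \<phi> z" using analytic_at_imp_isCont isCont_def by blast
      then show False using z(3) f unfolding reg_at_def by blast
    qed
    then show "z \<in> K \<inter> {z. \<not> \<phi> analytic_on {z}}" using z reg_high[of z] by (auto simp: K not_less[symmetric])
  qed
qed

lemma tame_evx: "tame (evx p)"
proof (induction p)
  case (pCons a p)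
  have "evx (pCons a p) = cst a + X44 * evx p" unfolding evx_def by (simp add: map_poly_pCons)
  then show ?case using pCons by (simp add: tame_add tame_mult tame_cst tame_X44)
qed (use tame_cst[of 0] in \<open>simp add: evx_0\<close>)

lemma regular_act_evx: "unimod a b c d \<Longrightarrow> regular (act a b c d (evx p))"
  using tameD(2)[OF tame_evx] mgrowth_imp_regular by blast

lemma pole_cancellation_act:
  assumes u: "unimod a b c d" and z: "Im z > 0"
  obtains m where "reg_at (act a b c d (evx ([:- x44 (moebius a b c d z), 1:] ^ m) * f)) z"
proof -
  obtain \<phi> where f: "\<phi> meromorphic_on upper_half_plane" "act a b c d f = abs_mero_uhp \<phi>" by (rule mero_uhp_cases)
  define v where "v = x44 (moebius a b c d z)"
  have hol: "(\<lambda>w. x44 (moebius a b c d w)) holomorphic_on upper_half_plane" by (rule holomorphic_moebius[OF unimod_real[OF u] x44_holomorphic])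
  have hol': "(\<lambda>w. x44 (moebius a b c d w) - v) holomorphic_on upper_half_plane" by (intro holomorphic_intros hol)
  have pow: "(\<lambda>w. (x44 (moebius a b c d w) - v) ^ m) meromorphic_on upper_half_plane" for m
    by (intro holomorphic_imp_meromorphic_uhp holomorphic_intros hol)
  have X: "act a b c d (evx [:- v, 1:]) = abs_mero_uhp (\<lambda>w. x44 (moebius a b c d w) - v)"
  proof -
    have "act a b c d (evx [:- v, 1:]) = act a b c d X44 - cst v" by (simp add: evx_X act_hom[OF u] cst_uminus)
    also have "\<dots> = abs_mero_uhp (\<lambda>w. x44 (moebius a b c d w)) - abs_mero_uhp (\<lambda>_. v)"
      by (simp add: act_abs_mero_uhp[OF x44_holomorphic u] cst_def)
    finally show ?thesis using mero_uhp_diff[OF holomorphic_imp_meromorphic_uhp[OF hol] meromorphic_on_const] by simp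
  qed
  have Xm: "abs_mero_uhp (\<lambda>w. x44 (moebius a b c d w) - v) ^ m = abs_mero_uhp (\<lambda>w. (x44 (moebius a b c d w) - v) ^ m)" for m
  proof (induction m)
    case 0
    show ?case using cst_1 unfolding cst_def by simp
  next
    case (Suc m)
    then show ?case using mero_uhp_mult[OF holomorphic_imp_meromorphic_uhp[OF hol'] pow] by simp
  qed
  obtain m k where mk: "(\<lambda>w. (x44 (moebius a b c d w) - v) ^ m * \<phi> w) \<midarrow>z\<rightarrow> k"
    by (rule pole_cancellation[OF f(1) hol' z]) (simp add: v_def)
  have "act a b c d (evx ([:- v, 1:] ^ m) * f) = abs_mero_uhp (\<lambda>w. (x44 (moebius a b c d w) - v) ^ m * \<phi> w)"
    unfolding act_hom[OF u] evx_power act_power[OF u] X Xm f(2) by (rule mero_uhp_mult[OF pow f(1)])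
  moreover have "(\<lambda>w. (x44 (moebius a b c d w) - v) ^ m * \<phi> w) meromorphic_on upper_half_plane"
    by (intro meromorphic_intros pow f)
  ultimately have "reg_at (act a b c d (evx ([:- v, 1:] ^ m) * f)) z" using mk unfolding reg_at_def by blast
  then show ?thesis using that unfolding v_def by blast
qed

text \<open>Every point can be moved into the box at the cost of replacing f by one of finitely many
  translates. Each translate has finitely many poles there, and one at z is cleared by a power of X
  - x(gamma z), gamma being the representative.\<close>

lemma clear_poles:
  assumes f: "f \<in> X0_field 44"
  shows "\<exists>B. B \<noteq> 0 \<and> regular (evx B * f)"
proof -
  obtain X :: "(int \<times> int \<times> int \<times> int) set" where X: "finite X" "\<And>a b c d. (a, b, c, d) \<in> X \<Longrightarrow> unimod a b c d"
    "\<And>a b c d. unimod a b c d \<Longrightarrow> \<exists>a' b' c' d'. (a', b', c', d') \<in> X \<and> int 44 dvd c * d' - d * c' \<and>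
       (\<forall>f \<in> X0_field 44. act a b c d f = act a' b' c' d' f)"
    using finite_representatives[of 44] by (metis zero_less_numeral)
  define act' where "act' = (\<lambda>(a, b, c, d). act a b c d)"
  define v where "v = (\<lambda>((a, b, c, d), z). x44 (moebius (real_of_int a) (real_of_int b) (real_of_int c) (real_of_int d) z))"
  define box where "box = {z. \<bar>Re z\<bar> \<le> 1 / 2 \<and> Im z \<ge> 1 / 2}"
  define Bad where "Bad = (SIGMA g:X. {z \<in> box. \<not> reg_at (act' g f) z})"
  have fin: "finite Bad"
    unfolding Bad_def
  proof (rule finite_SigmaI[OF X(1)])
    fix g assume g: "g \<in> X"
    obtain a b c d where abcd: "g = (a, b, c, d)" by (cases g)
    obtain h F where "h > 0" "has_q_expansion h (act a b c d f) F" using X0_fieldD(2)[OF f X(2)] g abcd by blast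
    from finite_bad_points[OF this(2,1)] show "finite {z \<in> box. \<not> reg_at (act' g f) z}"
      by (simp add: box_def act'_def abcd conj_assoc)
  qed
  have "\<exists>m. reg_at (act' (fst p) (evx ([:- v p, 1:] ^ m) * f)) (snd p)" if p: "p \<in> Bad" for p
  proof -
    obtain a b c d z where abcd: "p = ((a, b, c, d), z)" by (metis prod_cases5 surj_pair prod.collapse)
    have u: "unimod a b c d" and z: "Im z > 0" using p X(2) by (auto simp: abcd Bad_def box_def)
    from pole_cancellation_act[OF u z, of f] show ?thesis by (auto simp: abcd act'_def v_def)
  qed
  then obtain m where m: "\<And>p. p \<in> Bad \<Longrightarrow> reg_at (act' (fst p) (evx ([:- v p, 1:] ^ m p) * f)) (snd p)" by metis
  define B where "B = (\<Prod>p\<in>Bad. [:- v p, 1:] ^ m p)"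
  have "B \<noteq> 0" unfolding B_def using fin by simp
  have mem: "evx B * f \<in> X0_field 44" by (rule X0_field_mult[OF tame_imp_X0_field[OF tame_evx] f])
  have reg: "reg_at (act' g (evx B * f)) z" if g: "g \<in> X" and z: "z \<in> box" for g z
  proof -
    obtain a b c d where abcd: "g = (a, b, c, d)" by (cases g)
    have u: "unimod a b c d" using g X(2) abcd by blast
    have zp: "Im z > 0" using z by (simp add: box_def)
    show ?thesis
    proof (cases "(g, z) \<in> Bad")
      case True
      define B' where "B' = (\<Prod>p\<in>Bad - {(g, z)}. [:- v p, 1:] ^ m p)"
      have eq: "evx B * f = evx B' * (evx ([:- v (g, z), 1:] ^ m (g, z)) * f)"
        unfolding B_def B'_def prod.remove[OF fin True] evx_mult by (simp only: ac_simps)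
      have "reg_at (act a b c d (evx ([:- v (g, z), 1:] ^ m (g, z)) * f)) z"
        using m[OF True] by (simp add: act'_def abcd)
      from reg_at_mult_regular[OF regular_act_evx[OF u] this zp, of B']
      have "reg_at (act a b c d (evx B * f)) z" unfolding eq act_hom(3)[OF u, symmetric] .
      then show ?thesis by (simp add: act'_def abcd)
    next
      case False
      then have "reg_at (act a b c d f) z" using g z by (simp add: Bad_def act'_def abcd)
      from reg_at_mult_regular[OF regular_act_evx[OF u] this zp] show ?thesis by (simp add: act'_def abcd act_hom[OF u])
    qed
  qed
  have "regular (evx B * f)"
  proof (rule regular_if_reg_at)
    fix z :: complex assume z: "Im z > 0"
    obtain a b c d where u: "unimod a b c d" and box: "\<bar>Re (moebius a b c d z)\<bar> \<le> 1 / 2" "Im (moebius a b c d z) \<ge> 1 / 2"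
      using exists_high_translate[OF z] by blast
    obtain p q r s where g: "(p, q, r, s) \<in> X" "\<And>f. f \<in> X0_field 44 \<Longrightarrow> act d (- b) (- c) a f = act p q r s f"
      using X(3)[OF unimod_inverse[OF u]] by blast
    have "reg_at (act d (- b) (- c) a (evx B * f)) (moebius a b c d z)"
      using reg[OF g(1)] box g(2)[OF mem] by (simp add: box_def act'_def)
    from reg_at_act[OF this u z] have "reg_at (act a b c d (act d (- b) (- c) a (evx B * f))) z" .
    also have "act a b c d (act d (- b) (- c) a (evx B * f)) = act 1 0 0 1 (evx B * f)"
      unfolding act_act[OF u unimod_inverse[OF u]] using u by (simp add: unimod_def mult.commute)
    finally show "reg_at (evx B * f) z" by (simp add: act_one)
  qed
  then show ?thesis using \<open>B \<noteq> 0\<close> by blast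
qed

text \<open>The finitely many translates share a growth rate R, and (x - 1)^m decays with rate m pi
  / 22 at the cusps with 4 not dividing c.\<close>

lemma clear_cusps:
  assumes f: "f \<in> X0_field 44" "regular f"
  shows "\<exists>m. tame (evx ([:- 1, 1:] ^ m) * f)"
proof -
  obtain X :: "(int \<times> int \<times> int \<times> int) set" where X: "finite X" "\<And>a b c d. (a, b, c, d) \<in> X \<Longrightarrow> unimod a b c d"
    "\<And>a b c d. unimod a b c d \<Longrightarrow> \<exists>a' b' c' d'. (a', b', c', d') \<in> X \<and> int 44 dvd c * d' - d * c' \<and>
       (\<forall>f \<in> X0_field 44. act a b c d f = act a' b' c' d' f)"
    using finite_representatives[of 44] by (metis zero_less_numeral)
  have ex: "\<exists>r. mgrowth r (act a b c d f)" if u: "unimod a b c d" for a b c d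
  proof -
    obtain h F where F: "h > 0" "has_q_expansion h (act a b c d f) F" using X0_fieldD(2)[OF f(1) u] by blast
    show ?thesis
    proof (cases "F = 0")
      case True
      then have "act a b c d f = cst 0" using F has_q_expansion_zero_imp by simp
      then show ?thesis using mgrowth_cst by metis
    next
      case False
      then show ?thesis using mgrowth_if_has_q_expansion[OF regular_act[OF u f(2)] F] by blast
    qed
  qed
  define act' where "act' = (\<lambda>(a, b, c, d). act a b c d f)"
  have "\<exists>r. mgrowth r (act' g)" if "g \<in> X" for g
    using ex X(2) that by (cases g) (auto simp: act'_def)
  then obtain r where r: "\<And>g. g \<in> X \<Longrightarrow> mgrowth (r g) (act' g)" by metis
  define R where "R = (\<Sum>g\<in>X. \<bar>r g\<bar>)"
  have gR: "mgrowth R (act a b c d f)" if u: "unimod a b c d" for a b c d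
  proof -
    obtain p q u s where g: "(p, q, u, s) \<in> X" "act a b c d f = act p q u s f" using X(3)[OF u] f(1) by metis
    have "r (p, q, u, s) \<le> \<bar>r (p, q, u, s)\<bar>" by simp
    also have "\<dots> \<le> R" unfolding R_def by (rule member_le_sum[OF g(1) _ X(1)]) simp
    finally show ?thesis using mgrowth_mono r[OF g(1)] g(2) by (simp add: act'_def)
  qed
  obtain m :: nat where m: "R / (pi / 22) \<le> real m" using real_arch_simple by blast
  have mem: "evx ([:- 1, 1:] ^ m) * f \<in> X0_field 44" by (rule X0_field_mult[OF tame_imp_X0_field[OF tame_evx] f(1)])
  have "tame (evx ([:- 1, 1:] ^ m) * f)"
  proof (rule tameI)
    fix a b c d :: int assume u: "unimod a b c d"
    show "44 dvd c \<Longrightarrow> act a b c d (evx ([:- 1, 1:] ^ m) * f) = evx ([:- 1, 1:] ^ m) * f"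
      using X0_fieldD(1)[OF mem u] by simp
    show "\<exists>r. mgrowth r (act a b c d (evx ([:- 1, 1:] ^ m) * f))"
      unfolding act_hom[OF u] using tameD(2)[OF tame_evx u] mgrowth_mult gR[OF u] by blast
    assume n4: "\<not> 4 dvd c"
    have "act a b c d (evx [:- 1, 1:]) = act a b c d (X44 - 1)" by (simp add: evx_X cst_uminus)
    then have "mgrowth (real m * (- (pi / 22))) (act a b c d (evx ([:- 1, 1:] ^ m)))"
      using mgrowth_power[OF X44_cusp[OF u n4], of m] by (simp add: evx_power act_power[OF u])
    from mgrowth_mult[OF this gR[OF u]] have "mgrowth (real m * (- (pi / 22)) + R) (act a b c d (evx ([:- 1, 1:] ^ m) * f))"
      unfolding act_hom[OF u] .
    then show "mgrowth 0 (act a b c d (evx ([:- 1, 1:] ^ m) * f))"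
      by (rule mgrowth_mono) (use m pi_gt_zero in \<open>simp add: field_simps\<close>)
  qed
  then show ?thesis by blast
qed

theorem X0_field_relation:
  assumes f: "f \<in> X0_field 44"
  shows "\<exists>q0 q1 q2 q3 q4. q0 \<noteq> 0 \<and> evx q0 * f = evx q1 + evx q2 * Y44 + evx q3 * T44 + evx q4 * Y44 * T44"
proof -
  obtain B where B: "B \<noteq> 0" "regular (evx B * f)" using clear_poles[OF f] by blast
  have "evx B * f \<in> X0_field 44" by (rule X0_field_mult[OF tame_imp_X0_field[OF tame_evx] f])
  from clear_cusps[OF this B(2)] obtain m where m: "tame (evx ([:- 1, 1:] ^ m) * (evx B * f))" by blast
  from tame_relation[OF m] obtain q0 q1 q2 q3 q4 where q: "q0 \<noteq> 0"
    "evx q0 * (evx ([:- 1, 1:] ^ m) * (evx B * f)) = evx q1 + evx q2 * Y44 + evx q3 * T44 + evx q4 * Y44 * T44" by blast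
  have "evx (q0 * [:- 1, 1:] ^ m * B) * f = evx q1 + evx q2 * Y44 + evx q3 * T44 + evx q4 * Y44 * T44"
    unfolding q(2)[symmetric] evx_mult by (simp only: ac_simps)
  moreover have "q0 * [:- 1, 1:] ^ m * B \<noteq> 0" using q(1) B(1) by simp
  ultimately show ?thesis by blast
qed

section \<open>Rational \<open>q\<close>-expansions\<close>

definition rq :: "mero_uhp \<Rightarrow> bool" where
  "rq f \<longleftrightarrow> (\<exists>F. has_q_expansion 1 f F \<and> (\<forall>n. fls_nth F n \<in> \<rat>))"

lemma rq_cst: "k \<in> \<rat> \<Longrightarrow> rq (cst k)"
  unfolding rq_def by (intro exI[of _ "fls_const k"]) (simp add: has_q_expansion_cst)

lemma
  assumes "rq f" "rq g"
  shows rq_add: "rq (f + g)" and rq_mult: "rq (f * g)"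
proof -
  obtain F G where *: "has_q_expansion 1 f F" "\<And>n. fls_nth F n \<in> \<rat>" "has_q_expansion 1 g G" "\<And>n. fls_nth G n \<in> \<rat>"
    using assms unfolding rq_def by blast
  show "rq (f + g)"
    unfolding rq_def by (rule exI[of _ "F + G"]) (use has_q_expansion_add[OF *(1,3)] in \<open>simp add: * Rats_add\<close>)
  have "fls_nth (F * G) n \<in> \<rat>" for n
    unfolding fls_times_nth(1) by (intro Rats_sum Rats_mult *)
  then show "rq (f * g)"
    unfolding rq_def using has_q_expansion_mult[OF *(1,3)] by (intro exI[of _ "F * G"]) simp
qed

lemma rq_uminus: "rq f \<Longrightarrow> rq (- f)"
  using rq_mult[OF rq_cst[of "- 1"]] cst_uminus[of 1] by simp

lemma rq_diff: "rq f \<Longrightarrow> rq g \<Longrightarrow> rq (f - g)"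
  using rq_add[OF _ rq_uminus, of f g] by simp

lemma rq_power: "rq f \<Longrightarrow> rq (f ^ n)"
  by (induction n) (use rq_cst[of 1] in \<open>auto intro: rq_mult\<close>)

text \<open>Comparing coefficients in F G = 1 gives a recursion over the rationals in which only the
  leading coefficient of F is divided by.\<close>

lemma rq_inverse:
  assumes "rq f"
  shows "rq (inverse f)"
proof -
  obtain F where F: "has_q_expansion 1 f F" "\<And>n. fls_nth F n \<in> \<rat>" using assms unfolding rq_def by blast
  define G where "G = inverse F"
  have "fls_nth G n \<in> \<rat>" for n
  proof (cases "F = 0")
    case False
    define d where "d = fls_subdegree F"
    have dG: "fls_subdegree G = - d" using False by (simp add: G_def d_def)
    have FG: "F * G = 1" using False by (simp add: G_def)
    have rec: "fls_nth G (int k - d) \<in> \<rat>" for k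
    proof (induction k rule: less_induct)
      case (less k)
      let ?t = "\<lambda>i. fls_nth F (d + i) * fls_nth G (int k - d - i)"
      have "fls_nth (F * G) (int k) = (\<Sum>i = 0..int k. ?t i)"
        using fls_times_nth(4)[of F G "int k"] by (simp add: dG flip: d_def)
      also have "{0..int k} = insert 0 {1..int k}" by auto
      also have "(\<Sum>i\<in>insert 0 {1..int k}. ?t i) = fls_nth F d * fls_nth G (int k - d) + (\<Sum>i = 1..int k. ?t i)"
        by simp
      finally have eq: "fls_nth G (int k - d) = (fls_nth 1 (int k) - (\<Sum>i = 1..int k. ?t i)) / fls_nth F d"
        using False by (simp add: FG d_def field_simps)
      have "?t i \<in> \<rat>" if "i \<in> {1..int k}" for i
        using less[of "nat (int k - i)"] that F(2) by (auto intro!: Rats_mult simp: algebra_simps)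
      then show ?case unfolding eq by (intro Rats_divide Rats_diff Rats_sum F(2)) auto
    qed
    show ?thesis
    proof (cases "n < - d")
      case True
      then show ?thesis using dG by simp
    next
      case False
      then show ?thesis using rec[of "nat (n + d)"] by simp
    qed
  qed (simp add: G_def)
  then show ?thesis unfolding rq_def using has_q_expansion_inverse[OF F(1)] unfolding G_def by auto
qed

section \<open>Rationality of the theta expansions\<close>

lemma rq_power_series:
  fixes e :: "int \<Rightarrow> nat" and c :: "int \<Rightarrow> complex"
  assumes hol: "\<phi> holomorphic_on upper_half_plane"
    and fin: "\<And>m. finite {n. e n = m}" and c: "\<And>n. c n \<in> \<rat>"
    and sum: "\<And>z. Im z > 0 \<Longrightarrow> ((\<lambda>n. c n * nome 1 z ^ e n) has_sum \<phi> z) UNIV"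
  shows "rq (abs_mero_uhp \<phi>)"
proof -
  \<comment> \<open>Several n may share an exponent, n and -n for instance; finite fibres keep the
    collected coefficients rational.\<close>
  define C where "C m = (\<Sum>n | e n = m. c n)" for m
  have sums: "(\<lambda>m. C m * nome 1 z ^ m) sums \<phi> z" if z: "Im z > 0" for z
  proof -
    have bij: "bij_betw (\<lambda>n. (e n, n)) UNIV (SIGMA m:UNIV. {n. e n = m})"
      by (rule bij_betw_byWitness[where f' = snd]) auto
    have "((\<lambda>(m, n). c n * nome 1 z ^ m) has_sum \<phi> z) (SIGMA m:UNIV. {n. e n = m})"
      using has_sum_reindex_bij_betw[OF bij, of "\<lambda>(m, n). c n * nome 1 z ^ m"] sum[OF z] by simp
    then have "((\<lambda>m. C m * nome 1 z ^ m) has_sum \<phi> z) UNIV"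
      by (rule has_sum_SigmaD) (use fin in \<open>auto simp: C_def sum_distrib_right intro!: has_sum_finiteI\<close>)
    then show ?thesis by (rule has_sum_imp_sums)
  qed
  define F where "F = Abs_fps C"
  have rad: "fps_conv_radius F > 0"
  proof -
    have "fps_conv_radius F \<ge> norm (nome 1 \<i>)"
      unfolding fps_conv_radius_def F_def using sums[of \<i>] by (intro conv_radius_geI) (auto simp: sums_iff)
    moreover have "norm (nome 1 \<i>) > 0" by simp
    ultimately show ?thesis by (metis ereal_less(2) less_le_trans)
  qed
  have L: "eval_fps F has_laurent_expansion fps_to_fls F"
    by (intro has_laurent_expansion_fps eval_fps_has_fps_expansion rad)
  have val: "\<phi> z = eval_fps F (nome 1 z)" if "Im z > 0" for z
    using sums[OF that] by (simp add: eval_fps_def F_def sums_iff)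
  have "\<forall>\<^sub>F w in at z. \<phi> w = eval_fps F (nome 1 w)" if "Im z > 0" for z
  proof -
    have "\<forall>\<^sub>F w in at z. w \<in> upper_half_plane"
      using that by (intro eventually_at_in_open'[OF open_upper_half_plane]) auto
    then show ?thesis by eventually_elim (use val in auto)
  qed
  then have "has_q_expansion 1 (abs_mero_uhp \<phi>) (fps_to_fls F)"
    using L by (subst has_q_expansion_altdef[OF holomorphic_imp_meromorphic_uhp[OF hol]]) (auto intro!: exI[of _ "eval_fps F"] exI[of _ 0])
  moreover have "fls_nth (fps_to_fls F) n \<in> \<rat>" for n
    using c by (auto simp: F_def C_def intro!: Rats_sum)
  ultimately show ?thesis unfolding rq_def by blast
qed

text \<open>(2 n + \<beta>)^2 = 4 n (n + \<beta>) + \<beta>, since \<beta> is 0 or 1. The last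
  summand is the fractional power of q that is split off on the left of \<open>eq\<close>; the rest
  has exponents in the natural numbers.\<close>

lemma rq_gauss_series:
  fixes \<alpha> :: nat and \<beta> :: int and \<sigma> :: "int \<Rightarrow> complex"
  assumes hol: "\<phi> holomorphic_on upper_half_plane" and \<alpha>: "\<alpha> > 0" and \<beta>: "\<beta> = 0 \<or> \<beta> = 1"
    and \<sigma>: "\<And>n. \<sigma> n \<in> \<rat>" "\<And>n. norm (\<sigma> n) = 1"
    and eq: "\<And>z. Im z > 0 \<Longrightarrow> \<phi> z * exp (\<i> * pi * (of_nat \<alpha> * z) * of_int \<beta> / 2) = (\<Sum>\<^sub>\<infinity>n. \<sigma> n * gauss_term (of_nat \<alpha> * z) (2 * n + \<beta>))"
  shows "rq (abs_mero_uhp \<phi>)"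
proof (rule rq_power_series[OF hol _ \<sigma>(1)])
  have sq: "\<bar>n\<bar> \<le> \<bar>n * (n + \<beta>)\<bar> + 1" for n :: int
  proof -
    have "\<bar>n\<bar> \<le> \<bar>n\<bar> * \<bar>n + \<beta>\<bar> + 1"
    proof (cases "\<bar>n + \<beta>\<bar> \<ge> 1")
      case True
      then have "\<bar>n\<bar> * 1 \<le> \<bar>n\<bar> * \<bar>n + \<beta>\<bar>" by (intro mult_left_mono) auto
      then show ?thesis by simp
    next
      case False
      then have "n = - \<beta>" by linarith
      then show ?thesis using \<beta> by auto
    qed
    then show ?thesis by (simp add: abs_mult)
  qed
  have nonneg: "0 \<le> n * (n + \<beta>)" for n
    using \<beta> by (cases "n \<ge> 0") (auto simp: zero_le_mult_iff)
  show "finite {n. \<alpha> * nat (n * (n + \<beta>)) = m}" for m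
  proof (rule finite_subset[of _ "{- (int m + 1)..int m + 1}"], intro subsetI)
    fix n assume "n \<in> {n. \<alpha> * nat (n * (n + \<beta>)) = m}"
    then have "\<alpha> * nat (n * (n + \<beta>)) = m" by simp
    moreover have "1 * nat (n * (n + \<beta>)) \<le> \<alpha> * nat (n * (n + \<beta>))" by (rule mult_right_mono) (use \<alpha> in auto)
    ultimately have "nat (n * (n + \<beta>)) \<le> m" by simp
    then have "n * (n + \<beta>) \<le> int m" by simp
    then show "n \<in> {- (int m + 1)..int m + 1}" using sq[of n] nonneg[of n] by auto
  qed simp
  fix z :: complex assume z: "Im z > 0"
  define E where "E = exp (\<i> * pi * (\<alpha> * z) * of_int \<beta> / 2)"
  have gterm: "gauss_term (\<alpha> * z) (2 * n + \<beta>) = nome 1 z ^ (\<alpha> * nat (n * (n + \<beta>))) * E" for n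
  proof -
    have b2: "(of_int \<beta> :: complex) * of_int \<beta> = of_int \<beta>" using \<beta> by auto
    have "nome 1 z ^ (\<alpha> * nat (n * (n + \<beta>))) * E = exp (of_nat (\<alpha> * nat (n * (n + \<beta>))) * (2 * of_real pi * \<i> * z / of_nat 1) + \<i> * pi * (\<alpha> * z) * of_int \<beta> / 2)"
      unfolding nome_def E_def exp_add exp_of_nat_mult by (rule refl)
    also have "(of_nat (\<alpha> * nat (n * (n + \<beta>))) :: complex) = of_nat \<alpha> * (of_int n * (of_int n + of_int \<beta>))"
      using nonneg[of n] by simp
    also have "of_nat \<alpha> * (of_int n * (of_int n + of_int \<beta>)) * (2 * of_real pi * \<i> * z / of_nat 1) + \<i> * pi * (\<alpha> * z) * of_int \<beta> / 2 = \<i> * pi * (\<alpha> * z) * (of_int (2 * n + \<beta>))\<^sup>2 / 2"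
      by (simp add: power2_eq_square algebra_simps b2)
    finally show ?thesis by (simp add: gauss_term_def)
  qed
  have Ez: "E \<noteq> 0" by (simp add: E_def)
  have "Im (\<alpha> * z) > 0" using z \<alpha> by simp
  from gauss_term_summable[OF this, of 2 \<beta>]
  have "(\<lambda>n. norm (\<sigma> n * gauss_term (\<alpha> * z) (2 * n + \<beta>))) summable_on UNIV" by (simp add: norm_mult \<sigma>(2))
  then have "(\<lambda>n. \<sigma> n * gauss_term (\<alpha> * z) (2 * n + \<beta>)) summable_on UNIV" by (rule abs_summable_summable)
  then have "((\<lambda>n. \<sigma> n * gauss_term (\<alpha> * z) (2 * n + \<beta>)) has_sum \<phi> z * E) UNIV"
    unfolding E_def eq[OF z] by (rule has_sum_infsum)
  from has_sum_cmult_left[OF this, of "inverse E"]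
  show "((\<lambda>n. \<sigma> n * nome 1 z ^ (\<alpha> * nat (n * (n + \<beta>)))) has_sum \<phi> z) UNIV"
    using Ez by (simp add: gterm mult.assoc)
qed

lemma holomorphic_scale_uhp:
  assumes "\<phi> holomorphic_on upper_half_plane" "(a :: nat) > 0"
  shows "(\<lambda>z. \<phi> (of_nat a * z)) holomorphic_on upper_half_plane"
  by (rule holomorphic_on_compose_gen[OF _ assms(1), unfolded o_def]) (use assms(2) in \<open>auto intro!: holomorphic_intros\<close>)

text \<open>\<open>th2\<close> and \<open>theta 2 1\<close> have the possibly fractional leading
  exponents a / 4 and a / 2 in q; the exponential factors remove them.\<close>

lemma
  fixes a :: nat
  assumes a: "a > 0"
  shows rq_th3: "rq (abs_mero_uhp (\<lambda>z. th3 (of_nat (2 * a) * z)))"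
    and rq_th4: "rq (abs_mero_uhp (\<lambda>z. th4 (of_nat (2 * a) * z)))"
    and rq_th2: "rq (abs_mero_uhp (\<lambda>z. th2 (of_nat (2 * a) * z) * exp (- (\<i> * pi * (a * z) / 2))))"
    and rq_theta_2_0: "rq (abs_mero_uhp (\<lambda>z. theta 2 0 (of_nat (2 * a) * z)))"
    and rq_theta_2_1: "rq (abs_mero_uhp (\<lambda>z. theta 2 1 (of_nat (2 * a) * z) * exp (- (\<i> * pi * (a * z)))))"
    and th_scaled_holomorphic:
      "(\<lambda>z. th3 (of_nat (2 * a) * z)) holomorphic_on upper_half_plane" "(\<lambda>z. th4 (of_nat (2 * a) * z)) holomorphic_on upper_half_plane"
      "(\<lambda>z. th2 (of_nat (2 * a) * z) * exp (- (\<i> * pi * (a * z) / 2))) holomorphic_on upper_half_plane"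
      "(\<lambda>z. theta 2 0 (of_nat (2 * a) * z)) holomorphic_on upper_half_plane"
      "(\<lambda>z. theta 2 1 (of_nat (2 * a) * z) * exp (- (\<i> * pi * (a * z)))) holomorphic_on upper_half_plane"
proof -
  have th: "(\<lambda>z. theta M h (of_nat (2 * a) * z)) holomorphic_on upper_half_plane" if "M > 0" for M h
    using holomorphic_scale_uhp[OF theta_holomorphic[OF that], of "2 * a" h] a by simp
  show h: "(\<lambda>z. th3 (of_nat (2 * a) * z)) holomorphic_on upper_half_plane" "(\<lambda>z. th4 (of_nat (2 * a) * z)) holomorphic_on upper_half_plane"
      "(\<lambda>z. th2 (of_nat (2 * a) * z) * exp (- (\<i> * pi * (a * z) / 2))) holomorphic_on upper_half_plane"
      "(\<lambda>z. theta 2 0 (of_nat (2 * a) * z)) holomorphic_on upper_half_plane"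
      "(\<lambda>z. theta 2 1 (of_nat (2 * a) * z) * exp (- (\<i> * pi * (a * z)))) holomorphic_on upper_half_plane"
    unfolding th2_def th3_def th4_def by (intro holomorphic_intros th; simp)+
  have s: "Im (of_nat (2 * a) * z) > 0" if "Im z > 0" for z :: complex using a that by simp
  have g: "gauss_term (2 * (of_nat (2 * a) * z)) n = gauss_term (a * z) (2 * n)" for n and z :: complex
    unfolding gauss_term_def by (rule arg_cong[of _ _ exp]) (simp add: power2_eq_square field_simps)
  have alt: "alt_sign n \<in> \<rat>" for n by (simp add: alt_sign_def)
  have eq: "th3 (of_nat (2 * a) * z) = (\<Sum>\<^sub>\<infinity>n. gauss_term (a * z) (2 * n))"
    "th4 (of_nat (2 * a) * z) = (\<Sum>\<^sub>\<infinity>n. alt_sign n * gauss_term (a * z) (2 * n))"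
    "th2 (of_nat (2 * a) * z) = (\<Sum>\<^sub>\<infinity>n. gauss_term (a * z) (2 * n + 1))"
    "theta 2 0 (of_nat (2 * a) * z) = (\<Sum>\<^sub>\<infinity>n. gauss_term (of_nat (2 * a) * z) (2 * n))"
    "theta 2 1 (of_nat (2 * a) * z) = (\<Sum>\<^sub>\<infinity>n. gauss_term (of_nat (2 * a) * z) (2 * n + 1))" if "Im z > 0" for z :: complex
    using th3_altdef[OF s[OF that]] th4_altdef[OF s[OF that]] th2_altdef[OF s[OF that]] theta_2_0_altdef[OF s[OF that]] theta_2_1_altdef[OF s[OF that]]
    unfolding g by simp_all
  have a2: "2 * a > 0" using a by simp
  have ex: "w * exp (- u) * exp u = w" for w u :: complex by (simp add: mult.assoc flip: exp_add)
  have ex1: "w * exp (- (\<i> * pi * (a * z) / 2)) * exp (\<i> * pi * (of_nat a * z) * of_int 1 / 2) = w" for w z :: complex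
    using ex[of w "\<i> * pi * (a * z) / 2"] by simp
  have ex2: "w * exp (- (\<i> * pi * (a * z))) * exp (\<i> * pi * (of_nat (2 * a) * z) * of_int 1 / 2) = w" for w z :: complex
    using ex[of w "\<i> * pi * (a * z)"] by (simp add: mult.assoc)
  show "rq (abs_mero_uhp (\<lambda>z. th3 (of_nat (2 * a) * z)))"
    by (rule rq_gauss_series[where \<alpha>=a and \<beta>=0 and \<sigma>="\<lambda>_. 1", OF h(1) a], simp_all only: eq(1)) simp_all
  show "rq (abs_mero_uhp (\<lambda>z. th4 (of_nat (2 * a) * z)))"
    by (rule rq_gauss_series[where \<alpha>=a and \<beta>=0 and \<sigma>=alt_sign, OF h(2) a], simp_all only: eq(2)) (simp_all add: alt)
  show "rq (abs_mero_uhp (\<lambda>z. th2 (of_nat (2 * a) * z) * exp (- (\<i> * pi * (a * z) / 2))))"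
    by (rule rq_gauss_series[where \<alpha>=a and \<beta>=1 and \<sigma>="\<lambda>_. 1", OF h(3) a], simp_all only: ex1 eq(3)) simp_all
  show "rq (abs_mero_uhp (\<lambda>z. theta 2 0 (of_nat (2 * a) * z)))"
    by (rule rq_gauss_series[where \<alpha>="2 * a" and \<beta>=0 and \<sigma>="\<lambda>_. 1", OF h(4) a2], simp_all only: eq(4)) simp_all
  show "rq (abs_mero_uhp (\<lambda>z. theta 2 1 (of_nat (2 * a) * z) * exp (- (\<i> * pi * (a * z)))))"
    by (rule rq_gauss_series[where \<alpha>="2 * a" and \<beta>=1 and \<sigma>="\<lambda>_. 1", OF h(5) a2], simp_all only: ex2 eq(5)) simp_all
qed

lemma rq_nome: "rq (abs_mero_uhp (nome 1))"
proof -
  have "has_q_expansion 1 (abs_mero_uhp (nome 1)) fls_X"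
    by (subst has_q_expansion_altdef[OF holomorphic_imp_meromorphic_uhp[OF nome_holomorphic]])
       (auto intro!: exI[of _ "\<lambda>q. q"] exI[of _ 0] laurent_expansion_intros)
  then show ?thesis unfolding rq_def by (intro exI[of _ fls_X]) simp
qed

lemma rq_abs_mult:
  assumes "rq (abs_mero_uhp \<phi>)" "rq (abs_mero_uhp \<psi>)" "\<phi> holomorphic_on upper_half_plane" "\<psi> holomorphic_on upper_half_plane"
  shows "rq (abs_mero_uhp (\<lambda>z. \<phi> z * \<psi> z))"
  using rq_mult[OF assms(1,2)] mero_uhp_mult[OF assms(3,4)[THEN holomorphic_imp_meromorphic_uhp]] by simp

lemma rq_abs_add:
  assumes "rq (abs_mero_uhp \<phi>)" "rq (abs_mero_uhp \<psi>)" "\<phi> holomorphic_on upper_half_plane" "\<psi> holomorphic_on upper_half_plane"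
  shows "rq (abs_mero_uhp (\<lambda>z. \<phi> z + \<psi> z))"
  using rq_add[OF assms(1,2)] mero_uhp_add[OF assms(3,4)[THEN holomorphic_imp_meromorphic_uhp]] by simp

lemma
  shows rq_P11: "rq (abs_mero_uhp (\<lambda>z. P11 (2 * z)))" and rq_N11: "rq (abs_mero_uhp (\<lambda>z. N11 (2 * z)))"
    and rq_R11: "rq (abs_mero_uhp (\<lambda>z. R11 (2 * z)))" and rq_Q11: "rq (abs_mero_uhp (\<lambda>z. Q11 (2 * z)))"
proof -
  have one: "(1::nat) > 0" and eleven: "(11::nat) > 0" by simp_all
  note h1 = th_scaled_holomorphic[OF one] and h11 = th_scaled_holomorphic[OF eleven]
  show "rq (abs_mero_uhp (\<lambda>z. P11 (2 * z)))"
    using rq_abs_mult[OF rq_th3[OF one] rq_th3[OF eleven] h1(1) h11(1)] by (simp add: P11_def mult.assoc)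
  show "rq (abs_mero_uhp (\<lambda>z. N11 (2 * z)))"
    using rq_abs_mult[OF rq_th4[OF one] rq_th4[OF eleven] h1(2) h11(2)] by (simp add: N11_def mult.assoc)
  have np: "rq (abs_mero_uhp (\<lambda>z. nome 1 z ^ n))" for n
  proof (induction n)
    case 0
    show ?case using rq_cst[of 1] by (simp add: cst_def del: cst_1)
  next
    case (Suc n)
    show ?case using rq_abs_mult[OF rq_nome Suc nome_holomorphic] by (auto intro!: holomorphic_intros)
  qed
  have nh: "(\<lambda>z. nome 1 z ^ n) holomorphic_on upper_half_plane" for n by (intro holomorphic_intros)
  have exp_eq_one: "w = 0 \<Longrightarrow> exp w = 1" for w :: complex by simp
  note hm2 = holomorphic_on_mult[OF h1(3) h11(3)] and hm1 = holomorphic_on_mult[OF h1(5) h11(5)]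
  \<comment> \<open>For a = 1 and a = 11 together the removed exponents are 12 / 4 = 3, and 12 / 2 =
    6 in the next equation, so integral powers of q restore them.\<close>
  have e2: "nome 1 z ^ 3 * (exp (- (\<i> * pi * (of_nat 1 * z) / 2)) * exp (- (\<i> * pi * (of_nat 11 * z) / 2))) = 1" for z
    unfolding nome_def exp_of_nat_mult[symmetric] exp_add[symmetric] by (rule exp_eq_one) simp
  have e1: "nome 1 z ^ 6 * (exp (- (\<i> * pi * (of_nat 1 * z))) * exp (- (\<i> * pi * (of_nat 11 * z)))) = 1" for z
    unfolding nome_def exp_of_nat_mult[symmetric] exp_add[symmetric] by (rule exp_eq_one) simp
  have "rq (abs_mero_uhp (\<lambda>z. nome 1 z ^ 3 * ((th2 (of_nat (2 * 1) * z) * exp (- (\<i> * pi * (of_nat 1 * z) / 2))) * (th2 (of_nat (2 * 11) * z) * exp (- (\<i> * pi * (of_nat 11 * z) / 2))))))"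
    by (rule rq_abs_mult[OF np rq_abs_mult[OF rq_th2[OF one] rq_th2[OF eleven] h1(3) h11(3)] nh hm2])
  moreover have "nome 1 z ^ 3 * ((th2 (of_nat (2 * 1) * z) * exp (- (\<i> * pi * (of_nat 1 * z) / 2))) * (th2 (of_nat (2 * 11) * z) * exp (- (\<i> * pi * (of_nat 11 * z) / 2)))) = R11 (2 * z)" for z
  proof -
    have "nome 1 z ^ 3 * ((th2 (of_nat (2 * 1) * z) * exp (- (\<i> * pi * (of_nat 1 * z) / 2))) * (th2 (of_nat (2 * 11) * z) * exp (- (\<i> * pi * (of_nat 11 * z) / 2)))) =
       (th2 (of_nat (2 * 1) * z) * th2 (of_nat (2 * 11) * z)) * (nome 1 z ^ 3 * (exp (- (\<i> * pi * (of_nat 1 * z) / 2)) * exp (- (\<i> * pi * (of_nat 11 * z) / 2))))"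
      by (simp only: ac_simps)
    then show ?thesis unfolding e2 by (simp add: R11_def mult.assoc)
  qed
  ultimately show "rq (abs_mero_uhp (\<lambda>z. R11 (2 * z)))" by simp
  have "rq (abs_mero_uhp (\<lambda>z. theta 2 0 (of_nat (2 * 1) * z) * theta 2 0 (of_nat (2 * 11) * z) +
      nome 1 z ^ 6 * ((theta 2 1 (of_nat (2 * 1) * z) * exp (- (\<i> * pi * (of_nat 1 * z)))) * (theta 2 1 (of_nat (2 * 11) * z) * exp (- (\<i> * pi * (of_nat 11 * z)))))))"
    by (rule rq_abs_add[OF rq_abs_mult[OF rq_theta_2_0[OF one] rq_theta_2_0[OF eleven] h1(4) h11(4)]
        rq_abs_mult[OF np rq_abs_mult[OF rq_theta_2_1[OF one] rq_theta_2_1[OF eleven] h1(5) h11(5)] nh hm1]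
        holomorphic_on_mult[OF h1(4) h11(4)] holomorphic_on_mult[OF nh hm1]])
  note Q = this
  have eq: "nome 1 z ^ 6 * ((theta 2 1 (of_nat (2 * 1) * z) * exp (- (\<i> * pi * (of_nat 1 * z)))) * (theta 2 1 (of_nat (2 * 11) * z) * exp (- (\<i> * pi * (of_nat 11 * z))))) =
      theta 2 1 (2 * z) * theta 2 1 (11 * (2 * z))" for z
  proof -
    have "nome 1 z ^ 6 * ((theta 2 1 (of_nat (2 * 1) * z) * exp (- (\<i> * pi * (of_nat 1 * z)))) * (theta 2 1 (of_nat (2 * 11) * z) * exp (- (\<i> * pi * (of_nat 11 * z))))) =
       (theta 2 1 (of_nat (2 * 1) * z) * theta 2 1 (of_nat (2 * 11) * z)) * (nome 1 z ^ 6 * (exp (- (\<i> * pi * (of_nat 1 * z))) * exp (- (\<i> * pi * (of_nat 11 * z)))))"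
      by (simp only: ac_simps)
    then show ?thesis unfolding e1 by (simp add: mult.assoc)
  qed
  show "rq (abs_mero_uhp (\<lambda>z. Q11 (2 * z)))"
    using Q unfolding eq by (simp add: Q11_def mult.assoc)
qed

lemma
  shows rq_X44: "rq X44" and rq_Y44: "rq Y44" and rq_T44: "rq T44"
proof -
  have c: "(\<lambda>z. f (2 * z)) holomorphic_on upper_half_plane" if "f holomorphic_on upper_half_plane" for f
    by (rule holomorphic_on_compose_gen[OF _ that, unfolded o_def]) (auto intro!: holomorphic_intros)
  note m = c[OF P11_holomorphic, THEN holomorphic_imp_meromorphic_uhp] c[OF N11_holomorphic, THEN holomorphic_imp_meromorphic_uhp]
    c[OF R11_holomorphic, THEN holomorphic_imp_meromorphic_uhp] c[OF Q11_holomorphic, THEN holomorphic_imp_meromorphic_uhp]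
  have cm: "(\<lambda>_. k) meromorphic_on upper_half_plane" for k by (rule meromorphic_on_const)
  let ?P = "abs_mero_uhp (\<lambda>z. P11 (2 * z))" and ?N = "abs_mero_uhp (\<lambda>z. N11 (2 * z))"
  let ?R = "abs_mero_uhp (\<lambda>z. R11 (2 * z))" and ?Q = "abs_mero_uhp (\<lambda>z. Q11 (2 * z))"
  note mi = meromorphic_on_inverse[OF m(3)]
  note md = meromorphic_on_diff[OF m(1,2)] and ma = meromorphic_on_mult[OF cm meromorphic_on_add[OF m(1,2)]] and mq = meromorphic_on_mult[OF cm m(4)]
  have "(?P - ?N) * inverse ?R = X44"
    unfolding mero_uhp_diff[OF m(1,2)] mero_uhp_inverse[OF m(3)] mero_uhp_mult[OF md mi] x44_def[abs_def] divide_inverse ..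
  moreover have "cst 2 * (?P + ?N) * inverse ?R = Y44"
    unfolding cst_def mero_uhp_add[OF m(1,2)] mero_uhp_inverse[OF m(3)] mero_uhp_mult[OF cm meromorphic_on_add[OF m(1,2)]] mero_uhp_mult[OF ma mi] y44_def[abs_def] divide_inverse ..
  moreover have "cst 4 * ?Q * inverse ?R = T44"
    unfolding cst_def mero_uhp_inverse[OF m(3)] mero_uhp_mult[OF cm m(4)] mero_uhp_mult[OF mq mi] t44_def[abs_def] divide_inverse ..
  moreover have "rq ((?P - ?N) * inverse ?R)" "rq (cst 2 * (?P + ?N) * inverse ?R)" "rq (cst 4 * ?Q * inverse ?R)"
    by (intro rq_mult rq_diff rq_add rq_inverse rq_cst rq_P11 rq_N11 rq_R11 rq_Q11; simp)+
  ultimately show "rq X44" "rq Y44" "rq T44" by simp_all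
qed

subsection \<open>Rational descent\<close>

text \<open>Extend a to a basis of the complex numbers over the rationals.\<close>

lemma exists_rational_functional:
  fixes a :: complex
  assumes "a \<noteq> 0"
  obtains g :: "complex \<Rightarrow> rat" where "g a = 1" "\<And>x y. g (x + y) = g x + g y" "\<And>r x. g (of_rat r * x) = r * g x"
proof -
  interpret V: vector_space "\<lambda>(r::rat) (x::complex). of_rat r * x"
    by unfold_locales (simp_all add: algebra_simps of_rat_add of_rat_mult)
  interpret W: vector_space "(*) :: rat \<Rightarrow> rat \<Rightarrow> rat"
    by unfold_locales (simp_all add: algebra_simps)
  interpret P: vector_space_pair "\<lambda>(r::rat) (x::complex). of_rat r * x" "(*) :: rat \<Rightarrow> rat \<Rightarrow> rat" ..
  have "V.independent {a}" using assms by simp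
  from P.linear_independent_extend[OF this, of "\<lambda>_. 1"] obtain g where g: "Vector_Spaces.linear (\<lambda>(r::rat) (x::complex). of_rat r * x) ((*) :: rat \<Rightarrow> rat \<Rightarrow> rat) g" "g a = 1"
    by auto
  interpret L: Vector_Spaces.linear "\<lambda>(r::rat) (x::complex). of_rat r * x" "(*) :: rat \<Rightarrow> rat \<Rightarrow> rat" g by (rule g(1))
  show ?thesis by (rule that[OF g(2) L.add L.scale])
qed

text \<open>The complex relation amounts to one linear equation with rational coefficients for each
  power of q, and a rational linear functional preserves all of them. Normalising it at
  \<open>c j\<close> keeps the coefficient of index j nonzero.\<close>

lemma rational_descent:
  assumes I: "finite I" and u: "\<And>i. i \<in> I \<Longrightarrow> rq (u i)"
    and rel: "(\<Sum>i\<in>I. cst (c i) * u i) = 0" and j: "j \<in> I" "c j \<noteq> 0"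
  shows "\<exists>r :: _ \<Rightarrow> rat. r j \<noteq> 0 \<and> (\<Sum>i\<in>I. of_rat (r i) * u i) = 0"
proof -
  have "\<forall>i\<in>I. \<exists>U. has_q_expansion 1 (u i) U \<and> (\<forall>n. fls_nth U n \<in> \<rat>)" using u unfolding rq_def by blast
  then obtain U where U: "\<And>i. i \<in> I \<Longrightarrow> has_q_expansion 1 (u i) (U i)" "\<And>i n. i \<in> I \<Longrightarrow> fls_nth (U i) n \<in> \<rat>" by metis
  have "\<forall>i n. \<exists>w :: rat. i \<in> I \<longrightarrow> fls_nth (U i) n = of_rat w" using U(2) unfolding Rats_def by blast
  then obtain w :: "_ \<Rightarrow> int \<Rightarrow> rat" where w: "\<And>i n. i \<in> I \<Longrightarrow> fls_nth (U i) n = of_rat (w i n)" by metis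
  have exp: "has_q_expansion 1 (\<Sum>i\<in>I. cst (d i) * u i) (\<Sum>i\<in>I. fls_const (d i) * U i)" for d
    by (intro has_q_expansion_sum has_q_expansion_mult has_q_expansion_cst U) simp_all
  have U0: "(\<Sum>i\<in>I. fls_const (c i) * U i) = 0"
    using exp[of c] zero_has_q_expansion_imp unfolding rel by simp
  have "(\<Sum>i\<in>I. c i * fls_nth (U i) n) = fls_nth (\<Sum>i\<in>I. fls_const (c i) * U i) n" for n
    by (simp add: fls_nth_sum)
  then have "(\<Sum>i\<in>I. c i * fls_nth (U i) n) = 0" for n by (simp add: U0)
  then have z: "(\<Sum>i\<in>I. of_rat (w i n) * c i) = 0" for n using w by (simp add: mult.commute)
  obtain g :: "complex \<Rightarrow> rat" where g: "g (c j) = 1" "\<And>x y. g (x + y) = g x + g y" "\<And>r x. g (of_rat r * x) = r * g x"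
    by (rule exists_rational_functional[OF j(2)]) blast
  have g0: "g 0 = 0" using g(2)[of 0 0] by simp
  have gsum: "g (\<Sum>i\<in>I. h i) = (\<Sum>i\<in>I. g (h i))" for h
    by (induction I rule: infinite_finite_induct) (simp_all add: g0 g(2))
  have z': "(\<Sum>i\<in>I. w i n * g (c i)) = 0" for n
    using arg_cong[OF z[of n], of g] unfolding gsum g(3) g0 .
  have "fls_nth (\<Sum>i\<in>I. fls_const (of_rat (g (c i))) * U i) n = of_rat (\<Sum>i\<in>I. w i n * g (c i))" for n
    using w by (simp add: fls_nth_sum of_rat_sum of_rat_mult mult.commute)
  then have "(\<Sum>i\<in>I. fls_const (of_rat (g (c i))) * U i) = 0" by (intro fls_eqI) (simp add: z')
  then have "(\<Sum>i\<in>I. cst (of_rat (g (c i))) * u i) = 0"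
    using exp[of "\<lambda>i. of_rat (g (c i))"] has_q_expansion_zero_imp by simp
  then show ?thesis using g(1) by (intro exI[of _ "\<lambda>i. g (c i)"]) (simp add: cst_of_rat)
qed

lemma X0_field_rat_iff: "f \<in> X0_field_rat 44 \<longleftrightarrow> f \<in> X0_field 44 \<and> rq f"
  by (simp add: X0_field_rat_def rq_def)

definition ratx :: "rat poly \<Rightarrow> mero_uhp" where "ratx R = poly (map_poly of_rat R) X44"

lemma ratx_altdef: "ratx R = evx (map_poly of_rat R)"
  unfolding ratx_def evx_def by (subst map_poly_map_poly) (simp_all add: o_def cst_of_rat)

lemma ratx_eq_0_iff: "ratx R = 0 \<longleftrightarrow> R = 0"
  by (simp add: ratx_altdef evx_eq_0_iff poly_eq_iff coeff_map_poly)

lemma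
  shows ratx_add: "ratx (p + q) = ratx p + ratx q" and ratx_mult: "ratx (p * q) = ratx p * ratx q"
proof -
  have h: "(of_rat 0 :: mero_uhp) = 0" "\<And>a b. of_rat (a + b) = (of_rat a + of_rat b :: mero_uhp)" "\<And>a b. of_rat (a * b) = (of_rat a * of_rat b :: mero_uhp)"
    by (simp_all add: of_rat_add of_rat_mult)
  show "ratx (p + q) = ratx p + ratx q" "ratx (p * q) = ratx p * ratx q"
    unfolding ratx_def by (rule poly_map_poly_add[OF h], rule poly_map_poly_mult[OF h])
qed

lemma ratx_monom: "ratx (monom a n) = of_rat a * X44 ^ n"
  unfolding ratx_def by (simp add: map_poly_monom poly_monom)

lemma ratx_0: "ratx 0 = 0"
  by (simp add: ratx_def)

lemma ratx_sum: "ratx (sum f A) = (\<Sum>i\<in>A. ratx (f i))"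
  by (induction A rule: infinite_finite_induct) (simp_all add: ratx_0 ratx_add)

lemma ratx_uminus: "ratx (- p) = - ratx p"
  using ratx_add[of p "- p"] by (simp add: ratx_0 eq_neg_iff_add_eq_0 add.commute)

lemma evx_coeffs:
  assumes "degree p \<le> D"
  shows "evx p = (\<Sum>i\<le>D. cst (coeff p i) * X44 ^ i)"
  unfolding evx_def poly_map_poly_altdef[of cst, OF cst_0]
  by (rule sum.mono_neutral_left) (use assms in \<open>auto simp: coeff_eq_0\<close>)

definition t44' :: mero_uhp where "t44' = (2 + X44) * T44"

text \<open>The polynomial coefficients are flattened: the relation becomes one between the finitely
  many functions X^i g, with g among f, 1, Y, T, Y T, and complex coefficients, to which the descent
  applies.\<close>

theorem rational_relation:
  assumes f: "f \<in> X0_field_rat 44"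
  obtains r0 r1 r2 r3 r4 where "r0 \<noteq> 0" "ratx r0 * f = ratx r1 + ratx r2 * Y44 + (ratx r3 + ratx r4 * Y44) * t44'"
proof -
  obtain q0 q1 q2 q3 q4 where q0: "q0 \<noteq> 0" and rel: "evx q0 * f = evx q1 + evx q2 * Y44 + evx q3 * T44 + evx q4 * Y44 * T44"
    using X0_field_relation f unfolding X0_field_rat_iff by metis
  define g where "g j = [f, 1, Y44, T44, Y44 * T44] ! j" for j
  define q where "q j = [- q0, q1, q2, q3, q4] ! j" for j
  have five: "{..<5} = {0, 1, 2, 3, 4 :: nat}" by auto
  define D where "D = Max ((\<lambda>j. degree (q j)) ` {..<5})"
  have D: "degree (q j) \<le> D" if "j < 5" for j unfolding D_def using that by (intro Max_ge) auto
  define u where "u p = X44 ^ snd p * g (fst p)" for p :: "nat \<times> nat"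
  define c where "c p = coeff (q (fst p)) (snd p)" for p :: "nat \<times> nat"
  have q0D: "degree q0 \<le> D" using D[of 0] by (simp add: q_def)
  have split: "(\<Sum>p\<in>{..<5} \<times> {..D}. h p * u p) = (\<Sum>j<5. (\<Sum>i\<le>D. h (j, i) * X44 ^ i) * g j)" for h
  proof -
    have "(\<Sum>j<5. (\<Sum>i\<le>D. h (j, i) * X44 ^ i) * g j) = (\<Sum>j<5. \<Sum>i\<le>D. h (j, i) * u (j, i))"
      by (simp only: u_def sum_distrib_right mult.assoc fst_conv snd_conv)
    also have "\<dots> = (\<Sum>(j, i)\<in>{..<5} \<times> {..D}. h (j, i) * u (j, i))" by (rule sum.cartesian_product)
    also have "\<dots> = (\<Sum>p\<in>{..<5} \<times> {..D}. h p * u p)" by (rule sum.cong) auto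
    finally show ?thesis by (rule sym)
  qed
  have rq_u: "rq (u p)" if "p \<in> {..<5} \<times> {..D}" for p
  proof -
    have "fst p < 5" using that by (simp add: mem_Times_iff)
    then have "fst p = 0 \<or> fst p = 1 \<or> fst p = 2 \<or> fst p = 3 \<or> fst p = 4" by linarith
    moreover have "rq f" "rq 1" using f rq_cst[of 1] by (simp_all add: X0_field_rat_iff)
    ultimately have "rq (g (fst p))"
      using rq_Y44 rq_T44 rq_mult[OF rq_Y44 rq_T44] by (elim disjE) (simp_all add: g_def)
    then show ?thesis unfolding u_def by (intro rq_mult rq_power rq_X44)
  qed
  have "(\<Sum>p\<in>{..<5} \<times> {..D}. cst (c p) * u p) = (\<Sum>j<5. evx (q j) * g j)"
    unfolding split by (rule sum.cong) (simp_all add: c_def evx_coeffs[OF D])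
  also have "\<dots> = evx (- q0) * f + evx q1 + evx q2 * Y44 + evx q3 * T44 + evx q4 * Y44 * T44"
    by (simp add: five q_def g_def algebra_simps)
  also have "\<dots> = 0"
  proof -
    have "evx (- q0) = - evx q0" using evx_add[of q0 "- q0"] by (simp add: evx_0 eq_neg_iff_add_eq_0 add.commute)
    then show ?thesis using rel by (simp add: algebra_simps)
  qed
  finally have "(\<Sum>p\<in>{..<5} \<times> {..D}. cst (c p) * u p) = 0" .
  \<comment> \<open>This index is the leading coefficient of q0, so the polynomial that multiplies f
    stays nonzero after the descent.\<close>
  from rational_descent[OF _ rq_u this, of "(0, degree q0)"] q0 q0D obtain r :: "nat \<times> nat \<Rightarrow> rat"
    where r: "r (0, degree q0) \<noteq> 0" "(\<Sum>p\<in>{..<5} \<times> {..D}. of_rat (r p) * u p) = 0"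
    by (auto simp: c_def q_def)
  define R where "R j = (\<Sum>i\<le>D. monom (r (j, i)) i)" for j
  have "coeff (R 0) (degree q0) = r (0, degree q0)" using q0D by (simp add: R_def coeff_sum)
  then have R0: "R 0 \<noteq> 0" using r(1) by auto
  have "(\<Sum>j<5. ratx (R j) * g j) = 0"
    using r(2) unfolding split R_def ratx_sum ratx_monom .
  then have R: "ratx (R 0) * f + ratx (R 1) + ratx (R 2) * Y44 + ratx (R 3) * T44 + ratx (R 4) * Y44 * T44 = 0"
    by (simp add: five g_def algebra_simps)
  have X2: "ratx [:2, 1:] = 2 + X44" by (simp add: ratx_def map_poly_pCons)
  \<comment> \<open>One multiplication by 2 + x turns every T into t.\<close>
  have "(2 + X44) * (ratx (R 0) * f) = (2 + X44) * - (ratx (R 1) + ratx (R 2) * Y44 + ratx (R 3) * T44 + ratx (R 4) * Y44 * T44)"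
  proof -
    have "ratx (R 0) * f + (ratx (R 1) + ratx (R 2) * Y44 + ratx (R 3) * T44 + ratx (R 4) * Y44 * T44) = 0"
      using R by (simp only: add.assoc)
    then have "ratx (R 0) * f = - (ratx (R 1) + ratx (R 2) * Y44 + ratx (R 3) * T44 + ratx (R 4) * Y44 * T44)"
      by (simp only: eq_neg_iff_add_eq_0)
    then show ?thesis by (rule arg_cong)
  qed
  then have "ratx ([:2, 1:] * R 0) * f = ratx (- ([:2, 1:] * R 1)) + ratx (- ([:2, 1:] * R 2)) * Y44 + (ratx (- R 3) + ratx (- R 4) * Y44) * t44'"
    unfolding ratx_mult ratx_uminus X2 t44'_def by (simp add: algebra_simps)
  moreover have "[:2, 1:] * R 0 \<noteq> 0" by (rule no_zero_divisors[OF _ R0]) simp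
  ultimately show ?thesis using that by blast
qed

lemma wop_evx: "wop (evx p) = evx p" and sop_evx: "sop (evx p) = evx p"
proof (induction p)
  case (pCons a p)
  have "evx (pCons a p) = cst a + X44 * evx p" unfolding evx_def by (simp add: map_poly_pCons)
  then show "wop (evx (pCons a p)) = evx (pCons a p)" "sop (evx (pCons a p)) = evx (pCons a p)"
    using pCons by (simp_all add: wop_hom sop_hom wop_generators sop_generators)
qed (use wop_hom(5)[of 0] sop_hom(5)[of 0] in \<open>simp_all add: evx_0\<close>)

lemma wop_ratx: "wop (ratx p) = ratx p" and sop_ratx: "sop (ratx p) = ratx p"
  unfolding ratx_altdef by (rule wop_evx, rule sop_evx)

lemma t44'_nonzero: "t44' \<noteq> 0"
proof -
  have "2 + X44 = ratx [:2, 1:]" by (simp add: ratx_def map_poly_pCons)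
  then show ?thesis using T44_nonzero by (simp add: t44'_def ratx_eq_0_iff)
qed

lemma wop_t44': "wop t44' = - t44'"
  using wop_hom(5)[of 2] by (simp add: t44'_def wop_hom wop_generators)

lemma double_zero:
  fixes f :: mero_uhp
  assumes "f = - f"
  shows "f = 0"
proof -
  have "2 * f = f + f" by (rule mult_2)
  also have "\<dots> = f + - f" using assms by (rule arg_cong)
  also have "\<dots> = 0" by (rule add.right_inverse)
  finally have "2 * f = 0" .
  then show ?thesis by simp
qed

text \<open>The summands are eigenvectors of \<open>sop\<close> for 1 and -1, so each of them
  vanishes; \<open>independent_1_t\<close> argues in the same way with \<open>wop\<close>.\<close>

lemma independent_1_y:
  assumes "ratx a + ratx b * Y44 = 0"
  shows "a = 0 \<and> b = 0"
proof -
  have "sop (ratx a + ratx b * Y44) = sop (cst 0)" using assms by simp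
  then have "ratx a - ratx b * Y44 = 0" unfolding sop_hom sop_ratx sop_generators by (simp del: cst_0)
  then have "ratx b * Y44 = - (ratx b * Y44)" using assms by (metis add_eq_0_iff2 eq_iff_diff_eq_0)
  then have "ratx b * Y44 = 0" by (rule double_zero)
  then show ?thesis using assms Y44_nonzero by (auto simp: ratx_eq_0_iff ratx_0)
qed

lemma independent_1_t:
  assumes "A + B * t44' = 0" "wop A = A" "wop B = B"
  shows "A = 0 \<and> B = 0"
proof -
  have "wop (A + B * t44') = wop (cst 0)" using assms by simp
  then have "A - B * t44' = 0" unfolding wop_hom assms(2,3) wop_t44' by (simp del: cst_0)
  then have "B * t44' = - (B * t44')" using assms(1) by (metis add_eq_0_iff2 eq_iff_diff_eq_0)
  then have "B * t44' = 0" by (rule double_zero)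
  then show ?thesis using assms t44'_nonzero by simp
qed

lemma wop_1_y: "wop (ratx a + ratx b * Y44) = ratx a + ratx b * Y44"
  by (simp add: wop_hom wop_ratx wop_generators)

subsection \<open>Subfields\<close>

lemma is_subfieldD:
  assumes "is_subfield K"
  shows "0 \<in> K" "1 \<in> K" "a \<in> K \<Longrightarrow> b \<in> K \<Longrightarrow> a + b \<in> K" "a \<in> K \<Longrightarrow> b \<in> K \<Longrightarrow> a * b \<in> K"
    "a \<in> K \<Longrightarrow> - a \<in> K" "a \<in> K \<Longrightarrow> inverse a \<in> K"
  using assms unfolding is_subfield_def by simp_all

lemma divide_in_subfield: "is_subfield K \<Longrightarrow> a \<in> K \<Longrightarrow> b \<in> K \<Longrightarrow> a / b \<in> K"
  unfolding divide_inverse by (intro is_subfieldD)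

lemma of_rat_in_subfield:
  fixes K :: "'a :: field_char_0 set"
  assumes K: "is_subfield K"
  shows "of_rat r \<in> K"
proof -
  have nat: "of_nat n \<in> K" for n by (induction n) (auto intro: is_subfieldD[OF K])
  have int: "of_int i \<in> K" for i using nat is_subfieldD(5)[OF K nat] by (cases i rule: int_cases2) auto
  show ?thesis by (cases r) (simp add: of_rat_rat int divide_in_subfield[OF K])
qed

lemma poly_map_poly_in_subfield:
  fixes K :: "'a :: field_char_0 set" and h :: "'b :: comm_ring_1 \<Rightarrow> 'a"
  assumes K: "is_subfield K" and h: "h 0 = 0" "\<And>a. h a \<in> K" and x: "x \<in> K"
  shows "poly (map_poly h p) x \<in> K"
  by (induction p) (simp_all add: map_poly_pCons h x is_subfieldD[OF K])

lemma is_subfield_rat_adjoin: "is_subfield (rat_adjoin S)"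
  unfolding rat_adjoin_def by (rule hull_in) (auto simp: is_subfield_def)

lemma rat_adjoin_subset: "S \<subseteq> K \<Longrightarrow> is_subfield K \<Longrightarrow> rat_adjoin S \<subseteq> K"
  unfolding rat_adjoin_def by (rule hull_minimal)

lemma subset_rat_adjoin: "S \<subseteq> rat_adjoin S"
  unfolding rat_adjoin_def by (rule hull_subset)

lemma ratx_in_subfield: "is_subfield K \<Longrightarrow> X44 \<in> K \<Longrightarrow> ratx p \<in> K"
  unfolding ratx_def by (rule poly_map_poly_in_subfield) (auto intro: of_rat_in_subfield)

lemma is_subfield_X0_field_rat: "is_subfield (X0_field_rat 44)"
proof -
  have "- f = cst (- 1) * f" for f using cst_uminus[of 1] by simp
  then have uminus: "f \<in> X0_field 44 \<Longrightarrow> - f \<in> X0_field 44" for f by (metis X0_field_mult X0_field_cst)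
  have "0 \<in> X0_field 44" "1 \<in> X0_field 44" "rq 0" "rq 1"
    using X0_field_cst[of 0 44] X0_field_cst[of 1 44] rq_cst[of 0] rq_cst[of 1] by simp_all
  then show ?thesis
    unfolding is_subfield_def
    by (intro conjI ballI)
      (simp_all add: X0_field_rat_iff X0_field_add X0_field_mult X0_field_inverse uminus rq_add rq_mult rq_uminus rq_inverse)
qed

lemma
  shows X44_in_X0_field_rat: "X44 \<in> X0_field_rat 44" and Y44_in_X0_field_rat: "Y44 \<in> X0_field_rat 44"
    and t44'_in_X0_field_rat: "t44' \<in> X0_field_rat 44"
proof -
  show X: "X44 \<in> X0_field_rat 44" and "Y44 \<in> X0_field_rat 44"
    by (simp_all add: X0_field_rat_iff X44_in_X0_field Y44_in_X0_field rq_X44 rq_Y44)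
  have "T44 \<in> X0_field_rat 44" by (simp add: X0_field_rat_iff T44_in_X0_field rq_T44)
  moreover have "2 + X44 \<in> X0_field_rat 44"
    using ratx_in_subfield[OF is_subfield_X0_field_rat X, of "[:2, 1:]"] by (simp add: ratx_def map_poly_pCons)
  ultimately show "t44' \<in> X0_field_rat 44"
    unfolding t44'_def by (rule is_subfieldD(4)[OF is_subfield_X0_field_rat, rotated])
qed

subsection \<open>Equations\<close>

text \<open>Division by a monic polynomial works over any commutative ring, so it can be used in T
  over Q[X][Y] and again in Y over Q[X].\<close>

lemma quadratic_division:
  fixes p :: "'a :: comm_ring_1 poly"
  shows "\<exists>v a b. p = v * [:- e, 0, 1:] + [:a, b:]"
proof (induction p)
  case 0
  show ?case by (intro exI[of _ 0]) simp
next
  case (pCons k p)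
  then obtain v a b where p: "p = v * [:- e, 0, 1:] + [:a, b:]" by blast
  have "pCons k p = (pCons b v) * [:- e, 0, 1:] + [:k + e * b, a:]"
    unfolding p by (simp add: algebra_simps)
  then show ?case by blast
qed

lemma
  fixes x y t :: "'a :: field_char_0"
  shows eval3_add: "eval3 x y t (P + Q) = eval3 x y t P + eval3 x y t Q"
    and eval3_mult: "eval3 x y t (P * Q) = eval3 x y t P * eval3 x y t Q"
    and eval3_pCons: "eval3 X44 Y44 s [:[:a, b:], [:c, d:]:] = ratx a + ratx b * Y44 + (ratx c + ratx d * Y44) * s"
proof -
  let ?h1 = "\<lambda>R. poly (map_poly of_rat R) x" and ?h2 = "\<lambda>Q. poly (map_poly (\<lambda>R. poly (map_poly of_rat R) x) Q) y"
  have h0: "(of_rat 0 :: 'a) = 0" "\<And>a b. of_rat (a + b) = (of_rat a + of_rat b :: 'a)" "\<And>a b. of_rat (a * b) = (of_rat a * of_rat b :: 'a)"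
    by (simp_all add: of_rat_add of_rat_mult)
  have h1: "?h1 0 = 0" "\<And>a b. ?h1 (a + b) = ?h1 a + ?h1 b" "\<And>a b. ?h1 (a * b) = ?h1 a * ?h1 b"
    using poly_map_poly_add[OF h0] poly_map_poly_mult[OF h0] by simp_all
  have h2: "?h2 0 = 0" "\<And>a b. ?h2 (a + b) = ?h2 a + ?h2 b" "\<And>a b. ?h2 (a * b) = ?h2 a * ?h2 b"
    using poly_map_poly_add[OF h1] poly_map_poly_mult[OF h1] by simp_all
  show "eval3 x y t (P + Q) = eval3 x y t P + eval3 x y t Q" "eval3 x y t (P * Q) = eval3 x y t P * eval3 x y t Q"
    unfolding eval3_def by (rule poly_map_poly_add[OF h2], rule poly_map_poly_mult[OF h2])
  show "eval3 X44 Y44 s [:[:a, b:], [:c, d:]:] = ratx a + ratx b * Y44 + (ratx c + ratx d * Y44) * s"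
    unfolding eval3_def ratx_def[symmetric] by (simp add: map_poly_pCons ratx_0 algebra_simps)
qed

lemma Y44_cubic: "Y44 ^ 2 = X44 ^ 3 + X44 ^ 2 + 3 * X44 - 1"
  unfolding Y44_square evx_def by (simp add: map_poly_pCons cst_uminus power2_eq_square power3_eq_cube algebra_simps)

lemma t44'_sextic: "t44' ^ 2 = (2 + X44) ^ 2 * (7 + 3 * X44 + 5 * X44 ^ 2 + X44 ^ 3)"
proof -
  have "evx [:7, 3, 5, 1:] = 7 + 3 * X44 + 5 * X44 ^ 2 + X44 ^ 3"
    unfolding evx_def by (simp add: map_poly_pCons power2_eq_square power3_eq_cube algebra_simps)
  then show ?thesis unfolding t44'_def power_mult_distrib T44_square by simp
qed

text \<open>Reduction modulo Q in T and modulo P in Y leaves a combination of 1, y, t, y t with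
  coefficients in Q[X]. These four are linearly independent, so a polynomial vanishing at (x, y, t)
  lies in the ideal.\<close>

lemma equations_44:
  defines "P \<equiv> var_Y ^ 2 - (var_X ^ 3 + var_X ^ 2 + 3 * var_X - 1)"
    and "Q \<equiv> var_T ^ 2 - (2 + var_X) ^ 2 * (7 + 3 * var_X + 5 * var_X ^ 2 + var_X ^ 3)"
  shows "equations_for (X0_field_rat 44) X44 Y44 t44' P Q"
proof -
  define c d :: "rat poly" where "c = [:- 1, 3, 1, 1:]" and "d = [:2, 1:] ^ 2 * [:7, 3, 5, 1:]"
  have P: "P = [:[:- c, 0, 1:]:]"
    unfolding P_def c_def var_Y_def var_X_def
    by (simp add: power2_eq_square power3_eq_cube numeral_poly one_pCons)
  have Q: "Q = [:- [:d:], 0, 1:]"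
    unfolding Q_def d_def var_T_def var_X_def
    by (simp add: power2_eq_square power3_eq_cube numeral_poly one_pCons)
  have h: "ratx [:2, 1:] = 2 + X44" "ratx c = Y44 ^ 2"
    unfolding ratx_def c_def Y44_cubic by (simp_all add: map_poly_pCons of_rat_minus power2_eq_square power3_eq_cube algebra_simps)
  have d: "ratx d = t44' ^ 2"
    unfolding t44'_sextic unfolding d_def power2_eq_square ratx_mult h
    by (simp add: ratx_def map_poly_pCons power2_eq_square power3_eq_cube algebra_simps)
  have ratx_1: "ratx 1 = 1" by (simp add: ratx_def one_pCons map_poly_pCons)
  have eP: "eval3 X44 Y44 t44' P = 0"
    unfolding P eval3_def ratx_def[symmetric]
    by (simp add: map_poly_pCons ratx_0 ratx_uminus h ratx_1 power2_eq_square)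
  have eQ: "eval3 X44 Y44 t44' Q = 0"
    unfolding Q eval3_def ratx_def[symmetric]
    by (simp add: map_poly_pCons ratx_0 ratx_uminus d ratx_1[unfolded one_pCons] one_pCons power2_eq_square)
  show ?thesis
    unfolding equations_for_def
  proof (intro conjI equalityI subsetI)
    fix R assume "R \<in> {U * P + V * Q | U V. True}"
    then show "R \<in> {R. eval3 X44 Y44 t44' R = 0}" by (auto simp: eval3_add eval3_mult eP eQ)
  next
    fix R assume R: "R \<in> {R. eval3 X44 Y44 t44' R = 0}"
    obtain V a b where 1: "R = V * Q + [:a, b:]" unfolding Q using quadratic_division by blast
    obtain A a0 a1 where a: "a = A * [:- c, 0, 1:] + [:a0, a1:]" using quadratic_division by blast
    obtain B b0 b1 where b: "b = B * [:- c, 0, 1:] + [:b0, b1:]" using quadratic_division by blast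
    have "[:a, b:] = [:A, B:] * P + [:[:a0, a1:], [:b0, b1:]:]"
      unfolding P a b by simp
    then have R': "R = V * Q + ([:A, B:] * P + [:[:a0, a1:], [:b0, b1:]:])" using 1 by simp
    have "ratx a0 + ratx a1 * Y44 + (ratx b0 + ratx b1 * Y44) * t44' = 0"
      using R unfolding R' mem_Collect_eq eval3_add eval3_mult eP eQ eval3_pCons by simp
    from independent_1_t[OF this wop_1_y wop_1_y] independent_1_y
    have "a0 = 0" "a1 = 0" "b0 = 0" "b1 = 0" by blast+
    then have "R = [:A, B:] * P + V * Q" using R' by simp
    then show "R \<in> {U * P + V * Q | U V. True}" by blast
  next
    fix f assume "f \<in> X0_field_rat 44"
    then obtain r0 r1 r2 r3 r4 where r: "r0 \<noteq> 0" "ratx r0 * f = ratx r1 + ratx r2 * Y44 + (ratx r3 + ratx r4 * Y44) * t44'"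
      by (rule rational_relation)
    have e0: "eval3 X44 Y44 t44' [:[:r0, 0:], [:0, 0:]:] = ratx r0"
      unfolding eval3_pCons by (simp add: ratx_0)
    have "f = (ratx r0 * f) / ratx r0" using r(1) by (simp add: ratx_eq_0_iff)
    also have "\<dots> = eval3 X44 Y44 t44' [:[:r1, r2:], [:r3, r4:]:] / eval3 X44 Y44 t44' [:[:r0, 0:], [:0, 0:]:]"
      unfolding r(2) e0 unfolding eval3_pCons ..
    finally show "f \<in> {eval3 X44 Y44 t44' R / eval3 X44 Y44 t44' S | R S. eval3 X44 Y44 t44' S \<noteq> 0}"
      using r(1) e0 by (metis (mono_tags, lifting) mem_Collect_eq ratx_eq_0_iff)
  next
    note K = is_subfield_X0_field_rat
    have "eval3 X44 Y44 t44' R \<in> X0_field_rat 44" for R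
      unfolding eval3_def
      by (intro poly_map_poly_in_subfield[OF K] of_rat_in_subfield[OF K] X44_in_X0_field_rat Y44_in_X0_field_rat t44'_in_X0_field_rat) simp_all
    then show "f \<in> X0_field_rat 44" if "f \<in> {eval3 X44 Y44 t44' R / eval3 X44 Y44 t44' S | R S. eval3 X44 Y44 t44' S \<noteq> 0}" for f
      using that divide_in_subfield[OF K] by auto
  qed
qed

theorem mainTheorem4:
  shows "\<exists>x\<in>X0_field_rat 44. \<exists>y\<in>X0_field_rat 44. \<exists>t\<in>X0_field_rat 44.
           X0_field_rat 44 = rat_adjoin {x, y, t} \<and>
           {f \<in> X0_field_rat 44. atkin_lehner 44 11 f = f} = rat_adjoin {x, y} \<and>
           atkin_lehner 44 11 t = - t \<and>
           y ^ 2 = x ^ 3 + x ^ 2 + 3 * x - 1 \<and>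
           t ^ 2 = (2 + x) ^ 2 * (7 + 3 * x + 5 * x ^ 2 + x ^ 3) \<and>
           equations_for (X0_field_rat 44) x y t
             (var_Y ^ 2 - (var_X ^ 3 + var_X ^ 2 + 3 * var_X - 1))
             (var_T ^ 2 - (2 + var_X) ^ 2 * (7 + 3 * var_X + 5 * var_X ^ 2 + var_X ^ 3))"
proof (rule bexI[of _ X44], rule bexI[of _ Y44], rule bexI[of _ t44'], intro conjI)
  show "X44 \<in> X0_field_rat 44" "Y44 \<in> X0_field_rat 44" "t44' \<in> X0_field_rat 44"
    by (rule X44_in_X0_field_rat Y44_in_X0_field_rat t44'_in_X0_field_rat)+
  show "Y44 ^ 2 = X44 ^ 3 + X44 ^ 2 + 3 * X44 - 1" "t44' ^ 2 = (2 + X44) ^ 2 * (7 + 3 * X44 + 5 * X44 ^ 2 + X44 ^ 3)"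
    by (rule Y44_cubic t44'_sextic)+
  show "equations_for (X0_field_rat 44) X44 Y44 t44'
      (var_Y ^ 2 - (var_X ^ 3 + var_X ^ 2 + 3 * var_X - 1))
      (var_T ^ 2 - (2 + var_X) ^ 2 * (7 + 3 * var_X + 5 * var_X ^ 2 + var_X ^ 3))"
    by (rule equations_44)
  note K = is_subfield_X0_field_rat
  have al: "atkin_lehner 44 11 f = wop f" if "f \<in> X0_field_rat 44" for f
    using that atkin_lehner_44 by (simp add: X0_field_rat_iff)
  then show "atkin_lehner 44 11 t44' = - t44'" using t44'_in_X0_field_rat wop_t44' by simp
  \<comment> \<open>Both generated fields are handled alike: f is the quotient of a combination of
    the generators by a nonzero polynomial in x.\<close>
  have quotient: "f \<in> L" if r: "r0 \<noteq> 0" "ratx r0 * f = g" and L: "is_subfield L" "X44 \<in> L" "g \<in> L" for r0 f g L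
  proof -
    have "f = g / ratx r0" using r by (auto simp: ratx_eq_0_iff field_simps)
    then show ?thesis using divide_in_subfield[OF L(1) L(3) ratx_in_subfield[OF L(1,2)]] by simp
  qed
  show "X0_field_rat 44 = rat_adjoin {X44, Y44, t44'}"
  proof
    show "rat_adjoin {X44, Y44, t44'} \<subseteq> X0_field_rat 44"
      by (rule rat_adjoin_subset[OF _ K]) (simp add: X44_in_X0_field_rat Y44_in_X0_field_rat t44'_in_X0_field_rat)
    show "X0_field_rat 44 \<subseteq> rat_adjoin {X44, Y44, t44'}"
    proof
      fix f assume "f \<in> X0_field_rat 44"
      then obtain r0 r1 r2 r3 r4 where r: "r0 \<noteq> 0" "ratx r0 * f = ratx r1 + ratx r2 * Y44 + (ratx r3 + ratx r4 * Y44) * t44'"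
        by (rule rational_relation)
      note L = is_subfield_rat_adjoin[of "{X44, Y44, t44'}"]
      have g: "X44 \<in> rat_adjoin {X44, Y44, t44'}" "Y44 \<in> rat_adjoin {X44, Y44, t44'}" "t44' \<in> rat_adjoin {X44, Y44, t44'}"
        using subset_rat_adjoin[of "{X44, Y44, t44'}"] by auto
      show "f \<in> rat_adjoin {X44, Y44, t44'}"
        by (rule quotient[OF r L g(1)]) (intro is_subfieldD(3,4)[OF L] ratx_in_subfield[OF L] g)
    qed
  qed
  show "{f \<in> X0_field_rat 44. atkin_lehner 44 11 f = f} = rat_adjoin {X44, Y44}"
  proof
    have "is_subfield {f \<in> X0_field_rat 44. wop f = f}"
    proof -
      have wop_0_1: "wop 0 = 0" "wop 1 = 1" using wop_hom(5)[of 0] wop_hom(5)[of 1] by simp_all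
      have "wop (- f) = - wop f" for f using wop_hom(2)[of 0 f] by (simp add: wop_0_1)
      then show ?thesis
        unfolding is_subfield_def by (intro conjI ballI) (simp_all add: is_subfieldD[OF K] wop_hom wop_0_1)
    qed
    moreover have "{f \<in> X0_field_rat 44. atkin_lehner 44 11 f = f} = {f \<in> X0_field_rat 44. wop f = f}"
      using al by auto
    ultimately show "rat_adjoin {X44, Y44} \<subseteq> {f \<in> X0_field_rat 44. atkin_lehner 44 11 f = f}"
      by (intro rat_adjoin_subset) (simp_all add: X44_in_X0_field_rat Y44_in_X0_field_rat wop_generators)
    show "{f \<in> X0_field_rat 44. atkin_lehner 44 11 f = f} \<subseteq> rat_adjoin {X44, Y44}"
    proof
      fix f assume "f \<in> {f \<in> X0_field_rat 44. atkin_lehner 44 11 f = f}"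
      then have f: "f \<in> X0_field_rat 44" "wop f = f" using al by auto
      obtain r0 r1 r2 r3 r4 where r: "r0 \<noteq> 0" "ratx r0 * f = ratx r1 + ratx r2 * Y44 + (ratx r3 + ratx r4 * Y44) * t44'"
        using f(1) by (rule rational_relation)
      \<comment> \<open>For w-invariant f the part even under w and the part odd under w vanish
        separately, which eliminates t from the relation.\<close>
      have "(ratx r1 + ratx r2 * Y44 - ratx r0 * f) + (ratx r3 + ratx r4 * Y44) * t44' = 0" unfolding r(2) by simp
      moreover have "wop (ratx r1 + ratx r2 * Y44 - ratx r0 * f) = ratx r1 + ratx r2 * Y44 - ratx r0 * f"
        unfolding wop_hom(2) wop_1_y wop_hom(3) wop_ratx f(2) ..
      ultimately have "ratx r1 + ratx r2 * Y44 - ratx r0 * f = 0"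
        using independent_1_t[OF _ _ wop_1_y] by blast
      then have r': "ratx r0 * f = ratx r1 + ratx r2 * Y44" by simp
      note L = is_subfield_rat_adjoin[of "{X44, Y44}"]
      have g: "X44 \<in> rat_adjoin {X44, Y44}" "Y44 \<in> rat_adjoin {X44, Y44}"
        using subset_rat_adjoin[of "{X44, Y44}"] by auto
      show "f \<in> rat_adjoin {X44, Y44}"
        by (rule quotient[OF r(1) r' L g(1)]) (intro is_subfieldD(3,4)[OF L] ratx_in_subfield[OF L] g)
    qed
  qed
qed

end
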